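(* Let $X$ be a spectrally negative Lévy process (not the negative of a subordinator). (i) Assume $\psi'(0+)>0$. Then for $-\infty<a\leq b$, $q\geq0$ and $x\in\mathbb R$, $$ \mathbb E_x\left[\mathrm e^{-q\int_0^\infty \mathbf 1_{(a,b)}(X_s)\,\mathrm ds}\right] = \frac{Z^{(q)}(x-a) - q\int_b^x W(x-y)Z^{(q)}(y-a)\,\mathrm dy}{1+\frac{q}{\psi'(0+)}\int_0^{b-a}Z^{(q)}(y)\,\mathrm dy}. $$ (ii) Assume $\psi'(0+)>0$. Then for $q\geq0$ and $b,x\in\mathbb R$, $$ \mathbb E_x\left[\mathrm e^{-q\int_0^\infty \mathbf 1_{(-\infty,b)}(X_s)\,\mathrm ds}\right] = \frac{\psi'(0+)\Phi(q)}{q}\,\mathcal H^{(q,-q)}(x-b), $$ where for $q=0$ the ratio $\Phi(q)/q$ is understood as its limit $\lim_{q\downarrow0}\Phi(q)/q=1/\psi'(0+)$. (iii) Assume $\psi'(0+)<0$. Then for $-\infty<a\leq b$, $q\geq0$ and $x\in\mathbb R$, $$ \mathbb E_x\left[\mathrm e^{-q\int_0^\infty \mathbf 1_{(a,b)}(X_s)\,\mathrm ds}\right] = Z^{(q)}(x-a) - q\int_b^x W(x-y)Z^{(q)}(y-a)\,\mathrm dy $$ $$ - \frac{q\int_0^{b-a}\mathrm e^{-\Phi(0)y}Z^{(q)}(y)\,\mathrm dy}{\psi'(\Phi(0)) + q\int_0^{b-a}\mathrm e^{-\Phi(0)y}\mathcal H^{(0,q)}(y)\,\mathrm dy}\left(\mathcal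 H^{(0,q)}(x-a) - q\int_b^x W(x-y)\mathcal H^{(0,q)}(y-a)\,\mathrm dy\right). $$ (iv) Assume $\psi'(0+)<0$. Then for $q\geq0$ and $a,x\in\mathbb R$, $$ \mathbb E_x\left[\mathrm e^{-q\int_0^\infty \mathbf 1_{(a,\infty)}(X_s)\,\mathrm ds}\right] = Z^{(q)}(x-a) - \frac{\Phi(q)-\Phi(0)}{\Phi(q)}\,\mathcal H^{(0,q)}(x-a). $$
   Context: $X=(X_t)_{t\geq0}$ is a spectrally negative Lévy process: a process with stationary independent increments and no positive jumps; the case where $X$ is the negative of a subordinator (non-increasing paths) is excluded. $\mathbb P_x$ is the law of $X$ with $X_0=x$, $\mathbb E_x$ the expectation. The Laplace exponent is defined by $\mathbb E_0[\mathrm e^{\lambda X_t}]=\mathrm e^{t\psi(\lambda)}$, $\lambda,t\geq0$, and $\Phi(q)=\sup\{\lambda\geq0:\psi(\lambda)=q\}$ for $q\geq0$. $\psi'(0+)$ is the right derivative of $\psi$ at $0$, equal to $\mathbb E_0[X_1]\in[-\infty,\infty)$. Scale functions: for $q\geq0$, $W^{(q)}$ is the unique function that is continuous on $[0,\infty)$ with $\int_0^\infty \mathrm e^{-\lambda y}W^{(q)}(y)\,\mathrm dy = \frac1{\psi(\lambda)-q}$ for $\lambda>\Phi(q)$, extended by $W^{(q)}(x)=0$ for $x<0$; $W:=W^{(0)}$. Also $Z^{(q)}(x)=1+q\int_0^x W^{(q)}(y)\,\mathrm dy$, $x\in\mathbb R$ (so $Z^{(q)}(x)=1$ for $x\leq0$).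 For $p\geq0$ and $q\in\mathbb R$ with $p+q\geq0$, $$\mathcal H^{(p,q)}(x)=\mathrm e^{\Phi(p)x}\left(1+q\int_0^x \mathrm e^{-\Phi(p)y}W^{(p+q)}(y)\,\mathrm dy\right),\quad x\in\mathbb R,$$ so that $\mathcal H^{(p,q)}(x)=\mathrm e^{\Phi(p)x}$ for $x\leq0$. Since $W$ vanishes on $(-\infty,0)$, integrals of the form $\int_b^x W(x-y)(\cdots)\,\mathrm dy$ are $0$ when $x\leq b$. *)

theory Defs
  imports "HOL-Probability.Probability"
begin

text \<open>Real-valued Levy processes indexed by \<open>t \<ge> 0\<close> and started at \<open>0\<close>; the values of \<open>X\<close> at
  negative times are irrelevant. The law of the process started at \<open>x\<close> is that of \<open>x + X\<close>.\<close>

locale levy_process = prob_space M for M :: "'a measure" +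
  fixes X :: "real \<Rightarrow> 'a \<Rightarrow> real"
  assumes measurable_X: "\<And>t. 0 \<le> t \<Longrightarrow> X t \<in> borel_measurable M"
    and X_0: "AE \<omega> in M. X 0 \<omega> = 0"
    and indep_increments: "\<And>(t :: nat \<Rightarrow> real) n. 0 \<le> t 0 \<Longrightarrow> mono t \<Longrightarrow>
          indep_vars (\<lambda>_. borel) (\<lambda>i \<omega>. X (t (Suc i)) \<omega> - X (t i) \<omega>) {..<n}"
    and stationary_increments: "\<And>s h. 0 \<le> s \<Longrightarrow> 0 \<le> h \<Longrightarrow>
          distr M borel (\<lambda>\<omega>. X (s + h) \<omega> - X s \<omega>) = distr M borel (X h)"
    and cadlag: "AE \<omega> in M.
          (\<forall>t\<ge>0. ((\<lambda>s. X s \<omega>) \<longlongrightarrow> X t \<omega>) (at_right t)) \<and>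
          (\<forall>t>0. \<exists>l. ((\<lambda>s. X s \<omega>) \<longlongrightarrow> l) (at_left t))"

locale spectrally_negative_levy = levy_process +
  assumes no_positive_jumps: "AE \<omega> in M. \<forall>t>0. \<forall>l.
          ((\<lambda>s. X s \<omega>) \<longlongrightarrow> l) (at_left t) \<longrightarrow> X t \<omega> \<le> l"
    and not_neg_subordinator: "\<not> (AE \<omega> in M. \<forall>s t. 0 \<le> s \<longrightarrow> s \<le> t \<longrightarrow> X t \<omega> \<le> X s \<omega>)"

text \<open>By stationarity and independence of the increments, the exponent is determined by time \<open>1\<close>.\<close>

definition laplace_exponent :: "'a measure \<Rightarrow> (real \<Rightarrow> 'a \<Rightarrow> real) \<Rightarrow> real \<Rightarrow> real" where
  "laplace_exponent M X l = ln (LINT \<omega>|M. exp (l * X 1 \<omega>))"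

definition right_inverse :: "(real \<Rightarrow> real) \<Rightarrow> real \<Rightarrow> real" where
  "right_inverse \<psi> q = Sup {l. 0 \<le> l \<and> \<psi> l = q}"

text \<open>Extended-real valued, since the right derivative of a Laplace exponent at \<open>0\<close> may
  be \<open>-\<infinity>\<close>.\<close>

definition right_deriv_0 :: "(real \<Rightarrow> real) \<Rightarrow> ereal" where
  "right_deriv_0 \<psi> = Lim (at_right 0) (\<lambda>h. ereal ((\<psi> h - \<psi> 0) / h))"

definition is_scale_function :: "(real \<Rightarrow> real) \<Rightarrow> real \<Rightarrow> (real \<Rightarrow> real) \<Rightarrow> bool" where
  "is_scale_function \<psi> q w \<longleftrightarrow>
     continuous_on {0..} w \<and> (\<forall>x<0. w x = 0) \<and>
     (\<forall>l>right_inverse \<psi> q.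
        set_integrable lborel {0..} (\<lambda>y. exp (- l * y) * w y) \<and>
        (LBINT y:{0..}. exp (- l * y) * w y) = 1 / (\<psi> l - q))"

text \<open>For \<open>x < 0\<close> the interval \<open>{0..x}\<close> is empty, in agreement with the oriented integral from
  \<open>0\<close> to \<open>x\<close> of a function vanishing on the negative half-line.\<close>

definition scale_Z :: "(real \<Rightarrow> real \<Rightarrow> real) \<Rightarrow> real \<Rightarrow> real \<Rightarrow> real" where
  "scale_Z W q x = 1 + q * (LBINT y:{0..x}. W q y)"

definition scale_H ::
  "(real \<Rightarrow> real) \<Rightarrow> (real \<Rightarrow> real \<Rightarrow> real) \<Rightarrow> real \<Rightarrow> real \<Rightarrow> real \<Rightarrow> real" where
  "scale_H \<Phi> W p q x =
     exp (\<Phi> p * x) * (1 + q * (LBINT y:{0..x}. exp (- \<Phi> p * y) * W (p + q) y))"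

definition exp_neg :: "ennreal \<Rightarrow> real" where
  "exp_neg t = (if t = \<infinity> then 0 else exp (- enn2real t))"

definition occupation_time :: "(real \<Rightarrow> real) \<Rightarrow> real set \<Rightarrow> ennreal" where
  "occupation_time f A = emeasure lborel {s. 0 \<le> s \<and> f s \<in> A}"

text \<open>The expectation is taken over the completion of \<open>M\<close> because the paths are regular only almost
  surely, so that the occupation time need only be measurable up to null sets.
  For \<open>q = 0\<close> the integrand is \<open>1\<close>, even on paths with infinite occupation time.\<close>

definition occupation_laplace ::
  "'a measure \<Rightarrow> (real \<Rightarrow> 'a \<Rightarrow> real) \<Rightarrow> real \<Rightarrow> real \<Rightarrow> real set \<Rightarrow> real" where
  "occupation_laplace M X x q A =
     (LINT \<omega>|completion M. exp_neg (ennreal q * occupation_time (\<lambda>s. x + X s \<omega>) A))"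

end

theory Submission
  imports Defs
begin

text \<open>After passing to a version \<open>Y\<close> of the process with regular paths, Dynkin's formula for
  \<open>exp (l * Y)\<close>, stopped at the passage above a level, gives the Laplace transform of the occupation
  measure before that passage. Letting the level tend to infinity shows that the process has the
  potential density \<open>exp (\<phi> * (x - y)) / \<kappa> - W (x - y)\<close> with \<open>\<phi> = \<Phi> 0\<close> and \<open>\<kappa> = \<psi>'(\<phi>)\<close>. By the Markov
  property the occupation functional of an interval then solves a linear integral equation: up to one
  unknown constant it is a Volterra equation, whose resolvent kernel is the \<open>q\<close>-scale function, and
  the constant is found by integrating the solution against \<open>exp (- \<phi> * y)\<close>. Half-lines are increasing
  limits of intervals; the limit of the constant is identified by Laplace transforms and growth
  rates rather than by asymptotics of scale functions.\<close>

text \<open>Scale functions are known here only through continuity on the half-line and a Laplace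
  transform; even their positivity must be derived. It comes from probability: the occupation
  measure before passage above \<open>a\<close> has the transform of
  \<open>exp (- \<phi> * a) * W (x + a) - W x\<close>, so this difference must be nonnegative.
  Stopping at the passage makes such transforms finite, and reflecting \<open>Y\<close> to
  \<open>- Y\<close> puts the measure on \<open>{- a..}\<close>, where a one-sided transform
  determines it. Stopping times and the strong Markov property are avoided: passages are observed on
  dyadic grids, where independence of increments at fixed times is enough, and the grid is refined
  along right-continuous paths. The absence of positive jumps enters through a single fact, a bound
  on the rise of a path over short intervals, uniform on bounded time; it yields the exponential
  moments and the vanishing overshoot at passage. Both signs of \<open>\<psi>'(0+)\<close> are
  treated at once: \<open>\<phi>\<close> is the largest root of \<open>\<psi>\<close> and
  \<open>\<kappa> > 0\<close> its slope there, which makes the potential finite on bounded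
  sets.\<close>

section \<open>Determining measures by moments and Laplace transforms\<close>

text \<open>Moments fix the integrals of polynomials, hence by Weierstrass those of all continuous
  functions on \<open>{0..1}\<close>; continuous ramps then decrease to the indicator of
  \<open>{..a}\<close>, so the distribution functions agree.\<close>

lemma finite_measure_eqI_moments:
  fixes M N :: "real measure"
  assumes fM: "finite_measure M" and fN: "finite_measure N"
    and sM: "sets M = sets borel" and sN: "sets N = sets borel"
    and M01: "AE x in M. x \<in> {0..1}" and N01: "AE x in N. x \<in> {0..1}"
    and eq: "\<And>n. (\<integral>x. x ^ n \<partial>M) = (\<integral>x. x ^ n \<partial>N)"
  shows "M = N"
proof -
  interpret M: finite_measure M by fact
  interpret N: finite_measure N by fact
  note [measurable_cong] = sM sN
  have bM: "integrable M f" if "f \<in> borel_measurable borel" "\<And>x. x \<in> {0..1} \<Longrightarrow> \<bar>f x\<bar> \<le> B" for f :: "real \<Rightarrow> real" and B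
    by (rule M.integrable_const_bound[where B=B]) (use that M01 in auto)
  have bN: "integrable N f" if "f \<in> borel_measurable borel" "\<And>x. x \<in> {0..1} \<Longrightarrow> \<bar>f x\<bar> \<le> B" for f :: "real \<Rightarrow> real" and B
    by (rule N.integrable_const_bound[where B=B]) (use that N01 in auto)
  have pow: "\<bar>x ^ n\<bar> \<le> 1" if "x \<in> {0..1}" for x :: real and n
    using that by (simp add: power_le_one)
  have poly: "(\<integral>x. g x \<partial>M) = (\<integral>x. g x \<partial>N)" if pg: "real_polynomial_function g" for g :: "real \<Rightarrow> real"
  proof -
    obtain a n where g: "g = (\<lambda>x. \<Sum>i\<le>n. a i * x ^ i)"
      using iffD1[OF real_polynomial_function_iff_sum pg] by (elim exE) (rule that)
    have "integrable M (\<lambda>x. x ^ i)" "integrable N (\<lambda>x. x ^ i)" for i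
      by (rule bM[of _ 1], simp, erule pow) (rule bN[of _ 1], simp, erule pow)
    then show ?thesis unfolding g by (simp add: eq)
  qed
  have cont: "(\<integral>x. f x \<partial>M) = (\<integral>x. f x \<partial>N)" if f: "continuous_on UNIV f" for f :: "real \<Rightarrow> real"
  proof (rule ccontr)
    assume "(\<integral>x. f x \<partial>M) \<noteq> (\<integral>x. f x \<partial>N)"
    define d where "d = \<bar>(\<integral>x. f x \<partial>M) - (\<integral>x. f x \<partial>N)\<bar>"
    \<comment> \<open>The \<open>+ 1\<close> keeps \<open>m\<close> positive for null measures too
      and makes the final estimate strict: an error below \<open>d / m\<close> under total mass less
      than \<open>m\<close> cannot add up to \<open>d\<close>.\<close>
    define m where "m = measure M (space M) + measure N (space N) + 1"
    have d: "d > 0" using \<open>_ \<noteq> _\<close> by (simp add: d_def)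
    have m: "m > 0" by (simp add: m_def add_nonneg_pos)
    obtain g where g: "real_polynomial_function g" "\<And>x. x \<in> {0..1} \<Longrightarrow> \<bar>f x - g x\<bar> < d / m"
      using Stone_Weierstrass_real_polynomial_function[of "{0..1::real}" f "d / m"] d m
        continuous_on_subset[OF f] by auto
    have [measurable]: "f \<in> borel_measurable borel" using f by (rule borel_measurable_continuous_onI)
    have gc: "continuous_on UNIV g"
      using g(1) continuous_on_polymonial_function real_polynomial_function_eq by blast
    then have [measurable]: "g \<in> borel_measurable borel" by (rule borel_measurable_continuous_onI)
    have bound: "\<exists>B. \<forall>x\<in>{0..1}. \<bar>h x\<bar> \<le> B" if "continuous_on UNIV h" for h :: "real \<Rightarrow> real"
      using compact_imp_bounded[OF compact_continuous_image[OF continuous_on_subset[OF that] compact_Icc]]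
      by (auto simp: bounded_iff)
    obtain B1 B2 where B: "\<forall>x\<in>{0..1}. \<bar>f x\<bar> \<le> B1" "\<forall>x\<in>{0..1}. \<bar>g x\<bar> \<le> B2"
      using bound[OF f] bound[OF gc] by blast
    have iM: "integrable M f" "integrable M g" and iN: "integrable N f" "integrable N g"
      by (rule bM[of f B1], simp, use B in blast) (rule bM[of g B2], simp, use B in blast,
        rule bN[of f B1], simp, use B in blast, rule bN[of g B2], simp, use B in blast)
    have "\<bar>(\<integral>x. f x \<partial>M) - (\<integral>x. g x \<partial>M)\<bar> \<le> (\<integral>x. \<bar>f x - g x\<bar> \<partial>M)"
      using integral_abs_bound[of M "\<lambda>x. f x - g x"] iM by simp
    also have "\<dots> \<le> (\<integral>x. d / m \<partial>M)"
      by (rule integral_mono_AE) (use iM M01 g(2) in \<open>auto intro: less_imp_le\<close>)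
    finally have 1: "\<bar>(\<integral>x. f x \<partial>M) - (\<integral>x. g x \<partial>M)\<bar> \<le> measure M (space M) * (d / m)" by simp
    have "\<bar>(\<integral>x. f x \<partial>N) - (\<integral>x. g x \<partial>N)\<bar> \<le> (\<integral>x. \<bar>f x - g x\<bar> \<partial>N)"
      using integral_abs_bound[of N "\<lambda>x. f x - g x"] iN by simp
    also have "\<dots> \<le> (\<integral>x. d / m \<partial>N)"
      by (rule integral_mono_AE) (use iN N01 g(2) in \<open>auto intro: less_imp_le\<close>)
    finally have 2: "\<bar>(\<integral>x. f x \<partial>N) - (\<integral>x. g x \<partial>N)\<bar> \<le> measure N (space N) * (d / m)" by simp
    have "d \<le> (measure M (space M) + measure N (space N)) * (d / m)"
      using 1 2 poly[OF g(1)] d_def unfolding distrib_right by linarith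
    also have "\<dots> < m * (d / m)"
      using d m by (intro mult_strict_right_mono) (auto simp: m_def)
    finally show False using m by simp
  qed
  have "cdf M a = cdf N a" for a
  proof -
    define f where "f = (\<lambda>(n::nat) x. max 0 (min 1 (1 - real n * (x - a))))"
    have fc: "continuous_on UNIV (f n)" for n unfolding f_def by (intro continuous_intros)
    have [measurable]: "f n \<in> borel_measurable borel" for n
      using fc by (rule borel_measurable_continuous_onI)
    have lim: "(\<lambda>n. f n x) \<longlonglongrightarrow> indicator {..a} x" for x
    proof (cases "x \<le> a")
      case True
      then have "f n x = 1" for n
        using mult_nonneg_nonneg[of "real n" "a - x"] by (simp add: f_def algebra_simps)
      then show ?thesis using True by simp
    next
      case False
      obtain n0 :: nat where n0: "n0 > 1 / (x - a)" using reals_Archimedean2 by blast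
      have "\<forall>\<^sub>F n in sequentially. f n x = 0"
        using eventually_ge_at_top[of n0]
      proof eventually_elim
        case (elim n)
        have "1 / (x - a) \<le> real n" using n0 elim by linarith
        then have "1 \<le> real n * (x - a)" using False by (simp add: field_simps)
        then show ?case by (simp add: f_def)
      qed
      then show ?thesis using False by (simp add: tendsto_eventually)
    qed
    have "(\<lambda>n. \<integral>x. f n x \<partial>M) \<longlonglongrightarrow> (\<integral>x. indicator {..a} x \<partial>M)"
      by (rule integral_dominated_convergence[where w="\<lambda>_. 1"]) (use lim in \<open>auto simp: f_def\<close>)
    moreover have "(\<lambda>n. \<integral>x. f n x \<partial>N) \<longlonglongrightarrow> (\<integral>x. indicator {..a} x \<partial>N)"
      by (rule integral_dominated_convergence[where w="\<lambda>_. 1"]) (use lim in \<open>auto simp: f_def\<close>)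
    ultimately have "(\<integral>x. indicator {..a} x \<partial>M) = ((\<integral>x. indicator {..a} x \<partial>N) :: real)"
      unfolding cont[OF fc] by (rule LIMSEQ_unique)
    then show ?thesis by (simp add: cdf_def)
  qed
  then show ?thesis
    by (intro cdf_unique' finite_borel_measure.intro fM fN)
      (auto simp: finite_borel_measure_axioms_def sM sN sets_eq_imp_space_eq[OF sM] sets_eq_imp_space_eq[OF sN])
qed

text \<open>Tilting by \<open>exp (- l * x)\<close> makes the measure finite, and the map
  \<open>exp (c - x)\<close> carries the half-line from \<open>c\<close> into the unit interval. The
  \<open>n\<close>-th moment of the image is, up to the factor \<open>exp (n * c)\<close>, the
  Laplace transform at \<open>l + n\<close>, so the moment lemma applies.\<close>

lemma measure_eqI_laplace:
  fixes \<mu> \<nu> :: "real measure"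
  assumes s\<mu>: "sets \<mu> = sets borel" and s\<nu>: "sets \<nu> = sets borel"
    and supp\<mu>: "AE x in \<mu>. c \<le> x" and supp\<nu>: "AE x in \<nu>. c \<le> x"
    and fin: "\<And>l. l > l0 \<Longrightarrow> (\<integral>\<^sup>+x. exp (- l * x) \<partial>\<mu>) < \<infinity>"
    and eq: "\<And>l. l > l0 \<Longrightarrow> (\<integral>\<^sup>+x. exp (- l * x) \<partial>\<mu>) = (\<integral>\<^sup>+x. exp (- l * x) \<partial>\<nu>)"
  shows "\<mu> = \<nu>"
proof -
  define l where "l = l0 + 1"
  define T where "T = (\<lambda>\<mu>. distr (density \<mu> (\<lambda>x. ennreal (exp (- l * x)))) borel (\<lambda>x. exp (c - x)))"
  have l: "l > l0" by (simp add: l_def)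
  have nnT: "(\<integral>\<^sup>+y. f y \<partial>T \<mu>) = (\<integral>\<^sup>+x. exp (- l * x) * f (exp (c - x)) \<partial>\<mu>)"
    if [measurable_cong]: "sets \<mu> = sets borel" and [measurable]: "f \<in> borel_measurable borel"
    for f :: "real \<Rightarrow> ennreal" and \<mu>
    unfolding T_def by (subst nn_integral_distr, simp, simp, subst nn_integral_density) auto
  have sT: "sets (T \<mu>) = sets borel" for \<mu> by (simp add: T_def)
  have fT: "finite_measure (T \<mu>)" if s: "sets \<mu> = sets borel" and f: "(\<integral>\<^sup>+x. exp (- l * x) \<partial>\<mu>) < \<infinity>" for \<mu>
  proof (rule finite_measureI)
    have "emeasure (T \<mu>) (space (T \<mu>)) = (\<integral>\<^sup>+y. 1 \<partial>T \<mu>)" by simp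
    also have "\<dots> = (\<integral>\<^sup>+x. ennreal (exp (- l * x)) * 1 \<partial>\<mu>)" by (rule nnT[OF s]) simp
    finally show "emeasure (T \<mu>) (space (T \<mu>)) \<noteq> \<infinity>" using f by simp
  qed
  have T01: "AE y in T \<mu>. y \<in> {0..1}" if [measurable_cong]: "sets \<mu> = sets borel" and "AE x in \<mu>. c \<le> x" for \<mu>
  proof -
    have "AE x in density \<mu> (\<lambda>x. ennreal (exp (- l * x))). exp (c - x) \<in> {0..1}"
      using that(2) by (subst AE_density) (auto elim!: eventually_mono)
    then show ?thesis unfolding T_def by (subst AE_distr_iff) auto
  qed
  have mom: "(\<integral>\<^sup>+y. ennreal (y ^ n) \<partial>T \<mu>) = exp (n * c) * (\<integral>\<^sup>+x. exp (- (l + n) * x) \<partial>\<mu>)"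
    if s [measurable_cong]: "sets \<mu> = sets borel" for \<mu> and n :: nat
  proof -
    have "(\<integral>\<^sup>+y. ennreal (y ^ n) \<partial>T \<mu>) = (\<integral>\<^sup>+x. exp (- l * x) * ennreal (exp (c - x) ^ n) \<partial>\<mu>)"
      by (rule nnT[OF s]) simp
    also have "\<dots> = (\<integral>\<^sup>+x. exp (n * c) * ennreal (exp (- (l + n) * x)) \<partial>\<mu>)"
      by (intro nn_integral_cong)
        (simp add: ennreal_mult'[symmetric] exp_of_nat_mult[symmetric] exp_add[symmetric] algebra_simps)
    also have "\<dots> = exp (n * c) * (\<integral>\<^sup>+x. exp (- (l + n) * x) \<partial>\<mu>)"
      by (rule nn_integral_cmult) auto
    finally show ?thesis .
  qed
  have fin': "(\<integral>\<^sup>+x. exp (- l * x) \<partial>\<nu>) < \<infinity>" using fin eq l by metis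
  have "T \<mu> = T \<nu>"
  proof (rule finite_measure_eqI_moments)
    fix n :: nat
    have "enn2real (\<integral>\<^sup>+y. ennreal (y ^ n) \<partial>T \<mu>) = enn2real (\<integral>\<^sup>+y. ennreal (y ^ n) \<partial>T \<nu>)"
      unfolding mom[OF s\<mu>] mom[OF s\<nu>] using eq[of "l + real n"] l by simp
    moreover have "(\<integral>y. y ^ n \<partial>T \<mu>') = enn2real (\<integral>\<^sup>+y. ennreal (y ^ n) \<partial>T \<mu>')"
      if "sets \<mu>' = sets borel" "AE x in \<mu>'. c \<le> x" for \<mu>'
      by (rule integral_eq_nn_integral) (use T01[OF that] sT[of \<mu>'] in \<open>auto simp: measurable_cong_sets[OF sT refl]\<close>)
    ultimately show "(\<integral>y. y ^ n \<partial>T \<mu>) = (\<integral>y. y ^ n \<partial>T \<nu>)"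
      using s\<mu> s\<nu> supp\<mu> supp\<nu> by simp
  qed (use fT[OF s\<mu> fin[OF l]] fT[OF s\<nu> fin'] sT T01[OF s\<mu> supp\<mu>] T01[OF s\<nu> supp\<nu>] in auto)
  \<comment> \<open>\<open>T\<close> is injective: \<open>c - ln y\<close> inverts the change of
    variable and the density \<open>exp (l * x)\<close> removes the tilt.\<close>
  moreover have inv: "\<mu>' = density (distr (T \<mu>') borel (\<lambda>y. c - ln y)) (\<lambda>x. ennreal (exp (l * x)))"
    if s [measurable_cong]: "sets \<mu>' = sets borel" for \<mu>'
  proof (rule measure_eqI)
    fix A assume "A \<in> sets \<mu>'"
    then have A [measurable]: "A \<in> sets borel" by (simp add: s)
    have "emeasure (density (distr (T \<mu>') borel (\<lambda>y. c - ln y)) (\<lambda>x. ennreal (exp (l * x)))) A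
        = (\<integral>\<^sup>+y. ennreal (exp (l * (c - ln y))) * indicator A (c - ln y) \<partial>T \<mu>')"
      by (subst emeasure_density, simp, simp, subst nn_integral_distr) (auto simp: measurable_cong_sets[OF sT refl])
    also have "\<dots> = (\<integral>\<^sup>+x. exp (- l * x) * (ennreal (exp (l * (c - ln (exp (c - x))))) * indicator A (c - ln (exp (c - x)))) \<partial>\<mu>')"
      by (rule nnT[OF s]) simp
    also have "\<dots> = (\<integral>\<^sup>+x. indicator A x \<partial>\<mu>')"
      by (intro nn_integral_cong)
        (simp add: mult.assoc[symmetric] ennreal_mult'[symmetric] exp_add[symmetric])
    also have "\<dots> = emeasure \<mu>' A" using \<open>A \<in> sets \<mu>'\<close> by simp
    finally show "emeasure \<mu>' A = emeasure (density (distr (T \<mu>') borel (\<lambda>y. c - ln y)) (\<lambda>x. ennreal (exp (l * x)))) A" ..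
  qed (simp add: s)
  ultimately show ?thesis using inv[OF s\<mu>] inv[OF s\<nu>] by metis
qed

section \<open>Convolution on the half-line\<close>

text \<open>The range \<open>{0..x}\<close> makes this the convolution of the restrictions to the
  half-line, whatever the factors are at negative arguments; constants and exponentials can thus be
  convolved as they stand.\<close>

definition conv :: "(real \<Rightarrow> real) \<Rightarrow> (real \<Rightarrow> real) \<Rightarrow> real \<Rightarrow> real" where
  "conv f g x = (LBINT y:{0..x}. f (x - y) * g y)"

text \<open>Bounds on compact parts of the half-line are all that convolutions need, and unlike
  global integrability they hold for exponentials and for scale functions.\<close>

definition locbd :: "(real \<Rightarrow> real) \<Rightarrow> bool" where
  "locbd f \<longleftrightarrow> f \<in> borel_measurable borel \<and> (\<forall>L. \<exists>B. \<forall>x\<in>{0..L}. \<bar>f x\<bar> \<le> B)"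

lemma locbdI:
  assumes "f \<in> borel_measurable borel" "\<And>L. \<exists>B. \<forall>x\<in>{0..L}. \<bar>f x\<bar> \<le> B"
  shows "locbd f"
  using assms by (simp add: locbd_def)

lemma locbd_measurable: "locbd f \<Longrightarrow> f \<in> borel_measurable borel"
  by (simp add: locbd_def)

lemma locbdE:
  assumes "locbd f" obtains B where "0 \<le> B" "\<And>x. 0 \<le> x \<Longrightarrow> x \<le> L \<Longrightarrow> \<bar>f x\<bar> \<le> B"
proof -
  obtain B where "\<forall>x\<in>{0..L}. \<bar>f x\<bar> \<le> B" using assms by (auto simp: locbd_def)
  then have "\<And>x. 0 \<le> x \<Longrightarrow> x \<le> L \<Longrightarrow> \<bar>f x\<bar> \<le> max 0 B" by (meson atLeastAtMost_iff max.coboundedI2)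
  then show thesis by (intro that[of "max 0 B"]) auto
qed

lemma locbd_add: "locbd f \<Longrightarrow> locbd g \<Longrightarrow> locbd (\<lambda>x. f x + g x)"
proof (rule locbdI)
  fix L assume "locbd f" "locbd g"
  obtain B where B: "0 \<le> B" "\<And>x. 0 \<le> x \<Longrightarrow> x \<le> L \<Longrightarrow> \<bar>f x\<bar> \<le> B" using locbdE[OF \<open>locbd f\<close>] by blast
  obtain C where C: "0 \<le> C" "\<And>x. 0 \<le> x \<Longrightarrow> x \<le> L \<Longrightarrow> \<bar>g x\<bar> \<le> C" using locbdE[OF \<open>locbd g\<close>] by blast
  have "\<forall>x\<in>{0..L}. \<bar>f x + g x\<bar> \<le> B + C" using B C by (force intro: order_trans[OF abs_triangle_ineq add_mono])
  then show "\<exists>B. \<forall>x\<in>{0..L}. \<bar>f x + g x\<bar> \<le> B" by blast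
qed (auto simp: locbd_def)

lemma locbd_mult: "locbd f \<Longrightarrow> locbd g \<Longrightarrow> locbd (\<lambda>x. f x * g x)"
proof (rule locbdI)
  fix L assume "locbd f" "locbd g"
  obtain B where B: "0 \<le> B" "\<And>x. 0 \<le> x \<Longrightarrow> x \<le> L \<Longrightarrow> \<bar>f x\<bar> \<le> B" using locbdE[OF \<open>locbd f\<close>] by blast
  obtain C where C: "0 \<le> C" "\<And>x. 0 \<le> x \<Longrightarrow> x \<le> L \<Longrightarrow> \<bar>g x\<bar> \<le> C" using locbdE[OF \<open>locbd g\<close>] by blast
  have "\<forall>x\<in>{0..L}. \<bar>f x * g x\<bar> \<le> B * C" using B C by (simp add: abs_mult mult_mono)
  then show "\<exists>B. \<forall>x\<in>{0..L}. \<bar>f x * g x\<bar> \<le> B" by blast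
qed (auto simp: locbd_def)

lemma locbd_continuous:
  assumes "f \<in> borel_measurable borel" "continuous_on {0..} f" shows "locbd f"
proof (rule locbdI)
  fix L
  have "compact (f ` {0..L})"
    by (intro compact_continuous_image continuous_on_subset[OF assms(2)]) auto
  then show "\<exists>B. \<forall>x\<in>{0..L}. \<bar>f x\<bar> \<le> B" by (auto dest: compact_imp_bounded simp: bounded_iff)
qed (use assms in simp)

lemma locbd_const: "locbd (\<lambda>x. c)"
  by (rule locbd_continuous) (auto intro: continuous_intros)

lemma locbd_exp: "locbd (\<lambda>x. exp (c * x))"
  by (rule locbd_continuous) (auto intro!: continuous_intros)

lemma locbd_bounded: "f \<in> borel_measurable borel \<Longrightarrow> (\<And>x. \<bar>f x\<bar> \<le> B) \<Longrightarrow> locbd f"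
  by (auto simp: locbd_def)

lemma conv_eq: "conv f g x = (\<integral>y. indicator {0..} (x - y) * f (x - y) * (indicator {0..} y * g y) \<partial>lborel)"
  unfolding conv_def set_lebesgue_integral_def
  by (intro Bochner_Integration.integral_cong) (auto simp: indicator_def)

lemma conv_neg: "x < 0 \<Longrightarrow> conv f g x = 0"
  by (simp add: conv_def set_lebesgue_integral_def)

lemma integrable_indicator_Icc: "integrable lborel (\<lambda>y. indicator {a..b::real} y * c :: real)"
  by (intro integrable_mult_left integrable_real_indicator) (auto simp: emeasure_lborel_Icc_eq)

lemma conv_integrable:
  assumes f: "locbd f" and g: "locbd g"
  shows "set_integrable lborel {0..x} (\<lambda>y. f (x - y) * g y)"
proof -
  note [measurable] = locbd_measurable[OF f] locbd_measurable[OF g]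
  obtain B where B: "0 \<le> B" "\<And>y. 0 \<le> y \<Longrightarrow> y \<le> x \<Longrightarrow> \<bar>f y\<bar> \<le> B" using locbdE[OF f] by blast
  obtain C where C: "0 \<le> C" "\<And>y. 0 \<le> y \<Longrightarrow> y \<le> x \<Longrightarrow> \<bar>g y\<bar> \<le> C" using locbdE[OF g] by blast
  show ?thesis unfolding set_integrable_def
  proof (rule Bochner_Integration.integrable_bound)
    show "integrable lborel (\<lambda>y. indicator {0..x} y * (B * C) :: real)"
      by (rule integrable_indicator_Icc)
    show "AE y in lborel. norm (indicator {0..x} y *\<^sub>R (f (x - y) * g y)) \<le> norm (indicator {0..x} y * (B * C))"
      using B C by (intro AE_I2) (auto simp: indicator_def abs_mult intro!: mult_mono)
  qed simp
qed

lemma conv_commute: "conv f g x = conv g f x"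
proof -
  have "conv f g x = (\<integral>y. indicator {0..} (x - (x + (-1) * y)) * f (x - (x + (-1) * y)) * (indicator {0..} (x + (-1) * y) * g (x + (-1) * y)) \<partial>lborel)"
    unfolding conv_eq by (subst lborel_integral_real_affine[where c="-1" and t=x]) auto
  also have "\<dots> = conv g f x" unfolding conv_eq by (intro Bochner_Integration.integral_cong) auto
  finally show ?thesis .
qed

lemma conv_measurable:
  assumes [measurable]: "f \<in> borel_measurable borel" "g \<in> borel_measurable borel"
  shows "conv f g \<in> borel_measurable borel"
proof -
  have "(\<lambda>x. \<integral>y. indicator {0..} (x - y) * f (x - y) * (indicator {0..} y * g y) \<partial>lborel) \<in> borel_measurable borel"
    by (rule lborel.borel_measurable_lebesgue_integral) measurable
  then show ?thesis by (simp add: conv_eq[abs_def])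
qed

lemma conv_add_right:
  assumes "locbd f" "locbd g" "locbd h"
  shows "conv f (\<lambda>x. g x + h x) x = conv f g x + conv f h x"
  unfolding conv_def
  using set_integral_add(2)[OF conv_integrable[OF assms(1,2)] conv_integrable[OF assms(1,3)]]
  by (simp add: distrib_left)

lemma conv_add_left:
  assumes "locbd f" "locbd g" "locbd h"
  shows "conv (\<lambda>x. f x + g x) h x = conv f h x + conv g h x"
  using conv_add_right[OF assms(3,1,2)] by (simp add: conv_commute)

lemma conv_cmult_right: "conv f (\<lambda>x. c * g x) x = c * conv f g x"
  unfolding conv_def by (simp add: mult.left_commute)

lemma conv_cmult_left: "conv (\<lambda>x. c * f x) g x = c * conv f g x"
  unfolding conv_def by (simp add: mult.assoc)

lemma conv_cong: "(\<And>y. 0 \<le> y \<Longrightarrow> y \<le> x \<Longrightarrow> g y = h y) \<Longrightarrow> conv f g x = conv f h x"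
  unfolding conv_def by (rule set_lebesgue_integral_cong) auto

lemma conv_cong_AE:
  assumes [measurable]: "f \<in> borel_measurable borel" "g \<in> borel_measurable borel" "h \<in> borel_measurable borel"
    and "AE y in lborel. 0 \<le> y \<longrightarrow> g y = h y"
  shows "conv f g x = conv f h x"
  unfolding conv_eq using assms(4) by (intro integral_cong_AE) (auto simp: indicator_def)

lemma conv_mono:
  assumes "locbd f" "locbd g" "locbd h" "\<And>y. 0 \<le> y \<Longrightarrow> 0 \<le> f y" "\<And>y. 0 \<le> y \<Longrightarrow> y \<le> x \<Longrightarrow> g y \<le> h y"
  shows "conv f g x \<le> conv f h x"
  unfolding conv_def
  by (rule set_integral_mono) (use assms conv_integrable in \<open>auto intro: mult_left_mono\<close>)

lemma locbd_conv:
  assumes f: "locbd f" and g: "locbd g"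
  shows "locbd (conv f g)"
proof (rule locbdI)
  fix L
  obtain B where B: "0 \<le> B" "\<And>x. 0 \<le> x \<Longrightarrow> x \<le> L \<Longrightarrow> \<bar>f x\<bar> \<le> B" using locbdE[OF f] by blast
  obtain C where C: "0 \<le> C" "\<And>x. 0 \<le> x \<Longrightarrow> x \<le> L \<Longrightarrow> \<bar>g x\<bar> \<le> C" using locbdE[OF g] by blast
  have "\<bar>conv f g x\<bar> \<le> L * (B * C)" if x: "0 \<le> x" "x \<le> L" for x
  proof -
    have "\<bar>conv f g x\<bar> \<le> (\<integral>y. norm (indicator {0..x} y *\<^sub>R (f (x - y) * g y)) \<partial>lborel)"
      unfolding conv_def set_lebesgue_integral_def
      using integral_norm_bound[of lborel "\<lambda>y. indicator {0..x} y *\<^sub>R (f (x - y) * g y)"] by simp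
    also have "\<dots> \<le> (\<integral>y. indicator {0..x} y * (B * C) \<partial>lborel)"
      using integrable_norm[OF conv_integrable[OF f g, of x, unfolded set_integrable_def]]
      by (rule integral_mono[OF _ integrable_indicator_Icc])
        (use B C x in \<open>auto simp: indicator_def abs_mult intro!: mult_mono\<close>)
    also have "\<dots> \<le> L * (B * C)" using x B C by (simp add: mult_right_mono)
    finally show ?thesis .
  qed
  then show "\<exists>B. \<forall>x\<in>{0..L}. \<bar>conv f g x\<bar> \<le> B"
    by (intro exI[of _ "L * (B * C)"] ballI) simp
qed (intro conv_measurable locbd_measurable f g)

text \<open>The two sides are the two iterated integrals of \<open>k\<close>. Cutting every factor
  off at 0 confines \<open>k\<close> to the square \<open>{0..x} \<times> {0..x}\<close>, where
  local bounds justify Fubini.\<close>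

lemma conv_assoc:
  assumes f: "locbd f" and g: "locbd g" and h: "locbd h"
  shows "conv (conv f g) h x = conv f (conv g h) x"
proof -
  note [measurable] = locbd_measurable[OF f] locbd_measurable[OF g] locbd_measurable[OF h]
  define f' g' h' where d: "f' y = indicator {0..} y * f y" "g' y = indicator {0..} y * g y"
    "h' y = indicator {0..} y * h y" for y
  have [measurable]: "f' \<in> borel_measurable borel" "g' \<in> borel_measurable borel" "h' \<in> borel_measurable borel"
    by (auto simp: d[abs_def])
  define k where "k = (\<lambda>(y, z). f' (x - z) * g' (z - y) * h' y)"
  have [measurable]: "k \<in> borel_measurable (borel \<Otimes>\<^sub>M borel)" unfolding k_def by measurable
  have cv: "conv u v s = (\<integral>y. (indicator {0..} (s - y) * u (s - y)) * (indicator {0..} y * v y) \<partial>lborel)" for u v s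
    by (simp add: conv_eq mult.assoc)
  have z1: "indicator {0..} s * conv u v s = conv u v s" for u v s
    using conv_neg[of s u v] by (auto simp: indicator_def)
  obtain B1 where B1: "0 \<le> B1" "\<And>y. 0 \<le> y \<Longrightarrow> y \<le> x \<Longrightarrow> \<bar>f y\<bar> \<le> B1" using locbdE[OF f] by blast
  obtain B2 where B2: "0 \<le> B2" "\<And>y. 0 \<le> y \<Longrightarrow> y \<le> x \<Longrightarrow> \<bar>g y\<bar> \<le> B2" using locbdE[OF g] by blast
  obtain B3 where B3: "0 \<le> B3" "\<And>y. 0 \<le> y \<Longrightarrow> y \<le> x \<Longrightarrow> \<bar>h y\<bar> \<le> B3" using locbdE[OF h] by blast
  have int: "integrable (lborel \<Otimes>\<^sub>M lborel) k"
  proof (rule Bochner_Integration.integrable_bound)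
    show "integrable (lborel \<Otimes>\<^sub>M lborel) (\<lambda>p. indicator ({0..x} \<times> {0..x}) p * (B1 * B2 * B3) :: real)"
      by (intro integrable_mult_left integrable_real_indicator)
        (auto simp: lborel.emeasure_pair_measure_Times ennreal_mult_less_top emeasure_lborel_Icc_eq simp del: lborel_prod)
    show "AE p in lborel \<Otimes>\<^sub>M lborel. norm (k p) \<le> norm (indicator ({0..x} \<times> {0..x}) p * (B1 * B2 * B3) :: real)"
      using B1 B2 B3 by (intro AE_I2) (auto simp: k_def d indicator_def abs_mult intro!: mult_mono)
  qed simp
  have "conv (conv f g) h x = (\<integral>y. (\<integral>z. k (y, z) \<partial>lborel) \<partial>lborel)"
    unfolding cv[of _ h x]
  proof (intro Bochner_Integration.integral_cong refl)
    fix y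
    have "conv f g (x - y) = (\<integral>z. f' (x - y - (-y + 1 * z)) * g' (-y + 1 * z) \<partial>lborel)"
      unfolding cv by (subst lborel_integral_real_affine[where c=1 and t="-y"]) (auto simp: d)
    then show "indicator {0..} (x - y) * conv f g (x - y) * (indicator {0..} y * h y) = (\<integral>z. k (y, z) \<partial>lborel)"
      unfolding z1 by (simp add: k_def d(3) add.commute)
  qed
  also have "\<dots> = (\<integral>z. (\<integral>y. k (y, z) \<partial>lborel) \<partial>lborel)"
    using lborel_pair.Fubini_integral[of "\<lambda>y z. k (y, z)"] int by simp
  also have "\<dots> = conv f (conv g h) x"
    unfolding cv[of f _ x]
  proof (intro Bochner_Integration.integral_cong refl)
    fix z
    show "(\<integral>y. k (y, z) \<partial>lborel) = indicator {0..} (x - z) * f (x - z) * (indicator {0..} z * conv g h z)"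
      unfolding z1 unfolding cv[of g h z] k_def by (simp add: d mult.assoc)
  qed
  finally show ?thesis .
qed

text \<open>The factor \<open>exp (- l * x)\<close> splits over \<open>x - y\<close> and
  \<open>y\<close>, so the weighted convolution is a full-line convolution of two integrable
  functions.\<close>

lemma laplace_conv:
  assumes f: "locbd f" and g: "locbd g"
    and fi: "set_integrable lborel {0..} (\<lambda>y. exp (- l * y) * f y)"
    and gi: "set_integrable lborel {0..} (\<lambda>y. exp (- l * y) * g y)"
  shows "set_integrable lborel {0..} (\<lambda>y. exp (- l * y) * conv f g y)"
    and "(LBINT y:{0..}. exp (- l * y) * conv f g y) =
      (LBINT y:{0..}. exp (- l * y) * f y) * (LBINT y:{0..}. exp (- l * y) * g y)"
proof -
  note [measurable] = locbd_measurable[OF f] locbd_measurable[OF g]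
  define f' g' where d: "f' y = indicator {0..} y * (exp (- l * y) * f y)" "g' y = indicator {0..} y * (exp (- l * y) * g y)" for y
  have [measurable]: "f' \<in> borel_measurable borel" "g' \<in> borel_measurable borel" by (auto simp: d[abs_def])
  have fi': "integrable lborel f'" and gi': "integrable lborel g'"
    using fi gi by (auto simp: set_integrable_def d[abs_def])
  have sh: "(\<integral>x. u (x - y) \<partial>lborel) = (\<integral>x. u x \<partial>lborel)" for u :: "real \<Rightarrow> real" and y
    using lborel_integral_real_affine[where c=1 and t="-y" and f=u] by (simp add: add.commute)
  have shi: "integrable lborel (\<lambda>x. u (x - y))" if "integrable lborel u" for u :: "real \<Rightarrow> real" and y
    using lborel_integrable_real_affine[OF that, where c=1 and t="-y"] by (simp add: add.commute)
  have int: "integrable (lborel \<Otimes>\<^sub>M lborel) (\<lambda>(y, x). f' (x - y) * g' y)"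
  proof (rule lborel_pair.Fubini_integrable)
    show "integrable lborel (\<lambda>y. \<integral>x. norm (case (y, x) of (y, x) \<Rightarrow> f' (x - y) * g' y) \<partial>lborel)"
      using gi' sh[of "\<lambda>x. \<bar>f' x\<bar>"] by (simp add: abs_mult)
    show "AE y in lborel. integrable lborel (\<lambda>x. case (y, x) of (y, x) \<Rightarrow> f' (x - y) * g' y)"
      using shi[OF fi'] by simp
  qed measurable
  have eq: "(\<integral>y. f' (x - y) * g' y \<partial>lborel) = indicator {0..} x *\<^sub>R (exp (- l * x) * conv f g x)" for x
  proof -
    have "exp (- l * x) * conv f g x = (\<integral>y. exp (- l * x) * (indicator {0..} (x - y) * f (x - y) * (indicator {0..} y * g y)) \<partial>lborel)"
      by (simp add: conv_eq)
    also have "\<dots> = (\<integral>y. f' (x - y) * g' y \<partial>lborel)"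
      by (intro Bochner_Integration.integral_cong)
        (auto simp: d indicator_def exp_add[symmetric] algebra_simps)
    finally have "(\<integral>y. f' (x - y) * g' y \<partial>lborel) = exp (- l * x) * conv f g x" ..
    moreover have "conv f g x = 0" if "x < 0" using that by (rule conv_neg)
    ultimately show ?thesis by (auto simp: indicator_def)
  qed
  show "set_integrable lborel {0..} (\<lambda>y. exp (- l * y) * conv f g y)"
    unfolding set_integrable_def eq[symmetric] using lborel_pair.integrable_snd[of "\<lambda>y x. f' (x - y) * g' y"] int by simp
  have "(LBINT y:{0..}. exp (- l * y) * conv f g y) = (\<integral>x. (\<integral>y. f' (x - y) * g' y \<partial>lborel) \<partial>lborel)"
    unfolding set_lebesgue_integral_def eq ..
  also have "\<dots> = (\<integral>y. (\<integral>x. f' (x - y) * g' y \<partial>lborel) \<partial>lborel)"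
    using lborel_pair.Fubini_integral[of "\<lambda>y x. f' (x - y) * g' y"] int by simp
  also have "\<dots> = (\<integral>x. f' x \<partial>lborel) * (\<integral>y. g' y \<partial>lborel)" by (simp add: sh)
  finally show "(LBINT y:{0..}. exp (- l * y) * conv f g y) =
      (LBINT y:{0..}. exp (- l * y) * f y) * (LBINT y:{0..}. exp (- l * y) * g y)"
    by (simp add: set_lebesgue_integral_def d)
qed

text \<open>The positive and negative parts of \<open>f - g\<close> are densities with equal
  transforms, hence equal almost everywhere; as at most one of them is nonzero at a point, both
  vanish.\<close>

lemma AE_eq_laplace:
  fixes f g :: "real \<Rightarrow> real"
  assumes [measurable]: "f \<in> borel_measurable borel" "g \<in> borel_measurable borel"
    and fi: "\<And>l. l > l0 \<Longrightarrow> set_integrable lborel {0..} (\<lambda>y. exp (- l * y) * f y)"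
    and gi: "\<And>l. l > l0 \<Longrightarrow> set_integrable lborel {0..} (\<lambda>y. exp (- l * y) * g y)"
    and eq: "\<And>l. l > l0 \<Longrightarrow> (LBINT y:{0..}. exp (- l * y) * f y) = (LBINT y:{0..}. exp (- l * y) * g y)"
  shows "AE y in lborel. 0 \<le> y \<longrightarrow> f y = g y"
proof -
  define d where "d y = f y - g y" for y
  have [measurable]: "d \<in> borel_measurable borel" by (simp add: d_def[abs_def])
  have di: "integrable lborel (\<lambda>y. indicator {0..} y * (exp (- l * y) * d y))" if "l > l0" for l
    using set_integral_diff(1)[OF fi[OF that] gi[OF that]] by (simp add: set_integrable_def d_def right_diff_distrib)
  have d0: "(\<integral>y. indicator {0..} y * (exp (- l * y) * d y) \<partial>lborel) = 0" if "l > l0" for l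
    using set_integral_diff(2)[OF fi[OF that] gi[OF that]] eq[OF that]
    by (simp add: set_lebesgue_integral_def d_def right_diff_distrib)
  define p n where "p y = indicator {0..} y * max 0 (d y)" and "n y = indicator {0..} y * max 0 (- d y)" for y
  have [measurable]: "p \<in> borel_measurable borel" "n \<in> borel_measurable borel" by (auto simp: p_def[abs_def] n_def[abs_def])
  have pn: "p y \<ge> 0" "n y \<ge> 0" for y by (auto simp: p_def n_def)
  have pi: "integrable lborel (\<lambda>y. exp (- l * y) * p y)" "integrable lborel (\<lambda>y. exp (- l * y) * n y)" if "l > l0" for l
    by (rule Bochner_Integration.integrable_bound[OF di[OF that]], simp, intro AE_I2, auto simp: p_def n_def indicator_def)+
  have nn: "(\<integral>\<^sup>+y. exp (- l * y) \<partial>density lborel (\<lambda>y. ennreal (u y))) = ennreal (\<integral>y. exp (- l * y) * u y \<partial>lborel)"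
    if [measurable]: "u \<in> borel_measurable borel" and "\<And>y. u y \<ge> 0" "integrable lborel (\<lambda>y. exp (- l * y) * u y)" for u l
    using that by (subst nn_integral_density) (auto simp: nn_integral_eq_integral[symmetric] ennreal_mult'[symmetric] mult.commute)
  have "density lborel (\<lambda>y. ennreal (p y)) = density lborel (\<lambda>y. ennreal (n y))"
  proof (rule measure_eqI_laplace[where c=0 and ?l0.0=l0])
    show "AE x in density lborel (\<lambda>y. ennreal (p y)). 0 \<le> x" "AE x in density lborel (\<lambda>y. ennreal (n y)). 0 \<le> x"
      by (auto simp: AE_density p_def n_def indicator_def)
    fix l assume l: "l > l0"
    show "(\<integral>\<^sup>+y. exp (- l * y) \<partial>density lborel (\<lambda>y. ennreal (p y))) < \<infinity>"
      by (subst nn) (use l pn pi in auto)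
    have "(\<integral>y. exp (- l * y) * p y \<partial>lborel) - (\<integral>y. exp (- l * y) * n y \<partial>lborel) = (\<integral>y. exp (- l * y) * p y - exp (- l * y) * n y \<partial>lborel)"
      using pi[OF l] by simp
    also have "\<dots> = (\<integral>y. indicator {0..} y * (exp (- l * y) * d y) \<partial>lborel)"
      by (intro Bochner_Integration.integral_cong) (auto simp: p_def n_def indicator_def max_def)
    finally have "(\<integral>y. exp (- l * y) * p y \<partial>lborel) = (\<integral>y. exp (- l * y) * n y \<partial>lborel)" using d0[OF l] by simp
    then show "(\<integral>\<^sup>+y. exp (- l * y) \<partial>density lborel (\<lambda>y. ennreal (p y))) = (\<integral>\<^sup>+y. exp (- l * y) \<partial>density lborel (\<lambda>y. ennreal (n y)))"
      using pi[OF l] pn by (subst (1 2) nn) auto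
  qed auto
  then have "AE y in lborel. ennreal (p y) = ennreal (n y)"
    by (subst (asm) sigma_finite_measure.density_unique_iff[OF lborel.sigma_finite_measure_axioms]) auto
  then show ?thesis
  proof eventually_elim
    case (elim y)
    then have "p y = n y" using pn by simp
    then show ?case by (auto simp: p_def n_def d_def indicator_def max_def split: if_splits)
  qed
qed

section \<open>Right inverses of convex functions\<close>

text \<open>Convexity and \<open>\<psi> 0 = 0\<close> give
  \<open>\<psi> x \<le> x / y * \<psi> y\<close> for \<open>x \<le> y\<close>: once above
  \<open>q\<close>, the function stays above, so the solution set is bounded. Wherever
  \<open>\<psi> a \<le> q\<close>, the intermediate value theorem finds a solution at or beyond
  \<open>a\<close>, which settles existence and the last claim.\<close>

lemma right_inverse_properties:
  fixes \<psi> :: "real \<Rightarrow> real"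
  assumes cont: "continuous_on {0..} \<psi>" and convex: "convex_on {0..} \<psi>" and zero: "\<psi> 0 = 0"
    and unbdd: "\<And>K. \<exists>l\<ge>0. K < \<psi> l" and q: "0 \<le> q"
  shows "0 \<le> right_inverse \<psi> q" "\<psi> (right_inverse \<psi> q) = q" "\<And>l. right_inverse \<psi> q < l \<Longrightarrow> q < \<psi> l"
proof -
  define S where "S = {l. 0 \<le> l \<and> \<psi> l = q}"
  have scale: "\<psi> x \<le> x / y * \<psi> y" if "0 \<le> x" "x \<le> y" "0 < y" for x y
    using convex_onD[OF convex, of "x / y" 0 y] that zero by simp
  have ivt: "\<exists>x\<in>S. a \<le> x" if "0 \<le> a" "\<psi> a \<le> q" for a
  proof -
    \<comment> \<open>A value above both \<open>q\<close> and \<open>\<psi> a\<close> cannot be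
      taken at some \<open>l \<le> a\<close>: convexity would bound it by
      \<open>max 0 (\<psi> a)\<close>.\<close>
    obtain l where l: "0 \<le> l" "max q (\<psi> a) + q < \<psi> l" using unbdd by blast
    obtain l' where l': "0 \<le> l'" "(a + 1) * \<bar>\<psi> l\<bar> + \<bar>q\<bar> + \<bar>\<psi> l\<bar> < \<psi> l'" using unbdd by blast
    have "\<exists>b\<ge>a. q < \<psi> b"
    proof (cases "l \<le> a")
      case True
      have "0 < l" using l q zero by (cases "l = 0") auto
      then have "\<psi> l \<le> l / a * \<psi> a" using scale[of l a] True by auto
      moreover have "l / a \<le> 1" "0 \<le> l / a" using True \<open>0 < l\<close> by auto
      ultimately have "\<psi> l \<le> max 0 (\<psi> a)"
        by (smt (verit) mult_left_le_one_le mult_nonneg_nonpos)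
      then show ?thesis using l q that by auto
    next
      case False then show ?thesis using l q by (intro exI[of _ l]) auto
    qed
    then obtain b where b: "a \<le> b" "q < \<psi> b" by blast
    have "\<exists>x\<ge>a. x \<le> b \<and> \<psi> x = q"
      by (rule IVT') (use b that continuous_on_subset[OF cont] in auto)
    then obtain x where "a \<le> x" "\<psi> x = q" by blast
    then show ?thesis using that(1) by (intro bexI[of _ x]) (auto simp: S_def)
  qed
  have ne: "S \<noteq> {}" using ivt[of 0] zero q by auto
  have bdd: "bdd_above S"
  proof -
    obtain l1 where l1: "0 \<le> l1" "q < \<psi> l1" using unbdd by blast
    have "0 < l1" using l1 q zero by (cases "l1 = 0") auto
    have "x \<le> l1" if "x \<in> S" for x
    proof (rule ccontr)
      assume "\<not> x \<le> l1"
      then have "\<psi> l1 \<le> l1 / x * q" using scale[of l1 x] \<open>0 < l1\<close> that by (auto simp: S_def)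
      also have "\<dots> \<le> q" using \<open>\<not> x \<le> l1\<close> \<open>0 < l1\<close> q by (intro mult_left_le_one_le) auto
      finally show False using l1 by simp
    qed
    then show ?thesis by (rule bdd_aboveI)
  qed
  have "closed S"
  proof -
    have "S = {0..} \<inter> \<psi> -` {q}" by (auto simp: S_def)
    then show ?thesis using continuous_on_closed_vimage[of "{0..}" \<psi>] cont by (simp add: Int_commute)
  qed
  then have mem: "Sup S \<in> S" using closed_contains_Sup[OF ne bdd] by blast
  have ri: "right_inverse \<psi> q = Sup S" by (simp add: right_inverse_def S_def)
  show "0 \<le> right_inverse \<psi> q" "\<psi> (right_inverse \<psi> q) = q" using mem by (auto simp: ri S_def)
  show "q < \<psi> l" if "right_inverse \<psi> q < l" for l
  proof (rule ccontr)
    assume "\<not> q < \<psi> l"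
    moreover have "0 \<le> l" using that mem by (simp add: ri S_def)
    ultimately obtain x where "x \<in> S" "l \<le> x" using ivt[of l] by auto
    then show False using cSup_upper[OF \<open>x \<in> S\<close> bdd] that ri by simp
  qed
qed

text \<open>For a convex function vanishing at 0 the quotient \<open>\<psi> h / h\<close> is
  nondecreasing, so its limit at 0 is its infimum, in the extended reals. This is what makes the
  \<open>Lim\<close> in \<open>right_deriv_0\<close> meaningful.\<close>

lemma right_deriv_0_tendsto:
  fixes \<psi> :: "real \<Rightarrow> real"
  assumes convex: "convex_on {0..} \<psi>" and zero: "\<psi> 0 = 0"
  shows "((\<lambda>h. ereal (\<psi> h / h)) \<longlongrightarrow> right_deriv_0 \<psi>) (at_right 0)"
    and "\<And>h. 0 < h \<Longrightarrow> right_deriv_0 \<psi> \<le> ereal (\<psi> h / h)"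
proof -
  define L where "L = (INF h\<in>{0<..}. ereal (\<psi> h / h))"
  have mono: "\<psi> x / x \<le> \<psi> y / y" if "0 < x" "x \<le> y" for x y
  proof -
    have "\<psi> x \<le> \<psi> y / y * x" using convex_onD[OF convex, of "x / y" 0 y] that zero by (simp add: mult.commute)
    then show ?thesis using that(1) by (simp add: pos_divide_le_eq)
  qed
  have lb: "L \<le> ereal (\<psi> h / h)" if "0 < h" for h
    unfolding L_def using that by (intro INF_lower) auto
  have lim: "((\<lambda>h. ereal (\<psi> h / h)) \<longlongrightarrow> L) (at_right 0)"
  proof (rule order_tendstoI)
    fix a assume "a < L"
    then show "\<forall>\<^sub>F h in at_right 0. a < ereal (\<psi> h / h)"
      unfolding eventually_at_right_field
      by (intro exI[of _ 1]) (auto intro: order.strict_trans2[OF _ lb])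
  next
    fix a assume "L < a"
    then obtain h0 where h0: "0 < h0" "ereal (\<psi> h0 / h0) < a" by (auto simp: L_def INF_less_iff)
    have "ereal (\<psi> h / h) < a" if "0 < h" "h < h0" for h
      using mono[of h h0] that h0 by (meson ereal_less_eq(3) less_imp_le order.strict_trans1)
    then show "\<forall>\<^sub>F h in at_right 0. ereal (\<psi> h / h) < a"
      using h0 by (auto simp: eventually_at_right[OF h0(1)] intro!: exI[of _ h0])
  qed
  then have "right_deriv_0 \<psi> = L"
    unfolding right_deriv_0_def using zero by (intro tendsto_Lim) auto
  then show "((\<lambda>h. ereal (\<psi> h / h)) \<longlongrightarrow> right_deriv_0 \<psi>) (at_right 0)"
    "\<And>h. 0 < h \<Longrightarrow> right_deriv_0 \<psi> \<le> ereal (\<psi> h / h)" using lim lb by auto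
qed

lemma right_deriv_0_pos:
  fixes \<psi> :: "real \<Rightarrow> real"
  assumes "convex_on {0..} \<psi>" "\<psi> 0 = 0" "right_deriv_0 \<psi> > 0"
  defines "m \<equiv> real_of_ereal (right_deriv_0 \<psi>)"
  shows "0 < m" "((\<lambda>h. \<psi> h / h) \<longlongrightarrow> m) (at_right 0)" "\<And>h. 0 < h \<Longrightarrow> m * h \<le> \<psi> h"
proof -
  note R = right_deriv_0_tendsto[OF assms(1,2)]
  have "right_deriv_0 \<psi> \<le> ereal (\<psi> 1 / 1)" using R(2)[of 1] by simp
  then have m: "right_deriv_0 \<psi> = ereal m" using assms(3) unfolding m_def by (cases "right_deriv_0 \<psi>") auto
  show "0 < m" using assms(3) m by simp
  show "((\<lambda>h. \<psi> h / h) \<longlongrightarrow> m) (at_right 0)" using R(1) unfolding m by simp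
  show "m * h \<le> \<psi> h" if "0 < h" for h using R(2)[OF that] that unfolding m by (simp add: field_simps)
qed

lemma right_deriv_0_neg:
  fixes \<psi> :: "real \<Rightarrow> real"
  assumes "convex_on {0..} \<psi>" "\<psi> 0 = 0" "right_deriv_0 \<psi> < 0"
  shows "\<exists>h>0. \<psi> h < 0"
proof -
  have "\<forall>\<^sub>F h in at_right 0. ereal (\<psi> h / h) < 0"
    using order_tendstoD(2)[OF right_deriv_0_tendsto(1)[OF assms(1,2)] assms(3)] .
  then obtain b where b: "0 < b" "\<And>h. 0 < h \<Longrightarrow> h < b \<Longrightarrow> ereal (\<psi> h / h) < 0"
    by (auto simp: eventually_at_right_field)
  then show ?thesis using b(2)[of "b / 2"] b(1) by (intro exI[of _ "b / 2"]) (auto simp: divide_less_0_iff)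
qed

text \<open>The chord from the point with negative value up to the root has slope
  \<open>s > 0\<close>, and by convexity every chord leaving the root to the right is at least as
  steep.\<close>

lemma convex_deriv_at_root_pos:
  fixes \<psi> :: "real \<Rightarrow> real"
  assumes convex: "convex_on {0..} \<psi>" and h: "0 \<le> h" "\<psi> h < 0" and r: "h < r" "\<psi> r = 0"
    and D: "(\<psi> has_real_derivative D) (at r)"
  shows "0 < D" "((\<lambda>x. \<psi> (r + x) / x) \<longlongrightarrow> D) (at_right 0)"
proof -
  have lim: "((\<lambda>x. \<psi> (r + x) / x) \<longlongrightarrow> D) (at 0)"
    using D r by (simp add: DERIV_def)
  then show lim': "((\<lambda>x. \<psi> (r + x) / x) \<longlongrightarrow> D) (at_right 0)"
    by (rule tendsto_mono[OF at_le, rotated]) simp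
  define s where "s = - \<psi> h / (r - h)"
  have s: "0 < s" using h r by (simp add: s_def divide_neg_pos)
  have "s \<le> \<psi> (r + x) / x" if x: "0 < x" for x
  proof -
    \<comment> \<open>The weight for which \<open>r\<close> is the convex combination of
      \<open>h\<close> and \<open>r + x\<close>.\<close>
    define t where "t = (r - h) / (r - h + x)"
    have t: "0 \<le> t" "t \<le> 1" using x r by (auto simp: t_def)
    have e: "(1 - t) *\<^sub>R h + t *\<^sub>R (r + x) = r"
    proof -
      have "t * (r - h + x) = r - h" using x r by (simp add: t_def)
      then show ?thesis by (simp add: algebra_simps)
    qed
    have "0 \<le> (1 - t) * \<psi> h + t * \<psi> (r + x)"
      using convex_onD[OF convex t, of h "r + x"] h r x unfolding e by simp
    moreover have "1 - t = x / (r - h + x)" using x r by (simp add: t_def field_simps)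
    ultimately have "0 \<le> (x * \<psi> h + (r - h) * \<psi> (r + x)) / (r - h + x)"
      by (simp add: t_def add_divide_distrib)
    then have "0 \<le> x * \<psi> h + (r - h) * \<psi> (r + x)" using x r by (simp add: zero_le_divide_iff)
    then show ?thesis using x r by (simp add: s_def field_simps)
  qed
  then have "s \<le> D"
    by (intro tendsto_lowerbound[OF lim']) (auto simp: eventually_at_filter)
  then show "0 < D" using s by simp
qed

text \<open>From \<open>m * \<Phi> q \<le> \<psi> (\<Phi> q) = q\<close> the value
  \<open>\<Phi> q\<close> tends to 0, and substituting \<open>h = \<Phi> q\<close> in the limit of
  \<open>\<psi> h / h\<close> gives the limit of \<open>q / \<Phi> q\<close>.\<close>

lemma right_inverse_ratio_tendsto:
  fixes \<psi> \<Phi> :: "real \<Rightarrow> real"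
  assumes m: "0 < m" and lim: "((\<lambda>h. \<psi> h / h) \<longlongrightarrow> m) (at_right 0)"
    and ge: "\<And>h. 0 < h \<Longrightarrow> m * h \<le> \<psi> h"
    and \<Phi>: "\<And>q. 0 < q \<Longrightarrow> 0 < \<Phi> q" "\<And>q. 0 < q \<Longrightarrow> \<psi> (\<Phi> q) = q"
  shows "((\<lambda>q. \<Phi> q / q) \<longlongrightarrow> 1 / m) (at_right 0)"
proof -
  have pos: "\<forall>\<^sub>F q in at_right (0::real). 0 < q" by (simp add: eventually_at_filter)
  have "(\<Phi> \<longlongrightarrow> 0) (at_right 0)"
  proof (rule real_tendsto_sandwich)
    show "\<forall>\<^sub>F q in at_right 0. 0 \<le> \<Phi> q" using pos by eventually_elim (use \<Phi>(1) in \<open>auto intro: less_imp_le\<close>)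
    show "\<forall>\<^sub>F q in at_right 0. \<Phi> q \<le> q / m"
      using pos by eventually_elim (use ge \<Phi> m in \<open>fastforce simp: field_simps\<close>)
    show "((\<lambda>q. q / m) \<longlongrightarrow> 0) (at_right 0)" by (rule tendsto_eq_intros refl | use m in simp)+
  qed simp
  then have "filterlim \<Phi> (at_right 0) (at_right 0)"
    unfolding filterlim_at using pos by (auto elim!: eventually_mono dest: \<Phi>(1))
  from filterlim_compose[OF lim this] have "((\<lambda>q. \<psi> (\<Phi> q) / \<Phi> q) \<longlongrightarrow> m) (at_right 0)" .
  then have "((\<lambda>q. inverse (\<psi> (\<Phi> q) / \<Phi> q)) \<longlongrightarrow> inverse m) (at_right 0)"
    using m by (intro tendsto_inverse) auto
  then have "((\<lambda>q. inverse (\<psi> (\<Phi> q) / \<Phi> q)) \<longlongrightarrow> 1 / m) (at_right 0)" by (simp add: inverse_eq_divide)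
  then show ?thesis
    by (rule Lim_transform_eventually) (use pos in \<open>eventually_elim, simp add: \<Phi>(2)\<close>)
qed

section \<open>Scale functions and Volterra equations\<close>

lemma set_integral_Icc_null:
  fixes f :: "real \<Rightarrow> real"
  assumes "x \<le> L" shows "(LBINT y:{L..x}. f y) = 0"
  unfolding set_lebesgue_integral_def
proof (rule integral_eq_zero_AE)
  show "AE y in lborel. indicator {L..x} y *\<^sub>R f y = 0"
    using AE_lborel_singleton[of L] by eventually_elim (use assms in \<open>simp add: indicator_def\<close>)
qed

text \<open>A contraction in the norm weighted by \<open>exp (l * z)\<close>: a bound
  \<open>- g z \<le> s * exp (l * z)\<close>, inserted into the equation, comes back with
  \<open>\<theta> * s\<close>, where \<open>\<theta> < 1\<close> is \<open>q\<close> times the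
  transform of \<open>W\<close> at \<open>l\<close>. Iteration drives the bound to 0.\<close>

lemma volterra_nonneg:
  assumes W: "locbd W" "\<And>y. 0 \<le> y \<Longrightarrow> 0 \<le> W y" and g: "locbd g"
    and h: "\<And>x. 0 \<le> x \<Longrightarrow> 0 \<le> h x" and q: "0 \<le> q" and l: "0 \<le> l"
    and Wi: "set_integrable lborel {0..} (\<lambda>y. exp (- l * y) * W y)"
    and small: "q * (LBINT y:{0..}. exp (- l * y) * W y) < 1"
    and eq: "\<And>x. 0 \<le> x \<Longrightarrow> g x = h x + q * conv W g x" and x: "0 \<le> x"
  shows "0 \<le> g x"
proof -
  define \<theta> where "\<theta> = q * (LBINT y:{0..}. exp (- l * y) * W y)"
  have LW: "0 \<le> (LBINT y:{0..}. exp (- l * y) * W y)"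
    unfolding set_lebesgue_integral_def using W(2) by (intro Bochner_Integration.integral_nonneg) (auto simp: indicator_def)
  have \<theta>: "0 \<le> \<theta>" "\<theta> < 1" using LW q small by (auto simp: \<theta>_def)
  have step: "\<forall>z\<in>{0..x}. - g z \<le> (\<theta> * s) * exp (l * z)"
    if s: "0 \<le> s" and IH: "\<forall>z\<in>{0..x}. - g z \<le> s * exp (l * z)" for s
  proof
    fix z assume z: "z \<in> {0..x}"
    have "conv W (\<lambda>y. (-1) * g y) z \<le> conv W (\<lambda>y. s * exp (l * y)) z"
      by (intro conv_mono locbd_mult locbd_const locbd_exp W g) (use z IH in auto)
    also have "\<dots> = s * conv (\<lambda>y. exp (l * y)) W z" by (simp add: conv_cmult_right conv_commute)
    also have "conv (\<lambda>y. exp (l * y)) W z = exp (l * z) * (LBINT y:{0..z}. exp (- l * y) * W y)"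
      unfolding conv_def by (subst set_integral_mult_right[symmetric], rule set_lebesgue_integral_cong)
        (auto simp: mult.assoc[symmetric] exp_add[symmetric] right_diff_distrib)
    also have "\<dots> \<le> exp (l * z) * (LBINT y:{0..}. exp (- l * y) * W y)"
    proof (intro mult_left_mono)
      show "(LBINT y:{0..z}. exp (- l * y) * W y) \<le> (LBINT y:{0..}. exp (- l * y) * W y)"
        using set_integrable_subset[OF Wi, of "{0..z}"] Wi W(2)
        unfolding set_lebesgue_integral_def set_integrable_def
        by (intro integral_mono) (auto simp: indicator_def)
    qed simp
    finally have "q * conv W (\<lambda>y. (-1) * g y) z \<le> q * (s * (exp (l * z) * (LBINT y:{0..}. exp (- l * y) * W y)))"
      using q s by (simp add: mult_left_mono)
    then have "- (q * conv W g z) \<le> \<theta> * s * exp (l * z)"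
      unfolding conv_cmult_right by (simp add: \<theta>_def mult_ac)
    then show "- g z \<le> (\<theta> * s) * exp (l * z)" using eq[of z] h[of z] z by auto
  qed
  obtain B where B: "0 \<le> B" "\<And>z. 0 \<le> z \<Longrightarrow> z \<le> x \<Longrightarrow> \<bar>g z\<bar> \<le> B" using locbdE[OF g] by blast
  have "\<forall>z\<in>{0..x}. - g z \<le> (\<theta> ^ n * B) * exp (l * z)" for n
  proof (induction n)
    case 0
    show ?case
    proof
      fix z assume z: "z \<in> {0..x}"
      have "- g z \<le> B * 1" using B(2)[of z] z by auto
      also have "\<dots> \<le> B * exp (l * z)" using B(1) l z by (intro mult_left_mono) auto
      finally show "- g z \<le> \<theta> ^ 0 * B * exp (l * z)" by simp
    qed
  next
    case (Suc n)
    then show ?case using step[of "\<theta> ^ n * B"] \<theta> B by (simp add: mult.assoc)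
  qed
  then have "- g x \<le> (\<theta> ^ n * B) * exp (l * x)" for n using x by simp
  moreover have "(\<lambda>n. (\<theta> ^ n * B) * exp (l * x)) \<longlonglongrightarrow> (0 * B) * exp (l * x)"
    using \<theta> by (intro tendsto_intros LIMSEQ_realpow_zero) auto
  ultimately have "- g x \<le> (0 * B) * exp (l * x)" using LIMSEQ_le_const by blast
  then show ?thesis by simp
qed

lemma scale_function_measurable:
  assumes "is_scale_function \<psi> r w" shows "w \<in> borel_measurable borel"
proof -
  have "(\<lambda>x. indicator {0..} x *\<^sub>R w x) \<in> borel_measurable borel"
    using assms by (intro borel_measurable_continuous_on_indicator) (auto simp: is_scale_function_def)
  also have "(\<lambda>x. indicator {0..} x *\<^sub>R w x) = w"
    using assms by (auto simp: is_scale_function_def indicator_def fun_eq_iff not_le)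
  finally show ?thesis .
qed

lemma scale_function_locbd:
  assumes "is_scale_function \<psi> r w" shows "locbd w"
  using scale_function_measurable[OF assms] assms
  by (intro locbd_continuous) (auto simp: is_scale_function_def)

text \<open>In transforms this is \<open>1 / (\<psi> - q) = 1 / \<psi> + q * (1 / \<psi>) * (1 /
  (\<psi> - q))\<close>. An identity almost everywhere is enough, as it is later used under
  integrals or for a sign almost everywhere, and it spares a proof that the convolution is
  continuous.\<close>

lemma scale_function_resolvent:
  assumes W: "is_scale_function \<psi> 0 W" and Wq: "is_scale_function \<psi> q Wq"
    and ge: "\<And>l. right_inverse \<psi> q < l \<Longrightarrow> right_inverse \<psi> 0 < l \<and> \<psi> l > q" and q: "0 \<le> q"
  shows "AE y in lborel. 0 \<le> y \<longrightarrow> Wq y = W y + q * conv W Wq y"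
proof (rule AE_eq_laplace)
  note lW = scale_function_locbd[OF W] and lWq = scale_function_locbd[OF Wq]
  show "Wq \<in> borel_measurable borel" by (rule locbd_measurable[OF lWq])
  show "(\<lambda>y. W y + q * conv W Wq y) \<in> borel_measurable borel"
    by (intro locbd_measurable locbd_add locbd_mult locbd_const locbd_conv lW lWq)
  fix l assume l: "l > right_inverse \<psi> q"
  have g: "right_inverse \<psi> 0 < l" "\<psi> l > q" using ge[OF l] by auto
  have 1: "set_integrable lborel {0..} (\<lambda>y. exp (- l * y) * W y)" "(LBINT y:{0..}. exp (- l * y) * W y) = 1 / \<psi> l"
    using W g by (auto simp: is_scale_function_def)
  have 2: "set_integrable lborel {0..} (\<lambda>y. exp (- l * y) * Wq y)" "(LBINT y:{0..}. exp (- l * y) * Wq y) = 1 / (\<psi> l - q)"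
    using Wq l by (auto simp: is_scale_function_def)
  show "set_integrable lborel {0..} (\<lambda>y. exp (- l * y) * Wq y)" by fact
  note 3 = laplace_conv[OF lW lWq 1(1) 2(1)]
  have e: "exp (- l * y) * (W y + q * conv W Wq y) = exp (- l * y) * W y + q * (exp (- l * y) * conv W Wq y)" for y
    by (simp add: algebra_simps)
  show "set_integrable lborel {0..} (\<lambda>y. exp (- l * y) * (W y + q * conv W Wq y))"
    unfolding e by (intro set_integral_add set_integrable_mult_right 1 3)
  have "(LBINT y:{0..}. exp (- l * y) * (W y + q * conv W Wq y)) = 1 / \<psi> l + q * (1 / \<psi> l * (1 / (\<psi> l - q)))"
    using set_integral_add(2)[OF 1(1) set_integrable_mult_right[OF 3(1)], of q]
    unfolding e set_integral_mult_right 1(2) 3(2) 2(2) .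
  also have "\<dots> = 1 / (\<psi> l - q)" using g q by (simp add: field_simps)
  finally show "(LBINT y:{0..}. exp (- l * y) * Wq y) = (LBINT y:{0..}. exp (- l * y) * (W y + q * conv W Wq y))"
    unfolding 2(2) by (rule sym)
qed

text \<open>\<open>Wq\<close> is the resolvent kernel of the equation
  \<open>g = h + q * conv W g\<close>; \<open>small\<close> names a point at which the weighted
  contraction of \<open>volterra_nonneg\<close> works.\<close>

locale volterra_resolvent =
  fixes W Wq :: "real \<Rightarrow> real" and q :: real
  assumes lW: "locbd W" and lWq: "locbd Wq" and q: "0 \<le> q"
    and resolvent: "AE y in lborel. 0 \<le> y \<longrightarrow> Wq y = W y + q * conv W Wq y"
    and W_nonneg: "\<And>y. 0 \<le> W y" and W_neg: "\<And>y. y < 0 \<Longrightarrow> W y = 0"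
    and small: "\<exists>l\<ge>0. set_integrable lborel {0..} (\<lambda>y. exp (- l * y) * W y) \<and>
       q * (LBINT y:{0..}. exp (- l * y) * W y) < 1"
begin

text \<open>The solution operator of \<open>g = h + q * conv W g\<close>. For the scale functions it
  maps the constant 1 to \<open>scale_Z W q\<close> and \<open>exp (\<Phi> 0 * x)\<close> to
  \<open>scale_H \<Phi> W 0 q\<close>.\<close>

definition R :: "(real \<Rightarrow> real) \<Rightarrow> real \<Rightarrow> real" where
  "R h x = h x + q * conv h Wq x"

lemma conv_resolvent: "locbd h \<Longrightarrow> conv h Wq x = conv h W x + q * conv h (conv W Wq) x"
proof -
  assume h: "locbd h"
  have "conv h Wq x = conv h (\<lambda>y. W y + q * conv W Wq y) x"
    by (intro conv_cong_AE locbd_measurable h lWq locbd_add locbd_mult locbd_const locbd_conv lW resolvent)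
  also have "\<dots> = conv h W x + q * conv h (conv W Wq) x"
    by (subst conv_add_right) (auto intro!: h lW locbd_mult locbd_const locbd_conv lWq simp: conv_cmult_right)
  finally show ?thesis .
qed

lemma Wq_nonneg: "AE y in lborel. 0 \<le> y \<longrightarrow> 0 \<le> Wq y"
proof -
  \<comment> \<open>\<open>c\<close> agrees with \<open>Wq\<close> almost everywhere on the
    half-line but satisfies the Volterra equation at every point, as \<open>volterra_nonneg\<close>
    demands.\<close>
  define c where "c y = W y + q * conv W Wq y" for y
  have lc: "locbd c" unfolding c_def by (intro locbd_add locbd_mult locbd_const locbd_conv lW lWq)
  have "conv W c x = conv W Wq x" for x
    by (rule sym, intro conv_cong_AE locbd_measurable lW lWq lc) (use resolvent in \<open>simp add: c_def\<close>)
  then have c_eq: "c x = W x + q * conv W c x" for x by (simp add: c_def)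
  obtain l where l: "0 \<le> l" "set_integrable lborel {0..} (\<lambda>y. exp (- l * y) * W y)"
    "q * (LBINT y:{0..}. exp (- l * y) * W y) < 1" using small by blast
  have "0 \<le> c x" if "0 \<le> x" for x
    by (rule volterra_nonneg[OF lW _ lc _ q l(1-3) c_eq that]) (simp_all add: W_nonneg)
  note c_nonneg = this
  from resolvent show ?thesis
    by eventually_elim (use c_nonneg in \<open>simp add: c_def\<close>)
qed

lemma locbd_R: "locbd h \<Longrightarrow> locbd (R h)"
  unfolding R_def by (intro locbd_add locbd_mult locbd_const locbd_conv lWq)

lemma R_ge: assumes "locbd h" "\<And>y. 0 \<le> y \<Longrightarrow> 0 \<le> h y" shows "h x \<le> R h x"
proof -
  have "0 \<le> conv h Wq x" unfolding conv_def set_lebesgue_integral_def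
  proof (rule integral_nonneg_AE)
    show "AE y in lborel. 0 \<le> indicator {0..x} y *\<^sub>R (h (x - y) * Wq y)"
      using Wq_nonneg by eventually_elim (use assms(2) in \<open>simp add: indicator_def\<close>)
  qed
  then show ?thesis using q by (simp add: R_def)
qed

text \<open>Reassociating \<open>conv W (conv h Wq)\<close> to \<open>conv h (conv W Wq)\<close>
  leaves exactly the resolvent equation of \<open>Wq\<close>, convolved with
  \<open>h\<close>.\<close>

lemma R_eq: assumes h: "locbd h" shows "R h x = h x + q * conv W (R h) x"
proof -
  have "conv W (R h) x = conv W h x + q * conv W (conv h Wq) x"
    unfolding R_def[abs_def] by (subst conv_add_right)
      (auto intro!: h lW locbd_mult locbd_const locbd_conv lWq simp: conv_cmult_right)
  also have "conv W (conv h Wq) x = conv (conv W h) Wq x" by (rule conv_assoc[OF lW h lWq, symmetric])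
  also have "conv W h = conv h W" by (rule ext) (rule conv_commute)
  also have "conv (conv h W) Wq x = conv h (conv W Wq) x" by (rule conv_assoc[OF h lW lWq])
  finally have main: "conv W (R h) x = conv h W x + q * conv h (conv W Wq) x" .
  show ?thesis unfolding R_def[of h x] main conv_resolvent[OF h] ..
qed

text \<open>Convolving the equation with \<open>Wq\<close> and using the resolvent equation cancels
  the unknown and leaves \<open>conv W g = conv Wq h\<close>. Having the equation on
  \<open>{0..L}\<close> suffices, since a convolution at \<open>x\<close> sees arguments up to
  \<open>x\<close> only.\<close>

lemma solution_unique:
  assumes h: "locbd h" and g: "locbd g"
    and eq: "\<And>x. 0 \<le> x \<Longrightarrow> x \<le> L \<Longrightarrow> g x = h x + q * conv W g x" and x: "0 \<le> x" "x \<le> L"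
  shows "g x = R h x"
proof -
  have "conv Wq g x = conv Wq (\<lambda>x. h x + q * conv W g x) x"
    by (rule conv_cong) (use eq x in auto)
  also have "\<dots> = conv Wq h x + q * conv Wq (conv W g) x"
    by (subst conv_add_right) (auto intro!: h g lW locbd_mult locbd_const locbd_conv lWq simp: conv_cmult_right)
  also have "conv Wq (conv W g) x = conv g (conv W Wq) x"
  proof -
    have "conv Wq (conv W g) x = conv (conv Wq W) g x" by (simp add: conv_assoc lW lWq g)
    also have "conv Wq W = conv W Wq" by (auto simp: conv_commute)
    finally show ?thesis by (simp add: conv_commute)
  qed
  finally have "conv W g x = conv Wq h x" using conv_resolvent[OF g, of x] by (simp add: conv_commute)
  then show ?thesis using eq[OF x] by (simp add: R_def conv_commute)
qed

text \<open>The source of the integrals over \<open>{b..x}\<close> in the final formulas: the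
  integral equation has the fixed upper limit \<open>L\<close>, whereas the resolvent handles the
  upper limit \<open>x\<close>.\<close>

lemma integral_Icc_0_L:
  assumes S: "locbd S" and L: "0 \<le> L"
  shows "(LBINT y:{0..L}. W (x - y) * S y) = conv W S x - (LBINT y:{L..x}. W (x - y) * S y)"
proof (cases "L < x")
  case True
  have i: "set_integrable lborel {0..x} (\<lambda>y. W (x - y) * S y)" by (rule conv_integrable[OF lW S])
  have "conv W S x = (LBINT y:{0..L} \<union> {L<..x}. W (x - y) * S y)"
    using True L by (simp add: conv_def ivl_disj_un)
  also have "\<dots> = (LBINT y:{0..L}. W (x - y) * S y) + (LBINT y:{L<..x}. W (x - y) * S y)"
    by (rule set_integral_Un) (use True L in \<open>auto intro!: set_integrable_subset[OF i]\<close>)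
  also have "(LBINT y:{L<..x}. W (x - y) * S y) = (LBINT y:{L..x}. W (x - y) * S y)"
    unfolding set_lebesgue_integral_def
    using locbd_measurable[OF lW] locbd_measurable[OF S] AE_lborel_singleton[of L]
    by (intro integral_cong_AE) (auto simp: indicator_def elim!: eventually_mono)
  finally show ?thesis by simp
next
  case False
  have "(LBINT y:{L..x}. W (x - y) * S y) = 0"
    using False by (intro set_integral_Icc_null) simp
  moreover have "(LBINT y:{0..L}. W (x - y) * S y) = conv W S x"
    unfolding conv_def set_lebesgue_integral_def
    by (intro Bochner_Integration.integral_cong refl) (use False W_neg in \<open>auto simp: indicator_def not_le\<close>)
  ultimately show ?thesis by simp
qed

text \<open>With \<open>F\<close> the solution shifted so that \<open>a\<close> becomes 0, the
  exponential part of the kernel contributes \<open>- q * c * exp (\<phi> * u)\<close>, so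
  \<open>F = Z - q * c * H\<close> on \<open>{0..L}\<close> by linearity of
  \<open>R\<close>.\<close>

lemma integral_equation_solution:
  assumes f: "f \<in> borel_measurable borel" "\<And>x. \<bar>f x\<bar> \<le> B" and ab: "a \<le> b" and \<kappa>: "0 < \<kappa>"
    and eq: "\<And>x. f x = 1 - q * (LBINT y:{a<..<b}. f y * (exp (\<phi> * (x - y)) / \<kappa> - W (x - y)))"
  defines "Z \<equiv> R (\<lambda>_. 1)" and "H \<equiv> R (\<lambda>x. exp (\<phi> * x))"
  shows "f x = Z (x - a) - q * (LBINT y:{b..x}. W (x - y) * Z (y - a))
      - q * (LBINT y:{0..b - a}. exp (- \<phi> * y) * Z y)
          / (\<kappa> + q * (LBINT y:{0..b - a}. exp (- \<phi> * y) * H y))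
        * (H (x - a) - q * (LBINT y:{b..x}. W (x - y) * H (y - a)))"
proof -
  define L where "L = b - a"
  define F where "F y = f (y + a)" for y
  define c where "c = (LBINT y:{0..L}. exp (- \<phi> * y) * F y) / \<kappa>"
  have L: "0 \<le> L" using ab by (simp add: L_def)
  have [measurable]: "f \<in> borel_measurable borel" by fact
  have lF: "locbd F" by (rule locbd_bounded[of _ B]) (auto simp: F_def[abs_def] f)
  have [measurable]: "W \<in> borel_measurable borel" by (rule locbd_measurable[OF lW])
  have lZ: "locbd Z" and lH: "locbd H" unfolding Z_def H_def by (intro locbd_R locbd_const locbd_exp)+
  have eI: "set_integrable lborel {0..L} (\<lambda>y. exp (- \<phi> * y) * S y)" if "locbd S" for S
  proof -
    have "set_integrable lborel {0..L} (\<lambda>y. exp (- \<phi> * L) * (exp (\<phi> * (L - y)) * S y))"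
      by (rule set_integrable_mult_right) (rule conv_integrable[OF locbd_exp[of "\<phi>"] that])
    also have "(\<lambda>y. exp (- \<phi> * L) * (exp (\<phi> * (L - y)) * S y)) = (\<lambda>y. exp (- \<phi> * y) * S y)"
      by (simp add: fun_eq_iff mult.assoc[symmetric] exp_add[symmetric] right_diff_distrib)
    finally show ?thesis .
  qed
  have wI: "set_integrable lborel {0..L} (\<lambda>y. W (u - y) * S y)" if S: "locbd S" for S u
  proof -
    show ?thesis
    proof (cases "u \<le> L")
      case True
      have "(\<lambda>y. indicator {0..L} y *\<^sub>R (W (u - y) * S y)) = (\<lambda>y. indicator {0..u} y *\<^sub>R (W (u - y) * S y))"
        using True W_neg by (auto simp: indicator_def fun_eq_iff not_le)
      then show ?thesis using conv_integrable[OF lW S, of u] by (simp only: set_integrable_def)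
    next
      case False
      then show ?thesis by (intro set_integrable_subset[OF conv_integrable[OF lW S, of u]]) auto
    qed
  qed
  have F_eq: "F u = 1 - q * c * exp (\<phi> * u) + q * (LBINT y:{0..L}. W (u - y) * F y)" for u
  proof -
    have "(LBINT y:{a<..<b}. f y * (exp (\<phi> * (u + a - y)) / \<kappa> - W (u + a - y)))
       = (\<integral>y. indicator {a<..<b} (a + 1 * y) *\<^sub>R (f (a + 1 * y) * (exp (\<phi> * (u + a - (a + 1 * y))) / \<kappa> - W (u + a - (a + 1 * y)))) \<partial>lborel)"
      unfolding set_lebesgue_integral_def by (subst lborel_integral_real_affine[where c=1 and t=a]) auto
    also have "\<dots> = (LBINT y:{0..L}. exp (\<phi> * u) / \<kappa> * (exp (- \<phi> * y) * F y) - W (u - y) * F y)"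
      unfolding set_lebesgue_integral_def
    proof (rule integral_cong_AE)
      show "AE y in lborel. indicator {a<..<b} (a + 1 * y) *\<^sub>R (f (a + 1 * y) * (exp (\<phi> * (u + a - (a + 1 * y))) / \<kappa> - W (u + a - (a + 1 * y)))) =
        indicator {0..L} y *\<^sub>R (exp (\<phi> * u) / \<kappa> * (exp (- \<phi> * y) * F y) - W (u - y) * F y)"
        using AE_lborel_singleton[of 0] AE_lborel_singleton[of L]
      proof eventually_elim
        case (elim y)
        have "exp (\<phi> * (u - y)) = exp (\<phi> * u) * exp (- \<phi> * y)" by (simp add: exp_add[symmetric] algebra_simps)
        then show ?case using elim by (auto simp: indicator_def L_def F_def algebra_simps)
      qed
    qed (auto simp: F_def)
    also have "\<dots> = exp (\<phi> * u) / \<kappa> * (LBINT y:{0..L}. exp (- \<phi> * y) * F y) - (LBINT y:{0..L}. W (u - y) * F y)"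
      by (subst set_integral_diff) (auto intro!: set_integrable_mult_right eI[simplified] wI lF)
    finally have k: "(LBINT y:{a<..<b}. f y * (exp (\<phi> * (u + a - y)) / \<kappa> - W (u + a - y))) =
      exp (\<phi> * u) / \<kappa> * (LBINT y:{0..L}. exp (- \<phi> * y) * F y) - (LBINT y:{0..L}. W (u - y) * F y)" .
    have "F u = 1 - q * (exp (\<phi> * u) / \<kappa> * (LBINT y:{0..L}. exp (- \<phi> * y) * F y) - (LBINT y:{0..L}. W (u - y) * F y))"
      using eq[of "u + a"] unfolding k by (simp only: F_def)
    then show ?thesis by (simp only: c_def) (simp add: right_diff_distrib)
  qed
  have FR: "F u = Z u - q * c * H u" if "0 \<le> u" "u \<le> L" for u
  proof -
    have FR1: "F u = R (\<lambda>u. 1 + (- q * c) * exp (\<phi> * u)) u"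
    proof (rule solution_unique[OF _ lF _ that])
      fix u assume u: "0 \<le> u" "u \<le> L"
      have "conv W F u = (LBINT y:{0..L}. W (u - y) * F y)"
        using integral_Icc_0_L[OF lF L, of u] set_integral_Icc_null[OF u(2)] by simp
      then show "F u = 1 + (- q * c) * exp (\<phi> * u) + q * conv W F u" by (subst F_eq) simp
    qed (intro locbd_add locbd_mult locbd_const locbd_exp)
    have "conv (\<lambda>u. 1 + (- q * c) * exp (\<phi> * u)) Wq u = conv (\<lambda>_. 1) Wq u + (- q * c) * conv (\<lambda>u. exp (\<phi> * u)) Wq u"
      unfolding conv_cmult_left[symmetric]
      by (rule conv_add_left[OF locbd_const locbd_mult[OF locbd_const locbd_exp] lWq])
    then have "R (\<lambda>u. 1 + (- q * c) * exp (\<phi> * u)) u = Z u - q * c * H u"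
      unfolding R_def Z_def H_def by (simp only:) (simp add: algebra_simps)
    with FR1 show ?thesis by simp
  qed
  define I J where "I = (LBINT y:{0..L}. exp (- \<phi> * y) * Z y)" and "J = (LBINT y:{0..L}. exp (- \<phi> * y) * H y)"
  have J: "0 \<le> J"
  proof -
    have "0 \<le> H y" for y
      using R_ge[OF locbd_exp, of \<phi> y] order.trans[OF exp_ge_zero] by (auto simp: H_def)
    then show ?thesis unfolding J_def set_lebesgue_integral_def by (intro Bochner_Integration.integral_nonneg) (auto simp: indicator_def)
  qed
  \<comment> \<open>Integrating the solution against \<open>exp (- \<phi> * y)\<close> reproduces
    \<open>\<kappa> * c\<close> on the left, a linear equation for \<open>c\<close>;
    \<open>\<kappa> > 0\<close> and \<open>J \<ge> 0\<close> make it solvable.\<close>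
  have "\<kappa> * c = (LBINT y:{0..L}. exp (- \<phi> * y) * Z y - q * c * (exp (- \<phi> * y) * H y))"
    using \<kappa> unfolding c_def by (simp, intro set_lebesgue_integral_cong) (auto simp: FR algebra_simps c_def)
  also have "\<dots> = I - q * c * J"
    unfolding I_def J_def by (subst set_integral_diff) (auto intro!: set_integrable_mult_right eI[simplified] lZ lH)
  finally have "c * (\<kappa> + q * J) = I" by (simp add: algebra_simps)
  moreover have pos: "\<kappa> + q * J > 0" using \<kappa> J q by (simp add: add_pos_nonneg)
  ultimately have c: "c = I / (\<kappa> + q * J)" by (simp add: eq_divide_eq)
  define u where "u = x - a"
  have sh: "(LBINT y:{b..x}. W (x - y) * S (y - a)) = (LBINT y:{L..u}. W (u - y) * S y)" for S
    unfolding set_lebesgue_integral_def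
    by (subst lborel_integral_real_affine[where c=1 and t=a])
      (auto simp: L_def u_def indicator_def algebra_simps intro!: Bochner_Integration.integral_cong)
  \<comment> \<open>The point \<open>u\<close> is now arbitrary: the integral equation expresses
    \<open>F u\<close> by values of \<open>F\<close> on \<open>{0..L}\<close>, where the solution is
    known.\<close>
  have "(LBINT y:{0..L}. W (u - y) * F y) = (LBINT y:{0..L}. W (u - y) * Z y - q * c * (W (u - y) * H y))"
    by (intro set_lebesgue_integral_cong) (auto simp: FR algebra_simps)
  also have "\<dots> = (LBINT y:{0..L}. W (u - y) * Z y) - q * c * (LBINT y:{0..L}. W (u - y) * H y)"
    by (subst set_integral_diff) (auto intro!: set_integrable_mult_right wI lZ lH)
  finally have 1: "F u = 1 - q * c * exp (\<phi> * u) + q * ((LBINT y:{0..L}. W (u - y) * Z y) - q * c * (LBINT y:{0..L}. W (u - y) * H y))"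
    using F_eq[of u] by simp
  have Z: "Z u = 1 + q * conv W Z u" and H: "H u = exp (\<phi> * u) + q * conv W H u"
    unfolding Z_def H_def by (rule R_eq, rule locbd_const, rule R_eq, rule locbd_exp)
  have "F u = Z u - q * (LBINT y:{L..u}. W (u - y) * Z y) - q * c * (H u - q * (LBINT y:{L..u}. W (u - y) * H y))"
    unfolding 1 integral_Icc_0_L[OF lZ L] integral_Icc_0_L[OF lH L] by (subst Z, subst H) (simp add: algebra_simps)
  then show ?thesis
    unfolding sh c I_def J_def by (simp add: F_def u_def L_def)
qed

end

section \<open>Spectrally negative paths\<close>

lemma right_continuous_sequentially:
  fixes f :: "real \<Rightarrow> real"
  assumes "(f \<longlongrightarrow> f s) (at_right s)" "x \<longlonglongrightarrow> s" "\<And>n. s \<le> x n"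
  shows "(\<lambda>n. f (x n)) \<longlonglongrightarrow> f s"
proof -
  \<comment> \<open>The sequence may take the value \<open>s\<close> itself, which
    \<open>at_right\<close> excludes; continuity within \<open>{s..}\<close> covers this
    case.\<close>
  have "at s within {s..} = at_right s"
    unfolding at_within_def by (intro arg_cong2[of _ _ _ _ inf] refl arg_cong[of _ _ principal]) auto
  then have "continuous (at s within {s..}) f"
    using assms(1) by (simp add: continuous_within)
  then show ?thesis
    using assms(2,3) unfolding continuous_within_sequentially by (auto simp: o_def)
qed

text \<open>The substitute for uniform continuity when jumps go down only. Otherwise pairs
  \<open>u \<le> v\<close> with a rise above \<open>e\<close> would accumulate at some
  \<open>t\<close>; close to \<open>t\<close> the path is within \<open>e / 2\<close> of its left
  limit \<open>l\<close> before \<open>t\<close> and of \<open>f t\<close> from \<open>t\<close> on,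
  and \<open>f t \<le> l\<close>.\<close>

lemma upward_modulus:
  fixes f :: "real \<Rightarrow> real"
  assumes right: "\<And>t. 0 \<le> t \<Longrightarrow> (f \<longlongrightarrow> f t) (at_right t)"
    and left: "\<And>t. 0 < t \<Longrightarrow> \<exists>l. (f \<longlongrightarrow> l) (at_left t) \<and> f t \<le> l" and e: "0 < e"
  shows "\<exists>d>0. \<forall>u v. 0 \<le> u \<and> u \<le> v \<and> v \<le> T \<and> v - u < d \<longrightarrow> f v \<le> f u + e"
proof (rule ccontr)
  assume neg: "\<not> ?thesis"
  have "\<exists>u v. 0 \<le> u \<and> u \<le> v \<and> v \<le> T \<and> v - u < 1 / real (Suc n) \<and> f u + e < f v" for n
    using neg by (simp add: not_le)
  then obtain u v where uv: "\<And>n. 0 \<le> u n" "\<And>n. u n \<le> v n" "\<And>n. v n \<le> T"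
    "\<And>n. v n - u n < 1 / real (Suc n)" "\<And>n. f (u n) + e < f (v n)"
    by metis
  have "\<forall>n. u n \<in> {0..T}" using uv(1-3) order_trans by (metis atLeastAtMost_iff)
  then obtain t r where t: "t \<in> {0..T}" and r: "strict_mono (r :: nat \<Rightarrow> nat)" and ur: "(u \<circ> r) \<longlonglongrightarrow> t"
    using compact_Icc[of 0 T] unfolding compact_def by blast
  have "(\<lambda>n. v n - u n) \<longlonglongrightarrow> 0"
    by (rule real_tendsto_sandwich[of "\<lambda>_. 0" _ _ "\<lambda>n. 1 / real (Suc n)"])
      (use uv(2,4) LIMSEQ_Suc[OF lim_1_over_n] in \<open>auto intro: less_imp_le always_eventually\<close>)
  then have "(\<lambda>n. v (r n) - u (r n)) \<longlonglongrightarrow> 0" using LIMSEQ_subseq_LIMSEQ[OF _ r] by (force simp: o_def)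
  from tendsto_add[OF this ur] have vr: "(\<lambda>n. v (r n)) \<longlonglongrightarrow> t" by (simp add: o_def)
  have "\<exists>d>0. \<forall>s. t < s \<and> s < t + d \<longrightarrow> \<bar>f s - f t\<bar> < e / 2"
    using tendstoD[OF right[of t], of "e / 2"] t e
    by (auto simp: eventually_at_right_field dist_real_def) (metis add.commute add_diff_cancel_left' diff_gt_0_iff_gt le_add_diff_inverse less_imp_le)
  then obtain d1 where d1: "0 < d1" "\<And>s. t < s \<Longrightarrow> s < t + d1 \<Longrightarrow> \<bar>f s - f t\<bar> < e / 2" by blast
  have loc: "\<exists>d>0. \<forall>u v. 0 \<le> u \<and> u \<le> v \<and> \<bar>u - t\<bar> < d \<and> \<bar>v - t\<bar> < d \<longrightarrow> f v \<le> f u + e"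
  proof (cases "t = 0")
    case True
    have near: "\<bar>f s - f 0\<bar> < e / 2" if "0 \<le> s" "\<bar>s - t\<bar> < d1" for s
      using d1(2)[of s] that e True by (cases "s = 0") auto
    have "f v \<le> f u + e" if "0 \<le> u" "u \<le> v" "\<bar>u - t\<bar> < d1" "\<bar>v - t\<bar> < d1" for u v
      using near[of u] near[of v] that by linarith
    then show ?thesis using d1(1) by blast
  next
    case False
    then have t0: "0 < t" using t by auto
    obtain l where l: "(f \<longlongrightarrow> l) (at_left t)" "f t \<le> l" using left[OF t0] by blast
    obtain b where b: "b < t" "\<And>s. b < s \<Longrightarrow> s < t \<Longrightarrow> \<bar>f s - l\<bar> < e / 2"
      using tendstoD[OF l(1), of "e / 2"] e by (auto simp: eventually_at_left_field dist_real_def)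
    have lft: "\<bar>f s - l\<bar> < e / 2" if "s < t" "\<bar>s - t\<bar> < min d1 (t - b)" for s
      using b(2)[of s] that by auto
    have rgt: "\<bar>f s - f t\<bar> < e / 2" if "t \<le> s" "\<bar>s - t\<bar> < min d1 (t - b)" for s
      using d1(2)[of s] that e by (cases "s = t") auto
    have "f v \<le> f u + e" if uv: "0 \<le> u" "u \<le> v" "\<bar>u - t\<bar> < min d1 (t - b)" "\<bar>v - t\<bar> < min d1 (t - b)" for u v
    proof -
      consider "v < t" | "u < t" "t \<le> v" | "t \<le> u" by linarith
      then show ?thesis
      proof cases
        case 1
        then show ?thesis using lft[of u] lft[of v] uv by linarith
      next
        case 2
        then show ?thesis using lft[of u] rgt[of v] uv l(2) by linarith
      next
        case 3
        then show ?thesis using rgt[of u] rgt[of v] uv by linarith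
      qed
    qed
    then show ?thesis using d1(1) b(1) by (intro exI[of _ "min d1 (t - b)"]) auto
  qed
  then obtain d where d: "0 < d" "\<And>u v. 0 \<le> u \<Longrightarrow> u \<le> v \<Longrightarrow> \<bar>u - t\<bar> < d \<Longrightarrow> \<bar>v - t\<bar> < d \<Longrightarrow> f v \<le> f u + e"
    by blast
  have "\<forall>\<^sub>F n in sequentially. \<bar>u (r n) - t\<bar> < d \<and> \<bar>v (r n) - t\<bar> < d"
    using tendstoD[OF ur d(1)] tendstoD[OF vr d(1)] by eventually_elim (simp add: dist_real_def)
  then obtain n where "\<bar>u (r n) - t\<bar> < d" "\<bar>v (r n) - t\<bar> < d"
    using eventually_happens'[OF sequentially_bot] by blast
  then show False using d(2)[of "u (r n)" "v (r n)"] uv(1,2,5)[of "r n"] by auto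
qed

text \<open>The index set of \<open>Y\<close> is extended to the negative half-line by \<open>0\<close>, so that every
  \<open>Y t\<close> is a random variable and every path is right-continuous on the whole line.\<close>

locale regular_levy = prob_space M for M :: "'a measure" +
  fixes Y :: "real \<Rightarrow> 'a \<Rightarrow> real"
  assumes measurable_Y [measurable]: "\<And>t. Y t \<in> borel_measurable M"
    and Y_neg: "\<And>t \<omega>. t \<le> 0 \<Longrightarrow> Y t \<omega> = 0"
    and indep_incr: "\<And>(t :: nat \<Rightarrow> real) n. 0 \<le> t 0 \<Longrightarrow> mono t \<Longrightarrow>
          indep_vars (\<lambda>_. borel) (\<lambda>i \<omega>. Y (t (Suc i)) \<omega> - Y (t i) \<omega>) {..<n}"
    and stationary: "\<And>s h. 0 \<le> s \<Longrightarrow> 0 \<le> h \<Longrightarrow>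
          distr M borel (\<lambda>\<omega>. Y (s + h) \<omega> - Y s \<omega>) = distr M borel (Y h)"
    and right_cont: "\<And>t \<omega>. ((\<lambda>s. Y s \<omega>) \<longlongrightarrow> Y t \<omega>) (at_right t)"
    and upward: "\<And>T e \<omega>. 0 < e \<Longrightarrow>
          \<exists>d>0. \<forall>u v. 0 \<le> u \<and> u \<le> v \<and> v \<le> T \<and> v - u < d \<longrightarrow> Y v \<omega> \<le> Y u \<omega> + e"
begin

lemma Y_sequentially: "x \<longlonglongrightarrow> s \<Longrightarrow> (\<And>n. s \<le> x n) \<Longrightarrow> (\<lambda>n. Y (x n) \<omega>) \<longlonglongrightarrow> Y s \<omega>"
  using right_continuous_sequentially[OF right_cont] by blast

text \<open>Times are rounded up because the paths are continuous only from the right. Dividing a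
  fixed \<open>T\<close> by powers of 2 places \<open>T\<close> itself on every grid.\<close>

lemma ceiling_grid_tendsto:
  fixes s T :: real assumes "0 < T"
  shows "(\<lambda>n. T / 2 ^ n * \<lceil>s / (T / 2 ^ n)\<rceil>) \<longlonglongrightarrow> s" "s \<le> T / 2 ^ n * \<lceil>s / (T / 2 ^ n)\<rceil>"
proof -
  have pos: "0 < T / 2 ^ n" for n :: nat using assms by simp
  have lower: "s \<le> T / 2 ^ n * \<lceil>s / (T / 2 ^ n)\<rceil>" for n :: nat
    using le_of_int_ceiling[of "s / (T / 2 ^ n)"] pos[of n] by (simp only: pos_divide_le_eq mult.commute)
  have upper: "T / 2 ^ n * \<lceil>s / (T / 2 ^ n)\<rceil> \<le> s + T / 2 ^ n" for n :: nat
  proof -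
    define \<delta> where "\<delta> = T / 2 ^ n"
    have \<delta>: "0 < \<delta>" using pos[of n] by (simp add: \<delta>_def)
    have "\<delta> * \<lceil>s / \<delta>\<rceil> \<le> \<delta> * (s / \<delta> + 1)" using \<delta> by (intro mult_left_mono) linarith+
    also have "\<dots> = s + \<delta>" using \<delta> by (simp add: distrib_left)
    finally show ?thesis by (simp only: \<delta>_def)
  qed
  have "(\<lambda>n. T / 2 ^ n) \<longlonglongrightarrow> 0"
    using tendsto_mult[OF tendsto_const[of T] LIMSEQ_inverse_realpow_zero[of 2]] by (simp add: divide_inverse)
  from tendsto_add[OF tendsto_const[of s] this] have "(\<lambda>n. s + T / 2 ^ n) \<longlonglongrightarrow> s" by simp
  then show "(\<lambda>n. T / 2 ^ n * \<lceil>s / (T / 2 ^ n)\<rceil>) \<longlonglongrightarrow> s"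
    by (rule real_tendsto_sandwich[rotated 3, where f="\<lambda>_. s"]) (use lower upper in auto)
  show "s \<le> T / 2 ^ n * \<lceil>s / (T / 2 ^ n)\<rceil>" by (rule lower)
qed

text \<open>Right-continuity makes the process a pointwise limit of processes that are constant on
  the cells of a countable grid, and these are jointly measurable.\<close>

lemma measurable_Y_pair [measurable]: "(\<lambda>(s, \<omega>). Y s \<omega>) \<in> borel_measurable ((borel :: real measure) \<Otimes>\<^sub>M M)"
proof (rule borel_measurable_LIMSEQ_real)
  fix p :: "real \<times> 'a"
  show "(\<lambda>n. (\<lambda>(s, \<omega>). Y (1 / 2 ^ n * real_of_int \<lceil>s / (1 / 2 ^ n)\<rceil>) \<omega>) p) \<longlonglongrightarrow> (\<lambda>(s, \<omega>). Y s \<omega>) p"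
    using Y_sequentially[OF ceiling_grid_tendsto(1) ceiling_grid_tendsto(2), of 1 "fst p" "snd p"]
    by (simp add: case_prod_beta)
next
  fix n
  have "(\<lambda>p. (\<lambda>i (s, \<omega>). Y (1 / 2 ^ n * real_of_int i) \<omega>) \<lceil>fst p / (1 / 2 ^ n :: real)\<rceil> p) \<in> borel_measurable ((borel :: real measure) \<Otimes>\<^sub>M M)"
    by (rule measurable_compose_countable) measurable
  then show "(\<lambda>(s, \<omega>). Y (1 / 2 ^ n * real_of_int \<lceil>s / (1 / 2 ^ n)\<rceil>) \<omega>) \<in> borel_measurable ((borel :: real measure) \<Otimes>\<^sub>M M)"
    by (simp add: case_prod_beta)
qed

text \<open>Replaces the first passage time above \<open>a\<close>: the event that no passage has
  occurred up to \<open>s\<close>, free of stopping times.\<close>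

definition below :: "real \<Rightarrow> real \<Rightarrow> 'a \<Rightarrow> bool" where
  "below a s \<omega> \<longleftrightarrow> (\<forall>u\<in>{0..s}. Y u \<omega> \<le> a)"

text \<open>By right-continuity an exceedance at \<open>u < s\<close> persists just after
  \<open>u\<close>, hence at a rational fraction of \<open>s\<close>. Fractions of \<open>s\<close>
  keep the index set independent of \<open>s\<close>, which gives measurability jointly in time and
  path.\<close>

lemma below_iff_rat:
  assumes s: "0 \<le> s"
  shows "below a s \<omega> \<longleftrightarrow> Y s \<omega> \<le> a \<and> (\<forall>r::rat. 0 \<le> r \<and> r \<le> 1 \<longrightarrow> Y (of_rat r * s) \<omega> \<le> a)"
proof safe
  assume "below a s \<omega>"
  then show "Y s \<omega> \<le> a" using s by (simp add: below_def)
  fix r :: rat assume "0 \<le> r" "r \<le> 1"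
  then have "(0::real) \<le> of_rat r" "of_rat r \<le> (1::real)" by auto
  then have "of_rat r * s \<in> {0..s}" using s by (auto simp: mult_left_le_one_le)
  then show "Y (of_rat r * s) \<omega> \<le> a" using \<open>below a s \<omega>\<close> unfolding below_def by blast
next
  assume R: "Y s \<omega> \<le> a" "\<forall>r::rat. 0 \<le> r \<and> r \<le> 1 \<longrightarrow> Y (of_rat r * s) \<omega> \<le> a"
  show "below a s \<omega>" unfolding below_def
  proof (rule ballI, rule ccontr)
    fix u assume u: "u \<in> {0..s}" and gt: "\<not> Y u \<omega> \<le> a"
    then have us: "u < s" using R(1) by (cases "u = s") auto
    have "\<forall>\<^sub>F v in at_right u. a < Y v \<omega>" using order_tendstoD(1)[OF right_cont] gt by auto
    then obtain b where b: "u < b" "\<And>v. u < v \<Longrightarrow> v < b \<Longrightarrow> a < Y v \<omega>"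
      by (auto simp: eventually_at_right_field)
    have s0: "0 < s" using us u by auto
    have "u / s < min b s / s" using us b(1) s0 by (simp add: divide_strict_right_mono)
    then obtain r where r: "u / s < of_rat r" "of_rat r < min b s / s" using of_rat_dense by blast
    have "u < of_rat r * s" "of_rat r * s < min b s" using r s0 by (simp_all add: pos_divide_less_eq pos_less_divide_eq)
    moreover have "0 \<le> r"
    proof -
      have "0 \<le> u / s" using u s0 by simp
      then have "(0::real) < of_rat r" using r(1) by linarith
      then show ?thesis by simp
    qed
    moreover have "r \<le> 1"
    proof -
      have "min b s / s \<le> 1" using s0 by simp
      then have "of_rat r < (1::real)" using r(2) by linarith
      then show ?thesis by simp
    qed
    ultimately show False using b(2)[of "of_rat r * s"] R(2) by force
  qed
qed

lemma measurable_below [measurable (raw)]: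
  assumes [measurable]: "f \<in> borel_measurable N" "g \<in> measurable N M"
  shows "Measurable.pred N (\<lambda>x. below a (f x) (g x))"
proof -
  have "below a s \<omega> \<longleftrightarrow> s < 0 \<or> Y s \<omega> \<le> a \<and> (\<forall>r::rat. 0 \<le> r \<and> r \<le> 1 \<longrightarrow> Y (of_rat r * s) \<omega> \<le> a)" for s \<omega>
    using below_iff_rat[of s a \<omega>] by (cases "s < 0") (auto simp: below_def)
  then show ?thesis by simp
qed

lemma below_antimono: "below a t \<omega> \<Longrightarrow> s \<le> t \<Longrightarrow> below a s \<omega>"
  by (auto simp: below_def)

lemma below_Y: "below a s \<omega> \<Longrightarrow> 0 \<le> s \<Longrightarrow> Y s \<omega> \<le> a"
  by (auto simp: below_def)

text \<open>\<open>upward\<close> with \<open>e = 1\<close> allows a rise of at most 1 on each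
  stretch of length \<open>d / 2\<close>, so the path is bounded above on \<open>{0..s}\<close> by
  the number of stretches.\<close>

lemma below_exists: "\<exists>n::nat. \<forall>k\<ge>n. below (real k) s \<omega>"
proof -
  obtain d where d: "0 < d" "\<And>u v. 0 \<le> u \<Longrightarrow> u \<le> v \<Longrightarrow> v \<le> s \<Longrightarrow> v - u < d \<Longrightarrow> Y v \<omega> \<le> Y u \<omega> + 1"
    using upward[of 1 s \<omega>] by auto
  have bound: "Y v \<omega> \<le> real n" if "0 \<le> v" "v \<le> s" "v \<le> real n * (d / 2)" for v n
    using that
  proof (induction n arbitrary: v)
    case 0
    then show ?case by (simp add: Y_neg)
  next
    case (Suc n)
    define u where "u = max 0 (v - d / 2)"
    have "u \<le> real n * (d / 2)" unfolding u_def
      by (rule max.boundedI) (use Suc.prems(3) d(1) in \<open>auto simp: algebra_simps\<close>)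
    then have "Y u \<omega> \<le> real n" using Suc.prems d(1) by (intro Suc.IH) (auto simp: u_def)
    moreover have "Y v \<omega> \<le> Y u \<omega> + 1" using Suc.prems d(1) by (intro d(2)) (auto simp: u_def)
    ultimately show ?case by simp
  qed
  obtain n :: nat where n: "s / (d / 2) < real n" using reals_Archimedean2 by blast
  then have "s \<le> real n * (d / 2)" using d(1) by (simp add: pos_divide_less_eq)
  then have "Y v \<omega> \<le> real n" if "0 \<le> v" "v \<le> s" for v using bound that by simp
  then show ?thesis by (intro exI[of _ n]) (force simp: below_def)
qed

end

section \<open>Exponential moments and the Laplace exponent\<close>

text \<open>Tonelli for the joint law, which under independence is a product: the second variable is
  replaced by an independent copy.\<close>

lemma (in prob_space) indep_var_nn_integral:
  assumes ind: "indep_var S X T Z" and [measurable]: "h \<in> borel_measurable (S \<Otimes>\<^sub>M T)"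
  shows "(\<integral>\<^sup>+\<omega>. h (X \<omega>, Z \<omega>) \<partial>M) = (\<integral>\<^sup>+\<omega>. \<integral>\<^sup>+\<omega>'. h (X \<omega>, Z \<omega>') \<partial>M \<partial>M)"
proof -
  have d: "distr M S X \<Otimes>\<^sub>M distr M T Z = distr M (S \<Otimes>\<^sub>M T) (\<lambda>\<omega>. (X \<omega>, Z \<omega>))"
    and [measurable]: "X \<in> measurable M S" "Z \<in> measurable M T"
    using ind unfolding indep_var_distribution_eq by auto
  interpret Z: prob_space "distr M T Z" by (rule prob_space_distr) simp
  have "(\<integral>\<^sup>+\<omega>. h (X \<omega>, Z \<omega>) \<partial>M) = (\<integral>\<^sup>+p. h p \<partial>distr M (S \<Otimes>\<^sub>M T) (\<lambda>\<omega>. (X \<omega>, Z \<omega>)))"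
    by (rule nn_integral_distr[symmetric]) measurable
  also have "\<dots> = (\<integral>\<^sup>+x. \<integral>\<^sup>+z. h (x, z) \<partial>distr M T Z \<partial>distr M S X)"
    unfolding d[symmetric] by (rule Z.nn_integral_fst[symmetric]) measurable
  also have "\<dots> = (\<integral>\<^sup>+x. \<integral>\<^sup>+\<omega>'. h (x, Z \<omega>') \<partial>M \<partial>distr M S X)"
    by (intro nn_integral_cong nn_integral_distr) (auto intro: measurable_Pair2)
  also have "\<dots> = (\<integral>\<^sup>+\<omega>. \<integral>\<^sup>+\<omega>'. h (X \<omega>, Z \<omega>') \<partial>M \<partial>M)"
    by (rule nn_integral_distr) measurable
  finally show ?thesis .
qed

lemma (in prob_space) indep_var_nn_integral_mult:
  assumes ind: "indep_var S X T Z" and [measurable]: "f \<in> borel_measurable S" "g \<in> borel_measurable T"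
  shows "(\<integral>\<^sup>+\<omega>. f (X \<omega>) * g (Z \<omega>) \<partial>M) = (\<integral>\<^sup>+\<omega>. f (X \<omega>) \<partial>M) * (\<integral>\<^sup>+\<omega>. g (Z \<omega>) \<partial>M)"
proof -
  have [measurable]: "X \<in> measurable M S" "Z \<in> measurable M T"
    using ind unfolding indep_var_distribution_eq by auto
  have "(\<integral>\<^sup>+\<omega>. f (X \<omega>) * g (Z \<omega>) \<partial>M) = (\<integral>\<^sup>+\<omega>. \<integral>\<^sup>+\<omega>'. f (X \<omega>) * g (Z \<omega>') \<partial>M \<partial>M)"
    using indep_var_nn_integral[OF ind, of "\<lambda>(x, z). f x * g z"] by simp
  also have "\<dots> = (\<integral>\<^sup>+\<omega>. f (X \<omega>) \<partial>M) * (\<integral>\<^sup>+\<omega>. g (Z \<omega>) \<partial>M)"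
    by (simp add: nn_integral_cmult nn_integral_multc)
  finally show ?thesis .
qed

context regular_levy
begin

definition incr :: "real \<Rightarrow> real \<Rightarrow> nat \<Rightarrow> 'a \<Rightarrow> real" where
  "incr s \<delta> i \<omega> = Y (s + real (Suc i) * \<delta>) \<omega> - Y (s + real i * \<delta>) \<omega>"

lemma measurable_incr [measurable]: "incr s \<delta> i \<in> borel_measurable M"
  unfolding incr_def[abs_def] by measurable

lemma sum_incr: "(\<Sum>i<k. incr s \<delta> i \<omega>) = Y (s + real k * \<delta>) \<omega> - Y s \<omega>"
  by (induction k) (auto simp: incr_def)

lemma indep_incr_grid: "0 \<le> s \<Longrightarrow> 0 \<le> \<delta> \<Longrightarrow> indep_vars (\<lambda>_. borel) (incr s \<delta>) {..<n}"
  using indep_incr[of "\<lambda>i. s + real i * \<delta>" n]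
  by (simp add: incr_def[abs_def] mono_def mult_right_mono)

lemma distr_incr: "0 \<le> s \<Longrightarrow> 0 \<le> \<delta> \<Longrightarrow> distr M borel (incr s \<delta> i) = distr M borel (Y \<delta>)"
  using stationary[of "s + real i * \<delta>" \<delta>] by (simp add: incr_def[abs_def] algebra_simps)

lemma nn_integral_incr:
  assumes "0 \<le> s" "0 \<le> \<delta>" and [measurable]: "f \<in> borel_measurable borel"
  shows "(\<integral>\<^sup>+\<omega>. f (incr s \<delta> i \<omega>) \<partial>M) = (\<integral>\<^sup>+\<omega>. f (Y \<delta> \<omega>) \<partial>M)"
  using nn_integral_distr[of "incr s \<delta> i" M borel f] nn_integral_distr[of "Y \<delta>" M borel f] distr_incr[OF assms(1,2)]
  by simp

lemma indep_incr_split: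
  assumes "0 \<le> s" "0 \<le> \<delta>" "k \<le> n"
  shows "indep_var (PiM {..<k} (\<lambda>_. borel)) (\<lambda>\<omega>. restrict (\<lambda>i. incr s \<delta> i \<omega>) {..<k})
    (PiM {k..<n} (\<lambda>_. borel)) (\<lambda>\<omega>. restrict (\<lambda>i. incr s \<delta> i \<omega>) {k..<n})"
  by (rule indep_var_restrict[OF indep_incr_grid[OF assms(1,2), of n]]) (use assms(3) in auto)

text \<open>The Markov property at a fixed time for finitely many later increments:
  \<open>Y s\<close> is itself an increment, so it is independent of them, and their joint law, a
  product, does not depend on the starting time.\<close>

lemma markov_grid:
  assumes s: "0 \<le> s" and \<delta>: "0 \<le> \<delta>" and N: "0 < N"
    and F [measurable]: "F \<in> borel_measurable (borel \<Otimes>\<^sub>M PiM {..<N} (\<lambda>_. borel))"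
  shows "(\<integral>\<^sup>+\<omega>. F (Y s \<omega>, restrict (\<lambda>i. incr s \<delta> i \<omega>) {..<N}) \<partial>M) =
    (\<integral>\<^sup>+\<omega>. \<integral>\<^sup>+\<omega>'. F (Y s \<omega>, restrict (\<lambda>i. incr 0 \<delta> i \<omega>') {..<N}) \<partial>M \<partial>M)"
proof -
  \<comment> \<open>The grid from \<open>s\<close> with time 0 put in front, so that increment 0 is
    \<open>Y s\<close> and increment \<open>Suc i\<close> is \<open>incr s \<delta> i\<close>;
    \<open>sh\<close> undoes this index shift.\<close>
  define t where "t i = (case i of 0 \<Rightarrow> 0 | Suc j \<Rightarrow> s + real j * \<delta>)" for i
  define Z where "Z i \<omega> = Y (t (Suc i)) \<omega> - Y (t i) \<omega>" for i \<omega>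
  have "mono t" unfolding mono_iff_le_Suc t_def using s \<delta> by (auto split: nat.split simp: distrib_right)
  then have indZ: "indep_vars (\<lambda>_. borel) Z {..<Suc N}"
    using indep_incr[of t "Suc N"] by (simp add: t_def Z_def[abs_def])
  have Z0: "Z 0 = Y s" by (simp add: fun_eq_iff Z_def t_def Y_neg)
  have ZS: "Z (Suc i) = incr s \<delta> i" for i by (simp add: fun_eq_iff Z_def t_def incr_def)
  have ind: "indep_var (PiM {0} (\<lambda>_. borel)) (\<lambda>\<omega>. restrict (\<lambda>i. Z i \<omega>) {0})
    (PiM {1..<Suc N} (\<lambda>_. borel)) (\<lambda>\<omega>. restrict (\<lambda>i. Z i \<omega>) {1..<Suc N})"
    by (rule indep_var_restrict[OF indZ]) auto
  define sh where "sh v = (\<lambda>i\<in>{..<N}. v (Suc i))" for v :: "nat \<Rightarrow> real"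
  have shm: "sh \<in> measurable (PiM {1..<Suc N} (\<lambda>_. borel)) (PiM {..<N} (\<lambda>_. borel))"
    unfolding sh_def[abs_def] by (auto intro!: measurable_restrict measurable_component_singleton)
  have z0: "(\<lambda>v. v 0) \<in> borel_measurable (PiM {0::nat} (\<lambda>_. borel :: real measure))"
    by (rule measurable_component_singleton) simp
  have shZ: "sh (restrict (\<lambda>i. Z i \<omega>) {1..<Suc N}) = restrict (\<lambda>i. incr s \<delta> i \<omega>) {..<N}" for \<omega>
    by (auto simp: sh_def fun_eq_iff ZS restrict_def)
  have law: "distr M (PiM {..<N} (\<lambda>_. borel)) (\<lambda>\<omega>. restrict (\<lambda>i. incr u \<delta> i \<omega>) {..<N}) = PiM {..<N} (\<lambda>_. distr M borel (Y \<delta>))"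
    if "0 \<le> u" for u
    using indep_vars_iff_distr_eq_PiM[where I="{..<N}" and M'="\<lambda>_. borel" and X="incr u \<delta>"] indep_incr_grid[OF that \<delta>, of N] N
    by (simp add: distr_incr[OF that \<delta>] lessThan_empty_iff)
  have meas [measurable]: "(\<lambda>\<omega>. restrict (\<lambda>i. incr u \<delta> i \<omega>) {..<N}) \<in> measurable M (PiM {..<N} (\<lambda>_. borel))" for u
    by (rule measurable_restrict) simp
  have "(\<integral>\<^sup>+\<omega>. F (Y s \<omega>, restrict (\<lambda>i. incr s \<delta> i \<omega>) {..<N}) \<partial>M) =
    (\<integral>\<^sup>+\<omega>. \<integral>\<^sup>+\<omega>'. F (Y s \<omega>, restrict (\<lambda>i. incr s \<delta> i \<omega>') {..<N}) \<partial>M \<partial>M)"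
  proof -
    have "(\<lambda>p. F (fst p 0, sh (snd p))) \<in> borel_measurable (PiM {0::nat} (\<lambda>_. borel) \<Otimes>\<^sub>M PiM {1..<Suc N} (\<lambda>_. borel))"
      by (intro measurable_compose[OF _ F] measurable_Pair measurable_compose[OF measurable_fst z0] measurable_compose[OF measurable_snd shm])
    from indep_var_nn_integral[OF ind this] show ?thesis
      by (simp only: shZ Z0[THEN fun_cong] restrict_apply singletonI if_True fst_conv snd_conv)
  qed
  also have "\<dots> = (\<integral>\<^sup>+\<omega>. \<integral>\<^sup>+\<omega>'. F (Y s \<omega>, restrict (\<lambda>i. incr 0 \<delta> i \<omega>') {..<N}) \<partial>M \<partial>M)"
  proof (rule nn_integral_cong)
    fix \<omega>
    have [measurable]: "(\<lambda>v. F (Y s \<omega>, v)) \<in> borel_measurable (PiM {..<N} (\<lambda>_. borel))"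
      by (rule measurable_Pair2[OF F]) simp
    have "(\<integral>\<^sup>+\<omega>'. F (Y s \<omega>, restrict (\<lambda>i. incr u \<delta> i \<omega>') {..<N}) \<partial>M) =
      (\<integral>\<^sup>+v. F (Y s \<omega>, v) \<partial>PiM {..<N} (\<lambda>_. distr M borel (Y \<delta>)))" if "0 \<le> u" for u
      by (subst law[OF that, symmetric], subst nn_integral_distr) auto
    then show "(\<integral>\<^sup>+\<omega>'. F (Y s \<omega>, restrict (\<lambda>i. incr s \<delta> i \<omega>') {..<N}) \<partial>M) =
      (\<integral>\<^sup>+\<omega>'. F (Y s \<omega>, restrict (\<lambda>i. incr 0 \<delta> i \<omega>') {..<N}) \<partial>M)" using s by simp
  qed
  finally show ?thesis .
qed

text \<open>Valued in \<open>ennreal\<close>, since the semigroup law is needed before finiteness is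
  known.\<close>

definition mgf :: "real \<Rightarrow> real \<Rightarrow> ennreal" where
  "mgf l t = (\<integral>\<^sup>+\<omega>. exp (l * Y t \<omega>) \<partial>M)"

lemma mgf_0: "mgf l 0 = 1"
  by (simp add: mgf_def Y_neg emeasure_space_1)

lemma mgf_add: assumes "0 \<le> s" "0 \<le> t" shows "mgf l (s + t) = mgf l s * mgf l t"
proof -
  define F where "F = (\<lambda>(y, v :: nat \<Rightarrow> real). ennreal (exp (l * y)) * ennreal (exp (l * v 0)))"
  have [measurable]: "(\<lambda>v. v 0) \<in> borel_measurable (PiM {..<1::nat} (\<lambda>_. borel :: real measure))"
    by (rule measurable_component_singleton) simp
  have F: "F \<in> borel_measurable (borel \<Otimes>\<^sub>M PiM {..<1} (\<lambda>_. borel))" unfolding F_def by measurable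
  have "mgf l (s + t) = (\<integral>\<^sup>+\<omega>. F (Y s \<omega>, restrict (\<lambda>i. incr s t i \<omega>) {..<1}) \<partial>M)"
    unfolding mgf_def F_def by (intro nn_integral_cong)
      (simp add: incr_def ennreal_mult'[symmetric] exp_add[symmetric] algebra_simps)
  also have "\<dots> = (\<integral>\<^sup>+\<omega>. \<integral>\<^sup>+\<omega>'. F (Y s \<omega>, restrict (\<lambda>i. incr 0 t i \<omega>') {..<1}) \<partial>M \<partial>M)"
    by (rule markov_grid[OF assms _ F]) simp
  also have "\<dots> = mgf l s * mgf l t"
    by (simp add: F_def incr_def Y_neg mgf_def nn_integral_cmult nn_integral_multc)
  finally show ?thesis .
qed

lemma mgf_mult: "0 \<le> t \<Longrightarrow> mgf l (real k * t) = mgf l t ^ k"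
  by (induction k) (auto simp: mgf_0 mgf_add distrib_right)

lemma mgf_pos: "0 < mgf l t"
proof -
  have "mgf l t \<noteq> 0"
  proof
    assume "mgf l t = 0"
    then have "AE \<omega> in M. ennreal (exp (l * Y t \<omega>)) = 0"
      unfolding mgf_def by (subst (asm) nn_integral_0_iff_AE) auto
    then have "AE \<omega> in M. False" by simp
    then show False using AE_False by simp
  qed
  then show ?thesis by (simp add: zero_less_iff_neq_zero)
qed

text \<open>Decompose at the first grid time at which the truncated walk reaches \<open>1\<close>: there it is at most
  \<open>2\<close>, and the remaining increments are independent of the past.\<close>

lemma truncated_mgf_bound:
  fixes N :: nat and l \<delta> :: real
  assumes l: "0 \<le> l" and \<delta>: "0 \<le> \<delta>"
  defines "A \<equiv> (\<integral>\<^sup>+\<omega>. exp (l * (\<Sum>i<N. min 1 (incr 0 \<delta> i \<omega>))) \<partial>M)"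
  shows "A \<le> exp l + exp (2 * l) * emeasure M {\<omega>\<in>space M. \<not> below (1 / 2) (real N * \<delta>) \<omega>} * max 1 A"
proof -
  define z where "z i \<omega> = min 1 (incr 0 \<delta> i \<omega>)" for i \<omega>
  define S where "S k \<omega> = (\<Sum>i<k. z i \<omega>)" for k \<omega>
  define \<phi> where "\<phi> = (\<integral>\<^sup>+\<omega>. exp (l * min 1 (Y \<delta> \<omega>)) \<partial>M)"
  have [measurable]: "z i \<in> borel_measurable M" "S k \<in> borel_measurable M" for i k
    unfolding z_def[abs_def] S_def[abs_def] by measurable
  have z1: "z i \<omega> \<le> 1" for i \<omega> by (simp add: z_def)
  define P where "P k v \<longleftrightarrow> (\<forall>j\<in>{..<k}. (\<Sum>i<j. min 1 (v i)) < 1) \<and> 1 \<le> (\<Sum>i<k. min 1 (v i))" for k and v :: "nat \<Rightarrow> real"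
  define T where "T k \<omega> \<longleftrightarrow> (\<forall>j<k. S j \<omega> < 1) \<and> 1 \<le> S k \<omega>" for k \<omega>
  have [measurable]: "Measurable.pred M (T k)" for k unfolding T_def[abs_def] by measurable
  have sm: "(\<lambda>v. \<Sum>i<j. min 1 (v i)) \<in> borel_measurable (PiM {..<k} (\<lambda>_. borel :: real measure))" if "j \<le> k" for j k :: nat
    using that by (intro borel_measurable_sum borel_measurable_min measurable_component_singleton) auto
  have [measurable]: "Measurable.pred (PiM {..<k} (\<lambda>_. borel)) (P k)" for k
    unfolding P_def[abs_def]
    by (intro pred_intros_logic pred_intros_finite borel_measurable_pred_less borel_measurable_const sm) (auto intro: sm)?
  have TP: "T k \<omega> \<longleftrightarrow> P k (restrict (\<lambda>i. incr 0 \<delta> i \<omega>) {..<k})" for k \<omega>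
    unfolding T_def P_def S_def z_def by (intro arg_cong2[of _ _ _ _ "(\<and>)"]) (auto intro!: ball_cong)
  have \<phi>pow: "(\<integral>\<^sup>+\<omega>. exp (l * (\<Sum>i\<in>{k..<n}. z i \<omega>)) \<partial>M) = \<phi> ^ (n - k)" if "k \<le> n" for k n
    using that
  proof (induction n rule: dec_induct)
    case base
    show ?case by (simp add: emeasure_space_1)
  next
    case (step n)
    have ms: "(\<lambda>v. ennreal (exp (l * (\<Sum>i\<in>{k..<n}. min 1 (v i))))) \<in> borel_measurable (PiM {..<n} (\<lambda>_. borel))"
      using step by (auto intro!: borel_measurable_sum borel_measurable_min measurable_component_singleton measurable_compose[OF _ measurable_ennreal] borel_measurable_exp borel_measurable_times)
    have mn: "(\<lambda>v. ennreal (exp (l * min 1 (v n)))) \<in> borel_measurable (PiM {n..<Suc n} (\<lambda>_. borel))"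
      by (auto intro!: borel_measurable_min measurable_component_singleton measurable_compose[OF _ measurable_ennreal] borel_measurable_exp borel_measurable_times)
    have "(\<integral>\<^sup>+\<omega>. exp (l * (\<Sum>i\<in>{k..<Suc n}. z i \<omega>)) \<partial>M) =
       (\<integral>\<^sup>+\<omega>. ennreal (exp (l * (\<Sum>i\<in>{k..<n}. min 1 (restrict (\<lambda>i. incr 0 \<delta> i \<omega>) {..<n} i)))) *
          ennreal (exp (l * min 1 (restrict (\<lambda>i. incr 0 \<delta> i \<omega>) {n..<Suc n} n))) \<partial>M)"
      using step by (intro nn_integral_cong)
        (simp add: z_def ennreal_mult'[symmetric] exp_add[symmetric] distrib_left)
    also have "\<dots> = (\<integral>\<^sup>+\<omega>. exp (l * (\<Sum>i\<in>{k..<n}. z i \<omega>)) \<partial>M) * (\<integral>\<^sup>+\<omega>. exp (l * min 1 (incr 0 \<delta> n \<omega>)) \<partial>M)"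
      by (subst indep_var_nn_integral_mult[OF indep_incr_split[of 0 \<delta> n "Suc n"] ms mn])
        (use \<delta> in \<open>auto simp: z_def intro!: nn_integral_cong\<close>)
    also have "\<dots> = \<phi> ^ (Suc n - k)"
      using step nn_integral_incr[of 0 \<delta> "\<lambda>y. ennreal (exp (l * min 1 y))" n] \<delta>
      by (simp add: \<phi>_def Suc_diff_le mult.commute)
    finally show ?case .
  qed
  have A: "A = \<phi> ^ N" using \<phi>pow[of 0 N] by (simp add: A_def z_def atLeast0LessThan)
  \<comment> \<open>As \<open>A = \<phi> ^ N\<close>, a lower power of \<open>\<phi>\<close> is at
    most 1 or at most \<open>A\<close>, according to the side of 1 on which \<open>\<phi>\<close>
    lies.\<close>
  have pw: "\<phi> ^ k \<le> max 1 A" if "k \<le> N" for k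
  proof (cases "\<phi> \<le> 1")
    case True
    then show ?thesis by (simp add: power_le_one max.coboundedI1)
  next
    case False
    then have "\<phi> ^ k \<le> \<phi> ^ N" using that by (intro power_increasing) auto
    then show ?thesis by (simp add: A max.coboundedI2)
  qed
  have point: "ennreal (exp (l * S N \<omega>)) \<le> ennreal (exp l) +
      (\<Sum>k\<in>{1..N}. ennreal (exp (2 * l)) * (indicator {\<omega>. T k \<omega>} \<omega> * ennreal (exp (l * (\<Sum>i\<in>{k..<N}. z i \<omega>)))))" for \<omega>
  proof (cases "\<exists>k\<le>N. 1 \<le> S k \<omega>")
    case False
    then have "S N \<omega> \<le> 1" by (meson less_le_not_le linear)
    then have "exp (l * S N \<omega>) \<le> exp l" using l mult_left_mono[of "S N \<omega>" 1 l] by simp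
    then have "ennreal (exp (l * S N \<omega>)) \<le> ennreal (exp l)" by (rule ennreal_leI)
    then show ?thesis by (rule order_trans) (rule add_increasing2[OF zero_le order_refl])
  next
    case True
    define k where "k = (LEAST k. 1 \<le> S k \<omega>)"
    have k: "1 \<le> S k \<omega>" unfolding k_def by (rule LeastI_ex) (use True in blast)
    have kl: "S j \<omega> < 1" if "j < k" for j using not_less_Least[of j "\<lambda>k. 1 \<le> S k \<omega>"] that by (auto simp: k_def)
    have kN: "k \<le> N" using True unfolding k_def by (meson Least_le order_trans)
    have "k \<noteq> 0"
    proof
      assume "k = 0"
      with k show False by (simp add: S_def)
    qed
    then obtain k' where k': "k = Suc k'" by (cases k) auto
    have "S k \<omega> \<le> 2" using kl[of k'] z1[of k' \<omega>] by (simp add: k' S_def)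
    have "S N \<omega> = S k \<omega> + (\<Sum>i\<in>{k..<N}. z i \<omega>)"
      unfolding S_def using kN by (simp add: lessThan_atLeast0 sum.atLeastLessThan_concat)
    then have "l * S N \<omega> \<le> 2 * l + l * (\<Sum>i\<in>{k..<N}. z i \<omega>)"
      using mult_left_mono[OF \<open>S k \<omega> \<le> 2\<close> l] by (simp add: distrib_left)
    then have "ennreal (exp (l * S N \<omega>)) \<le> ennreal (exp (2 * l)) * ennreal (exp (l * (\<Sum>i\<in>{k..<N}. z i \<omega>)))"
      by (simp add: ennreal_mult'[symmetric] exp_add[symmetric])
    also have "\<dots> = ennreal (exp (2 * l)) * (indicator {\<omega>. T k \<omega>} \<omega> * ennreal (exp (l * (\<Sum>i\<in>{k..<N}. z i \<omega>))))"
      using k kl by (simp add: T_def)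
    also have "\<dots> \<le> (\<Sum>k\<in>{1..N}. ennreal (exp (2 * l)) * (indicator {\<omega>. T k \<omega>} \<omega> * ennreal (exp (l * (\<Sum>i\<in>{k..<N}. z i \<omega>)))))"
      by (rule member_le_sum) (use k' kN in auto)
    finally show ?thesis by (rule order_trans) (rule add_increasing[OF zero_le order_refl])
  qed
  have Tk: "(\<integral>\<^sup>+\<omega>. indicator {\<omega>. T k \<omega>} \<omega> * ennreal (exp (l * (\<Sum>i\<in>{k..<N}. z i \<omega>))) \<partial>M) =
      emeasure M {\<omega>\<in>space M. T k \<omega>} * \<phi> ^ (N - k)" if "k \<le> N" for k
  proof -
    have mn: "(\<lambda>v. ennreal (exp (l * (\<Sum>i\<in>{k..<N}. min 1 (v i))))) \<in> borel_measurable (PiM {k..<N} (\<lambda>_. borel))"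
      by (auto intro!: borel_measurable_sum borel_measurable_min measurable_component_singleton measurable_compose[OF _ measurable_ennreal] borel_measurable_exp borel_measurable_times)
    have mp: "(\<lambda>v. indicator {v. P k v} v :: ennreal) \<in> borel_measurable (PiM {..<k} (\<lambda>_. borel))"
      by measurable
    have "(\<integral>\<^sup>+\<omega>. indicator {\<omega>. T k \<omega>} \<omega> * ennreal (exp (l * (\<Sum>i\<in>{k..<N}. z i \<omega>))) \<partial>M) =
      (\<integral>\<^sup>+\<omega>. indicator {v. P k v} (restrict (\<lambda>i. incr 0 \<delta> i \<omega>) {..<k}) *
         ennreal (exp (l * (\<Sum>i\<in>{k..<N}. min 1 (restrict (\<lambda>i. incr 0 \<delta> i \<omega>) {k..<N} i)))) \<partial>M)"
      by (intro nn_integral_cong) (simp add: TP z_def indicator_def)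
    also have "\<dots> = (\<integral>\<^sup>+\<omega>. indicator {\<omega>. T k \<omega>} \<omega> \<partial>M) * (\<integral>\<^sup>+\<omega>. exp (l * (\<Sum>i\<in>{k..<N}. z i \<omega>)) \<partial>M)"
      by (subst indep_var_nn_integral_mult[OF indep_incr_split[of 0 \<delta> k N] mp mn])
        (use \<delta> that in \<open>auto simp: z_def TP indicator_def intro!: nn_integral_cong arg_cong2[of _ _ _ _ "(*)"]\<close>)
    also have "(\<integral>\<^sup>+\<omega>. indicator {\<omega>. T k \<omega>} \<omega> \<partial>M) = (\<integral>\<^sup>+\<omega>. indicator {\<omega>\<in>space M. T k \<omega>} \<omega> \<partial>M)"
      by (intro nn_integral_cong) (auto simp: indicator_def)
    finally show ?thesis using that by (simp add: \<phi>pow)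
  qed
  have "A = (\<integral>\<^sup>+\<omega>. exp (l * S N \<omega>) \<partial>M)" by (simp add: A_def S_def z_def)
  also have "\<dots> \<le> (\<integral>\<^sup>+\<omega>. ennreal (exp l) +
      (\<Sum>k\<in>{1..N}. ennreal (exp (2 * l)) * (indicator {\<omega>. T k \<omega>} \<omega> * ennreal (exp (l * (\<Sum>i\<in>{k..<N}. z i \<omega>))))) \<partial>M)"
    by (intro nn_integral_mono point)
  also have "\<dots> = exp l + (\<Sum>k\<in>{1..N}. exp (2 * l) * (emeasure M {\<omega>\<in>space M. T k \<omega>} * \<phi> ^ (N - k)))"
    by (subst nn_integral_add, simp, simp, subst nn_integral_sum, simp)
      (auto simp: emeasure_space_1 nn_integral_cmult Tk intro!: arg_cong2[of _ _ _ _ "(+)"] sum.cong)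
  also have "\<dots> \<le> exp l + (\<Sum>k\<in>{1..N}. exp (2 * l) * (emeasure M {\<omega>\<in>space M. T k \<omega>} * max 1 A))"
    by (intro add_left_mono sum_mono mult_left_mono pw) auto
  also have "\<dots> = exp l + exp (2 * l) * (\<Sum>k\<in>{1..N}. emeasure M {\<omega>\<in>space M. T k \<omega>}) * max 1 A"
    by (simp add: sum_distrib_left sum_distrib_right mult.assoc)
  also have "(\<Sum>k\<in>{1..N}. emeasure M {\<omega>\<in>space M. T k \<omega>}) = emeasure M (\<Union>k\<in>{1..N}. {\<omega>\<in>space M. T k \<omega>})"
  proof (rule sum_emeasure)
    show "disjoint_family_on (\<lambda>k. {\<omega> \<in> space M. T k \<omega>}) {1..N}"
      unfolding disjoint_family_on_def T_def by (auto simp: not_le[symmetric]) (metis linorder_neqE_nat not_le)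
  qed auto
  \<comment> \<open>Truncation only lowers the sum, so a truncated walk at 1 or higher means that
    \<open>Y\<close> itself is at 1 or higher at a grid time, hence above
    \<open>1 / 2\<close>.\<close>
  also have "exp l + exp (2 * l) * emeasure M (\<Union>k\<in>{1..N}. {\<omega>\<in>space M. T k \<omega>}) * max 1 A \<le>
      exp l + exp (2 * l) * emeasure M {\<omega>\<in>space M. \<not> below (1 / 2) (real N * \<delta>) \<omega>} * max 1 A"
  proof (intro add_left_mono mult_right_mono mult_left_mono emeasure_mono subsetI)
    fix \<omega> assume "\<omega> \<in> (\<Union>k\<in>{1..N}. {\<omega>\<in>space M. T k \<omega>})"
    then obtain k where k: "k \<le> N" "\<omega> \<in> space M" "1 \<le> S k \<omega>" by (auto simp: T_def)
    have "S k \<omega> \<le> (\<Sum>i<k. incr 0 \<delta> i \<omega>)" unfolding S_def z_def by (rule sum_mono) simp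
    also have "\<dots> = Y (real k * \<delta>) \<omega>" by (simp add: sum_incr Y_neg)
    finally have "1 / 2 < Y (real k * \<delta>) \<omega>" using k by simp
    moreover have "real k * \<delta> \<in> {0..real N * \<delta>}" using k(1) \<delta> by (auto intro!: mult_right_mono)
    ultimately show "\<omega> \<in> {\<omega>\<in>space M. \<not> below (1 / 2) (real N * \<delta>) \<omega>}" using k(2) by (force simp: below_def)
  qed auto
  finally show ?thesis .
qed

end

lemma exp_diff_bound: fixes a b :: real shows "\<bar>exp b - exp a\<bar> \<le> \<bar>b - a\<bar> * max (exp a) (exp b)"
proof -
  have "exp b - exp a \<le> \<bar>b - a\<bar> * exp b" for a b :: real
  proof -
    have "exp b * (1 + (a - b)) \<le> exp b * exp (a - b)" by (intro mult_left_mono exp_ge_add_one_self) auto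
    also have "\<dots> = exp a" by (simp add: exp_add[symmetric])
    finally have "exp b - exp a \<le> (b - a) * exp b" by (simp add: algebra_simps)
    also have "\<dots> \<le> \<bar>b - a\<bar> * exp b" by (intro mult_right_mono) auto
    finally show ?thesis .
  qed
  from this[of b a] this[of a b] have "\<bar>exp b - exp a\<bar> \<le> max (\<bar>b - a\<bar> * exp a) (\<bar>b - a\<bar> * exp b)"
    by (auto simp: abs_minus_commute)
  also have "\<dots> = \<bar>b - a\<bar> * max (exp a) (exp b)" by (simp add: max_def mult_left_mono)
  finally show ?thesis .
qed

text \<open>An integrable majorant for differentiating \<open>exp (k * y)\<close> in
  \<open>k\<close> under the expectation: the factor \<open>\<bar>y\<bar>\<close> is at most
  \<open>exp (r * \<bar>y\<bar>) / r\<close>, which raises the exponent to at most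
  \<open>4 * r * y\<close> for \<open>y \<ge> 0\<close> and is absorbed by \<open>k \<ge> r\<close>
  for \<open>y < 0\<close>.\<close>

lemma abs_mult_exp_bound:
  fixes r y k :: real
  assumes r: "0 < r" and k: "r \<le> k" "k \<le> 3 * r"
  shows "\<bar>y\<bar> * exp (k * y) \<le> (1 + exp (4 * r * y)) / r"
proof (cases "0 \<le> y")
  case True
  have "r * y \<le> exp (r * y)" using exp_ge_add_one_self[of "r * y"] by linarith
  then have "r * y * exp (k * y) \<le> exp (r * y) * exp (3 * r * y)"
    using True k r by (intro mult_mono) (auto intro: mult_right_mono)
  also have "\<dots> = exp (4 * r * y)" by (simp add: exp_add[symmetric] algebra_simps)
  finally have "r * (\<bar>y\<bar> * exp (k * y)) \<le> 1 + exp (4 * r * y)" using True by simp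
  then show ?thesis using r by (simp add: pos_le_divide_eq mult.commute)
next
  case False
  have "r * (- y) \<le> exp (r * (- y))" using exp_ge_add_one_self[of "r * (- y)"] by linarith
  then have "r * (- y) * exp (k * y) \<le> exp (r * (- y)) * exp (r * y)"
    using False k r by (intro mult_mono) (auto intro: mult_right_mono_neg)
  also have "\<dots> = 1" by (simp add: exp_add[symmetric])
  finally have "r * (\<bar>y\<bar> * exp (k * y)) \<le> 1 + exp (4 * r * y)" using False by (simp add: add_increasing2)
  then show ?thesis using r by (simp add: pos_le_divide_eq mult.commute)
qed

section \<open>Finiteness of exponential moments and regularity of the Laplace exponent\<close>

context regular_levy
begin

lemma grid_increments_small:
  assumes "0 < e" "0 < t"
  shows "\<forall>\<^sub>F n in sequentially. \<forall>i<2 ^ n. incr 0 (t / 2 ^ n) i \<omega> \<le> e"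
proof -
  obtain d where d: "0 < d" "\<And>u v. 0 \<le> u \<Longrightarrow> u \<le> v \<Longrightarrow> v \<le> t \<Longrightarrow> v - u < d \<Longrightarrow> Y v \<omega> \<le> Y u \<omega> + e"
    using upward[OF assms(1), of t \<omega>] by auto
  have "(\<lambda>n. t / 2 ^ n) \<longlonglongrightarrow> 0"
    using tendsto_mult[OF tendsto_const[of t] LIMSEQ_inverse_realpow_zero[of 2]] by (simp add: divide_inverse)
  then have "\<forall>\<^sub>F n in sequentially. t / 2 ^ n < d" using d(1) by (rule order_tendstoD(2))
  then show ?thesis
  proof eventually_elim
    case (elim n)
    show ?case
    proof safe
      fix i :: nat assume i: "i < 2 ^ n"
      define \<delta> where "\<delta> = t / 2 ^ n"
      have \<delta>: "0 < \<delta>" "\<delta> < d" "2 ^ n * \<delta> = t" using elim assms by (auto simp: \<delta>_def)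
      have "real (Suc i) \<le> 2 ^ n" using i by (metis Suc_leI of_nat_le_iff of_nat_numeral of_nat_power)
      then have "real (Suc i) * \<delta> \<le> t" using mult_right_mono[of "real (Suc i)" "2 ^ n" \<delta>] \<delta> by simp
      then have "Y (real (Suc i) * \<delta>) \<omega> \<le> Y (real i * \<delta>) \<omega> + e"
        using \<delta> by (intro d(2)) (auto simp: algebra_simps)
      then show "incr 0 (t / 2 ^ n) i \<omega> \<le> e" by (simp add: incr_def \<delta>_def)
    qed
  qed
qed

text \<open>Paths start at 0 and are right-continuous, so the decreasing events of exceeding
  \<open>1 / 2\<close> by time \<open>1 / Suc k\<close> have empty intersection.\<close>

lemma not_below_small:
  assumes "0 < e"
  shows "\<exists>k. emeasure M {\<omega>\<in>space M. \<not> below (1 / 2) (1 / real (Suc k)) \<omega>} \<le> ennreal e"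
proof -
  define A where "A k = {\<omega>\<in>space M. \<not> below (1 / 2) (1 / real (Suc k)) \<omega>}" for k
  have [measurable]: "A k \<in> sets M" for k unfolding A_def by measurable
  have "decseq A"
    unfolding decseq_Suc_iff
  proof safe
    fix n \<omega> assume "\<omega> \<in> A (Suc n)"
    moreover have "1 / real (Suc (Suc n)) \<le> 1 / real (Suc n)" by (simp add: frac_le)
    ultimately show "\<omega> \<in> A n" using below_antimono by (auto simp del: of_nat_Suc simp: A_def)
  qed
  then have lim: "(\<lambda>k. measure M (A k)) \<longlonglongrightarrow> measure M (\<Inter>k. A k)"
    by (intro finite_Lim_measure_decseq) auto
  have "(\<Inter>k. A k) = {}"
  proof safe
    fix \<omega> assume "\<omega> \<in> (\<Inter>k. A k)"
    then have nb: "\<not> below (1 / 2) (1 / real (Suc k)) \<omega>" for k by (auto simp: A_def)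
    have "\<forall>\<^sub>F u in at_right 0. Y u \<omega> < 1 / 2"
      by (rule order_tendstoD(2)[OF right_cont]) (simp add: Y_neg)
    then obtain b where b: "0 < b" "\<And>u. 0 < u \<Longrightarrow> u < b \<Longrightarrow> Y u \<omega> < 1 / 2"
      by (auto simp: eventually_at_right_field)
    obtain k where k: "1 / real (Suc k) < b" using b(1) nat_approx_posE by metis
    have "below (1 / 2) (1 / real (Suc k)) \<omega>"
      unfolding below_def
    proof
      fix u assume "u \<in> {0..1 / real (Suc k)}"
      then show "Y u \<omega> \<le> 1 / 2" using b(2)[of u] k by (cases "u = 0") (auto simp: Y_neg)
    qed
    then show "\<omega> \<in> {}" using nb by auto
  qed
  then have "(\<lambda>k. measure M (A k)) \<longlonglongrightarrow> 0" using lim by simp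
  then have "\<forall>\<^sub>F k in sequentially. measure M (A k) < e" using assms by (rule order_tendstoD(2))
  then obtain k where "measure M (A k) < e" using eventually_happens'[OF sequentially_bot] by blast
  then have "emeasure M (A k) \<le> ennreal e" by (simp add: emeasure_eq_measure ennreal_leI)
  then show ?thesis unfolding A_def by blast
qed

text \<open>For small \<open>t\<close> the factor \<open>exp (2 * l)\<close> times the probability
  of exceeding \<open>1 / 2\<close> by time \<open>t\<close> is at most \<open>1 / 2\<close>, and
  \<open>truncated_mgf_bound\<close> becomes \<open>A \<le> exp l + max 1 A / 2\<close>, a bound
  free of the grid. Truncation is inactive on fine grids by \<open>grid_increments_small\<close>, so
  Fatou gives a finite moment at \<open>t\<close>, and the semigroup law one at time 1.\<close>

lemma mgf_1_finite: assumes l: "0 \<le> l" shows "mgf l 1 < \<infinity>"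
proof -
  define e where "e = exp (- 2 * l) / 2"
  have e: "0 < e" "exp (2 * l) * e = 1 / 2" by (auto simp: e_def exp_add[symmetric])
  obtain k where k: "emeasure M {\<omega>\<in>space M. \<not> below (1 / 2) (1 / real (Suc k)) \<omega>} \<le> ennreal e"
    using not_below_small[OF e(1)] by blast
  define t where "t = 1 / real (Suc k)"
  have t: "0 < t" by (simp add: t_def)
  define S where "S n \<omega> = (\<Sum>i<2 ^ n. min 1 (incr 0 (t / 2 ^ n) i \<omega>))" for n \<omega>
  have [measurable]: "S n \<in> borel_measurable M" for n unfolding S_def[abs_def] by measurable
  have bound: "(\<integral>\<^sup>+\<omega>. exp (l * S n \<omega>) \<partial>M) \<le> ennreal (2 * exp l + 1)" for n
  proof -
    define A where "A = (\<integral>\<^sup>+\<omega>. exp (l * S n \<omega>) \<partial>M)"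
    \<comment> \<open>A crude bound depending on \<open>n\<close>: the inequality for
      \<open>A\<close> can be solved only once \<open>A\<close> is known to be finite.\<close>
    have "S n \<omega> \<le> 2 ^ n" for \<omega>
      unfolding S_def using sum_mono[of "{..<2 ^ n}" "\<lambda>i. min 1 (incr 0 (t / 2 ^ n) i \<omega>)" "\<lambda>_. 1"] by simp
    then have "A \<le> (\<integral>\<^sup>+\<omega>. exp (l * 2 ^ n) \<partial>M)" unfolding A_def using l
      by (intro nn_integral_mono ennreal_leI) (simp add: mult_left_mono)
    also have "\<dots> < \<infinity>" by (simp add: emeasure_space_1)
    finally obtain a where a: "A = ennreal a" "0 \<le> a" by (cases A) auto
    have "A \<le> exp l + exp (2 * l) * emeasure M {\<omega>\<in>space M. \<not> below (1 / 2) (real (2 ^ n) * (t / 2 ^ n)) \<omega>} * max 1 A"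
      unfolding A_def S_def by (rule truncated_mgf_bound) (use l t in auto)
    also have "real (2 ^ n) * (t / 2 ^ n) = 1 / real (Suc k)" by (simp add: t_def)
    also have "exp l + exp (2 * l) * emeasure M {\<omega>\<in>space M. \<not> below (1 / 2) (1 / real (Suc k)) \<omega>} * max 1 A
        \<le> exp l + exp (2 * l) * ennreal e * max 1 A"
      by (intro add_left_mono mult_right_mono mult_left_mono k) auto
    also have "max 1 A = ennreal (max 1 a)" using a by (simp add: max_def ennreal_1[symmetric] del: ennreal_1)
    also have "exp l + exp (2 * l) * ennreal e * ennreal (max 1 a) = ennreal (exp l + exp (2 * l) * e * max 1 a)"
      using e by (simp add: ennreal_mult'[symmetric] ennreal_plus[symmetric] del: ennreal_plus)
    finally have "ennreal a \<le> ennreal (exp l + exp (2 * l) * e * max 1 a)" unfolding a(1) .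
    then have "a \<le> exp l + exp (2 * l) * e * max 1 a" using e(1) by (subst (asm) ennreal_le_iff) auto
    then have "a \<le> exp l + 1 / 2 * max 1 a" unfolding e(2) .
    moreover have "max 1 a \<le> 1 + a" using a(2) by simp
    ultimately have "a \<le> 2 * exp l + 1" by linarith
    then show ?thesis unfolding A_def[symmetric] a(1) by (rule ennreal_leI)
  qed
  have lim: "(\<lambda>n. ennreal (exp (l * S n \<omega>))) \<longlonglongrightarrow> ennreal (exp (l * Y t \<omega>))" for \<omega>
  proof (rule tendsto_eventually)
    show "\<forall>\<^sub>F n in sequentially. ennreal (exp (l * S n \<omega>)) = ennreal (exp (l * Y t \<omega>))"
      using grid_increments_small[OF zero_less_one t, of \<omega>]
    proof eventually_elim
      case (elim n)
      then have "S n \<omega> = (\<Sum>i<2 ^ n. incr 0 (t / 2 ^ n) i \<omega>)" unfolding S_def by (intro sum.cong) auto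
      then show ?case by (simp add: sum_incr Y_neg)
    qed
  qed
  have "mgf l t = (\<integral>\<^sup>+\<omega>. liminf (\<lambda>n. ennreal (exp (l * S n \<omega>))) \<partial>M)"
    unfolding mgf_def by (intro nn_integral_cong) (simp add: lim_imp_Liminf[OF _ lim])
  also have "\<dots> \<le> liminf (\<lambda>n. \<integral>\<^sup>+\<omega>. exp (l * S n \<omega>) \<partial>M)" by (rule nn_integral_liminf) simp
  also have "\<dots> \<le> liminf (\<lambda>n. ennreal (2 * exp l + 1))" by (intro Liminf_mono always_eventually allI bound)
  also have "\<dots> = ennreal (2 * exp l + 1)" by (rule lim_imp_Liminf) auto
  finally have "mgf l t < \<infinity>" by (rule order.strict_trans1) simp
  moreover have "mgf l 1 = mgf l t ^ Suc k" using mgf_mult[of t l "Suc k"] t by (simp add: t_def)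
  ultimately show ?thesis by (simp del: power_Suc add: power_less_top_ennreal)
qed

abbreviation \<psi> :: "real \<Rightarrow> real" where "\<psi> \<equiv> laplace_exponent M Y"

lemma mgf_1: assumes "0 \<le> l" shows "mgf l 1 = ennreal (exp (\<psi> l))"
proof -
  have i: "integrable M (\<lambda>\<omega>. exp (l * Y 1 \<omega>))"
    using mgf_1_finite[OF assms] by (intro integrableI_bounded) (auto simp: mgf_def)
  have "mgf l 1 = ennreal (LINT \<omega>|M. exp (l * Y 1 \<omega>))"
    unfolding mgf_def by (rule nn_integral_eq_integral[OF i]) simp
  moreover from this have "0 < (LINT \<omega>|M. exp (l * Y 1 \<omega>))" using mgf_pos[of l 1] by simp
  ultimately show ?thesis by (simp add: laplace_exponent_def)
qed

lemma mgf_dyadic: assumes l: "0 \<le> l" shows "mgf l (real k / 2 ^ n) = ennreal (exp (real k / 2 ^ n * \<psi> l))"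
proof -
  have p: "mgf l (1 / 2 ^ n) ^ 2 ^ n = ennreal (exp (\<psi> l))"
    using mgf_mult[of "1 / 2 ^ n" l "2 ^ n"] by (simp add: mgf_1[OF l])
  then have "mgf l (1 / 2 ^ n) < \<infinity>" by (metis ennreal_less_top infinity_ennreal_def power_less_top_ennreal zero_less_numeral zero_less_power neq0_conv)
  then obtain c where c: "mgf l (1 / 2 ^ n) = ennreal c" "0 \<le> c" by (cases "mgf l (1 / 2 ^ n)") auto
  have "c ^ 2 ^ n = exp (\<psi> l)" using p c by (simp add: ennreal_power)
  also have "\<dots> = exp (\<psi> l / 2 ^ n) ^ 2 ^ n" by (simp add: exp_of_nat_mult[symmetric])
  finally have "c = exp (\<psi> l / 2 ^ n)" using c(2) by (subst (asm) power_eq_iff_eq_base) auto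
  then have "mgf l (real k * (1 / 2 ^ n)) = ennreal (exp (\<psi> l / 2 ^ n) ^ k)"
    using mgf_mult[of "1 / 2 ^ n" l k] c by (simp add: ennreal_power)
  then show ?thesis by (simp add: exp_of_nat_mult[symmetric])
qed

text \<open>Fatou along dyadic times from the right yields only \<open>\<le>\<close>. Applied to
  both factors of \<open>mgf l t * mgf l (k - t)\<close>, whose product is known exactly for an
  integer \<open>k \<ge> t\<close>, it forces equality.\<close>

lemma mgf_eq: assumes l: "0 \<le> l" and t: "0 \<le> t" shows "mgf l t = ennreal (exp (t * \<psi> l))"
proof -
  have le: "mgf l t \<le> ennreal (exp (t * \<psi> l))" if t: "0 \<le> t" for t
  proof -
    define u where "u n = 1 / 2 ^ n * real_of_int \<lceil>t / (1 / 2 ^ n)\<rceil>" for n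
    have ut: "u \<longlonglongrightarrow> t" "\<And>n. t \<le> u n"
      using ceiling_grid_tendsto[of 1 t] by (auto simp: u_def[abs_def])
    have "u n = real (nat \<lceil>t / (1 / 2 ^ n)\<rceil>) / 2 ^ n" for n using t by (simp add: u_def)
    then have mu: "mgf l (u n) = ennreal (exp (u n * \<psi> l))" for n using mgf_dyadic[OF l] by metis
    have lim: "(\<lambda>n. ennreal (exp (l * Y (u n) \<omega>))) \<longlonglongrightarrow> ennreal (exp (l * Y t \<omega>))" for \<omega>
      by (intro tendsto_intros tendsto_ennrealI Y_sequentially ut)
    have "mgf l t = (\<integral>\<^sup>+\<omega>. liminf (\<lambda>n. ennreal (exp (l * Y (u n) \<omega>))) \<partial>M)"
      unfolding mgf_def by (intro nn_integral_cong) (simp add: lim_imp_Liminf[OF _ lim])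
    also have "\<dots> \<le> liminf (\<lambda>n. mgf l (u n))" unfolding mgf_def by (rule nn_integral_liminf) simp
    also have "\<dots> = ennreal (exp (t * \<psi> l))"
      unfolding mu by (intro lim_imp_Liminf tendsto_intros tendsto_ennrealI ut) simp
    finally show ?thesis .
  qed
  define k where "k = nat \<lceil>t\<rceil>"
  have k: "t \<le> real k" unfolding k_def by (rule real_nat_ceiling_ge)
  obtain c d where c: "mgf l t = ennreal c" "0 \<le> c" "c \<le> exp (t * \<psi> l)"
    and d: "mgf l (real k - t) = ennreal d" "0 \<le> d" "d \<le> exp ((real k - t) * \<psi> l)"
    using le[of t] le[of "real k - t"] t k
    by (cases "mgf l t"; cases "mgf l (real k - t)") (auto simp: ennreal_le_iff top_unique)
  have "mgf l t * mgf l (real k - t) = ennreal (exp (real k * \<psi> l))"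
    using mgf_add[of t "real k - t" l] mgf_dyadic[OF l, of k 0] t k by simp
  then have cd: "c * d = exp (real k * \<psi> l)" using c d by (simp add: ennreal_mult'[symmetric])
  also have "\<dots> = exp (t * \<psi> l) * exp ((real k - t) * \<psi> l)" by (simp add: exp_add[symmetric] algebra_simps)
  finally have "exp (t * \<psi> l) * exp ((real k - t) * \<psi> l) \<le> c * exp ((real k - t) * \<psi> l)"
    using mult_left_mono[OF d(3) c(2)] by simp
  then have "exp (t * \<psi> l) \<le> c" by simp
  then show ?thesis using c by simp
qed

lemma exp_integrable: "0 \<le> l \<Longrightarrow> 0 \<le> t \<Longrightarrow> integrable M (\<lambda>\<omega>. exp (l * Y t \<omega>))"
  using mgf_eq[of l t] by (intro integrableI_bounded) (auto simp: mgf_def)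

lemma exp_integral: "0 \<le> l \<Longrightarrow> 0 \<le> t \<Longrightarrow> (\<integral>\<omega>. exp (l * Y t \<omega>) \<partial>M) = exp (t * \<psi> l)"
  using mgf_eq[of l t] nn_integral_eq_integral[OF exp_integrable[of l t]] by (simp add: mgf_def)

lemma \<psi>_0: "\<psi> 0 = 0"
  by (simp add: laplace_exponent_def prob_space)

text \<open>Hoelder's inequality in the form of convexity of \<open>exp\<close> at the two exponents
  \<open>x * Y 1 - \<psi> x\<close> and \<open>y * Y 1 - \<psi> y\<close>, normalised so that their
  exponentials have expectation 1.\<close>

lemma \<psi>_convex: "convex_on {0..} \<psi>"
proof (rule convex_onI)
  fix t x y :: real assume t: "0 < t" "t < 1" and xy: "x \<in> {0..}" "y \<in> {0..}"
  define z where "z = (1 - t) * x + t * y"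
  have z: "0 \<le> z" using t xy by (simp add: z_def)
  have "(\<integral>\<omega>. exp (z * Y 1 \<omega> - ((1 - t) * \<psi> x + t * \<psi> y)) \<partial>M) \<le> (\<integral>\<omega>. (1 - t) * (exp (x * Y 1 \<omega>) / exp (\<psi> x)) + t * (exp (y * Y 1 \<omega>) / exp (\<psi> y)) \<partial>M)"
  proof (rule integral_mono)
    fix \<omega>
    have "exp ((1 - t) *\<^sub>R (x * Y 1 \<omega> - \<psi> x) + t *\<^sub>R (y * Y 1 \<omega> - \<psi> y)) \<le> (1 - t) * exp (x * Y 1 \<omega> - \<psi> x) + t * exp (y * Y 1 \<omega> - \<psi> y)"
      by (rule convex_onD[OF exp_convex]) (use t in auto)
    then show "exp (z * Y 1 \<omega> - ((1 - t) * \<psi> x + t * \<psi> y)) \<le> (1 - t) * (exp (x * Y 1 \<omega>) / exp (\<psi> x)) + t * (exp (y * Y 1 \<omega>) / exp (\<psi> y))"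
      by (simp add: z_def exp_diff algebra_simps)
  next
    show "integrable M (\<lambda>\<omega>. exp (z * Y 1 \<omega> - ((1 - t) * \<psi> x + t * \<psi> y)))"
      unfolding exp_diff using exp_integrable[OF z, of 1] by auto
    show "integrable M (\<lambda>\<omega>. (1 - t) * (exp (x * Y 1 \<omega>) / exp (\<psi> x)) + t * (exp (y * Y 1 \<omega>) / exp (\<psi> y)))"
      using exp_integrable[of x 1] exp_integrable[of y 1] xy by auto
  qed
  also have "\<dots> = 1" using exp_integrable[of x 1] exp_integrable[of y 1] xy by (simp add: exp_integral)
  also have "(\<integral>\<omega>. exp (z * Y 1 \<omega> - ((1 - t) * \<psi> x + t * \<psi> y)) \<partial>M) = exp (\<psi> z - ((1 - t) * \<psi> x + t * \<psi> y))"
    unfolding exp_diff[of "_ * _"] exp_diff[of "\<psi> z"] using exp_integral[OF z, of 1] by simp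
  finally show "\<psi> ((1 - t) *\<^sub>R x + t *\<^sub>R y) \<le> (1 - t) * \<psi> x + t * \<psi> y" by (simp add: z_def)
qed simp

lemma \<psi>_continuous: "continuous_on {0..} \<psi>"
proof -
  have "continuous_on {0..} (\<lambda>l. \<integral>\<omega>. exp (l * Y 1 \<omega>) \<partial>M)"
    unfolding continuous_on_sequentially
  proof (intro allI ballI impI, elim conjE)
    fix x :: "nat \<Rightarrow> real" and l :: real assume xl: "\<forall>n. x n \<in> {0..}" "l \<in> {0..}" "x \<longlonglongrightarrow> l"
    obtain L where L: "\<And>n. \<bar>x n\<bar> \<le> L" using convergent_imp_Bseq[OF convergentI[OF xl(3)]] by (auto simp: Bseq_def)
    have L0: "0 \<le> L" using L[of 0] by linarith
    show "((\<lambda>l. \<integral>\<omega>. exp (l * Y 1 \<omega>) \<partial>M) \<circ> x) \<longlonglongrightarrow> (\<integral>\<omega>. exp (l * Y 1 \<omega>) \<partial>M)"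
      unfolding o_def
    proof (rule integral_dominated_convergence[where w="\<lambda>\<omega>. 1 + exp (L * Y 1 \<omega>)"])
      show "integrable M (\<lambda>\<omega>. 1 + exp (L * Y 1 \<omega>))" using exp_integrable[OF L0, of 1] by simp
      show "AE \<omega> in M. (\<lambda>n. exp (x n * Y 1 \<omega>)) \<longlonglongrightarrow> exp (l * Y 1 \<omega>)"
        using xl(3) by (intro AE_I2 tendsto_intros)
      show "AE \<omega> in M. norm (exp (x n * Y 1 \<omega>)) \<le> 1 + exp (L * Y 1 \<omega>)" for n
      proof (rule AE_I2)
        fix \<omega>
        have x: "0 \<le> x n" "x n \<le> L" using xl(1) L[of n] by auto
        show "norm (exp (x n * Y 1 \<omega>)) \<le> 1 + exp (L * Y 1 \<omega>)"
        proof (cases "0 \<le> Y 1 \<omega>")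
          case True
          then have "exp (x n * Y 1 \<omega>) \<le> exp (L * Y 1 \<omega>)" using x by (simp add: mult_right_mono)
          then show ?thesis by (simp del: exp_le_cancel_iff)
        next
          case False
          then have "exp (x n * Y 1 \<omega>) \<le> 1" using x by (simp add: mult_nonneg_nonpos)
          then show ?thesis by (simp add: add_increasing2)
        qed
      qed
    qed measurable
  qed
  then have "continuous_on {0..} (\<lambda>l. ln (\<integral>\<omega>. exp (l * Y 1 \<omega>) \<partial>M))"
    by (rule continuous_on_ln) (simp add: exp_integral)
  then show ?thesis by (rule continuous_on_cong[THEN iffD1, rotated -1]) (simp_all add: exp_integral)
qed

lemma \<psi>_differentiable: assumes l: "0 < l" shows "(\<psi> has_real_derivative deriv \<psi> l) (at l)"
proof -
  \<comment> \<open>With \<open>l = 2 * r\<close> and increments of size at most \<open>r\<close>,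
    all exponents stay between \<open>r\<close> and \<open>3 * r\<close>, the range of
    \<open>abs_mult_exp_bound\<close>.\<close>
  define r where "r = l / 2"
  have r: "0 < r" and lr: "l = 2 * r" using l by (auto simp: r_def)
  define D where "D = (\<integral>\<omega>. Y 1 \<omega> * exp (l * Y 1 \<omega>) \<partial>M)"
  define E where "E l = (\<integral>\<omega>. exp (l * Y 1 \<omega>) \<partial>M)" for l
  have "((\<lambda>h. (E (l + h) - E l) / h) \<longlongrightarrow> D) (at 0 within {-r<..<r})"
    unfolding tendsto_at_iff_sequentially
  proof (intro allI impI)
    fix x :: "nat \<Rightarrow> real" assume x: "\<forall>i. x i \<in> {-r<..<r} - {0}" and x0: "x \<longlonglongrightarrow> 0"
    have xr: "\<bar>x i\<bar> \<le> r" "x i \<noteq> 0" "0 \<le> l + x i" for i using x[rule_format, of i] lr by (auto simp: abs_if)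
    have "(\<lambda>i. \<integral>\<omega>. (exp ((l + x i) * Y 1 \<omega>) - exp (l * Y 1 \<omega>)) / x i \<partial>M) \<longlonglongrightarrow> D"
      unfolding D_def
    proof (rule integral_dominated_convergence[where w="\<lambda>\<omega>. (1 + exp (4 * r * Y 1 \<omega>)) / r"])
      show "integrable M (\<lambda>\<omega>. (1 + exp (4 * r * Y 1 \<omega>)) / r)" using exp_integrable[of "4 * r" 1] r by simp
      show "AE \<omega> in M. (\<lambda>i. (exp ((l + x i) * Y 1 \<omega>) - exp (l * Y 1 \<omega>)) / x i) \<longlonglongrightarrow> Y 1 \<omega> * exp (l * Y 1 \<omega>)"
      proof (rule AE_I2)
        fix \<omega>
        have "((\<lambda>l. exp (l * Y 1 \<omega>)) has_real_derivative Y 1 \<omega> * exp (l * Y 1 \<omega>)) (at l)"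
          by (auto intro!: derivative_eq_intros)
        then have "((\<lambda>h. (exp ((l + h) * Y 1 \<omega>) - exp (l * Y 1 \<omega>)) / h) \<longlongrightarrow> Y 1 \<omega> * exp (l * Y 1 \<omega>)) (at 0)"
          by (simp add: DERIV_def)
        then show "(\<lambda>i. (exp ((l + x i) * Y 1 \<omega>) - exp (l * Y 1 \<omega>)) / x i) \<longlonglongrightarrow> Y 1 \<omega> * exp (l * Y 1 \<omega>)"
          using x0 xr(2) unfolding tendsto_at_iff_sequentially by (auto simp: o_def)
      qed
      show "AE \<omega> in M. norm ((exp ((l + x i) * Y 1 \<omega>) - exp (l * Y 1 \<omega>)) / x i) \<le> (1 + exp (4 * r * Y 1 \<omega>)) / r" for i
      proof (rule AE_I2)
        fix \<omega>
        have "\<bar>exp ((l + x i) * Y 1 \<omega>) - exp (l * Y 1 \<omega>)\<bar> \<le> \<bar>(l + x i) * Y 1 \<omega> - l * Y 1 \<omega>\<bar> * max (exp (l * Y 1 \<omega>)) (exp ((l + x i) * Y 1 \<omega>))"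
          by (rule exp_diff_bound)
        also have "\<bar>(l + x i) * Y 1 \<omega> - l * Y 1 \<omega>\<bar> = \<bar>x i\<bar> * \<bar>Y 1 \<omega>\<bar>" by (simp add: distrib_right abs_mult)
        also have "\<bar>x i\<bar> * \<bar>Y 1 \<omega>\<bar> * max (exp (l * Y 1 \<omega>)) (exp ((l + x i) * Y 1 \<omega>)) \<le> \<bar>x i\<bar> * ((1 + exp (4 * r * Y 1 \<omega>)) / r)"
        proof -
          have "\<bar>Y 1 \<omega>\<bar> * max (exp (l * Y 1 \<omega>)) (exp ((l + x i) * Y 1 \<omega>)) \<le> (1 + exp (4 * r * Y 1 \<omega>)) / r"
            using abs_mult_exp_bound[OF r, of l "Y 1 \<omega>"] abs_mult_exp_bound[OF r, of "l + x i" "Y 1 \<omega>"] xr(1)[of i] r lr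
            by (auto simp: max_def abs_le_iff)
          from mult_left_mono[OF this, of "\<bar>x i\<bar>"] show ?thesis by (simp add: mult.assoc)
        qed
        finally show "norm ((exp ((l + x i) * Y 1 \<omega>) - exp (l * Y 1 \<omega>)) / x i) \<le> (1 + exp (4 * r * Y 1 \<omega>)) / r"
          using xr(2)[of i] by (simp add: pos_divide_le_eq mult.commute)
      qed
    qed measurable
    moreover have "(\<integral>\<omega>. (exp ((l + x i) * Y 1 \<omega>) - exp (l * Y 1 \<omega>)) / x i \<partial>M) = (E (l + x i) - E l) / x i" for i
      using exp_integrable[OF xr(3)[of i], of 1] exp_integrable[of l 1] l by (simp add: E_def)
    ultimately have "(\<lambda>i. (E (l + x i) - E l) / x i) \<longlonglongrightarrow> D" by (simp only:)
    then show "((\<lambda>h. (E (l + h) - E l) / h) \<circ> x) \<longlonglongrightarrow> D" by (simp only: o_def)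
  qed
  moreover have "at 0 within {-r<..<r} = at 0" using r by (intro at_within_open) auto
  ultimately have ED: "(E has_real_derivative D) (at l)" by (simp add: DERIV_def)
  then have "((\<lambda>l. ln (E l)) has_real_derivative inverse (E l) * D) (at l)"
    using l by (intro DERIV_chain2[OF DERIV_ln ED]) (simp add: E_def exp_integral)
  then have "(\<psi> has_real_derivative inverse (E l) * D) (at l)"
    by (simp add: laplace_exponent_def[abs_def] E_def[abs_def])
  then show ?thesis by (simp add: DERIV_imp_deriv)
qed

text \<open>\<open>Y 1\<close> exceeds some \<open>1 / Suc n\<close> with positive probability
  \<open>p\<close>, so \<open>\<psi> l \<ge> ln p + l / Suc n\<close> grows without bound.\<close>

lemma \<psi>_unbounded:
  assumes "0 < prob {\<omega>\<in>space M. 0 < Y 1 \<omega>}"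
  shows "\<exists>l\<ge>0. K < \<psi> l"
proof -
  define A where "A n = {\<omega>\<in>space M. 1 / real (Suc n) < Y 1 \<omega>}" for n
  have [measurable]: "A n \<in> sets M" for n unfolding A_def by measurable
  have "incseq A" unfolding incseq_Suc_iff A_def
    by (auto elim!: order.strict_trans1[rotated] simp: frac_le)
  then have "(\<lambda>n. prob (A n)) \<longlonglongrightarrow> prob (\<Union>n. A n)" by (intro finite_Lim_measure_incseq) auto
  moreover have "(\<Union>n. A n) = {\<omega>\<in>space M. 0 < Y 1 \<omega>}"
  proof safe
    fix \<omega> assume "\<omega> \<in> space M" "0 < Y 1 \<omega>"
    then obtain n where "1 / real (Suc n) < Y 1 \<omega>" using nat_approx_posE by metis
    then show "\<omega> \<in> (\<Union>n. A n)" using \<open>\<omega> \<in> space M\<close> by (auto simp: A_def)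
  next
    fix \<omega> n assume "\<omega> \<in> A n"
    then show "0 < Y 1 \<omega>" by (auto simp: A_def elim: order.strict_trans[rotated])
  qed (auto simp: A_def)
  ultimately have "\<forall>\<^sub>F n in sequentially. 0 < prob (A n)" using assms by (intro order_tendstoD(1)) auto
  then obtain n where n: "0 < prob (A n)" using eventually_happens'[OF sequentially_bot] by blast
  define l where "l = max 0 ((K - ln (prob (A n)) + 1) * real (Suc n))"
  have l: "0 \<le> l" by (simp add: l_def)
  have "prob (A n) * exp (l / real (Suc n)) = (\<integral>\<omega>. indicator (A n) \<omega> * exp (l / real (Suc n)) \<partial>M)" by simp
  also have "\<dots> \<le> (\<integral>\<omega>. exp (l * Y 1 \<omega>) \<partial>M)"
  proof (rule integral_mono)
    fix \<omega>
    show "indicator (A n) \<omega> * exp (l / real (Suc n)) \<le> exp (l * Y 1 \<omega>)"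
      using l mult_left_mono[of "1 / real (Suc n)" "Y 1 \<omega>" l] by (auto simp: indicator_def A_def)
  next
    show "integrable M (\<lambda>\<omega>. indicator (A n) \<omega> * exp (l / real (Suc n)))"
      by (intro integrable_mult_left integrable_real_indicator) (auto simp: emeasure_eq_measure)
  qed (use exp_integrable[OF l, of 1] in auto)
  also have "\<dots> = exp (\<psi> l)" using exp_integral[OF l, of 1] by simp
  finally have "prob (A n) * exp (l / real (Suc n)) \<le> exp (\<psi> l)" .
  then have "ln (prob (A n) * exp (l / real (Suc n))) \<le> ln (exp (\<psi> l))"
    using n by (subst ln_le_cancel_iff) auto
  then have "ln (prob (A n)) + l / real (Suc n) \<le> \<psi> l" using n by (simp add: ln_mult)
  moreover have "K - ln (prob (A n)) + 1 \<le> l / real (Suc n)"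
    by (subst pos_le_divide_eq) (auto simp: l_def)
  ultimately show ?thesis using l by (intro exI[of _ l]) auto
qed

end

section \<open>Regular versions\<close>

text \<open>Paths are set to 0 on a null set and at negative times; increments change only on null
  sets, so their joint laws are unchanged, and with them independence and stationarity.\<close>

lemma (in spectrally_negative_levy) regular_version:
  shows "\<exists>Y. regular_levy M Y \<and> (AE \<omega> in M. \<forall>t\<ge>0. Y t \<omega> = X t \<omega>)"
proof -
  define G where "G \<omega> \<longleftrightarrow> X 0 \<omega> = 0 \<and> (\<forall>t\<ge>0. ((\<lambda>s. X s \<omega>) \<longlongrightarrow> X t \<omega>) (at_right t)) \<and>
    (\<forall>t>0. \<exists>l. ((\<lambda>s. X s \<omega>) \<longlongrightarrow> l) (at_left t) \<and> X t \<omega> \<le> l)" for \<omega>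
  have "AE \<omega> in M. G \<omega>"
    using X_0 cadlag no_positive_jumps unfolding G_def by eventually_elim blast
  \<comment> \<open>The set where \<open>G\<close> fails need not be measurable; it is enclosed in a
    measurable null set, which is discarded.\<close>
  then obtain N where N: "{\<omega> \<in> space M. \<not> G \<omega>} \<subseteq> N" "emeasure M N = 0" "N \<in> sets M"
    by (rule AE_E)
  define \<Omega> where "\<Omega> = space M - N"
  have \<Omega>: "\<Omega> \<in> sets M" "\<And>\<omega>. \<omega> \<in> \<Omega> \<Longrightarrow> G \<omega>" using N by (auto simp: \<Omega>_def)
  have AE_\<Omega>: "AE \<omega> in M. \<omega> \<in> \<Omega>"
    by (rule AE_I[of _ _ N]) (use N in \<open>auto simp: \<Omega>_def\<close>)
  define Y where "Y t \<omega> = (if 0 \<le> t \<and> \<omega> \<in> \<Omega> then X t \<omega> else 0)" for t \<omega>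
  have eq: "AE \<omega> in M. \<forall>t\<ge>0. Y t \<omega> = X t \<omega>"
    using AE_\<Omega> by eventually_elim (simp add: Y_def)
  have mY: "Y t \<in> borel_measurable M" for t
  proof (cases "0 \<le> t")
    case True
    have "(\<lambda>\<omega>. if \<omega> \<in> \<Omega> then X t \<omega> else 0) \<in> borel_measurable M"
      using measurable_X[OF True] \<Omega>(1) by measurable
    then show ?thesis using True by (simp add: Y_def[abs_def])
  qed (simp add: Y_def[abs_def])
  have rc: "((\<lambda>s. Y s \<omega>) \<longlongrightarrow> Y t \<omega>) (at_right t)" for t \<omega>
  proof (cases "0 \<le> t \<and> \<omega> \<in> \<Omega>")
    case True
    then have "((\<lambda>s. X s \<omega>) \<longlongrightarrow> Y t \<omega>) (at_right t)" using \<Omega>(2) by (simp add: Y_def G_def)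
    then show ?thesis
      by (rule Lim_transform_eventually) (use True in \<open>auto simp: eventually_at_filter Y_def\<close>)
  next
    case False
    have "\<forall>\<^sub>F s in at_right t. Y s \<omega> = 0"
    proof (cases "\<omega> \<in> \<Omega>")
      case True
      then have "t < 0" using False by auto
      then show ?thesis unfolding eventually_at_right_field by (intro exI[of _ 0]) (auto simp: Y_def)
    qed (simp add: Y_def)
    then show ?thesis using False by (auto simp: Y_def intro: tendsto_eventually)
  qed
  have up: "\<exists>d>0. \<forall>u v. 0 \<le> u \<and> u \<le> v \<and> v \<le> T \<and> v - u < d \<longrightarrow> Y v \<omega> \<le> Y u \<omega> + e"
    if e: "0 < e" for T e \<omega>
  proof (rule upward_modulus[OF rc _ e])
    fix t :: real assume t: "0 < t"
    show "\<exists>l. ((\<lambda>s. Y s \<omega>) \<longlongrightarrow> l) (at_left t) \<and> Y t \<omega> \<le> l"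
    proof (cases "\<omega> \<in> \<Omega>")
      case True
      then obtain l where l: "((\<lambda>s. X s \<omega>) \<longlongrightarrow> l) (at_left t)" "X t \<omega> \<le> l" using \<Omega>(2)[OF True] t by (auto simp: G_def)
      have "\<forall>\<^sub>F s in at_left t. X s \<omega> = Y s \<omega>"
        unfolding eventually_at_left_field using t True by (intro exI[of _ 0]) (auto simp: Y_def)
      with l show ?thesis using t True by (intro exI[of _ l]) (auto simp: Y_def intro: Lim_transform_eventually)
    qed (auto simp: Y_def intro!: exI[of _ 0])
  qed
  have AEd: "AE \<omega> in M. Y s \<omega> - Y t \<omega> = X s \<omega> - X t \<omega>" if "0 \<le> s" "0 \<le> t" for s t
    using eq by eventually_elim (use that in simp)
  have st: "distr M borel (\<lambda>\<omega>. Y (s + h) \<omega> - Y s \<omega>) = distr M borel (Y h)" if "0 \<le> s" "0 \<le> h" for s h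
  proof -
    have "distr M borel (\<lambda>\<omega>. Y (s + h) \<omega> - Y s \<omega>) = distr M borel (\<lambda>\<omega>. X (s + h) \<omega> - X s \<omega>)"
      using that mY measurable_X by (intro distr_cong_AE AEd borel_measurable_diff) auto
    also have "\<dots> = distr M borel (X h)" by (rule stationary_increments[OF that])
    also have "\<dots> = distr M borel (Y h)"
      using eq that mY measurable_X by (intro distr_cong_AE) auto
    finally show ?thesis .
  qed
  have ind: "indep_vars (\<lambda>_. borel) (\<lambda>i \<omega>. Y (t (Suc i)) \<omega> - Y (t i) \<omega>) {..<n}"
    if t: "0 \<le> t 0" "mono t" for t :: "nat \<Rightarrow> real" and n
  proof (cases "n = 0")
    case True
    then show ?thesis by (simp add: indep_vars_def indep_sets_def)
  next
    case False
    then have ne: "{..<n} \<noteq> {}" by auto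
    have t0: "0 \<le> t i" for i using t monoD[OF t(2), of 0 i] by simp
    define Z Z' where "Z i \<omega> = Y (t (Suc i)) \<omega> - Y (t i) \<omega>" and "Z' i \<omega> = X (t (Suc i)) \<omega> - X (t i) \<omega>" for i \<omega>
    have [measurable]: "Z i \<in> borel_measurable M" "Z' i \<in> borel_measurable M" for i
      using mY measurable_X t0 by (auto simp: Z_def[abs_def] Z'_def[abs_def])
    have AEZ: "AE \<omega> in M. Z i \<omega> = Z' i \<omega>" for i unfolding Z_def Z'_def by (rule AEd[OF t0 t0])
    have "indep_vars (\<lambda>_. borel) Z' {..<n}"
      using indep_increments[OF t, of n] by (simp add: Z'_def[abs_def])
    then have "distr M (PiM {..<n} (\<lambda>_. borel)) (\<lambda>x. \<lambda>i\<in>{..<n}. Z' i x) = PiM {..<n} (\<lambda>i. distr M borel (Z' i))"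
      by (subst (asm) indep_vars_iff_distr_eq_PiM[OF ne]) auto
    moreover have "distr M (PiM {..<n} (\<lambda>_. borel)) (\<lambda>x. \<lambda>i\<in>{..<n}. Z' i x) = distr M (PiM {..<n} (\<lambda>_. borel)) (\<lambda>x. \<lambda>i\<in>{..<n}. Z i x)"
    proof (rule distr_cong_AE)
      have "AE x in M. \<forall>i\<in>{..<n}. Z i x = Z' i x" using AEZ by (simp add: AE_ball_countable)
      then show "AE x in M. (\<lambda>i\<in>{..<n}. Z' i x) = (\<lambda>i\<in>{..<n}. Z i x)"
        by eventually_elim (auto simp: restrict_def fun_eq_iff)
    qed (auto intro!: measurable_restrict)
    moreover have "distr M borel (Z' i) = distr M borel (Z i)" for i
      by (rule distr_cong_AE) (use AEZ in \<open>auto simp: eq_commute\<close>)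
    ultimately have "indep_vars (\<lambda>_. borel) Z {..<n}"
      by (subst indep_vars_iff_distr_eq_PiM[OF ne]) auto
    then show ?thesis by (simp add: Z_def[abs_def])
  qed
  have "Y t \<omega> = 0" if "t \<le> 0" for t \<omega>
    using that \<Omega>(2)[of \<omega>] by (cases "t = 0") (auto simp: Y_def G_def)
  then have "regular_levy M Y"
    by unfold_locales (use mY rc up st ind in auto)
  with eq show ?thesis by blast
qed

text \<open>If \<open>Y 1 \<le> 0\<close> almost surely, then the event that all
  \<open>2 ^ n\<close> dyadic increments are positive is null; its probability being
  \<open>p ^ 2 ^ n\<close>, each increment is almost surely at most 0, and right-continuity makes
  the paths nonincreasing.\<close>

lemma (in regular_levy) prob_pos:
  assumes not_mono: "\<not> (AE \<omega> in M. \<forall>s t. 0 \<le> s \<longrightarrow> s \<le> t \<longrightarrow> Y t \<omega> \<le> Y s \<omega>)"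
  shows "0 < prob {\<omega>\<in>space M. 0 < Y 1 \<omega>}"
proof (rule ccontr)
  assume "\<not> 0 < prob {\<omega>\<in>space M. 0 < Y 1 \<omega>}"
  then have p1: "prob {\<omega>\<in>space M. 0 < Y 1 \<omega>} = 0" using measure_nonneg[of M "{\<omega>\<in>space M. 0 < Y 1 \<omega>}"] by linarith
  have incr0: "prob {\<omega>\<in>space M. 0 < incr 0 (1 / 2 ^ n) i \<omega>} = 0" for n i
  proof -
    define \<delta> :: real where "\<delta> = 1 / 2 ^ n"
    have \<delta>: "0 \<le> \<delta>" by (simp add: \<delta>_def)
    define p where "p = prob {\<omega>\<in>space M. 0 < Y \<delta> \<omega>}"
    have p: "prob {\<omega>\<in>space M. 0 < incr 0 \<delta> i \<omega>} = p" for i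
    proof -
      have "measure (distr M borel (incr 0 \<delta> i)) {0<..} = measure (distr M borel (Y \<delta>)) {0<..}"
        by (simp add: distr_incr \<delta>)
      then show ?thesis by (simp add: measure_distr p_def vimage_def Int_def conj_commute)
    qed
    define J where "J = {..<(2::nat) ^ n}"
    have J: "J \<noteq> {}" "finite J" by (auto simp: J_def lessThan_empty_iff)
    have "prob (\<Inter>i\<in>J. incr 0 \<delta> i -` {0<..} \<inter> space M) = (\<Prod>i\<in>J. prob (incr 0 \<delta> i -` {0<..} \<inter> space M))"
      by (rule indep_varsD[OF indep_incr_grid[of 0 \<delta> "2 ^ n"]]) (use J \<delta> in \<open>auto simp: J_def\<close>)
    also have "\<dots> = p ^ 2 ^ n"
      using p by (simp add: vimage_def Int_def conj_commute J_def)
    finally have "p ^ 2 ^ n = prob (\<Inter>i\<in>J. incr 0 \<delta> i -` {0<..} \<inter> space M)" ..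
    also have "\<dots> \<le> prob {\<omega>\<in>space M. 0 < Y 1 \<omega>}"
    proof (rule finite_measure_mono)
      show "(\<Inter>i\<in>J. incr 0 \<delta> i -` {0<..} \<inter> space M) \<subseteq> {\<omega>\<in>space M. 0 < Y 1 \<omega>}"
      proof
        fix \<omega> assume \<omega>: "\<omega> \<in> (\<Inter>i\<in>J. incr 0 \<delta> i -` {0<..} \<inter> space M)"
        then have "0 < (\<Sum>i\<in>J. incr 0 \<delta> i \<omega>)" using J by (intro sum_pos) auto
        then show "\<omega> \<in> {\<omega>\<in>space M. 0 < Y 1 \<omega>}" using \<omega> J by (auto simp: J_def sum_incr Y_neg \<delta>_def)
      qed
    qed simp
    finally have "p ^ 2 ^ n \<le> 0" by (simp add: p1)
    moreover have "0 \<le> p" by (simp add: p_def)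
    ultimately have "p ^ 2 ^ n = 0" by (intro antisym) auto
    then show ?thesis using p by (simp add: \<delta>_def)
  qed
  have "AE \<omega> in M. incr 0 (1 / 2 ^ n) i \<omega> \<le> 0" for n i
    using incr0[of n i] by (subst (asm) prob_eq_0) (auto simp: not_less)
  then have "AE \<omega> in M. \<forall>n i. incr 0 (1 / 2 ^ n) i \<omega> \<le> 0" by (simp add: AE_all_countable)
  then have "AE \<omega> in M. \<forall>s t. 0 \<le> s \<longrightarrow> s \<le> t \<longrightarrow> Y t \<omega> \<le> Y s \<omega>"
  proof eventually_elim
    case (elim \<omega>)
    have grid: "Y (real k * (1 / 2 ^ n)) \<omega> \<le> Y (real j * (1 / 2 ^ n)) \<omega>" if "j \<le> k" for n j k
      using that
    proof (induction k rule: dec_induct)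
      case (step k)
      then show ?case using elim[rule_format, of n k] by (simp add: incr_def)
    qed simp
    show ?case
    proof (intro allI impI)
      fix s t :: real assume st: "0 \<le> s" "s \<le> t"
      define u where "u x n = 1 / 2 ^ n * real_of_int \<lceil>x / (1 / 2 ^ n)\<rceil>" for x :: real and n
      have u: "u x \<longlonglongrightarrow> x" "\<And>n. x \<le> u x n" for x
        using ceiling_grid_tendsto[of 1 x] by (auto simp: u_def[abs_def])
      have uk: "u x n = real (nat \<lceil>x / (1 / 2 ^ n)\<rceil>) * (1 / 2 ^ n)" if "0 \<le> x" for x n
        using that by (simp add: u_def)
      have "Y (u t n) \<omega> \<le> Y (u s n) \<omega>" for n
        unfolding uk[OF st(1)] uk[OF order_trans[OF st]]
        by (intro grid nat_mono ceiling_mono divide_right_mono st) simp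
      then show "Y t \<omega> \<le> Y s \<omega>"
        by (intro LIMSEQ_le[OF Y_sequentially[OF u] Y_sequentially[OF u]]) auto
    qed
  qed
  with not_mono show False by simp
qed

section \<open>Dynkin's formula at first passage\<close>

text \<open>Bounded second moments give uniform integrability: truncation at \<open>R\<close> costs
  at most \<open>K / R\<close>, and the truncated variables converge by domination.
  \<open>R \<ge> B\<close> leaves the limit untouched, and \<open>R \<ge> 4 * K / e\<close> makes
  the cost less than \<open>e / 2\<close>.\<close>

lemma (in prob_space) L2_bounded_convergence:
  fixes S :: "nat \<Rightarrow> 'a \<Rightarrow> real"
  assumes [measurable]: "\<And>n. S n \<in> borel_measurable M" "L \<in> borel_measurable M"
    and nonneg: "\<And>n \<omega>. 0 \<le> S n \<omega>"
    and lim: "\<And>\<omega>. (\<lambda>n. S n \<omega>) \<longlonglongrightarrow> L \<omega>" and L: "\<And>\<omega>. L \<omega> \<le> B"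
    and int: "\<And>n. integrable M (S n)" and int2: "\<And>n. integrable M (\<lambda>\<omega>. (S n \<omega>)\<^sup>2)"
    and K: "\<And>n. expectation (\<lambda>\<omega>. (S n \<omega>)\<^sup>2) \<le> K"
  shows "(\<lambda>n. expectation (S n)) \<longlonglongrightarrow> expectation L"
proof (rule LIMSEQ_I)
  fix e :: real assume e: "0 < e"
  have K0: "0 \<le> K" using order_trans[OF Bochner_Integration.integral_nonneg K[of 0]] by simp
  define R where "R = max 1 (max B (4 * K / e))"
  have R: "0 < R" "B \<le> R" "K / R < e / 2"
  proof -
    show R0: "0 < R" "B \<le> R" by (auto simp: R_def)
    have "4 * K / e \<le> R" by (simp add: R_def)
    then have "4 * K \<le> R * e" using e by (simp add: pos_divide_le_eq)
    moreover have "0 < R * e" using R0 e by simp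
    ultimately have "K < R * e / 2" using K0 by linarith
    then show "K / R < e / 2" using R0 by (simp add: pos_divide_less_eq mult.commute)
  qed
  have L0: "0 \<le> L \<omega>" for \<omega> by (rule LIMSEQ_le_const[OF lim]) (use nonneg in auto)
  have "(\<lambda>n. expectation (\<lambda>\<omega>. min (S n \<omega>) R)) \<longlonglongrightarrow> expectation (\<lambda>\<omega>. min (L \<omega>) R)"
    by (rule integral_dominated_convergence[where w="\<lambda>_. R"])
      (use lim nonneg R in \<open>auto intro!: tendsto_min AE_I2 simp: abs_le_iff\<close>)
  also have "(\<lambda>\<omega>. min (L \<omega>) R) = L" using L R(2) order_trans by (fastforce simp: min_def fun_eq_iff)
  finally have "\<forall>\<^sub>F n in sequentially. dist (expectation (\<lambda>\<omega>. min (S n \<omega>) R)) (expectation L) < e / 2"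
    using e by (intro tendstoD) auto
  then obtain n0 where n0: "\<And>n. n \<ge> n0 \<Longrightarrow> \<bar>expectation (\<lambda>\<omega>. min (S n \<omega>) R) - expectation L\<bar> < e / 2"
    by (auto simp: eventually_sequentially dist_real_def)
  have tr: "\<bar>expectation (S n) - expectation (\<lambda>\<omega>. min (S n \<omega>) R)\<bar> \<le> K / R" for n
  proof -
    have mi: "integrable M (\<lambda>\<omega>. min (S n \<omega>) R)"
      by (rule integrable_const_bound[of _ R]) (use nonneg R in \<open>auto intro!: AE_I2 simp: abs_le_iff\<close>)
    have "expectation (S n) - expectation (\<lambda>\<omega>. min (S n \<omega>) R) = expectation (\<lambda>\<omega>. S n \<omega> - min (S n \<omega>) R)"
      using int mi by simp
    also have "\<dots> \<le> expectation (\<lambda>\<omega>. (S n \<omega>)\<^sup>2 / R)"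
    proof (rule integral_mono)
      fix \<omega>
      show "S n \<omega> - min (S n \<omega>) R \<le> (S n \<omega>)\<^sup>2 / R"
      proof (cases "S n \<omega> \<le> R")
        case False
        then have "S n \<omega> * R \<le> (S n \<omega>)\<^sup>2" using nonneg[of n \<omega>] by (simp add: power2_eq_square mult_left_mono)
        then have "S n \<omega> \<le> (S n \<omega>)\<^sup>2 / R" using R by (simp add: pos_le_divide_eq)
        then show ?thesis using False R by simp
      qed (use R in simp)
    qed (use int int2 mi in auto)
    also have "\<dots> \<le> K / R" using K[of n] R by (simp add: divide_right_mono)
    finally have "expectation (S n) - expectation (\<lambda>\<omega>. min (S n \<omega>) R) \<le> K / R" .
    moreover have "expectation (\<lambda>\<omega>. min (S n \<omega>) R) \<le> expectation (S n)"
      by (rule integral_mono) (use mi int in auto)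
    ultimately show ?thesis by simp
  qed
  show "\<exists>no. \<forall>n\<ge>no. norm (expectation (S n) - expectation L) < e"
  proof (intro exI allI impI)
    fix n assume "n0 \<le> n"
    then show "norm (expectation (S n) - expectation L) < e"
      using n0[of n] tr[of n] R(3) unfolding real_norm_def by linarith
  qed
qed

text \<open>Writes a sum over right end points as the integral of a step function, so that refining
  the grid becomes dominated convergence and Riemann integrability of the path is not an
  issue.\<close>

lemma integral_step_function:
  fixes g :: "real \<Rightarrow> real" assumes \<delta>: "0 < \<delta>"
  shows "set_integrable lborel {0<..real N * \<delta>} (\<lambda>s. g (\<delta> * \<lceil>s / \<delta>\<rceil>))"
    and "(LBINT s:{0<..real N * \<delta>}. g (\<delta> * \<lceil>s / \<delta>\<rceil>)) = \<delta> * (\<Sum>k\<in>{1..N}. g (real k * \<delta>))"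
proof -
  have "set_integrable lborel {0<..real N * \<delta>} (\<lambda>s. g (\<delta> * \<lceil>s / \<delta>\<rceil>)) \<and>
    (LBINT s:{0<..real N * \<delta>}. g (\<delta> * \<lceil>s / \<delta>\<rceil>)) = \<delta> * (\<Sum>k\<in>{1..N}. g (real k * \<delta>))"
  proof (induction N)
    case 0
    then show ?case by (simp add: set_integrable_def set_lebesgue_integral_def)
  next
    case (Suc N)
    have ce: "\<delta> * \<lceil>s / \<delta>\<rceil> = real (Suc N) * \<delta>" if "s \<in> {real N * \<delta><..real (Suc N) * \<delta>}" for s
    proof -
      have "real N < s / \<delta>" "s / \<delta> \<le> real (Suc N)" using that \<delta> by (auto simp: pos_less_divide_eq pos_divide_le_eq)
      then have "\<lceil>s / \<delta>\<rceil> = int (Suc N)" by (intro ceiling_unique) auto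
      then show ?thesis by simp
    qed
    have e: "indicator {real N * \<delta><..real (Suc N) * \<delta>} s *\<^sub>R g (\<delta> * \<lceil>s / \<delta>\<rceil>) =
        indicator {real N * \<delta><..real (Suc N) * \<delta>} s *\<^sub>R g (real (Suc N) * \<delta>)" for s
    proof (cases "s \<in> {real N * \<delta><..real (Suc N) * \<delta>}")
      case True
      then show ?thesis by (simp only: ce[OF True])
    next
      case False
      then show ?thesis by (simp only: indicator_simps(2)[OF False] scaleR_zero_left)
    qed
    have 1: "set_integrable lborel {real N * \<delta><..real (Suc N) * \<delta>} (\<lambda>s. g (\<delta> * \<lceil>s / \<delta>\<rceil>))"
      unfolding set_integrable_def e by (simp add: distrib_right \<delta> less_imp_le)
    have 2: "(LBINT s:{real N * \<delta><..real (Suc N) * \<delta>}. g (\<delta> * \<lceil>s / \<delta>\<rceil>)) = \<delta> * g (real (Suc N) * \<delta>)"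
      unfolding set_lebesgue_integral_def e using \<delta> by (simp add: distrib_right)
    have un: "{0<..real (Suc N) * \<delta>} = {0<..real N * \<delta>} \<union> {real N * \<delta><..real (Suc N) * \<delta>}"
    proof -
      have "0 \<le> real N * \<delta>" "real N * \<delta> \<le> real (Suc N) * \<delta>" using \<delta> by (auto intro!: mult_right_mono)
      then show ?thesis by (auto simp del: of_nat_Suc)
    qed
    show ?case
      unfolding un using Suc 1 2
      by (auto simp: set_integral_Un distrib_left intro: set_integrable_Un)
  qed
  then show "set_integrable lborel {0<..real N * \<delta>} (\<lambda>s. g (\<delta> * \<lceil>s / \<delta>\<rceil>))"
    "(LBINT s:{0<..real N * \<delta>}. g (\<delta> * \<lceil>s / \<delta>\<rceil>)) = \<delta> * (\<Sum>k\<in>{1..N}. g (real k * \<delta>))" by auto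
qed


lemma step_generator_tendsto:
  fixes p T :: real assumes T: "0 < T"
  shows "(\<lambda>n. (exp (T / 2 ^ n * p) - 1) / (T / 2 ^ n)) \<longlonglongrightarrow> p"
proof -
  have "((\<lambda>h. exp (h * p)) has_real_derivative p) (at 0)"
    by (auto intro!: derivative_eq_intros)
  then have lim: "((\<lambda>h. (exp (h * p) - 1) / h) \<longlongrightarrow> p) (at 0)" by (simp add: DERIV_def)
  have "(\<lambda>n. T / 2 ^ n) \<longlonglongrightarrow> 0"
    using tendsto_mult[OF tendsto_const[of T] LIMSEQ_inverse_realpow_zero[of 2]] by (simp add: divide_inverse)
  then have "filterlim (\<lambda>n. T / 2 ^ n) (at 0) sequentially" using T by (simp add: filterlim_at)
  from filterlim_compose[OF lim this] show ?thesis by simp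
qed

context regular_levy
begin

definition grid_below :: "real \<Rightarrow> real \<Rightarrow> real \<Rightarrow> 'a \<Rightarrow> bool" where
  "grid_below a \<delta> s \<omega> \<longleftrightarrow> (\<forall>j::nat. real j * \<delta> \<le> s \<longrightarrow> Y (real j * \<delta>) \<omega> \<le> a)"

lemma grid_below_measurable [measurable]: "Measurable.pred M (grid_below a \<delta> s)"
  unfolding grid_below_def[abs_def] by measurable

lemma grid_below_mult: "0 < \<delta> \<Longrightarrow> grid_below a \<delta> (real k * \<delta>) \<omega> \<longleftrightarrow> (\<forall>j\<le>k. Y (real j * \<delta>) \<omega> \<le> a)"
  by (auto simp: grid_below_def)

lemma grid_below_if_below: "0 < \<delta> \<Longrightarrow> below a s \<omega> \<Longrightarrow> grid_below a \<delta> s \<omega>"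
  by (auto simp: grid_below_def below_def)

text \<open>By right-continuity an exceedance at \<open>u\<close> is still seen at the grid time to
  which \<open>u\<close> is rounded up, and rounding \<open>s\<close> up keeps this grid time within
  range.\<close>

lemma eventually_not_grid_below:
  assumes T: "0 < T" and u: "0 \<le> u" "u \<le> s" "a < Y u \<omega>"
  shows "\<forall>\<^sub>F n in sequentially. \<not> grid_below a (T / 2 ^ n) (T / 2 ^ n * \<lceil>s / (T / 2 ^ n)\<rceil>) \<omega>"
proof -
  define v where "v n = T / 2 ^ n * real_of_int \<lceil>u / (T / 2 ^ n)\<rceil>" for n
  have "(\<lambda>n. Y (v n) \<omega>) \<longlonglongrightarrow> Y u \<omega>"
    unfolding v_def by (intro Y_sequentially ceiling_grid_tendsto T)
  then have "\<forall>\<^sub>F n in sequentially. a < Y (v n) \<omega>" using u(3) by (rule order_tendstoD(1))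
  then show ?thesis
  proof eventually_elim
    case (elim n)
    define j where "j = nat \<lceil>u / (T / 2 ^ n)\<rceil>"
    have j: "v n = real j * (T / 2 ^ n)" using u(1) T by (simp add: j_def v_def)
    have "v n \<le> T / 2 ^ n * \<lceil>s / (T / 2 ^ n)\<rceil>"
      unfolding v_def using u T by (intro mult_left_mono) (auto intro!: ceiling_mono divide_right_mono mult_right_mono)
    then show ?case using elim unfolding j grid_below_def by (auto simp: not_le)
  qed
qed

text \<open>Not having passed by grid time \<open>k\<close> is decided by the first \<open>k\<close>
  increments; the next one is independent of them and contributes the factor
  \<open>exp (\<delta> * \<psi> l)\<close>.\<close>

lemma grid_below_step:
  assumes l: "0 \<le> l" and \<delta>: "0 < \<delta>" and a: "0 \<le> a"
  shows "integrable M (\<lambda>\<omega>. of_bool (grid_below a \<delta> (real k * \<delta>) \<omega>) * exp (l * Y (real k * \<delta>) \<omega>))"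
    and "integrable M (\<lambda>\<omega>. of_bool (grid_below a \<delta> (real k * \<delta>) \<omega>) * exp (l * Y (real (Suc k) * \<delta>) \<omega>))"
    and "(\<integral>\<omega>. of_bool (grid_below a \<delta> (real k * \<delta>) \<omega>) * exp (l * Y (real (Suc k) * \<delta>) \<omega>) \<partial>M) =
      exp (\<delta> * \<psi> l) * (\<integral>\<omega>. of_bool (grid_below a \<delta> (real k * \<delta>) \<omega>) * exp (l * Y (real k * \<delta>) \<omega>) \<partial>M)"
proof -
  show i1: "integrable M (\<lambda>\<omega>. of_bool (grid_below a \<delta> (real k * \<delta>) \<omega>) * exp (l * Y (real k * \<delta>) \<omega>))"
    by (rule Bochner_Integration.integrable_bound[OF exp_integrable[OF l, of "real k * \<delta>"]]) (use \<delta> in auto)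
  show i2: "integrable M (\<lambda>\<omega>. of_bool (grid_below a \<delta> (real k * \<delta>) \<omega>) * exp (l * Y (real (Suc k) * \<delta>) \<omega>))"
    by (rule Bochner_Integration.integrable_bound[OF exp_integrable[OF l, of "real (Suc k) * \<delta>"]]) (use \<delta> in auto)
  define F where "F v = ennreal (of_bool (\<forall>j\<in>{..k}. (\<Sum>i<j. v i) \<le> a) * exp (l * (\<Sum>i<k. v i)))" for v :: "nat \<Rightarrow> real"
  define G where "G v = ennreal (exp (l * v k))" for v :: "nat \<Rightarrow> real"
  have sm: "(\<lambda>v. \<Sum>i<j. v i) \<in> borel_measurable (PiM {..<k} (\<lambda>_. borel :: real measure))" if "j \<le> k" for j
    using that by (intro borel_measurable_sum measurable_component_singleton) auto
  have pm: "Measurable.pred (PiM {..<k} (\<lambda>_. borel)) (\<lambda>v::nat \<Rightarrow> real. \<forall>j\<in>{..k}. (\<Sum>i<j. v i) \<le> a)"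
    by (intro pred_intros_finite) (auto simp: pred_def intro!: borel_measurable_le sm)
  have mF: "F \<in> borel_measurable (PiM {..<k} (\<lambda>_. borel))"
    unfolding F_def[abs_def] using pm sm[of k] by measurable
  have mG: "G \<in> borel_measurable (PiM {k..<Suc k} (\<lambda>_. borel))"
    unfolding G_def[abs_def]
    by (intro measurable_compose[OF _ measurable_ennreal] borel_measurable_exp borel_measurable_times borel_measurable_const measurable_component_singleton) auto
  have FY: "F (restrict (\<lambda>i. incr 0 \<delta> i \<omega>) {..<k}) = ennreal (of_bool (grid_below a \<delta> (real k * \<delta>) \<omega>) * exp (l * Y (real k * \<delta>) \<omega>))" for \<omega>
  proof -
    have "(\<Sum>i<j. restrict (\<lambda>i. incr 0 \<delta> i \<omega>) {..<k} i) = Y (real j * \<delta>) \<omega>" if "j \<le> k" for j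
    proof -
      have "(\<Sum>i<j. restrict (\<lambda>i. incr 0 \<delta> i \<omega>) {..<k} i) = (\<Sum>i<j. incr 0 \<delta> i \<omega>)"
        using that by (intro sum.cong) auto
      then show ?thesis by (simp add: sum_incr Y_neg)
    qed
    then show ?thesis unfolding F_def by (simp add: grid_below_mult[OF \<delta>] Ball_def)
  qed
  have GY: "G (restrict (\<lambda>i. incr 0 \<delta> i \<omega>) {k..<Suc k}) = ennreal (exp (l * incr 0 \<delta> k \<omega>))" for \<omega>
    by (simp add: G_def)
  have "ennreal (\<integral>\<omega>. of_bool (grid_below a \<delta> (real k * \<delta>) \<omega>) * exp (l * Y (real (Suc k) * \<delta>) \<omega>) \<partial>M) =
    (\<integral>\<^sup>+\<omega>. of_bool (grid_below a \<delta> (real k * \<delta>) \<omega>) * exp (l * Y (real (Suc k) * \<delta>) \<omega>) \<partial>M)"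
    by (rule nn_integral_eq_integral[OF i2, symmetric]) simp
  also have "\<dots> = (\<integral>\<^sup>+\<omega>. F (restrict (\<lambda>i. incr 0 \<delta> i \<omega>) {..<k}) * G (restrict (\<lambda>i. incr 0 \<delta> i \<omega>) {k..<Suc k}) \<partial>M)"
    unfolding FY GY
    by (intro nn_integral_cong) (simp add: ennreal_mult'[symmetric] mult.assoc exp_add[symmetric] incr_def algebra_simps)
  also have "\<dots> = (\<integral>\<^sup>+\<omega>. F (restrict (\<lambda>i. incr 0 \<delta> i \<omega>) {..<k}) \<partial>M) * (\<integral>\<^sup>+\<omega>. G (restrict (\<lambda>i. incr 0 \<delta> i \<omega>) {k..<Suc k}) \<partial>M)"
    by (rule indep_var_nn_integral_mult[OF indep_incr_split mF mG]) (use \<delta> in auto)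
  also have "(\<integral>\<^sup>+\<omega>. F (restrict (\<lambda>i. incr 0 \<delta> i \<omega>) {..<k}) \<partial>M) =
      ennreal (\<integral>\<omega>. of_bool (grid_below a \<delta> (real k * \<delta>) \<omega>) * exp (l * Y (real k * \<delta>) \<omega>) \<partial>M)"
    unfolding FY by (rule nn_integral_eq_integral[OF i1]) simp
  also have "(\<integral>\<^sup>+\<omega>. G (restrict (\<lambda>i. incr 0 \<delta> i \<omega>) {k..<Suc k}) \<partial>M) = ennreal (exp (\<delta> * \<psi> l))"
    unfolding GY using nn_integral_incr[of 0 \<delta> "\<lambda>y. ennreal (exp (l * y))" k] mgf_eq[OF l, of \<delta>] \<delta> by (simp add: mgf_def)
  finally have "ennreal (\<integral>\<omega>. of_bool (grid_below a \<delta> (real k * \<delta>) \<omega>) * exp (l * Y (real (Suc k) * \<delta>) \<omega>) \<partial>M) =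
    ennreal ((\<integral>\<omega>. of_bool (grid_below a \<delta> (real k * \<delta>) \<omega>) * exp (l * Y (real k * \<delta>) \<omega>) \<partial>M) * exp (\<delta> * \<psi> l))"
    by (simp add: ennreal_mult')
  then show "(\<integral>\<omega>. of_bool (grid_below a \<delta> (real k * \<delta>) \<omega>) * exp (l * Y (real (Suc k) * \<delta>) \<omega>) \<partial>M) =
      exp (\<delta> * \<psi> l) * (\<integral>\<omega>. of_bool (grid_below a \<delta> (real k * \<delta>) \<omega>) * exp (l * Y (real k * \<delta>) \<omega>) \<partial>M)"
    by (subst (asm) ennreal_inj) (auto intro!: Bochner_Integration.integral_nonneg simp: mult.commute)
qed

text \<open>The value of \<open>exp (l * Y)\<close> at the first grid time, up to \<open>N * \<delta>\<close>, at which \<open>Y\<close> exceeds \<open>a\<close>,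
  and \<open>0\<close> if there is none.\<close>

definition exp_at_passage :: "real \<Rightarrow> real \<Rightarrow> real \<Rightarrow> nat \<Rightarrow> 'a \<Rightarrow> real" where
  "exp_at_passage l a \<delta> N \<omega> = (\<Sum>k<N. of_bool (grid_below a \<delta> (real k * \<delta>) \<omega> \<and> \<not> grid_below a \<delta> (real (Suc k) * \<delta>) \<omega>)
      * exp (l * Y (real (Suc k) * \<delta>) \<omega>))"

lemma exp_at_passage_cases:
  assumes "0 < \<delta>" "0 \<le> a"
  shows "grid_below a \<delta> (real N * \<delta>) \<omega> \<and> (\<forall>l. exp_at_passage l a \<delta> N \<omega> = 0) \<or>
    (\<exists>k<N. Y (real k * \<delta>) \<omega> \<le> a \<and> a < Y (real (Suc k) * \<delta>) \<omega> \<and> (\<forall>l. exp_at_passage l a \<delta> N \<omega> = exp (l * Y (real (Suc k) * \<delta>) \<omega>)))"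
proof -
  note gb = grid_below_mult[OF assms(1)]
  show ?thesis
  proof (cases "grid_below a \<delta> (real N * \<delta>) \<omega>")
    case True
    then have "grid_below a \<delta> (real (Suc k) * \<delta>) \<omega>" if "k < N" for k using that unfolding gb by auto
    then have "exp_at_passage l a \<delta> N \<omega> = 0" for l unfolding exp_at_passage_def by (intro sum.neutral) auto
    then show ?thesis using True by blast
  next
    case False
    define k where "k = (LEAST k. \<not> grid_below a \<delta> (real k * \<delta>) \<omega>)"
    have nk: "\<not> grid_below a \<delta> (real k * \<delta>) \<omega>" unfolding k_def by (rule LeastI[where P="\<lambda>k. \<not> grid_below a \<delta> (real k * \<delta>) \<omega>", OF False])
    have lk: "grid_below a \<delta> (real j * \<delta>) \<omega>" if "j < k" for j using not_less_Least that unfolding k_def by blast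
    have mk: "\<not> grid_below a \<delta> (real j * \<delta>) \<omega>" if "k \<le> j" for j using nk that unfolding gb by (meson order_trans)
    have "k \<noteq> 0"
    proof
      assume "k = 0"
      with nk show False using assms(2) by (simp add: grid_below_def mult_le_0_iff Y_neg)
    qed
    then obtain i where i: "k = Suc i" by (cases k) auto
    have iN: "i < N" using mk[of N] lk[of N] False i by (metis Suc_le_lessD k_def Least_le)
    have "exp_at_passage l a \<delta> N \<omega> = (\<Sum>j<N. if j = i then exp (l * Y (real (Suc i) * \<delta>) \<omega>) else 0)" for l
      unfolding exp_at_passage_def
    proof (rule sum.cong)
      fix j assume "j \<in> {..<N}"
      show "of_bool (grid_below a \<delta> (real j * \<delta>) \<omega> \<and> \<not> grid_below a \<delta> (real (Suc j) * \<delta>) \<omega>) * exp (l * Y (real (Suc j) * \<delta>) \<omega>) =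
        (if j = i then exp (l * Y (real (Suc i) * \<delta>) \<omega>) else 0)"
      proof (rule linorder_cases[of j i])
        assume "j < i" then show ?thesis using lk[of "Suc j"] i by simp
      next
        assume "j = i" then show ?thesis using lk[of j] mk[of "Suc j"] i by simp
      next
        assume "i < j" then show ?thesis using mk[of j] i by simp
      qed
    qed simp
    then have "exp_at_passage l a \<delta> N \<omega> = exp (l * Y (real (Suc i) * \<delta>) \<omega>)" for l using iN by simp
    moreover have "Y (real i * \<delta>) \<omega> \<le> a" using lk[of i] i unfolding gb by simp
    moreover have "a < Y (real (Suc i) * \<delta>) \<omega>"
    proof (rule ccontr)
      assume "\<not> a < Y (real (Suc i) * \<delta>) \<omega>"
      then have "grid_below a \<delta> (real k * \<delta>) \<omega>" using lk[of i] i unfolding gb by (auto simp: le_Suc_eq simp del: of_nat_Suc)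
      with nk show False by simp
    qed
    ultimately show ?thesis using iN by blast
  qed
qed

text \<open>The discrete Dynkin formula: by \<open>grid_below_step\<close> each summand has
  expectation \<open>exp (\<delta> * \<psi> l) * e k - e (Suc k)\<close>, a telescoping difference
  plus a multiple of \<open>exp (\<delta> * \<psi> l) - 1\<close>.\<close>

lemma exp_at_passage_integral:
  assumes l: "0 \<le> l" and \<delta>: "0 < \<delta>" and a: "0 \<le> a"
  defines "e \<equiv> \<lambda>k. (\<integral>\<omega>. of_bool (grid_below a \<delta> (real k * \<delta>) \<omega>) * exp (l * Y (real k * \<delta>) \<omega>) \<partial>M)"
  shows "integrable M (exp_at_passage l a \<delta> N)"
    and "(\<integral>\<omega>. exp_at_passage l a \<delta> N \<omega> \<partial>M) = 1 - e N + (exp (\<delta> * \<psi> l) - 1) * (\<Sum>k<N. e k)"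
    and "0 \<le> e k" "e k \<le> exp (l * a)"
proof -
  note st = grid_below_step[OF l \<delta> a]
  have eq: "exp_at_passage l a \<delta> N \<omega> = (\<Sum>k<N. of_bool (grid_below a \<delta> (real k * \<delta>) \<omega>) * exp (l * Y (real (Suc k) * \<delta>) \<omega>)
      - of_bool (grid_below a \<delta> (real (Suc k) * \<delta>) \<omega>) * exp (l * Y (real (Suc k) * \<delta>) \<omega>))" for \<omega>
    unfolding exp_at_passage_def
  proof (rule sum.cong)
    fix k
    have "grid_below a \<delta> (real (Suc k) * \<delta>) \<omega> \<Longrightarrow> grid_below a \<delta> (real k * \<delta>) \<omega>" unfolding grid_below_mult[OF \<delta>] by simp
    then show "of_bool (grid_below a \<delta> (real k * \<delta>) \<omega> \<and> \<not> grid_below a \<delta> (real (Suc k) * \<delta>) \<omega>) * exp (l * Y (real (Suc k) * \<delta>) \<omega>) =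
      of_bool (grid_below a \<delta> (real k * \<delta>) \<omega>) * exp (l * Y (real (Suc k) * \<delta>) \<omega>)
      - of_bool (grid_below a \<delta> (real (Suc k) * \<delta>) \<omega>) * exp (l * Y (real (Suc k) * \<delta>) \<omega>)"
      by (cases "grid_below a \<delta> (real (Suc k) * \<delta>) \<omega>"; cases "grid_below a \<delta> (real k * \<delta>) \<omega>") simp_all
  qed simp
  show "integrable M (exp_at_passage l a \<delta> N)"
    unfolding eq[abs_def] by (intro Bochner_Integration.integrable_sum Bochner_Integration.integrable_diff st)
  have "(\<integral>\<omega>. exp_at_passage l a \<delta> N \<omega> \<partial>M) = (\<Sum>k<N. exp (\<delta> * \<psi> l) * e k - e (Suc k))"
    unfolding eq e_def
    by (subst Bochner_Integration.integral_sum, intro Bochner_Integration.integrable_diff st, intro sum.cong refl,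
        subst Bochner_Integration.integral_diff[OF st(2) st(1)], simp only: st(3))
  also have "\<dots> = (\<Sum>k<N. (exp (\<delta> * \<psi> l) - 1) * e k) + (\<Sum>k<N. e k - e (Suc k))"
    by (simp add: sum.distrib[symmetric] algebra_simps)
  also have "(\<Sum>k<N. e k - e (Suc k)) = e 0 - e N" by (rule sum_lessThan_telescope')
  also have "e 0 = 1" using \<delta> a by (simp add: e_def grid_below_mult[of \<delta> a 0, simplified] Y_neg prob_space)
  finally show "(\<integral>\<omega>. exp_at_passage l a \<delta> N \<omega> \<partial>M) = 1 - e N + (exp (\<delta> * \<psi> l) - 1) * (\<Sum>k<N. e k)"
    by (simp add: sum_distrib_left)
  show "0 \<le> e k" unfolding e_def by (intro Bochner_Integration.integral_nonneg) simp
  have "e k \<le> (\<integral>\<omega>. exp (l * a) \<partial>M)"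
    unfolding e_def
  proof (rule integral_mono[OF st(1)])
    fix \<omega>
    show "of_bool (grid_below a \<delta> (real k * \<delta>) \<omega>) * exp (l * Y (real k * \<delta>) \<omega>) \<le> exp (l * a)"
      using l by (cases "grid_below a \<delta> (real k * \<delta>) \<omega>") (auto simp: grid_below_mult[OF \<delta>] mult_left_mono)
  qed simp
  then show "e k \<le> exp (l * a)" by (simp add: prob_space)
qed

end

section \<open>From the grid to continuous time\<close>

context regular_levy
begin

lemma measurable_Y_path [measurable (raw)]:
  assumes [measurable]: "f \<in> borel_measurable N" shows "(\<lambda>x. Y (f x) \<omega>) \<in> borel_measurable N"
proof (rule borel_measurable_LIMSEQ_real)
  fix x
  show "(\<lambda>n. Y (1 / 2 ^ n * real_of_int \<lceil>f x / (1 / 2 ^ n)\<rceil>) \<omega>) \<longlonglongrightarrow> Y (f x) \<omega>"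
    by (intro Y_sequentially ceiling_grid_tendsto) simp_all
next
  fix n
  have "(\<lambda>x. (\<lambda>i x. Y (1 / 2 ^ n * real_of_int i) \<omega>) \<lceil>f x / (1 / 2 ^ n :: real)\<rceil> x) \<in> borel_measurable N"
    by (rule measurable_compose_countable) measurable
  then show "(\<lambda>x. Y (1 / 2 ^ n * real_of_int \<lceil>f x / (1 / 2 ^ n)\<rceil>) \<omega>) \<in> borel_measurable N" by simp
qed

lemma measurable_below_path [measurable (raw)]:
  assumes [measurable]: "f \<in> borel_measurable N" shows "Measurable.pred N (\<lambda>x. below a (f x) \<omega>)"
proof -
  have "below a s \<omega> \<longleftrightarrow> s < 0 \<or> Y s \<omega> \<le> a \<and> (\<forall>r::rat. 0 \<le> r \<and> r \<le> 1 \<longrightarrow> Y (of_rat r * s) \<omega> \<le> a)" for s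
    using below_iff_rat[of s a \<omega>] by (cases "s < 0") (auto simp: below_def)
  then show ?thesis by simp
qed

text \<open>Rounding \<open>s\<close> up may pick up a passage immediately after \<open>s\<close>.
  This can disturb the limit only if \<open>s\<close> is the last time with
  \<open>below a s \<omega>\<close>, a single time on each path.\<close>

lemma AE_below_continuity:
  "AE s in lborel. 0 \<le> s \<and> below a s \<omega> \<longrightarrow> (\<exists>s'>s. below a s' \<omega>)"
proof (cases "\<exists>p\<ge>0. below a p \<omega> \<and> \<not> (\<exists>s'>p. below a s' \<omega>)")
  case True
  then obtain p where p: "below a p \<omega>" "\<not> (\<exists>s'>p. below a s' \<omega>)" by blast
  have "0 \<le> s \<and> below a s \<omega> \<longrightarrow> (\<exists>s'>s. below a s' \<omega>)" if "s \<noteq> p" for s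
    using p that by (cases "s < p") auto
  note off_p = this
  from AE_lborel_singleton[of p] show ?thesis by eventually_elim (rule off_p)
next
  case False
  then show ?thesis by (auto intro!: AE_I2)
qed

lemma grid_below_tendsto:
  assumes T: "0 < T" and s: "0 \<le> s" and ex: "below a s \<omega> \<Longrightarrow> \<exists>s'>s. below a s' \<omega>"
  shows "\<forall>\<^sub>F n in sequentially. grid_below a (T / 2 ^ n) (T / 2 ^ n * \<lceil>s / (T / 2 ^ n)\<rceil>) \<omega> = below a s \<omega>"
proof (cases "below a s \<omega>")
  case True
  then obtain s' where s': "s < s'" "below a s' \<omega>" using ex by blast
  have "\<forall>\<^sub>F n in sequentially. T / 2 ^ n * \<lceil>s / (T / 2 ^ n)\<rceil> < s'"
    using ceiling_grid_tendsto(1)[OF T] s'(1) by (rule order_tendstoD(2))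
  then show ?thesis
  proof eventually_elim
    case (elim n)
    have "0 < T / 2 ^ n" using T by simp
    then have "grid_below a (T / 2 ^ n) (T / 2 ^ n * \<lceil>s / (T / 2 ^ n)\<rceil>) \<omega>"
      by (rule grid_below_if_below) (rule below_antimono[OF s'(2) less_imp_le[OF elim]])
    then show ?case using True by simp
  qed
next
  case False
  then obtain u where u: "0 \<le> u" "u \<le> s" "a < Y u \<omega>" by (auto simp: below_def not_le)
  show ?thesis using eventually_not_grid_below[OF T u] by eventually_elim (use False in simp)
qed

text \<open>\<open>T\<close> lies on every grid, so no exceptional time arises here, unlike for the
  rounded times of \<open>grid_below_tendsto\<close>.\<close>

lemma grid_below_T_tendsto:
  assumes T: "0 < T"
  shows "\<forall>\<^sub>F n in sequentially. grid_below a (T / 2 ^ n) T \<omega> = below a T \<omega>"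
proof (cases "below a T \<omega>")
  case True
  then show ?thesis using T grid_below_if_below by (intro always_eventually allI) auto
next
  case False
  then obtain u where u: "0 \<le> u" "u \<le> T" "a < Y u \<omega>" by (auto simp: below_def not_le)
  have "T / 2 ^ n * \<lceil>T / (T / 2 ^ n)\<rceil> = T" for n
  proof -
    have "T / (T / 2 ^ n) = of_int (2 ^ n)" using T by simp
    then have "\<lceil>T / (T / 2 ^ n)\<rceil> = 2 ^ n" by (metis ceiling_of_int)
    then show ?thesis by simp
  qed
  then show ?thesis using eventually_not_grid_below[OF T u] False by simp
qed

text \<open>No overshoot in the limit: on a fine grid no increment exceeds \<open>d / 2\<close>, so
  the first grid value above \<open>a\<close> lies within \<open>d / 2\<close> of
  \<open>a\<close>.\<close>

lemma exp_at_passage_tendsto: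
  assumes T: "0 < T" and a: "0 \<le> a" and l: "0 \<le> l"
  shows "(\<lambda>n. exp_at_passage l a (T / 2 ^ n) (2 ^ n) \<omega>) \<longlonglongrightarrow> of_bool (\<not> below a T \<omega>) * exp (l * a)"
proof (cases "below a T \<omega>")
  case True
  have "exp_at_passage l a (T / 2 ^ n) (2 ^ n) \<omega> = 0" for n
  proof -
    have \<delta>: "0 < T / 2 ^ n" "real (2 ^ n) * (T / 2 ^ n) = T" using T by auto
    have "grid_below a (T / 2 ^ n) (real (2 ^ n) * (T / 2 ^ n)) \<omega>" unfolding \<delta>(2) by (rule grid_below_if_below[OF \<delta>(1) True])
    then have "Y (real (Suc k) * (T / 2 ^ n)) \<omega> \<le> a" if "k < 2 ^ n" for k
      using that unfolding grid_below_mult[OF \<delta>(1)] by (meson Suc_leI)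
    then show ?thesis
      using exp_at_passage_cases[OF \<delta>(1) a, of "2 ^ n" \<omega>] by (meson not_le)
  qed
  then show ?thesis using True by simp
next
  case False
  show ?thesis
  proof (rule LIMSEQ_I)
    fix e :: real assume e: "0 < e"
    have "isCont (\<lambda>h. exp (l * (a + h))) 0" by (intro continuous_intros)
    then obtain d where d: "0 < d" "\<And>h. \<bar>h\<bar> < d \<Longrightarrow> \<bar>exp (l * (a + h)) - exp (l * a)\<bar> < e"
      using e unfolding continuous_at_eps_delta dist_real_def by auto
    have "\<forall>\<^sub>F n in sequentially. norm (exp_at_passage l a (T / 2 ^ n) (2 ^ n) \<omega> - of_bool (\<not> below a T \<omega>) * exp (l * a)) < e"
      using grid_below_T_tendsto[OF T, of a \<omega>] grid_increments_small[OF half_gt_zero[OF d(1)] T, of \<omega>]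
    proof eventually_elim
      case (elim n)
      have \<delta>: "0 < T / 2 ^ n" "real (2 ^ n) * (T / 2 ^ n) = T" using T by auto
      have "\<not> grid_below a (T / 2 ^ n) (real (2 ^ n) * (T / 2 ^ n)) \<omega>" unfolding \<delta>(2) using elim(1) False by simp
      then obtain k where k: "k < 2 ^ n" "Y (real k * (T / 2 ^ n)) \<omega> \<le> a" "a < Y (real (Suc k) * (T / 2 ^ n)) \<omega>"
        "\<And>l. exp_at_passage l a (T / 2 ^ n) (2 ^ n) \<omega> = exp (l * Y (real (Suc k) * (T / 2 ^ n)) \<omega>)"
        using exp_at_passage_cases[OF \<delta>(1) a, of "2 ^ n" \<omega>] by blast
      define h where "h = Y (real (Suc k) * (T / 2 ^ n)) \<omega> - a"
      have "incr 0 (T / 2 ^ n) k \<omega> \<le> d / 2" using elim(2) k(1) by blast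
      then have "0 < h" "h \<le> d / 2" using k(2,3) by (auto simp: h_def incr_def)
      then have "\<bar>exp (l * (a + h)) - exp (l * a)\<bar> < e" using d by auto
      then show ?case using False by (simp add: k(4) h_def)
    qed
    then show "\<exists>no. \<forall>n\<ge>no. norm (exp_at_passage l a (T / 2 ^ n) (2 ^ n) \<omega> - of_bool (\<not> below a T \<omega>) * exp (l * a)) < e"
      by (simp add: eventually_sequentially)
  qed
qed

text \<open>Supplies the second moment for \<open>L2_bounded_convergence\<close>: the overshoot on a
  fixed grid may be unbounded, so no constant majorant of \<open>exp_at_passage\<close> is at
  hand.\<close>

lemma exp_at_passage_square_bound:
  assumes l: "0 \<le> l" and T: "0 < T" and a: "0 \<le> a"
  shows "integrable M (\<lambda>\<omega>. (exp_at_passage l a (T / 2 ^ n) (2 ^ n) \<omega>)\<^sup>2)"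
    and "(\<integral>\<omega>. (exp_at_passage l a (T / 2 ^ n) (2 ^ n) \<omega>)\<^sup>2 \<partial>M) \<le>
      1 + T * \<bar>\<psi> (2 * l)\<bar> * exp (T * \<bar>\<psi> (2 * l)\<bar>) * exp (2 * l * a)"
proof -
  define \<delta> where "\<delta> = T / 2 ^ n"
  have \<delta>: "0 < \<delta>" "2 ^ n * \<delta> = T" "\<delta> \<le> T" using T by (auto simp: \<delta>_def field_simps)
  \<comment> \<open>At most one summand is nonzero, so squaring doubles \<open>l\<close>, and the
    discrete formula applies again.\<close>
  have sq: "(exp_at_passage l a \<delta> (2 ^ n) \<omega>)\<^sup>2 = exp_at_passage (2 * l) a \<delta> (2 ^ n) \<omega>" for \<omega>
  proof -
    have "(exp (l * y))\<^sup>2 = exp (2 * l * y)" for y by (simp add: exp_double[symmetric] mult.assoc)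
    then show ?thesis using exp_at_passage_cases[OF \<delta>(1) a, of "2 ^ n" \<omega>] by force
  qed
  define e where "e k = (\<integral>\<omega>. of_bool (grid_below a \<delta> (real k * \<delta>) \<omega>) * exp (2 * l * Y (real k * \<delta>) \<omega>) \<partial>M)" for k
  have l2: "0 \<le> 2 * l" using l by simp
  note ep = exp_at_passage_integral[OF l2 \<delta>(1) a, folded e_def]
  show "integrable M (\<lambda>\<omega>. (exp_at_passage l a (T / 2 ^ n) (2 ^ n) \<omega>)\<^sup>2)"
    unfolding \<delta>_def[symmetric] sq by (rule ep(1))
  define p where "p = \<psi> (2 * l)"
  have b: "exp (\<delta> * p) - 1 \<le> \<delta> * \<bar>p\<bar> * exp (T * \<bar>p\<bar>)"
  proof -
    have "exp (\<delta> * p) - 1 \<le> \<bar>exp (\<delta> * p) - exp 0\<bar>" by simp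
    also have "\<dots> \<le> \<bar>\<delta> * p - 0\<bar> * max (exp 0) (exp (\<delta> * p))" by (rule exp_diff_bound)
    also have "\<dots> \<le> \<delta> * \<bar>p\<bar> * exp (T * \<bar>p\<bar>)"
    proof (intro mult_mono)
      have "\<delta> * p \<le> \<delta> * \<bar>p\<bar>" using \<delta> by (intro mult_left_mono) auto
      also have "\<dots> \<le> T * \<bar>p\<bar>" by (intro mult_right_mono \<delta>) auto
      finally have "\<delta> * p \<le> T * \<bar>p\<bar>" .
      then show "max (exp 0) (exp (\<delta> * p)) \<le> exp (T * \<bar>p\<bar>)" using T by simp
    qed (use \<delta> in \<open>auto simp: abs_mult\<close>)
    finally show ?thesis .
  qed
  have "(\<integral>\<omega>. (exp_at_passage l a \<delta> (2 ^ n) \<omega>)\<^sup>2 \<partial>M) = 1 - e (2 ^ n) + (exp (\<delta> * p) - 1) * (\<Sum>k<2 ^ n. e k)"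
    unfolding sq using ep(2)[of "2 ^ n"] by (simp add: p_def)
  also have "\<dots> \<le> 1 + (\<delta> * \<bar>p\<bar> * exp (T * \<bar>p\<bar>)) * (\<Sum>k<(2::nat) ^ n. exp (2 * l * a))"
  proof -
    have s0: "0 \<le> (\<Sum>k<2 ^ n. e k)" by (intro sum_nonneg ep(3))
    have "(exp (\<delta> * p) - 1) * (\<Sum>k<2 ^ n. e k) \<le> (\<delta> * \<bar>p\<bar> * exp (T * \<bar>p\<bar>)) * (\<Sum>k<2 ^ n. e k)"
      by (rule mult_right_mono[OF b s0])
    also have "\<dots> \<le> (\<delta> * \<bar>p\<bar> * exp (T * \<bar>p\<bar>)) * (\<Sum>k<(2::nat) ^ n. exp (2 * l * a))"
      using \<delta>(1) by (intro mult_left_mono sum_mono ep(4)) auto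
    finally show ?thesis using ep(3)[of "2 ^ n"] by simp
  qed
  also have "\<dots> = 1 + T * \<bar>p\<bar> * exp (T * \<bar>p\<bar>) * exp (2 * l * a)"
    using \<delta>(2) by (simp add: algebra_simps)
  finally show "(\<integral>\<omega>. (exp_at_passage l a (T / 2 ^ n) (2 ^ n) \<omega>)\<^sup>2 \<partial>M) \<le>
      1 + T * \<bar>\<psi> (2 * l)\<bar> * exp (T * \<bar>\<psi> (2 * l)\<bar>) * exp (2 * l * a)"
    by (simp only: \<delta>_def p_def)
qed

text \<open>Dynkin's formula for \<open>exp (l * Y)\<close> stopped at the passage above \<open>a\<close>, where \<open>Y\<close> takes the
  value \<open>a\<close> because it has no positive jumps.\<close>

lemma dynkin_passage:
  assumes l: "0 \<le> l" and T: "0 < T" and a: "0 \<le> a"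
  shows "exp (l * a) * prob {\<omega>\<in>space M. \<not> below a T \<omega>} + (\<integral>\<omega>. of_bool (below a T \<omega>) * exp (l * Y T \<omega>) \<partial>M) - 1 =
    \<psi> l * (\<integral>\<omega>. (LBINT s:{0<..T}. of_bool (below a s \<omega>) * exp (l * Y s \<omega>)) \<partial>M)"
proof -
  define \<delta> where "\<delta> n = T / 2 ^ n" for n :: nat
  have \<delta>: "0 < \<delta> n" "real (2 ^ n) * \<delta> n = T" for n using T by (auto simp: \<delta>_def)
  define e where "e n k = (\<integral>\<omega>. of_bool (grid_below a (\<delta> n) (real k * \<delta> n) \<omega>) * exp (l * Y (real k * \<delta> n) \<omega>) \<partial>M)" for n k
  define Q where "Q n \<omega> = \<delta> n * (\<Sum>k\<in>{1..2 ^ n}. of_bool (grid_below a (\<delta> n) (real k * \<delta> n) \<omega>) * exp (l * Y (real k * \<delta> n) \<omega>))" for n \<omega>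
  define g where "g n \<omega> s = of_bool (grid_below a (\<delta> n) s \<omega>) * exp (l * Y s \<omega>)" for n \<omega> s
  have gb: "\<bar>of_bool (grid_below a (\<delta> n) (real k * \<delta> n) \<omega>) * exp (l * Y (real k * \<delta> n) \<omega>)\<bar> \<le> exp (l * a)" for n k \<omega>
    using l by (cases "grid_below a (\<delta> n) (real k * \<delta> n) \<omega>") (auto simp: grid_below_mult[OF \<delta>(1)] mult_left_mono)
  note st = grid_below_step[OF l \<delta>(1) a]
  note ep = exp_at_passage_integral[OF l \<delta>(1) a, folded e_def]
  have Qlim: "(\<lambda>n. Q n \<omega>) \<longlonglongrightarrow> (LBINT s:{0<..T}. of_bool (below a s \<omega>) * exp (l * Y s \<omega>))" for \<omega>
  proof -
    have Qs: "Q n \<omega> = (LBINT s:{0<..T}. g n \<omega> (\<delta> n * \<lceil>s / \<delta> n\<rceil>))" for n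
      using integral_step_function(2)[OF \<delta>(1)[of n], where N="2 ^ n" and g="g n \<omega>"] unfolding \<delta>(2) by (simp add: Q_def g_def)
    have gi: "set_integrable lborel {0<..T} (\<lambda>s. g n \<omega> (\<delta> n * \<lceil>s / \<delta> n\<rceil>))" for n
      using integral_step_function(1)[OF \<delta>(1)[of n], where N="2 ^ n" and g="g n \<omega>"] unfolding \<delta>(2) .
    have ceil: "\<exists>k::nat. \<delta> n * \<lceil>s / \<delta> n\<rceil> = real k * \<delta> n" if "0 < s" for n s
    proof -
      have "0 \<le> s / \<delta> n" using that \<delta>(1)[of n] by simp
      then have "real_of_int \<lceil>s / \<delta> n\<rceil> = real (nat \<lceil>s / \<delta> n\<rceil>)" by simp
      then show ?thesis by (metis mult.commute)
    qed
    show ?thesis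
      unfolding Qs set_lebesgue_integral_def
    proof (rule integral_dominated_convergence[where w="\<lambda>s. indicator {0<..T} s * exp (l * a)"])
      show "(\<lambda>s. indicator {0<..T} s *\<^sub>R g n \<omega> (\<delta> n * \<lceil>s / \<delta> n\<rceil>)) \<in> borel_measurable lborel" for n
        using gi[of n] unfolding set_integrable_def by (rule borel_measurable_integrable)
      show "integrable lborel (\<lambda>s. indicator {0<..T} s * exp (l * a) :: real)"
        by (intro integrable_mult_left integrable_real_indicator) (use T in auto)
      show "AE s in lborel. (\<lambda>n. indicator {0<..T} s *\<^sub>R g n \<omega> (\<delta> n * \<lceil>s / \<delta> n\<rceil>)) \<longlonglongrightarrow>
          indicator {0<..T} s *\<^sub>R (of_bool (below a s \<omega>) * exp (l * Y s \<omega>))"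
        using AE_below_continuity[of a \<omega>]
      proof eventually_elim
        case (elim s)
        show ?case
        proof (cases "0 < s")
          case True
          have "\<forall>\<^sub>F n in sequentially. grid_below a (\<delta> n) (\<delta> n * \<lceil>s / \<delta> n\<rceil>) \<omega> = below a s \<omega>"
            unfolding \<delta>_def using grid_below_tendsto[OF T, of s a \<omega>] True elim by auto
          then have "(\<lambda>n. of_bool (grid_below a (\<delta> n) (\<delta> n * \<lceil>s / \<delta> n\<rceil>) \<omega>) :: real) \<longlonglongrightarrow> of_bool (below a s \<omega>)"
            by (intro tendsto_eventually) (auto elim: eventually_mono)
          moreover have "(\<lambda>n. Y (\<delta> n * \<lceil>s / \<delta> n\<rceil>) \<omega>) \<longlonglongrightarrow> Y s \<omega>"
            unfolding \<delta>_def by (intro Y_sequentially ceiling_grid_tendsto T)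
          ultimately show ?thesis unfolding g_def by (intro tendsto_intros)
        qed simp
      qed
      show "AE s in lborel. norm (indicator {0<..T} s *\<^sub>R g n \<omega> (\<delta> n * \<lceil>s / \<delta> n\<rceil>)) \<le> indicator {0<..T} s * exp (l * a)" for n
      proof (rule AE_I2)
        fix s
        show "norm (indicator {0<..T} s *\<^sub>R g n \<omega> (\<delta> n * \<lceil>s / \<delta> n\<rceil>)) \<le> indicator {0<..T} s * exp (l * a)"
        proof (cases "s \<in> {0<..T}")
          case True
          then obtain k :: nat where k: "\<delta> n * \<lceil>s / \<delta> n\<rceil> = real k * \<delta> n" using ceil by auto
          show ?thesis unfolding g_def k using gb[of n k \<omega>] True by simp
        qed simp
      qed
    qed measurable
  qed
  have Qm [measurable]: "Q n \<in> borel_measurable M" for n unfolding Q_def[abs_def] by measurable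
  have Qint: "(\<integral>\<omega>. Q n \<omega> \<partial>M) = \<delta> n * (\<Sum>k\<in>{1..2 ^ n}. e n k)" for n
    unfolding Q_def e_def by (simp only: Bochner_Integration.integral_mult_right_zero Bochner_Integration.integral_sum[OF st(1)])
  have Qb: "\<bar>Q n \<omega>\<bar> \<le> T * exp (l * a)" for n \<omega>
  proof -
    have "\<bar>Q n \<omega>\<bar> \<le> \<delta> n * (\<Sum>k\<in>{1..(2::nat) ^ n}. exp (l * a))"
      unfolding Q_def abs_mult using \<delta>(1)[of n]
      by (intro mult_mono order_trans[OF sum_abs] sum_mono gb) (auto intro: sum_nonneg)
    also have "\<dots> = T * exp (l * a)" using \<delta>(2)[of n] by (simp add: mult.assoc[symmetric] mult.commute)
    finally show ?thesis .
  qed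
  have limI: "(\<lambda>n. \<delta> n * (\<Sum>k\<in>{1..2 ^ n}. e n k)) \<longlonglongrightarrow> (\<integral>\<omega>. (LBINT s:{0<..T}. of_bool (below a s \<omega>) * exp (l * Y s \<omega>)) \<partial>M)"
    unfolding Qint[symmetric]
  proof (rule integral_dominated_convergence[where w="\<lambda>_. T * exp (l * a)"])
    have "(\<lambda>\<omega>. LBINT s. indicator {0<..T} s *\<^sub>R (of_bool (below a s \<omega>) * exp (l * Y s \<omega>))) \<in> borel_measurable M"
      by (rule lborel.borel_measurable_lebesgue_integral) measurable
    then show "(\<lambda>\<omega>. LBINT s:{0<..T}. of_bool (below a s \<omega>) * exp (l * Y s \<omega>)) \<in> borel_measurable M"
      by (simp add: set_lebesgue_integral_def)
  qed (use Qlim Qb in auto)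
  have eN: "(\<lambda>n. e n (2 ^ n)) \<longlonglongrightarrow> (\<integral>\<omega>. of_bool (below a T \<omega>) * exp (l * Y T \<omega>) \<partial>M)"
    unfolding e_def \<delta>(2)
  proof (rule integral_dominated_convergence[where w="\<lambda>\<omega>. exp (l * Y T \<omega>)"])
    show "integrable M (\<lambda>\<omega>. exp (l * Y T \<omega>))" using exp_integrable[OF l, of T] T by simp
    show "AE \<omega> in M. (\<lambda>n. of_bool (grid_below a (\<delta> n) T \<omega>) * exp (l * Y T \<omega>)) \<longlonglongrightarrow> of_bool (below a T \<omega>) * exp (l * Y T \<omega>)"
    proof (rule AE_I2)
      fix \<omega>
      have "\<forall>\<^sub>F n in sequentially. of_bool (grid_below a (\<delta> n) T \<omega>) * exp (l * Y T \<omega>) = of_bool (below a T \<omega>) * exp (l * Y T \<omega>)"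
        using grid_below_T_tendsto[OF T, of a \<omega>] unfolding \<delta>_def by eventually_elim simp
      then show "(\<lambda>n. of_bool (grid_below a (\<delta> n) T \<omega>) * exp (l * Y T \<omega>)) \<longlonglongrightarrow> of_bool (below a T \<omega>) * exp (l * Y T \<omega>)"
        by (rule tendsto_eventually)
    qed
  qed (auto intro!: AE_I2)
  have S: "(\<lambda>n. \<integral>\<omega>. exp_at_passage l a (\<delta> n) (2 ^ n) \<omega> \<partial>M) \<longlonglongrightarrow> (\<integral>\<omega>. of_bool (\<not> below a T \<omega>) * exp (l * a) \<partial>M)"
  proof (rule L2_bounded_convergence[where B="exp (l * a)" and K="1 + T * \<bar>\<psi> (2 * l)\<bar> * exp (T * \<bar>\<psi> (2 * l)\<bar>) * exp (2 * l * a)"])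
    show "(\<lambda>n. exp_at_passage l a (\<delta> n) (2 ^ n) \<omega>) \<longlonglongrightarrow> of_bool (\<not> below a T \<omega>) * exp (l * a)" for \<omega>
      unfolding \<delta>_def by (rule exp_at_passage_tendsto[OF T a l])
    show "0 \<le> exp_at_passage l a (\<delta> n) (2 ^ n) \<omega>" for n \<omega>
      unfolding exp_at_passage_def by (intro sum_nonneg) auto
  qed (use exp_at_passage_square_bound[OF l T a] ep(1) in \<open>auto simp: \<delta>_def\<close>)
  have Sint: "(\<integral>\<omega>. of_bool (\<not> below a T \<omega>) * exp (l * a) \<partial>M) = exp (l * a) * prob {\<omega>\<in>space M. \<not> below a T \<omega>}"
  proof -
    have "(\<integral>\<omega>. of_bool (\<not> below a T \<omega>) * exp (l * a) \<partial>M) = (\<integral>\<omega>. indicator {\<omega>\<in>space M. \<not> below a T \<omega>} \<omega> * exp (l * a) \<partial>M)"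
      by (intro Bochner_Integration.integral_cong) (auto simp: indicator_def)
    then show ?thesis by simp
  qed
  \<comment> \<open>The discrete formula sums over left end points, the step functions use right
    ones; the discrepancy \<open>\<delta> n * (e n 0 - e n (2 ^ n))\<close> tends to 0.\<close>
  have "(\<integral>\<omega>. exp_at_passage l a (\<delta> n) (2 ^ n) \<omega> \<partial>M) + e n (2 ^ n) - 1 =
    (exp (\<delta> n * \<psi> l) - 1) / \<delta> n * (\<delta> n * (\<Sum>k\<in>{1..2 ^ n}. e n k) + \<delta> n * (e n 0 - e n (2 ^ n)))" for n
  proof -
    have "(\<Sum>k<2 ^ n. e n k) = (\<Sum>k\<in>{1..2 ^ n}. e n k) + e n 0 - e n (2 ^ n)"
    proof -
      have "e n 0 + (\<Sum>k\<in>{1..2 ^ n}. e n k) = (\<Sum>k\<le>2 ^ n. e n k)"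
      proof -
        have "{..2 ^ n} = insert 0 {1..(2::nat) ^ n}" by auto
        then show ?thesis by simp
      qed
      also have "\<dots> = (\<Sum>k<2 ^ n. e n k) + e n (2 ^ n)" by (simp add: lessThan_Suc_atMost[symmetric])
      finally show ?thesis by simp
    qed
    moreover have "(exp (\<delta> n * \<psi> l) - 1) / \<delta> n * (\<delta> n * A + \<delta> n * B) = (exp (\<delta> n * \<psi> l) - 1) * (A + B)" for A B
      using \<delta>(1)[of n] by (simp add: distrib_left[symmetric])
    ultimately show ?thesis unfolding ep(2) by (simp add: add_diff_eq)
  qed
  moreover have "(\<lambda>n. (\<integral>\<omega>. exp_at_passage l a (\<delta> n) (2 ^ n) \<omega> \<partial>M) + e n (2 ^ n) - 1) \<longlonglongrightarrow>
     exp (l * a) * prob {\<omega>\<in>space M. \<not> below a T \<omega>} + (\<integral>\<omega>. of_bool (below a T \<omega>) * exp (l * Y T \<omega>) \<partial>M) - 1"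
    using S unfolding Sint by (intro tendsto_intros eN)
  moreover have "(\<lambda>n. (exp (\<delta> n * \<psi> l) - 1) / \<delta> n * (\<delta> n * (\<Sum>k\<in>{1..2 ^ n}. e n k) + \<delta> n * (e n 0 - e n (2 ^ n)))) \<longlonglongrightarrow>
     \<psi> l * ((\<integral>\<omega>. (LBINT s:{0<..T}. of_bool (below a s \<omega>) * exp (l * Y s \<omega>)) \<partial>M) + 0)"
  proof (intro tendsto_mult tendsto_add limI)
    show "(\<lambda>n. (exp (\<delta> n * \<psi> l) - 1) / \<delta> n) \<longlonglongrightarrow> \<psi> l"
      unfolding \<delta>_def by (rule step_generator_tendsto[OF T])
    have d0: "\<delta> \<longlonglongrightarrow> 0" unfolding \<delta>_def
      using tendsto_mult[OF tendsto_const[of T] LIMSEQ_inverse_realpow_zero[of 2]] by (simp add: divide_inverse)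
    have "e n 0 = 1" for n using \<delta>(1)[of n] a by (simp add: e_def grid_below_mult[of _ _ 0, simplified] Y_neg prob_space)
    then show "(\<lambda>n. \<delta> n * (e n 0 - e n (2 ^ n))) \<longlonglongrightarrow> 0"
      using tendsto_mult[OF d0 tendsto_diff[OF tendsto_const eN]] by simp
  qed
  ultimately show ?thesis using LIMSEQ_unique by simp
qed

end

section \<open>The potential density\<close>

text \<open>Measures cannot be subtracted; sums allow an identity with a density of unknown sign to
  be written with its negative part on the other side.\<close>

lemma ex_sum_measure:
  assumes A: "sets A = sets (borel :: real measure)" and B: "sets B = sets (borel :: real measure)"
  shows "\<exists>C. sets C = sets borel \<and>
    (\<forall>f\<in>borel_measurable borel. (\<integral>\<^sup>+x. f x \<partial>C) = (\<integral>\<^sup>+x. f x \<partial>A) + (\<integral>\<^sup>+x. f x \<partial>B))"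
proof -
  note [measurable_cong] = A B
  define C where "C = measure_of UNIV (sets borel) (\<lambda>X. emeasure A X + emeasure B X)"
  have sC [measurable_cong]: "sets C = sets (borel :: real measure)"
    unfolding C_def using sets.sigma_sets_eq[of "borel :: real measure"] by (simp add: sets_measure_of)
  have eC: "emeasure C X = emeasure A X + emeasure B X" if "X \<in> sets borel" for X
  proof (rule emeasure_measure_of[OF C_def])
    show "countably_additive (sets C) (\<lambda>X. emeasure A X + emeasure B X)"
    proof (rule countably_additiveI)
      fix F :: "nat \<Rightarrow> real set"
      assume F: "range F \<subseteq> sets C" "disjoint_family F" "\<Union> (range F) \<in> sets C"
      have "(\<Sum>i. emeasure A (F i) + emeasure B (F i)) = (\<Sum>i. emeasure A (F i)) + (\<Sum>i. emeasure B (F i))"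
        by (rule suminf_add[symmetric]) auto
      also have "\<dots> = emeasure A (\<Union> (range F)) + emeasure B (\<Union> (range F))"
        using F A B sC by (simp add: suminf_emeasure)
      finally show "(\<Sum>i. emeasure A (F i) + emeasure B (F i)) = emeasure A (\<Union> (range F)) + emeasure B (\<Union> (range F))" .
    qed
  qed (use that sC in \<open>auto simp: positive_def\<close>)
  have "(\<integral>\<^sup>+x. f x \<partial>C) = (\<integral>\<^sup>+x. f x \<partial>A) + (\<integral>\<^sup>+x. f x \<partial>B)" if "f \<in> borel_measurable borel" for f
    using that
  proof (induction f rule: borel_measurable_induct)
    case (cong f g)
    then show ?case by (simp cong: nn_integral_cong)
  next
    case (set X)
    then show ?case using A B sC by (simp add: eC)
  next
    case (mult u c)
    then show ?case by (simp add: nn_integral_cmult distrib_left)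
  next
    case (add u v)
    then show ?case by (simp add: nn_integral_add ac_simps)
  next
    case (seq U)
    have inc: "incseq (\<lambda>i. \<integral>\<^sup>+x. U i x \<partial>N)" for N
      using seq(3) by (auto simp: incseq_def le_fun_def intro!: nn_integral_mono)
    have sup: "(\<integral>\<^sup>+x. (SUP i. U i) x \<partial>N) = (SUP i. \<integral>\<^sup>+x. U i x \<partial>N)" if [measurable_cong]: "sets N = sets borel" for N
      unfolding SUP_apply using seq(1) by (intro nn_integral_monotone_convergence_SUP seq(3)) measurable
    show ?case
      unfolding sup[OF sC] sup[OF A] sup[OF B] seq.IH by (rule ennreal_SUP_add[OF inc inc])
  qed
  with sC show ?thesis by blast
qed

lemma AE_lborel_dense:
  assumes "AE x in lborel. P x" "a < (b::real)" shows "\<exists>x. a < x \<and> x < b \<and> P x"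
proof (rule ccontr)
  assume "\<not> ?thesis"
  then have none: "\<And>x. P x \<Longrightarrow> x \<notin> {a<..<b}" by auto
  from assms(1) have "AE x in lborel. x \<notin> {a<..<b}" by eventually_elim (rule none)
  moreover have eq: "{x. a < x \<and> x < b} = {a<..<b}" by auto
  ultimately have "emeasure lborel {a<..<b} = 0" by (subst (asm) AE_iff_measurable[OF _ refl]) (auto simp: eq)
  then show False using assms(2) by (simp add: emeasure_lborel_Ioo)
qed

text \<open>On the set where \<open>f\<close> exceeds \<open>g\<close> the hypothesis lets the
  maximum of both be replaced by \<open>g\<close>, so the maximum and \<open>g\<close> define the
  same measure and agree almost everywhere.\<close>

lemma density_le_imp_AE_le:
  fixes f g :: "real \<Rightarrow> real"
  assumes [measurable]: "f \<in> borel_measurable borel" "g \<in> borel_measurable borel"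
    and nonneg: "\<And>x. 0 \<le> g x"
    and le: "\<And>A. A \<in> sets borel \<Longrightarrow> (\<integral>\<^sup>+x. ennreal (f x) * indicator A x \<partial>lborel) \<le> (\<integral>\<^sup>+x. ennreal (g x) * indicator A x \<partial>lborel)"
  shows "AE x in lborel. f x \<le> g x"
proof -
  have "density lborel (\<lambda>x. ennreal (max (f x) (g x))) = density lborel (\<lambda>x. ennreal (g x))"
  proof (rule measure_eqI)
    fix A assume "A \<in> sets (density lborel (\<lambda>x. ennreal (max (f x) (g x))))"
    then have [measurable]: "A \<in> sets borel" by simp
    define B where "B = {x. f x \<le> g x}"
    have [measurable]: "B \<in> sets borel" by (simp add: B_def)
    have "(\<integral>\<^sup>+x. ennreal (max (f x) (g x)) * indicator A x \<partial>lborel) =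
        (\<integral>\<^sup>+x. ennreal (g x) * indicator (A \<inter> B) x + ennreal (f x) * indicator (A - B) x \<partial>lborel)"
      by (intro nn_integral_cong) (auto simp: B_def indicator_def max_def)
    also have "\<dots> = (\<integral>\<^sup>+x. ennreal (g x) * indicator (A \<inter> B) x \<partial>lborel) + (\<integral>\<^sup>+x. ennreal (f x) * indicator (A - B) x \<partial>lborel)"
      by (rule nn_integral_add) auto
    also have "\<dots> \<le> (\<integral>\<^sup>+x. ennreal (g x) * indicator (A \<inter> B) x \<partial>lborel) + (\<integral>\<^sup>+x. ennreal (g x) * indicator (A - B) x \<partial>lborel)"
      by (intro add_left_mono le) auto
    also have "\<dots> = (\<integral>\<^sup>+x. ennreal (g x) * indicator (A \<inter> B) x + ennreal (g x) * indicator (A - B) x \<partial>lborel)"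
      by (rule nn_integral_add[symmetric]) auto
    also have "\<dots> = (\<integral>\<^sup>+x. ennreal (g x) * indicator A x \<partial>lborel)"
      by (intro nn_integral_cong) (auto simp: indicator_def)
    finally have "(\<integral>\<^sup>+x. ennreal (max (f x) (g x)) * indicator A x \<partial>lborel) \<le> (\<integral>\<^sup>+x. ennreal (g x) * indicator A x \<partial>lborel)" .
    moreover have "(\<integral>\<^sup>+x. ennreal (g x) * indicator A x \<partial>lborel) \<le> (\<integral>\<^sup>+x. ennreal (max (f x) (g x)) * indicator A x \<partial>lborel)"
      by (intro nn_integral_mono mult_right_mono ennreal_leI) auto
    ultimately show "emeasure (density lborel (\<lambda>x. ennreal (max (f x) (g x)))) A = emeasure (density lborel (\<lambda>x. ennreal (g x))) A"
      by (simp add: emeasure_density)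
  qed simp
  then have "AE x in lborel. ennreal (max (f x) (g x)) = ennreal (g x)"
    by (subst (asm) sigma_finite_measure.density_unique_iff[OF lborel.sigma_finite_measure_axioms]) auto
  then show ?thesis
  proof eventually_elim
    case (elim x)
    then have "max (f x) (g x) = g x" using nonneg[of x] by (subst (asm) ennreal_inj) auto
    then show ?case by linarith
  qed
qed

text \<open>Covers both signs of the drift: \<open>\<phi> = 0\<close> and
  \<open>\<kappa> = \<psi>'(0+)\<close> if the latter is positive, \<open>\<phi>\<close> the
  positive root and \<open>\<kappa> = \<psi>'(\<phi>)\<close> if it is negative. The slope is a
  limit from the right because \<open>\<phi>\<close> may be 0.\<close>

locale transient_levy = regular_levy M Y for M :: "'a measure" and Y +
  fixes \<phi> \<kappa> :: real and W :: "real \<Rightarrow> real"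
  assumes \<phi>_nonneg: "0 \<le> \<phi>" and \<psi>_\<phi>: "laplace_exponent M Y \<phi> = 0"
    and \<psi>_pos: "\<And>l. \<phi> < l \<Longrightarrow> 0 < laplace_exponent M Y l"
    and \<kappa>_pos: "0 < \<kappa>" and \<kappa>_lim: "((\<lambda>h. laplace_exponent M Y (\<phi> + h) / h) \<longlongrightarrow> \<kappa>) (at_right 0)"
    and W_measurable [measurable]: "W \<in> borel_measurable borel"
    and W_cont: "continuous_on {0..} W" and W_neg: "\<And>x. x < 0 \<Longrightarrow> W x = 0"
    and W_laplace: "\<And>l. \<phi> < l \<Longrightarrow> set_integrable lborel {0..} (\<lambda>y. exp (- l * y) * W y)"
      "\<And>l. \<phi> < l \<Longrightarrow> (LBINT y:{0..}. exp (- l * y) * W y) = 1 / laplace_exponent M Y l"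
begin

text \<open>The reflected occupation measure of \<open>Y\<close> up to its passage above \<open>a\<close>.\<close>

definition K :: "real \<Rightarrow> real measure" where
  "K a = distr (density (lborel \<Otimes>\<^sub>M M) (\<lambda>(s, \<omega>). indicator {0<..} s * of_bool (below a s \<omega>))) borel (\<lambda>(s, \<omega>). - Y s \<omega>)"

lemma sets_K: "sets (K a) = sets borel"
  by (simp add: K_def)

lemma nn_integral_K:
  assumes [measurable]: "f \<in> borel_measurable borel"
  shows "(\<integral>\<^sup>+x. f x \<partial>K a) = (\<integral>\<^sup>+\<omega>. \<integral>\<^sup>+s. indicator {0<..} s * of_bool (below a s \<omega>) * f (- Y s \<omega>) \<partial>lborel \<partial>M)"
    and "(\<integral>\<^sup>+x. f x \<partial>K a) = (\<integral>\<^sup>+s. \<integral>\<^sup>+\<omega>. indicator {0<..} s * of_bool (below a s \<omega>) * f (- Y s \<omega>) \<partial>M \<partial>lborel)"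
proof -
  interpret P: pair_sigma_finite lborel M ..
  have "(\<integral>\<^sup>+x. f x \<partial>K a) = (\<integral>\<^sup>+p. (case p of (s, \<omega>) \<Rightarrow> indicator {0<..} s * of_bool (below a s \<omega>) * f (- Y s \<omega>)) \<partial>(lborel \<Otimes>\<^sub>M M))"
    unfolding K_def by (subst nn_integral_distr, simp, simp, subst nn_integral_density) (auto simp: case_prod_beta intro!: nn_integral_cong)
  then show "(\<integral>\<^sup>+x. f x \<partial>K a) = (\<integral>\<^sup>+s. \<integral>\<^sup>+\<omega>. indicator {0<..} s * of_bool (below a s \<omega>) * f (- Y s \<omega>) \<partial>M \<partial>lborel)"
    by (subst (asm) nn_integral_fst[symmetric]) auto
  also have "\<dots> = (\<integral>\<^sup>+\<omega>. \<integral>\<^sup>+s. indicator {0<..} s * of_bool (below a s \<omega>) * f (- Y s \<omega>) \<partial>lborel \<partial>M)"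
    by (rule P.Fubini'[symmetric]) measurable
  finally show "(\<integral>\<^sup>+x. f x \<partial>K a) = (\<integral>\<^sup>+\<omega>. \<integral>\<^sup>+s. indicator {0<..} s * of_bool (below a s \<omega>) * f (- Y s \<omega>) \<partial>lborel \<partial>M)" .
qed

definition hit :: "real \<Rightarrow> real" where
  "hit a = lim (\<lambda>n. prob {\<omega>\<in>space M. \<not> below a (real (Suc n)) \<omega>})"

lemma hit_tendsto: "(\<lambda>n. prob {\<omega>\<in>space M. \<not> below a (real (Suc n)) \<omega>}) \<longlonglongrightarrow> hit a"
proof -
  have inc: "incseq (\<lambda>n. prob {\<omega>\<in>space M. \<not> below a (real (Suc n)) \<omega>})"
    unfolding incseq_Suc_iff
  proof (intro allI finite_measure_mono)
    fix n
    have "real (Suc n) \<le> real (Suc (Suc n))" by simp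
    then show "{\<omega>\<in>space M. \<not> below a (real (Suc n)) \<omega>} \<subseteq> {\<omega>\<in>space M. \<not> below a (real (Suc (Suc n))) \<omega>}"
      using below_antimono by blast
  qed simp
  have le1: "\<forall>n. prob {\<omega>\<in>space M. \<not> below a (real (Suc n)) \<omega>} \<le> 1" by simp
  obtain h where "(\<lambda>n. prob {\<omega>\<in>space M. \<not> below a (real (Suc n)) \<omega>}) \<longlonglongrightarrow> h"
    by (rule incseq_convergent[OF inc le1])
  then show ?thesis unfolding hit_def by (simp add: convergent_LIMSEQ_iff[symmetric] convergentI)
qed

text \<open>Dynkin's formula as the time horizon tends to infinity: the occupation term increases
  and is bounded by \<open>(exp (l * a) - 1) / \<psi> l\<close>, and the term \<open>e l T\<close>
  of paths still below \<open>a\<close> dies out. At \<open>l = \<phi>\<close> the occupation term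
  has factor 0, which bounds \<open>hit a\<close>.\<close>

lemma K_laplace_hit:
  assumes a: "0 \<le> a" and l: "\<phi> < l"
  shows "(\<integral>\<^sup>+x. exp (- l * x) \<partial>K a) = ennreal ((hit a * exp (l * a) - 1) / \<psi> l)"
    and "1 \<le> hit a * exp (l * a)" and "hit a \<le> exp (- \<phi> * a)"
proof -
  define p where "p T = prob {\<omega>\<in>space M. \<not> below a T \<omega>}" for T
  define e where "e l s = (\<integral>\<omega>. of_bool (below a s \<omega>) * exp (l * Y s \<omega>) \<partial>M)" for l s
  define I where "I l T = (\<integral>\<omega>. (LBINT s:{0<..T}. of_bool (below a s \<omega>) * exp (l * Y s \<omega>)) \<partial>M)" for l T
  have dyn: "exp (l * a) * p T + e l T - 1 = \<psi> l * I l T" if "0 \<le> l" "0 < T" for l T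
    using dynkin_passage[OF that a] by (simp add: p_def e_def I_def)
  have e0: "0 \<le> e l s" for l s unfolding e_def by (intro Bochner_Integration.integral_nonneg) auto
  have pmono: "p s \<le> p t" if "s \<le> t" for s t
    unfolding p_def using that below_antimono by (intro finite_measure_mono) auto
  have p01: "0 \<le> p t" "p t \<le> 1" for t by (auto simp: p_def)
  have bnd: "of_bool (below a s \<omega>) * exp (l * Y s \<omega>) \<le> exp (l * a)" if "0 \<le> l" "0 \<le> s" for l s \<omega>
    using that by (cases "below a s \<omega>") (auto simp: below_Y mult_left_mono)
  have ei: "integrable M (\<lambda>\<omega>. of_bool (below a s \<omega>) * exp (l * Y s \<omega>))" if "0 \<le> l" "0 \<le> s" for l s
    by (rule integrable_const_bound[where B="exp (l * a)"]) (use bnd[OF that] in auto)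
  have I_nn: "ennreal (I l T) = (\<integral>\<^sup>+s. indicator {0<..T} s * ennreal (e l s) \<partial>lborel)" if l: "0 \<le> l" and T: "0 \<le> T" for l T
  proof -
    interpret P: pair_sigma_finite lborel M ..
    have si: "integrable lborel (\<lambda>s. indicator {0<..T} s *\<^sub>R (of_bool (below a s \<omega>) * exp (l * Y s \<omega>)))" for \<omega>
    proof (rule Bochner_Integration.integrable_bound)
      show "integrable lborel (\<lambda>s. indicator {0<..T} s * exp (l * a) :: real)"
        by (intro integrable_mult_left integrable_real_indicator) (use T in auto)
    qed (use bnd[OF l] in \<open>auto intro!: AE_I2 simp: indicator_def\<close>)
    have li: "ennreal (LBINT s:{0<..T}. of_bool (below a s \<omega>) * exp (l * Y s \<omega>)) = (\<integral>\<^sup>+s. indicator {0<..T} s * ennreal (of_bool (below a s \<omega>) * exp (l * Y s \<omega>)) \<partial>lborel)" for \<omega>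
      unfolding set_lebesgue_integral_def
      by (subst nn_integral_eq_integral[OF si, symmetric]) (auto intro!: nn_integral_cong simp: indicator_def)
    have L0: "0 \<le> (LBINT s:{0<..T}. of_bool (below a s \<omega>) * exp (l * Y s \<omega>))" for \<omega>
      unfolding set_lebesgue_integral_def by (intro Bochner_Integration.integral_nonneg) auto
    have LT: "(LBINT s:{0<..T}. of_bool (below a s \<omega>) * exp (l * Y s \<omega>)) \<le> T * exp (l * a)" for \<omega>
    proof -
      have "(LBINT s:{0<..T}. of_bool (below a s \<omega>) * exp (l * Y s \<omega>)) \<le> (\<integral>s. indicator {0<..T} s * exp (l * a) \<partial>lborel)"
        unfolding set_lebesgue_integral_def
        by (rule integral_mono[OF si], intro integrable_mult_left integrable_real_indicator)
          (use T bnd[OF l] in \<open>auto simp: indicator_def\<close>)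
      then show ?thesis using T by simp
    qed
    have "(\<lambda>\<omega>. LBINT s. indicator {0<..T} s *\<^sub>R (of_bool (below a s \<omega>) * exp (l * Y s \<omega>))) \<in> borel_measurable M"
      by (rule lborel.borel_measurable_lebesgue_integral) measurable
    then have "integrable M (\<lambda>\<omega>. LBINT s:{0<..T}. of_bool (below a s \<omega>) * exp (l * Y s \<omega>))"
      using L0 LT by (intro integrable_const_bound[where B="T * exp (l * a)"]) (auto simp: set_lebesgue_integral_def)
    then have "ennreal (I l T) = (\<integral>\<^sup>+\<omega>. ennreal (LBINT s:{0<..T}. of_bool (below a s \<omega>) * exp (l * Y s \<omega>)) \<partial>M)"
      unfolding I_def using L0 by (intro nn_integral_eq_integral[symmetric]) auto
    also have "\<dots> = (\<integral>\<^sup>+s. \<integral>\<^sup>+\<omega>. indicator {0<..T} s * ennreal (of_bool (below a s \<omega>) * exp (l * Y s \<omega>)) \<partial>M \<partial>lborel)"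
      unfolding li by (rule P.Fubini') measurable
    also have "\<dots> = (\<integral>\<^sup>+s. indicator {0<..T} s * ennreal (e l s) \<partial>lborel)"
    proof (rule nn_integral_cong)
      fix s
      show "(\<integral>\<^sup>+\<omega>. indicator {0<..T} s * ennreal (of_bool (below a s \<omega>) * exp (l * Y s \<omega>)) \<partial>M) = indicator {0<..T} s * ennreal (e l s)"
      proof (cases "s \<in> {0<..T}")
        case True
        then show ?thesis using nn_integral_eq_integral[OF ei[OF l, of s]] by (simp add: e_def)
      qed simp
    qed
    finally show ?thesis .
  qed
  have l0: "0 \<le> l" using l \<phi>_nonneg by simp
  have em [measurable]: "e l \<in> borel_measurable borel" for l
    unfolding e_def[abs_def] by (rule borel_measurable_lebesgue_integral) measurable
  have I0: "0 \<le> I l T" for l T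
    unfolding I_def set_lebesgue_integral_def by (intro Bochner_Integration.integral_nonneg) auto
  have eb: "e l T \<le> exp (l * a) * (1 - p T)" if "0 \<le> l" "0 \<le> T" for l T
  proof -
    have "e l T \<le> (\<integral>\<omega>. indicator {\<omega>\<in>space M. below a T \<omega>} \<omega> * exp (l * a) \<partial>M)"
      unfolding e_def
      by (rule integral_mono[OF ei[OF that]], intro integrable_mult_left integrable_real_indicator)
        (use that in \<open>auto simp: indicator_def emeasure_eq_measure below_Y mult_left_mono\<close>)
    also have "\<dots> = exp (l * a) * prob {\<omega>\<in>space M. below a T \<omega>}" by simp
    also have "prob {\<omega>\<in>space M. below a T \<omega>} = 1 - p T"
      unfolding p_def by (subst prob_neg[symmetric]) auto
    finally show ?thesis .
  qed
  have IT: "I l T \<le> (exp (l * a) - 1) / \<psi> l" if "0 < T" for T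
    using dyn[OF l0 that] eb[OF l0, of T] that \<psi>_pos[OF l] by (simp add: pos_le_divide_eq algebra_simps)
  have Imono: "I l s \<le> I l t" if "0 \<le> s" "s \<le> t" for s t
  proof -
    have "ennreal (I l s) \<le> ennreal (I l t)"
      unfolding I_nn[OF l0 that(1)] I_nn[OF l0 order_trans[OF that]]
      using that by (intro nn_integral_mono mult_right_mono) (auto simp: indicator_def)
    then show ?thesis by (simp add: I0 ennreal_le_iff)
  qed
  define J where "J n = I l (real (Suc n))" for n
  have "incseq J" unfolding incseq_Suc_iff J_def by (auto intro!: Imono)
  moreover have "J n \<le> (exp (l * a) - 1) / \<psi> l" for n unfolding J_def by (rule IT) simp
  ultimately obtain Jl where Jl: "J \<longlonglongrightarrow> Jl" using incseq_convergent by blast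
  \<comment> \<open>Integrability of \<open>e l\<close> alone does not force it to 0. By Dynkin's
    formula \<open>e l\<close> at the end of a unit interval exceeds its values inside by at most
    \<open>\<psi> l\<close> times the increment of \<open>J\<close>; integrating over the interval
    bounds that end value by increments of a convergent sequence.\<close>
  have estep: "e l (real (Suc (Suc n))) \<le> (1 + \<psi> l) * (J (Suc n) - J n)" for n
  proof -
    define r where "r = max 0 (e l (real (Suc (Suc n))) - \<psi> l * (J (Suc n) - J n))"
    have es: "r \<le> e l s" if s: "s \<in> {real (Suc n)<..real (Suc (Suc n))}" for s
    proof -
      have "e l s = 1 + \<psi> l * I l s - exp (l * a) * p s" using dyn[OF l0, of s] s by (simp add: algebra_simps)
      moreover have "e l (real (Suc (Suc n))) = 1 + \<psi> l * J (Suc n) - exp (l * a) * p (real (Suc (Suc n)))"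
        using dyn[OF l0, of "real (Suc (Suc n))"] by (simp add: algebra_simps J_def)
      moreover have "\<psi> l * J n \<le> \<psi> l * I l s"
        unfolding J_def using s \<psi>_pos[OF l] by (intro mult_left_mono Imono) auto
      moreover have "exp (l * a) * p s \<le> exp (l * a) * p (real (Suc (Suc n)))"
        using s by (intro mult_left_mono pmono) auto
      ultimately have "e l (real (Suc (Suc n))) - \<psi> l * (J (Suc n) - J n) \<le> e l s"
        unfolding right_diff_distrib by linarith
      then show ?thesis using e0[of l s] by (simp add: r_def)
    qed
    have "ennreal (J n) + ennreal r = (\<integral>\<^sup>+s. indicator {0<..real (Suc n)} s * ennreal (e l s) \<partial>lborel) +
        (\<integral>\<^sup>+s. indicator {real (Suc n)<..real (Suc (Suc n))} s * ennreal r \<partial>lborel)"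
      using I_nn[OF l0, of "real (Suc n)"] by (simp add: J_def nn_integral_multc)
    also have "\<dots> \<le> (\<integral>\<^sup>+s. indicator {0<..real (Suc n)} s * ennreal (e l s) \<partial>lborel) +
        (\<integral>\<^sup>+s. indicator {real (Suc n)<..real (Suc (Suc n))} s * ennreal (e l s) \<partial>lborel)"
      using es by (intro add_left_mono nn_integral_mono) (auto simp: indicator_def intro!: ennreal_leI)
    also have "\<dots> = (\<integral>\<^sup>+s. indicator {0<..real (Suc n)} s * ennreal (e l s) + indicator {real (Suc n)<..real (Suc (Suc n))} s * ennreal (e l s) \<partial>lborel)"
      by (rule nn_integral_add[symmetric]) auto
    also have "\<dots> = (\<integral>\<^sup>+s. indicator {0<..real (Suc (Suc n))} s * ennreal (e l s) \<partial>lborel)"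
      by (intro nn_integral_cong) (auto simp: indicator_def)
    also have "\<dots> = ennreal (J (Suc n))" using I_nn[OF l0, of "real (Suc (Suc n))"] by (simp add: J_def)
    finally have "ennreal (J n + r) \<le> ennreal (J (Suc n))"
      using I0 by (simp add: r_def J_def)
    then have "J n + r \<le> J (Suc n)" using I0 by (simp add: ennreal_le_iff J_def)
    then show ?thesis by (simp add: r_def algebra_simps)
  qed
  have elim: "(\<lambda>n. e l (real (Suc (Suc n)))) \<longlonglongrightarrow> 0"
  proof (rule real_tendsto_sandwich[of "\<lambda>_. 0"])
    have "(\<lambda>n. (1 + \<psi> l) * (J (Suc n) - J n)) \<longlonglongrightarrow> (1 + \<psi> l) * (Jl - Jl)"
      by (intro tendsto_intros Jl LIMSEQ_Suc)
    then show "(\<lambda>n. (1 + \<psi> l) * (J (Suc n) - J n)) \<longlonglongrightarrow> 0" by simp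
  qed (use e0 estep in auto)
  have h: "(\<lambda>n. p (real (Suc n))) \<longlonglongrightarrow> hit a" unfolding p_def by (rule hit_tendsto)
  have "(\<lambda>n. exp (l * a) * p (real (Suc (Suc n))) + e l (real (Suc (Suc n))) - 1) \<longlonglongrightarrow> exp (l * a) * hit a + 0 - 1"
    by (intro tendsto_intros elim LIMSEQ_Suc[OF h])
  moreover have "exp (l * a) * p (real (Suc (Suc n))) + e l (real (Suc (Suc n))) - 1 = \<psi> l * J (Suc n)" for n
    unfolding J_def by (rule dyn[OF l0]) simp
  moreover have "(\<lambda>n. \<psi> l * J (Suc n)) \<longlonglongrightarrow> \<psi> l * Jl" by (intro tendsto_intros LIMSEQ_Suc[OF Jl])
  ultimately have "exp (l * a) * hit a + 0 - 1 = \<psi> l * Jl" by (simp only:) (rule LIMSEQ_unique)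
  then have hl: "\<psi> l * Jl = hit a * exp (l * a) - 1" by (simp add: mult.commute)
  have Jl0: "0 \<le> Jl" by (rule LIMSEQ_le_const[OF Jl]) (use I0 in \<open>auto simp: J_def\<close>)
  show "1 \<le> hit a * exp (l * a)" using hl mult_nonneg_nonneg[OF less_imp_le[OF \<psi>_pos[OF l]] Jl0] by simp
  have "(\<integral>\<^sup>+x. exp (- l * x) \<partial>K a) = (\<integral>\<^sup>+s. \<integral>\<^sup>+\<omega>. indicator {0<..} s * of_bool (below a s \<omega>) * ennreal (exp (- l * - Y s \<omega>)) \<partial>M \<partial>lborel)"
    by (rule nn_integral_K(2)) simp
  also have "\<dots> = (\<integral>\<^sup>+s. indicator {0<..} s * ennreal (e l s) \<partial>lborel)"
  proof (rule nn_integral_cong)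
    fix s
    show "(\<integral>\<^sup>+\<omega>. indicator {0<..} s * of_bool (below a s \<omega>) * ennreal (exp (- l * - Y s \<omega>)) \<partial>M) = indicator {0<..} s * ennreal (e l s)"
    proof (cases "0 < s")
      case True
      have "(\<integral>\<^sup>+\<omega>. of_bool (below a s \<omega>) * ennreal (exp (l * Y s \<omega>)) \<partial>M) = (\<integral>\<^sup>+\<omega>. ennreal (of_bool (below a s \<omega>) * exp (l * Y s \<omega>)) \<partial>M)"
        by (intro nn_integral_cong) auto
      also have "\<dots> = ennreal (e l s)" using nn_integral_eq_integral[OF ei[OF l0, of s]] True by (simp add: e_def)
      finally show ?thesis using True by simp
    qed simp
  qed
  also have "\<dots> = (\<integral>\<^sup>+s. (SUP n. indicator {0<..real (Suc n)} s * ennreal (e l s)) \<partial>lborel)"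
  proof (rule nn_integral_cong)
    fix s
    show "indicator {0<..} s * ennreal (e l s) = (SUP n. indicator {0<..real (Suc n)} s * ennreal (e l s))"
    proof (rule antisym)
      obtain n :: nat where "s \<le> real n" using real_arch_simple by blast
      then have "indicator {0<..} s * ennreal (e l s) \<le> indicator {0<..real (Suc n)} s * ennreal (e l s)"
        by (auto simp: indicator_def)
      then show "indicator {0<..} s * ennreal (e l s) \<le> (SUP n. indicator {0<..real (Suc n)} s * ennreal (e l s))"
        by (rule order_trans) (rule SUP_upper, simp)
      show "(SUP n. indicator {0<..real (Suc n)} s * ennreal (e l s)) \<le> indicator {0<..} s * ennreal (e l s)"
        by (rule SUP_least) (auto simp: indicator_def)
    qed
  qed
  also have "\<dots> = (SUP n. \<integral>\<^sup>+s. indicator {0<..real (Suc n)} s * ennreal (e l s) \<partial>lborel)"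
    by (rule nn_integral_monotone_convergence_SUP) (auto simp: incseq_def le_fun_def indicator_def)
  also have "\<dots> = (SUP n. ennreal (J n))" unfolding J_def by (subst I_nn[OF l0]) auto
  also have "\<dots> = ennreal Jl"
  proof (rule LIMSEQ_unique)
    show "(\<lambda>n. ennreal (J n)) \<longlonglongrightarrow> (SUP n. ennreal (J n))"
      by (rule LIMSEQ_SUP) (use \<open>incseq J\<close> in \<open>auto simp: incseq_def intro: ennreal_leI\<close>)
    show "(\<lambda>n. ennreal (J n)) \<longlonglongrightarrow> ennreal Jl" by (rule tendsto_ennrealI[OF Jl])
  qed
  also have "Jl = (hit a * exp (l * a) - 1) / \<psi> l" using hl \<psi>_pos[OF l] by (simp add: field_simps)
  finally show "(\<integral>\<^sup>+x. exp (- l * x) \<partial>K a) = ennreal ((hit a * exp (l * a) - 1) / \<psi> l)" .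
  have "p (real (Suc n)) \<le> exp (- \<phi> * a)" for n
  proof -
    have "exp (\<phi> * a) * p (real (Suc n)) \<le> 1"
      using dyn[OF \<phi>_nonneg, of "real (Suc n)"] e0[of \<phi> "real (Suc n)"] by (simp add: \<psi>_\<phi>)
    then show ?thesis by (simp add: exp_minus field_simps)
  qed
  then show "hit a \<le> exp (- \<phi> * a)" by (intro LIMSEQ_le_const2[OF h]) auto
qed

text \<open>The lower bound for \<open>hit a\<close> at all \<open>l > \<phi>\<close> is pushed down
  to \<open>\<phi>\<close>. So the overall supremum of the path is exponential with rate
  \<open>\<phi>\<close>, and every level is passed almost surely if
  \<open>\<phi> = 0\<close>.\<close>

lemma hit_eq: assumes a: "0 \<le> a" shows "hit a = exp (- \<phi> * a)"
proof (rule antisym)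
  show "hit a \<le> exp (- \<phi> * a)" by (rule K_laplace_hit(3)[OF a, of "\<phi> + 1"]) simp
  have "exp (- (\<phi> + 1 / real (Suc n)) * a) \<le> hit a" for n
    using K_laplace_hit(2)[OF a, of "\<phi> + 1 / real (Suc n)"] by (simp add: exp_minus field_simps del: of_nat_Suc)
  moreover have "(\<lambda>n. exp (- (\<phi> + 1 / real (Suc n)) * a)) \<longlonglongrightarrow> exp (- (\<phi> + 0) * a)"
    by (intro tendsto_intros LIMSEQ_Suc[OF lim_1_over_n])
  ultimately show "exp (- \<phi> * a) \<le> hit a" using LIMSEQ_le_const2[of _ "exp (- (\<phi> + 0) * a)" "hit a"] by auto
qed

lemma K_laplace:
  assumes a: "0 \<le> a" and l: "\<phi> < l"
  shows "(\<integral>\<^sup>+x. exp (- l * x) \<partial>K a) = ennreal ((exp (- \<phi> * a) * exp (l * a) - 1) / \<psi> l)"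
    and "1 \<le> exp (- \<phi> * a) * exp (l * a)"
  using K_laplace_hit[OF a l] by (simp_all add: hit_eq[OF a])

end

section \<open>Positivity of \<open>W\<close>, the stopped occupation measure and the
  potential\<close>

context transient_levy
begin

lemma W_right_cont: "(\<lambda>n. x n) \<longlonglongrightarrow> y \<Longrightarrow> (\<And>n. y \<le> x n) \<Longrightarrow> (\<lambda>n. W (x n)) \<longlonglongrightarrow> W y"
proof (cases "0 \<le> y")
  case True
  assume "(\<lambda>n. x n) \<longlonglongrightarrow> y" "\<And>n. y \<le> x n"
  moreover from this True have "x n \<in> {0..}" for n using order_trans by auto
  ultimately show ?thesis using W_cont True unfolding continuous_on_sequentially by (auto simp: o_def)
next
  case False
  assume "(\<lambda>n. x n) \<longlonglongrightarrow> y" "\<And>n. y \<le> x n"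
  then have "\<forall>\<^sub>F n in sequentially. x n < 0" using False by (intro order_tendstoD(2)) auto
  then have "\<forall>\<^sub>F n in sequentially. W (x n) = W y" by eventually_elim (use False in \<open>simp add: W_neg\<close>)
  then show ?thesis by (rule tendsto_eventually)
qed

lemma nn_integral_shift:
  fixes f :: "real \<Rightarrow> ennreal"
  assumes [measurable]: "f \<in> borel_measurable borel"
  shows "(\<integral>\<^sup>+x. f (x + a) \<partial>lborel) = (\<integral>\<^sup>+x. f x \<partial>lborel)"
  using nn_integral_real_affine[of f 1 a] by (simp add: add.commute)

lemma nn_integral_exp_shift:
  fixes f :: "real \<Rightarrow> real"
  assumes [measurable]: "f \<in> borel_measurable borel" and f: "\<And>x. 0 \<le> f x"
  shows "(\<integral>\<^sup>+x. ennreal (exp (- l * x) * f (x + a)) \<partial>lborel) = ennreal (exp (l * a)) * (\<integral>\<^sup>+x. ennreal (exp (- l * x) * f x) \<partial>lborel)"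
proof -
  have "(\<integral>\<^sup>+x. ennreal (exp (- l * x) * f (x + a)) \<partial>lborel) = (\<integral>\<^sup>+x. ennreal (exp (l * a)) * ennreal (exp (- l * (x + a)) * f (x + a)) \<partial>lborel)"
  proof (rule nn_integral_cong)
    fix x
    have "exp (l * a) * exp (- l * (x + a)) = exp (- l * x)"
      unfolding exp_add[symmetric] by (simp add: distrib_left)
    then show "ennreal (exp (- l * x) * f (x + a)) = ennreal (exp (l * a)) * ennreal (exp (- l * (x + a)) * f (x + a))"
      by (simp add: ennreal_mult'[symmetric] mult.assoc[symmetric])
  qed
  also have "\<dots> = ennreal (exp (l * a)) * (\<integral>\<^sup>+x. ennreal (exp (- l * (x + a)) * f (x + a)) \<partial>lborel)"
    by (rule nn_integral_cmult) simp
  also have "(\<integral>\<^sup>+x. ennreal (exp (- l * (x + a)) * f (x + a)) \<partial>lborel) = (\<integral>\<^sup>+x. ennreal (exp (- l * x) * f x) \<partial>lborel)"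
    by (rule nn_integral_shift) simp
  finally show ?thesis .
qed

lemma AE_K: "AE x in K a. - a \<le> x"
proof -
  have "emeasure (K a) {..<- a} = (\<integral>\<^sup>+x. indicator {..<- a} x \<partial>K a)"
    by (rule nn_integral_indicator[symmetric]) (simp add: sets_K)
  also have "\<dots> = (\<integral>\<^sup>+\<omega>. \<integral>\<^sup>+s. indicator {0<..} s * of_bool (below a s \<omega>) * indicator {..<- a} (- Y s \<omega>) \<partial>lborel \<partial>M)"
    by (rule nn_integral_K(1)) simp
  also have "\<dots> = (\<integral>\<^sup>+\<omega>. \<integral>\<^sup>+(s::real). 0 \<partial>lborel \<partial>M)"
  proof (rule nn_integral_cong, rule nn_integral_cong)
    fix \<omega> s
    show "indicator {0<..} s * of_bool (below a s \<omega>) * indicator {..<- a} (- Y s \<omega>) = (0 :: ennreal)"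
      using below_Y[of a s \<omega>] by (auto simp: indicator_def)
  qed
  finally have "emeasure (K a) {..<- a} = 0" by simp
  then show ?thesis by (intro AE_I[where N="{..<- a}"]) (auto simp: sets_K)
qed

text \<open>The transform of \<open>K a\<close> is that of \<open>h * W (x + a) - W x\<close>, but a
  function of unknown sign is not yet a density. Splitting \<open>W\<close> into positive and
  negative parts turns the identity into one between measures, \<open>K a\<close> plus the density
  \<open>d1\<close> equals the density \<open>d2\<close>, and dropping \<open>K a\<close> gives
  \<open>d1 \<le> d2\<close> almost everywhere, which is the claim rearranged.\<close>

lemma W_growth: assumes a: "0 \<le> a" shows "W x \<le> exp (- \<phi> * a) * W (x + a)"
proof -
  define h where "h = exp (- \<phi> * a)"
  have h: "0 < h" by (simp add: h_def)
  define Wp Wn where "Wp x = max 0 (W x)" and "Wn x = max 0 (- W x)" for x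
  have [measurable]: "Wp \<in> borel_measurable borel" "Wn \<in> borel_measurable borel"
    by (simp_all add: Wp_def[abs_def] Wn_def[abs_def])
  have nonneg: "0 \<le> Wp x" "0 \<le> Wn x" for x by (simp_all add: Wp_def Wn_def)
  have Wpn: "Wp x - Wn x = W x" for x by (simp add: Wp_def Wn_def)
  have sup0: "Wp x = 0" "Wn x = 0" if "x < 0" for x using W_neg[OF that] by (simp_all add: Wp_def Wn_def)
  have intp: "integrable lborel (\<lambda>x. exp (- l * x) * Wp x)" and intn: "integrable lborel (\<lambda>x. exp (- l * x) * Wn x)"
    and diff: "(\<integral>x. exp (- l * x) * Wp x \<partial>lborel) - (\<integral>x. exp (- l * x) * Wn x \<partial>lborel) = 1 / \<psi> l" if l: "\<phi> < l" for l
  proof -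
    have i: "integrable lborel (\<lambda>y. indicator {0..} y *\<^sub>R (exp (- l * y) * W y))"
      using W_laplace(1)[OF l] by (simp add: set_integrable_def)
    show p: "integrable lborel (\<lambda>x. exp (- l * x) * Wp x)"
      by (rule Bochner_Integration.integrable_bound[OF i]) (auto intro!: AE_I2 simp: indicator_def Wp_def W_neg max_def)
    show n: "integrable lborel (\<lambda>x. exp (- l * x) * Wn x)"
      by (rule Bochner_Integration.integrable_bound[OF i]) (auto intro!: AE_I2 simp: indicator_def Wn_def W_neg max_def)
    have "(\<integral>x. exp (- l * x) * Wp x \<partial>lborel) - (\<integral>x. exp (- l * x) * Wn x \<partial>lborel) = (\<integral>x. exp (- l * x) * Wp x - exp (- l * x) * Wn x \<partial>lborel)"
      by (rule Bochner_Integration.integral_diff[symmetric, OF p n])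
    also have "\<dots> = (LBINT y:{0..}. exp (- l * y) * W y)"
      unfolding set_lebesgue_integral_def right_diff_distrib[symmetric] Wpn
      by (intro Bochner_Integration.integral_cong) (auto simp: indicator_def W_neg)
    finally show "(\<integral>x. exp (- l * x) * Wp x \<partial>lborel) - (\<integral>x. exp (- l * x) * Wn x \<partial>lborel) = 1 / \<psi> l"
      using W_laplace(2)[OF l] by simp
  qed
  define d1 d2 where "d1 x = Wp x + h * Wn (x + a)" and "d2 x = h * Wp (x + a) + Wn x" for x
  have [measurable]: "d1 \<in> borel_measurable borel" "d2 \<in> borel_measurable borel"
    by (simp_all add: d1_def[abs_def] d2_def[abs_def])
  have d0: "0 \<le> d1 x" "0 \<le> d2 x" for x using h nonneg by (simp_all add: d1_def d2_def)
  have mix: "(\<integral>\<^sup>+x. exp (- l * x) \<partial>density lborel (\<lambda>x. ennreal (c1 * u x + c2 * v (x + a)))) =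
      ennreal (c1 * (\<integral>x. exp (- l * x) * u x \<partial>lborel) + c2 * (exp (l * a) * (\<integral>x. exp (- l * x) * v x \<partial>lborel)))"
    if c: "0 \<le> c1" "0 \<le> c2" and [measurable]: "u \<in> borel_measurable borel" "v \<in> borel_measurable borel"
      and uv: "\<And>x. 0 \<le> u x" "\<And>x. 0 \<le> v x"
      and i: "integrable lborel (\<lambda>x. exp (- l * x) * u x)" "integrable lborel (\<lambda>x. exp (- l * x) * v x)" for c1 c2 u v l
  proof -
    have "(\<integral>\<^sup>+x. exp (- l * x) \<partial>density lborel (\<lambda>x. ennreal (c1 * u x + c2 * v (x + a)))) =
      (\<integral>\<^sup>+x. ennreal (c1 * u x + c2 * v (x + a)) * ennreal (exp (- l * x)) \<partial>lborel)"
      by (rule nn_integral_density) auto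
    also have "\<dots> = (\<integral>\<^sup>+x. ennreal c1 * ennreal (exp (- l * x) * u x) + ennreal c2 * ennreal (exp (- l * x) * v (x + a)) \<partial>lborel)"
      using c uv by (intro nn_integral_cong) (simp add: ennreal_mult'[symmetric] ennreal_plus[symmetric] algebra_simps del: ennreal_plus)
    also have "\<dots> = ennreal c1 * (\<integral>\<^sup>+x. ennreal (exp (- l * x) * u x) \<partial>lborel) + ennreal c2 * (\<integral>\<^sup>+x. ennreal (exp (- l * x) * v (x + a)) \<partial>lborel)"
      by (simp add: nn_integral_add nn_integral_cmult)
    also have "\<dots> = ennreal c1 * ennreal (\<integral>x. exp (- l * x) * u x \<partial>lborel) + ennreal c2 * (ennreal (exp (l * a)) * ennreal (\<integral>x. exp (- l * x) * v x \<partial>lborel))"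
      by (subst nn_integral_exp_shift) (use uv nn_integral_eq_integral[OF i(1)] nn_integral_eq_integral[OF i(2)] in auto)
    also have "\<dots> = ennreal (c1 * (\<integral>x. exp (- l * x) * u x \<partial>lborel) + c2 * (exp (l * a) * (\<integral>x. exp (- l * x) * v x \<partial>lborel)))"
      using c uv by (simp add: ennreal_mult'[symmetric] ennreal_plus[symmetric] Bochner_Integration.integral_nonneg del: ennreal_plus)
    finally show ?thesis .
  qed
  obtain \<mu> where s\<mu>: "sets \<mu> = sets borel"
    and \<mu>: "\<And>f. f \<in> borel_measurable borel \<Longrightarrow> (\<integral>\<^sup>+x. f x \<partial>\<mu>) = (\<integral>\<^sup>+x. f x \<partial>K a) + (\<integral>\<^sup>+x. f x \<partial>density lborel (\<lambda>x. ennreal (d1 x)))"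
    using ex_sum_measure[OF sets_K, of "density lborel (\<lambda>x. ennreal (d1 x))" a] by auto
  have "\<mu> = density lborel (\<lambda>x. ennreal (d2 x))"
  proof (rule measure_eqI_laplace[where c="- a" and ?l0.0=\<phi>])
    have "emeasure \<mu> {..<- a} = (\<integral>\<^sup>+x. indicator {..<- a} x \<partial>K a) + (\<integral>\<^sup>+x. indicator {..<- a} x \<partial>density lborel (\<lambda>x. ennreal (d1 x)))"
      using \<mu>[of "indicator {..<- a}"] by (simp add: s\<mu>)
    also have "(\<integral>\<^sup>+x. indicator {..<- a} x \<partial>K a) = (\<integral>\<^sup>+x. 0 \<partial>K a)"
      by (rule nn_integral_cong_AE) (use AE_K[of a] in \<open>eventually_elim, simp add: indicator_def\<close>)
    also have "(\<integral>\<^sup>+x. indicator {..<- a} x \<partial>density lborel (\<lambda>x. ennreal (d1 x))) = (\<integral>\<^sup>+x. ennreal (d1 x) * indicator {..<- a} x \<partial>lborel)"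
      by (rule nn_integral_density) auto
    also have "\<dots> = (\<integral>\<^sup>+(x::real). 0 \<partial>lborel)"
    proof (rule nn_integral_cong)
      fix x
      show "ennreal (d1 x) * indicator {..<- a} x = 0"
      proof (cases "x < - a")
        case True
        then have "x < 0" "x + a < 0" using a by auto
        then show ?thesis by (simp add: d1_def sup0)
      qed simp
    qed
    finally have "emeasure \<mu> {..<- a} = 0" by simp
    then show "AE x in \<mu>. - a \<le> x" by (intro AE_I[where N="{..<- a}"]) (auto simp: s\<mu>)
    show "AE x in density lborel (\<lambda>x. ennreal (d2 x)). - a \<le> x"
    proof (subst AE_density, simp, rule AE_I2, rule impI, rule ccontr)
      fix x assume "0 < ennreal (d2 x)" "\<not> - a \<le> x"
      then have "x < 0" "x + a < 0" using a by auto
      then have "d2 x = 0" by (simp add: d2_def sup0)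
      with \<open>0 < ennreal (d2 x)\<close> show False by simp
    qed
  next
    fix l assume l: "\<phi> < l"
    define p n where "p = (\<integral>x. exp (- l * x) * Wp x \<partial>lborel)" and "n = (\<integral>x. exp (- l * x) * Wn x \<partial>lborel)"
    have pn: "0 \<le> p" "0 \<le> n" using nonneg by (auto simp: p_def n_def intro!: Bochner_Integration.integral_nonneg)
    have e1: "(\<integral>\<^sup>+x. exp (- l * x) \<partial>density lborel (\<lambda>x. ennreal (d1 x))) = ennreal (p + h * (exp (l * a) * n))"
      using mix[of 1 h Wp Wn l] h nonneg intp[OF l] intn[OF l] by (simp add: d1_def p_def n_def)
    have e2: "(\<integral>\<^sup>+x. exp (- l * x) \<partial>density lborel (\<lambda>x. ennreal (d2 x))) = ennreal (n + h * (exp (l * a) * p))"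
      using mix[of 1 h Wn Wp l] h nonneg intp[OF l] intn[OF l] by (simp add: d2_def p_def n_def add.commute)
    have "(\<integral>\<^sup>+x. exp (- l * x) \<partial>\<mu>) = ennreal ((h * exp (l * a) - 1) / \<psi> l) + ennreal (p + h * (exp (l * a) * n))"
      using \<mu>[of "\<lambda>x. ennreal (exp (- l * x))"] K_laplace(1)[OF a l] e1 by (simp add: h_def)
    also have "\<dots> = ennreal ((h * exp (l * a) - 1) / \<psi> l + (p + h * (exp (l * a) * n)))"
      using K_laplace(2)[OF a l] \<psi>_pos[OF l] pn h by (intro ennreal_plus[symmetric]) (auto simp: h_def)
    also have "(h * exp (l * a) - 1) / \<psi> l = (h * exp (l * a) - 1) * (p - n)"
      using diff[OF l] by (simp add: p_def n_def)
    also have "(h * exp (l * a) - 1) * (p - n) + (p + h * (exp (l * a) * n)) = n + h * (exp (l * a) * p)"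
      by (simp add: algebra_simps)
    finally have e\<mu>: "(\<integral>\<^sup>+x. exp (- l * x) \<partial>\<mu>) = ennreal (n + h * (exp (l * a) * p))" .
    show "(\<integral>\<^sup>+x. exp (- l * x) \<partial>\<mu>) < \<infinity>" unfolding e\<mu> by simp
    show "(\<integral>\<^sup>+x. exp (- l * x) \<partial>\<mu>) = (\<integral>\<^sup>+x. exp (- l * x) \<partial>density lborel (\<lambda>x. ennreal (d2 x)))"
      unfolding e\<mu> e2 ..
  qed (simp_all add: s\<mu>)
  then have "AE x in lborel. d1 x \<le> d2 x"
  proof (intro density_le_imp_AE_le d0)
    fix A :: "real set" assume [measurable]: "A \<in> sets borel"
    have "(\<integral>\<^sup>+x. ennreal (d1 x) * indicator A x \<partial>lborel) = (\<integral>\<^sup>+x. indicator A x \<partial>density lborel (\<lambda>x. ennreal (d1 x)))"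
      by (rule nn_integral_density[symmetric]) auto
    also have "\<dots> \<le> (\<integral>\<^sup>+x. indicator A x \<partial>\<mu>)" by (subst \<mu>) auto
    also have "\<dots> = (\<integral>\<^sup>+x. ennreal (d2 x) * indicator A x \<partial>lborel)"
      unfolding \<open>\<mu> = density lborel (\<lambda>x. ennreal (d2 x))\<close> by (rule nn_integral_density) auto
    finally show "(\<integral>\<^sup>+x. ennreal (d1 x) * indicator A x \<partial>lborel) \<le> (\<integral>\<^sup>+x. ennreal (d2 x) * indicator A x \<partial>lborel)" .
  qed simp_all
  then have AE: "AE x in lborel. W x \<le> h * W (x + a)"
  proof eventually_elim
    case (elim x)
    then have "Wp x - Wn x \<le> h * (Wp (x + a) - Wn (x + a))" by (simp add: d1_def d2_def algebra_simps)
    then show ?case by (simp only: Wpn)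
  qed
  \<comment> \<open>From almost every to every point: \<open>W\<close> is right-continuous
    everywhere, also at 0, where it may jump, so points to the right of \<open>x\<close>
    suffice.\<close>
  have "\<exists>z. x < z \<and> z < x + 1 / real (Suc n) \<and> W z \<le> h * W (z + a)" for n
    using AE_lborel_dense[OF AE, of x "x + 1 / real (Suc n)"] by simp
  then obtain z where z: "\<And>n. x < z n" "\<And>n. z n < x + 1 / real (Suc n)" "\<And>n. W (z n) \<le> h * W (z n + a)" by metis
  have zx: "z \<longlonglongrightarrow> x"
  proof (rule real_tendsto_sandwich)
    show "\<forall>\<^sub>F n in sequentially. x \<le> z n" by (intro always_eventually allI less_imp_le z(1))
    show "\<forall>\<^sub>F n in sequentially. z n \<le> x + 1 / real (Suc n)" by (intro always_eventually allI less_imp_le z(2))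
    show "(\<lambda>n. x + 1 / real (Suc n)) \<longlonglongrightarrow> x" using tendsto_add[OF tendsto_const LIMSEQ_Suc[OF lim_1_over_n], of x] by simp
  qed (rule tendsto_const)
  have "(\<lambda>n. W (z n)) \<longlonglongrightarrow> W x" by (rule W_right_cont[OF zx less_imp_le[OF z(1)]])
  moreover have "(\<lambda>n. h * W (z n + a)) \<longlonglongrightarrow> h * W (x + a)"
    using z(1) by (intro tendsto_intros W_right_cont zx) (simp add: less_imp_le)
  ultimately show ?thesis unfolding h_def[symmetric] by (rule LIMSEQ_le) (use z(3) in auto)
qed

text \<open>Growth started from \<open>- 1\<close>, where \<open>W\<close> vanishes.\<close>

lemma W_nonneg: "0 \<le> W x"
proof (cases "x < 0")
  case False
  have "W (- 1) \<le> exp (- \<phi> * (x + 1)) * W (- 1 + (x + 1))" using False by (intro W_growth) simp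
  then show ?thesis by (simp add: W_neg zero_le_mult_iff)
qed (simp add: W_neg)

lemma nn_integral_laplace_W:
  assumes "\<phi> < l" shows "(\<integral>\<^sup>+x. ennreal (exp (- l * x) * W x) \<partial>lborel) = ennreal (1 / \<psi> l)"
proof -
  have "(\<integral>\<^sup>+x. ennreal (exp (- l * x) * W x) \<partial>lborel) = (\<integral>\<^sup>+x. ennreal (indicator {0..} x *\<^sub>R (exp (- l * x) * W x)) \<partial>lborel)"
    by (intro nn_integral_cong) (auto simp: indicator_def W_neg)
  also have "\<dots> = ennreal (LBINT x:{0..}. exp (- l * x) * W x)"
    unfolding set_lebesgue_integral_def
    by (rule nn_integral_eq_integral) (use W_laplace(1)[OF assms] W_nonneg in \<open>auto simp: set_integrable_def\<close>)
  finally show ?thesis using W_laplace(2)[OF assms] by simp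
qed

text \<open>By \<open>W_growth\<close> the candidate density is nonnegative. The transform of
  \<open>W\<close> is added on both sides and cancelled at the end, which avoids subtracting in
  \<open>ennreal\<close>.\<close>

lemma K_density:
  assumes a: "0 \<le> a" shows "K a = density lborel (\<lambda>x. ennreal (exp (- \<phi> * a) * W (x + a) - W x))"
proof (rule measure_eqI_laplace[where c="- a" and ?l0.0=\<phi>])
  show "AE x in K a. - a \<le> x" by (rule AE_K)
  show "AE x in density lborel (\<lambda>x. ennreal (exp (- \<phi> * a) * W (x + a) - W x)). - a \<le> x"
  proof (subst AE_density, simp, rule AE_I2, rule impI, rule ccontr)
    fix x assume "0 < ennreal (exp (- \<phi> * a) * W (x + a) - W x)" "\<not> - a \<le> x"
    then have "x < 0" "x + a < 0" using a by auto
    then have "exp (- \<phi> * a) * W (x + a) - W x = 0" by (simp add: W_neg)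
    with \<open>0 < ennreal (exp (- \<phi> * a) * W (x + a) - W x)\<close> show False by simp
  qed
  fix l assume l: "\<phi> < l"
  note psi = \<psi>_pos[OF l] and k = K_laplace[OF a l]
  define D where "D = (\<integral>\<^sup>+x. exp (- l * x) \<partial>density lborel (\<lambda>x. ennreal (exp (- \<phi> * a) * W (x + a) - W x)))"
  show "(\<integral>\<^sup>+x. exp (- l * x) \<partial>K a) < \<infinity>" unfolding k by simp
  have "D + ennreal (1 / \<psi> l) = (\<integral>\<^sup>+x. ennreal (exp (- \<phi> * a) * W (x + a) - W x) * ennreal (exp (- l * x)) \<partial>lborel) + (\<integral>\<^sup>+x. ennreal (exp (- l * x) * W x) \<partial>lborel)"
    unfolding nn_integral_laplace_W[OF l] D_def by (subst nn_integral_density) auto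
  also have "\<dots> = (\<integral>\<^sup>+x. ennreal (exp (- \<phi> * a) * W (x + a) - W x) * ennreal (exp (- l * x)) + ennreal (exp (- l * x) * W x) \<partial>lborel)"
    by (rule nn_integral_add[symmetric]) auto
  also have "\<dots> = (\<integral>\<^sup>+x. ennreal (exp (- \<phi> * a)) * ennreal (exp (- l * x) * W (x + a)) \<partial>lborel)"
  proof (rule nn_integral_cong)
    fix x
    have "ennreal (exp (- \<phi> * a) * W (x + a) - W x) * ennreal (exp (- l * x)) + ennreal (exp (- l * x) * W x) =
      ennreal ((exp (- \<phi> * a) * W (x + a) - W x) * exp (- l * x) + exp (- l * x) * W x)"
      using W_growth[OF a, of x] W_nonneg by (simp add: ennreal_mult'[symmetric] ennreal_plus[symmetric] del: ennreal_plus)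
    also have "\<dots> = ennreal (exp (- \<phi> * a)) * ennreal (exp (- l * x) * W (x + a))"
      using W_nonneg by (simp add: ennreal_mult'[symmetric] algebra_simps)
    finally show "ennreal (exp (- \<phi> * a) * W (x + a) - W x) * ennreal (exp (- l * x)) + ennreal (exp (- l * x) * W x) =
      ennreal (exp (- \<phi> * a)) * ennreal (exp (- l * x) * W (x + a))" .
  qed
  also have "\<dots> = ennreal (exp (- \<phi> * a)) * (ennreal (exp (l * a)) * ennreal (1 / \<psi> l))"
    by (subst nn_integral_cmult, simp, subst nn_integral_exp_shift) (auto simp: W_nonneg nn_integral_laplace_W[OF l, simplified])
  also have "\<dots> = ennreal (exp (- \<phi> * a) * exp (l * a) / \<psi> l)"
    using psi by (simp add: ennreal_mult'[symmetric] mult.assoc[symmetric])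
  also have "\<dots> = ennreal ((exp (- \<phi> * a) * exp (l * a) - 1) / \<psi> l) + ennreal (1 / \<psi> l)"
  proof -
    have "exp (- \<phi> * a) * exp (l * a) / \<psi> l = (exp (- \<phi> * a) * exp (l * a) - 1) / \<psi> l + 1 / \<psi> l"
      by (simp add: diff_divide_distrib)
    moreover have "0 \<le> (exp (- \<phi> * a) * exp (l * a) - 1) / \<psi> l"
      using psi k(2) by (intro divide_nonneg_pos) auto
    ultimately show ?thesis using psi by (simp only: ennreal_plus less_imp_le zero_le_divide_1_iff)
  qed
  finally have "D = ennreal ((exp (- \<phi> * a) * exp (l * a) - 1) / \<psi> l)" by simp
  then show "(\<integral>\<^sup>+x. exp (- l * x) \<partial>K a) = (\<integral>\<^sup>+x. exp (- l * x) \<partial>density lborel (\<lambda>x. ennreal (exp (- \<phi> * a) * W (x + a) - W x)))"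
    unfolding k D_def by simp
qed (simp_all add: sets_K)

text \<open>The exponential tilt that makes \<open>W\<close> monotone. Its transform is
  \<open>1 / \<psi> (\<phi> + l)\<close>, so it is the scale function for the shifted exponent
  \<open>\<psi> (\<phi> + l)\<close>, whose right derivative at 0 is
  \<open>\<kappa>\<close>.\<close>

definition g :: "real \<Rightarrow> real" where "g x = exp (- \<phi> * x) * W x"

lemma g_mono: "x \<le> y \<Longrightarrow> g x \<le> g y"
proof -
  assume "x \<le> y"
  then have "exp (- \<phi> * x) * W x \<le> exp (- \<phi> * x) * (exp (- \<phi> * (y - x)) * W (x + (y - x)))"
    by (intro mult_left_mono W_growth) auto
  also have "\<dots> = exp (- \<phi> * y) * W y"
  proof -
    have "exp (- \<phi> * x) * exp (- \<phi> * (y - x)) = exp (- \<phi> * y)"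
      unfolding exp_add[symmetric] by (simp add: right_diff_distrib)
    then show ?thesis by (simp add: mult.assoc[symmetric])
  qed
  finally show "g x \<le> g y" by (simp add: g_def)
qed

lemma W_eq_g: "W x = exp (\<phi> * x) * g x"
  by (simp add: g_def mult.assoc[symmetric] exp_add[symmetric])

lemma W_tilt: "exp (- \<phi> * y) * W (x + y) = exp (\<phi> * x) * g (x + y)"
proof -
  have "exp (\<phi> * x) * exp (- \<phi> * (x + y)) = exp (- \<phi> * y)"
    unfolding exp_add[symmetric] by (simp add: distrib_left)
  then show ?thesis by (simp add: g_def mult.assoc[symmetric])
qed

lemma g_nonneg: "0 \<le> g x"
  by (simp add: g_def W_nonneg)

lemma g_laplace:
  assumes l: "0 < l"
  shows "(\<integral>\<^sup>+x. ennreal (exp (- l * x) * g x) \<partial>lborel) = ennreal (1 / \<psi> (\<phi> + l))"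
proof -
  have "exp (- l * x) * g x = exp (- (\<phi> + l) * x) * W x" for x
  proof -
    have "exp (- l * x) * exp (- \<phi> * x) = exp (- (\<phi> + l) * x)"
      unfolding exp_add[symmetric] by (simp add: algebra_simps)
    then show ?thesis by (simp add: g_def mult.assoc[symmetric])
  qed
  then show ?thesis using nn_integral_laplace_W[of "\<phi> + l"] l by simp
qed

lemma nn_integral_exp_tail:
  assumes l: "0 < (l::real)"
  shows "(\<integral>\<^sup>+x. ennreal (exp (- l * x) * indicator {z..} x) \<partial>lborel) = ennreal (exp (- l * z) / l)"
proof -
  have "(\<integral>\<^sup>+x. ennreal (exp (- l * x)) * indicator {z..} x \<partial>lborel) = ennreal (0 - (- exp (- l * z) / l))"
  proof (rule nn_integral_FTC_atLeast)
    show "((\<lambda>x. - exp (- l * x) / l) has_real_derivative exp (- l * x)) (at x)" for x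
      using l by (auto intro!: derivative_eq_intros)
    have "((\<lambda>x. exp (- l * x)) \<longlongrightarrow> 0) at_top"
      using l by (intro filterlim_compose[OF exp_at_bot] filterlim_tendsto_neg_mult_at_bot[OF tendsto_const _ filterlim_ident]) auto
    then show "((\<lambda>x. - exp (- l * x) / l) \<longlongrightarrow> 0) at_top"
      using tendsto_divide[OF tendsto_minus tendsto_const, of "\<lambda>x. exp (- l * x)" 0 at_top l] l by simp
  qed auto
  then show ?thesis by (simp add: ennreal_mult' ennreal_indicator)
qed

lemma ratio_tendsto: "((\<lambda>l. l / \<psi> (\<phi> + l)) \<longlongrightarrow> 1 / \<kappa>) (at_right 0)"
  using tendsto_inverse[OF \<kappa>_lim] \<kappa>_pos by (simp add: inverse_eq_divide)

text \<open>An elementary Tauberian comparison: by monotonicity the transform of \<open>g\<close> at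
  \<open>l\<close> is at least \<open>g z * exp (- l * z) / l\<close>, and \<open>l\<close> times
  the transform tends to \<open>1 / \<kappa>\<close> as \<open>l\<close> decreases to 0.\<close>

lemma g_le: "g z \<le> 1 / \<kappa>"
proof -
  have "\<forall>\<^sub>F l in at_right 0. g z * exp (- l * z) \<le> l / \<psi> (\<phi> + l)"
    unfolding eventually_at_right_field
  proof (intro exI[of _ 1] conjI allI impI)
    fix l :: real assume l: "0 < l"
    have "ennreal (g z) * ennreal (exp (- l * z) / l) = (\<integral>\<^sup>+x. ennreal (g z) * ennreal (exp (- l * x) * indicator {z..} x) \<partial>lborel)"
      unfolding nn_integral_exp_tail[OF l, symmetric] by (rule nn_integral_cmult[symmetric]) simp
    also have "\<dots> \<le> (\<integral>\<^sup>+x. ennreal (exp (- l * x) * g x) \<partial>lborel)"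
      using g_mono[of z] g_nonneg
      by (intro nn_integral_mono) (auto simp: indicator_def ennreal_mult'[symmetric] mult.commute intro!: ennreal_leI)
    also have "\<dots> = ennreal (1 / \<psi> (\<phi> + l))" by (rule g_laplace[OF l])
    finally have "ennreal (g z * (exp (- l * z) / l)) \<le> ennreal (1 / \<psi> (\<phi> + l))"
      unfolding ennreal_mult'[OF g_nonneg] .
    then have "g z * (exp (- l * z) / l) \<le> 1 / \<psi> (\<phi> + l)"
      using \<psi>_pos[of "\<phi> + l"] l by (subst (asm) ennreal_le_iff) auto
    then show "g z * exp (- l * z) \<le> l / \<psi> (\<phi> + l)" using l by (simp add: field_simps)
  qed simp
  moreover have "((\<lambda>l. g z * exp (- l * z)) \<longlongrightarrow> g z * exp (- 0 * z)) (at_right 0)"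
    by (intro tendsto_intros)
  ultimately have "g z * exp (- 0 * z) \<le> 1 / \<kappa>" by (intro tendsto_le[OF _ ratio_tendsto]) auto
  then show ?thesis by simp
qed

text \<open>The reverse comparison: a bound \<open>c\<close> on \<open>g\<close> bounds the
  transform by \<open>c / l\<close>, so \<open>1 / \<kappa> \<le> c\<close> for the limit
  \<open>c\<close> of the increasing values.\<close>

lemma g_tendsto: "(\<lambda>n. g (x + real n)) \<longlonglongrightarrow> 1 / \<kappa>"
proof -
  have inc: "incseq (\<lambda>n. g (x + real n))" by (auto simp: incseq_def intro!: g_mono)
  have bd: "\<forall>n. g (x + real n) \<le> 1 / \<kappa>" using g_le by simp
  obtain c where c: "(\<lambda>n. g (x + real n)) \<longlonglongrightarrow> c" "\<forall>n. g (x + real n) \<le> c"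
    by (rule incseq_convergent[OF inc bd])
  have gc: "g z \<le> c" for z
  proof -
    obtain n :: nat where "z - x \<le> real n" using real_arch_simple by blast
    then have "g z \<le> g (x + real n)" by (intro g_mono) simp
    then show ?thesis using c(2)[rule_format, of n] by simp
  qed
  have c0: "0 \<le> c" using gc[of 0] g_nonneg[of 0] by linarith
  have "\<forall>\<^sub>F l in at_right 0. l / \<psi> (\<phi> + l) \<le> c"
    unfolding eventually_at_right_field
  proof (intro exI[of _ 1] conjI allI impI)
    fix l :: real assume l: "0 < l"
    have "ennreal (1 / \<psi> (\<phi> + l)) = (\<integral>\<^sup>+x. ennreal (exp (- l * x) * g x) \<partial>lborel)" by (rule g_laplace[OF l, symmetric])
    also have "\<dots> \<le> (\<integral>\<^sup>+x. ennreal c * ennreal (exp (- l * x) * indicator {0..} x) \<partial>lborel)"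
      using gc c0 W_neg
      by (intro nn_integral_mono) (auto simp: indicator_def ennreal_mult'[symmetric] mult.commute g_def not_le intro!: ennreal_leI)
    also have "\<dots> = ennreal c * ennreal (exp (- l * 0) / l)"
      unfolding nn_integral_exp_tail[OF l, symmetric] by (rule nn_integral_cmult) simp
    finally have "ennreal (1 / \<psi> (\<phi> + l)) \<le> ennreal (c / l)" using c0 by (simp add: ennreal_mult'[symmetric])
    then have "1 / \<psi> (\<phi> + l) \<le> c / l" using c0 l by (subst (asm) ennreal_le_iff) auto
    then show "l / \<psi> (\<phi> + l) \<le> c" using l by (simp add: field_simps)
  qed simp
  then have "1 / \<kappa> \<le> c" by (intro tendsto_upperbound[OF ratio_tendsto]) auto
  moreover have "c \<le> 1 / \<kappa>" by (rule LIMSEQ_le_const2[OF c(1)]) (use g_le in auto)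
  ultimately show ?thesis using c(1) by simp
qed

lemma W_le: "W x \<le> exp (\<phi> * x) / \<kappa>"
  using mult_left_mono[OF g_le[of x], of "exp (\<phi> * x)"] by (simp add: W_eq_g)

text \<open>The passage level tends to infinity: by \<open>below_exists\<close> every time is
  eventually counted, and the density \<open>exp (\<phi> * x) * g (x + n) - W x\<close> increases to
  the stated one by \<open>g_tendsto\<close>.\<close>

theorem potential_density:
  assumes [measurable]: "f \<in> borel_measurable borel"
  shows "(\<integral>\<^sup>+\<omega>. \<integral>\<^sup>+s. indicator {0<..} s * f (- Y s \<omega>) \<partial>lborel \<partial>M) = (\<integral>\<^sup>+x. f x * ennreal (exp (\<phi> * x) / \<kappa> - W x) \<partial>lborel)"
proof -
  have bm: "below (real m) s \<omega> \<Longrightarrow> below (real n) s \<omega>" if "m \<le> n" for m n s \<omega>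
    using that by (force simp: below_def)
  have b1: "(SUP n. indicator {0<..} s * of_bool (below (real n) s \<omega>) * f (- Y s \<omega>)) = indicator {0<..} s * f (- Y s \<omega>)" for s \<omega>
  proof (rule antisym)
    show "(SUP n. indicator {0<..} s * of_bool (below (real n) s \<omega>) * f (- Y s \<omega>)) \<le> indicator {0<..} s * f (- Y s \<omega>)"
      by (rule SUP_least) auto
    obtain n where "below (real n) s \<omega>" using below_exists by blast
    then have "indicator {0<..} s * f (- Y s \<omega>) \<le> indicator {0<..} s * of_bool (below (real n) s \<omega>) * f (- Y s \<omega>)" by simp
    then show "indicator {0<..} s * f (- Y s \<omega>) \<le> (SUP n. indicator {0<..} s * of_bool (below (real n) s \<omega>) * f (- Y s \<omega>))"
      by (rule order_trans) (rule SUP_upper, simp)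
  qed
  have im: "indicator {0<..} s * of_bool (below (real m) s \<omega>) * f (- Y s \<omega>) \<le> indicator {0<..} s * of_bool (below (real n) s \<omega>) * f (- Y s \<omega>)"
    if "m \<le> n" for m n s \<omega>
    using bm[OF that] by (cases "below (real m) s \<omega>") auto
  have "(\<integral>\<^sup>+\<omega>. \<integral>\<^sup>+s. indicator {0<..} s * f (- Y s \<omega>) \<partial>lborel \<partial>M) =
    (\<integral>\<^sup>+\<omega>. \<integral>\<^sup>+s. (SUP n. indicator {0<..} s * of_bool (below (real n) s \<omega>) * f (- Y s \<omega>)) \<partial>lborel \<partial>M)"
    unfolding b1 ..
  also have "\<dots> = (\<integral>\<^sup>+\<omega>. (SUP n. \<integral>\<^sup>+s. indicator {0<..} s * of_bool (below (real n) s \<omega>) * f (- Y s \<omega>) \<partial>lborel) \<partial>M)"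
  proof (rule nn_integral_cong, rule nn_integral_monotone_convergence_SUP)
    fix \<omega>
    show "incseq (\<lambda>n s. indicator {0<..} s * of_bool (below (real n) s \<omega>) * f (- Y s \<omega>))"
      unfolding incseq_def le_fun_def by (intro allI impI im)
  qed simp
  also have "\<dots> = (SUP n. \<integral>\<^sup>+\<omega>. \<integral>\<^sup>+s. indicator {0<..} s * of_bool (below (real n) s \<omega>) * f (- Y s \<omega>) \<partial>lborel \<partial>M)"
  proof (rule nn_integral_monotone_convergence_SUP)
    show "incseq (\<lambda>n \<omega>. \<integral>\<^sup>+s. indicator {0<..} s * of_bool (below (real n) s \<omega>) * f (- Y s \<omega>) \<partial>lborel)"
      unfolding incseq_def le_fun_def by (intro allI impI nn_integral_mono im)
  qed measurable
  also have "\<dots> = (SUP n. \<integral>\<^sup>+x. f x \<partial>K (real n))" by (simp add: nn_integral_K(1))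
  also have "\<dots> = (SUP n. \<integral>\<^sup>+x. f x * ennreal (exp (- \<phi> * real n) * W (x + real n) - W x) \<partial>lborel)"
    by (subst K_density, simp, subst nn_integral_density) (simp_all add: mult.commute)
  also have "\<dots> = (SUP n. \<integral>\<^sup>+x. f x * ennreal (exp (\<phi> * x) * g (x + real n) - W x) \<partial>lborel)"
    by (simp only: W_tilt)
  also have "\<dots> = (\<integral>\<^sup>+x. (SUP n. f x * ennreal (exp (\<phi> * x) * g (x + real n) - W x)) \<partial>lborel)"
  proof (rule nn_integral_monotone_convergence_SUP[symmetric])
    show "incseq (\<lambda>n x. f x * ennreal (exp (\<phi> * x) * g (x + real n) - W x))"
      by (auto simp: incseq_def le_fun_def intro!: mult_left_mono ennreal_leI g_mono)
  qed (simp add: g_def)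
  also have "\<dots> = (\<integral>\<^sup>+x. f x * ennreal (exp (\<phi> * x) / \<kappa> - W x) \<partial>lborel)"
  proof (rule nn_integral_cong)
    fix x
    have "(SUP n. ennreal (exp (\<phi> * x) * g (x + real n) - W x)) = ennreal (exp (\<phi> * x) / \<kappa> - W x)"
    proof (rule LIMSEQ_unique)
      show "(\<lambda>n. ennreal (exp (\<phi> * x) * g (x + real n) - W x)) \<longlonglongrightarrow> (SUP n. ennreal (exp (\<phi> * x) * g (x + real n) - W x))"
        by (rule LIMSEQ_SUP) (auto simp: incseq_def intro!: ennreal_leI mult_left_mono g_mono)
      have "(\<lambda>n. ennreal (exp (\<phi> * x) * g (x + real n) - W x)) \<longlonglongrightarrow> ennreal (exp (\<phi> * x) * (1 / \<kappa>) - W x)"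
        by (intro tendsto_ennrealI tendsto_intros g_tendsto)
      then show "(\<lambda>n. ennreal (exp (\<phi> * x) * g (x + real n) - W x)) \<longlonglongrightarrow> ennreal (exp (\<phi> * x) / \<kappa> - W x)" by simp
    qed
    then show "(SUP n. f x * ennreal (exp (\<phi> * x) * g (x + real n) - W x)) = f x * ennreal (exp (\<phi> * x) / \<kappa> - W x)"
      by (simp add: SUP_mult_left_ennreal[symmetric])
  qed
  finally show ?thesis .
qed

end

section \<open>Additive functionals\<close>

lemma integrable_indicator_Ioc: "integrable lborel (\<lambda>u. indicator {s<..t::real} u * c :: real)"
  by (cases "s \<le> t") (auto intro!: integrable_mult_left integrable_real_indicator)

text \<open>The integrand is only measurable, so the fundamental theorem of calculus does not apply; the
  two sides differ by a function of \<open>T\<close> whose increments are quadratically small.\<close>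

lemma one_minus_exp_integral:
  fixes r :: "real \<Rightarrow> real"
  assumes [measurable]: "r \<in> borel_measurable borel" and r: "\<And>u. 0 \<le> r u" "\<And>u. r u \<le> B" and T: "0 \<le> T"
  defines "A \<equiv> \<lambda>t. LBINT u:{0<..t}. r u"
  shows "1 - exp (- A T) = (LBINT s:{0<..T}. r s * exp (- (A T - A s)))"
    and "\<And>s t. 0 \<le> s \<Longrightarrow> s \<le> t \<Longrightarrow> A t - A s = (LBINT u:{s<..t}. r u)"
    and "A \<in> borel_measurable borel" and "\<And>s t. 0 \<le> s \<Longrightarrow> s \<le> t \<Longrightarrow> A s \<le> A t"
proof -
  have B: "0 \<le> B" using r[of 0] by linarith
  have i: "set_integrable lborel {s<..t} r" for s t
    unfolding set_integrable_def
    by (rule Bochner_Integration.integrable_bound[OF integrable_indicator_Ioc[of s t B]])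
      (use r B in \<open>auto simp: indicator_def intro!: AE_I2\<close>)
  have split: "(LBINT u:{0<..t}. f u) = (LBINT u:{0<..s}. f u) + (LBINT u:{s<..t}. f u)"
    if st: "0 \<le> s" "s \<le> t" and f: "set_integrable lborel {0<..t} f" for s t and f :: "real \<Rightarrow> real"
  proof -
    have un: "{0<..t} = {0<..s} \<union> {s<..t}" using st by auto
    show ?thesis unfolding un
      by (rule set_integral_Un) (use st in \<open>auto intro!: set_integrable_subset[OF f]\<close>)
  qed
  show Ad: "A t - A s = (LBINT u:{s<..t}. r u)" if "0 \<le> s" "s \<le> t" for s t
    unfolding A_def using split[OF that i] by simp
  have bnd: "0 \<le> (LBINT u:{s<..t}. r u)" "(LBINT u:{s<..t}. r u) \<le> B * (t - s)" if "s \<le> t" for s t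
  proof -
    show "0 \<le> (LBINT u:{s<..t}. r u)" unfolding set_lebesgue_integral_def
      using r by (intro Bochner_Integration.integral_nonneg) (auto simp: indicator_def)
    have "(LBINT u:{s<..t}. r u) \<le> (LBINT u:{s<..t}. B)"
      by (rule set_integral_mono[OF i]) (use r integrable_indicator_Ioc[of s t B] in \<open>auto simp: set_integrable_def\<close>)
    then show "(LBINT u:{s<..t}. r u) \<le> B * (t - s)" using that by (simp add: set_lebesgue_integral_def mult.commute)
  qed
  show Amono: "A s \<le> A t" if "0 \<le> s" "s \<le> t" for s t using Ad[OF that] bnd(1)[OF that(2)] by simp
  have A0: "A 0 = 0" by (simp add: A_def set_lebesgue_integral_def)
  show mA [measurable]: "A \<in> borel_measurable borel"
    unfolding A_def[abs_def] set_lebesgue_integral_def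
  proof (rule lborel.borel_measurable_lebesgue_integral)
    have "(\<lambda>(t, u). (if 0 < u \<and> u \<le> t then r u else 0)) \<in> borel_measurable (borel \<Otimes>\<^sub>M lborel)" by measurable
    also have "(\<lambda>(t, u). (if 0 < u \<and> u \<le> t then r u else 0)) = (\<lambda>(t, u). indicator {0<..t} u *\<^sub>R r u)"
      by (auto simp: indicator_def fun_eq_iff)
    finally show "(\<lambda>(t, u). indicator {0<..t} u *\<^sub>R r u) \<in> borel_measurable (borel \<Otimes>\<^sub>M lborel)" .
  qed
  define b where "b s = r s * exp (A s)" for s
  have ib: "set_integrable lborel {s<..t} b" if "0 \<le> s" "t \<le> T" for s t
    unfolding set_integrable_def b_def
  proof (rule Bochner_Integration.integrable_bound[where f="\<lambda>u. indicator {s<..t} u * (B * exp (A T))"])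
    show "AE x in lborel. norm (indicator {s<..t} x *\<^sub>R (r x * exp (A x))) \<le> norm (indicator {s<..t} x * (B * exp (A T)))"
      using r B that Amono by (intro AE_I2) (auto simp: indicator_def intro!: mult_mono)
    show "integrable lborel (\<lambda>u. indicator {s<..t} u * (B * exp (A T)) :: real)"
      by (rule integrable_indicator_Ioc)
  qed simp
  define D where "D t = exp (A t) - 1 - (LBINT s:{0<..t}. b s)" for t
  \<comment> \<open>The step error is at most \<open>exp (A s + a) * a\<^sup>2\<close>, where
    \<open>a \<le> B * (t - s)\<close> and both \<open>A s\<close> and \<open>a\<close> are at most
    \<open>A T\<close>.\<close>
  define C where "C = exp (2 * A T) * B\<^sup>2"
  have Dstep: "\<bar>D t - D s\<bar> \<le> C * (t - s)\<^sup>2" if st: "0 \<le> s" "s \<le> t" "t \<le> T" for s t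
  proof -
    define a where "a = A t - A s"
    have a: "0 \<le> a" "a \<le> B * (t - s)" "a \<le> A T"
      using bnd[OF st(2)] Ad[OF st(1,2)] Amono[OF _ st(3)] Amono[OF order_refl st(1)] st A0 by (auto simp: a_def)
    have "(LBINT u:{s<..t}. b u) \<le> (LBINT u:{s<..t}. r u * exp (A t))"
      by (rule set_integral_mono[OF ib[OF st(1,3)]]) (use i r Amono st in \<open>auto simp: b_def intro!: mult_left_mono set_integrable_mult_left\<close>)
    then have up: "(LBINT u:{s<..t}. b u) \<le> a * exp (A t)" using Ad[OF st(1,2)] by (simp add: a_def)
    have "(LBINT u:{s<..t}. r u * exp (A s)) \<le> (LBINT u:{s<..t}. b u)"
      by (rule set_integral_mono[OF _ ib[OF st(1,3)]]) (use i r Amono st in \<open>auto simp: b_def intro!: mult_left_mono set_integrable_mult_left\<close>)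
    then have lo: "a * exp (A s) \<le> (LBINT u:{s<..t}. b u)" using Ad[OF st(1,2)] by (simp add: a_def)
    have eA: "exp (A t) = exp (A s) * exp a" by (simp add: a_def exp_add[symmetric])
    have D: "D t - D s = exp (A s) * (exp a - 1) - (LBINT u:{s<..t}. b u)"
      using split[OF st(1,2) ib[OF order_refl st(3)]] by (simp add: D_def eA algebra_simps)
    have e1: "1 + a \<le> exp a" by (rule exp_ge_add_one_self)
    have e2: "exp a - 1 \<le> a * exp a"
    proof -
      have "exp a * (1 - a) \<le> exp a * exp (- a)" using exp_ge_add_one_self[of "- a"] by (intro mult_left_mono) auto
      then show ?thesis by (simp add: exp_minus algebra_simps)
    qed
    have sq: "a * (exp a - 1) \<le> a * (a * exp a)" using e2 a by (intro mult_left_mono) auto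
    have "D t - D s \<le> exp (A s) * (exp a - 1 - a)" using D lo by (simp add: algebra_simps)
    also have "\<dots> \<le> exp (A s) * (a * (a * exp a))"
      using sq e1 e2 a by (intro mult_left_mono) (auto simp: algebra_simps)
    finally have 1: "D t - D s \<le> exp (A s) * (a * (a * exp a))" .
    have "- (D t - D s) \<le> exp (A s) * (a * exp a - (exp a - 1))" using D up unfolding eA by (simp add: algebra_simps)
    also have "\<dots> \<le> exp (A s) * (a * (a * exp a))"
    proof (rule mult_left_mono)
      show "a * exp a - (exp a - 1) \<le> a * (a * exp a)"
        using sq e1 unfolding right_diff_distrib by linarith
    qed simp
    finally have 2: "- (D t - D s) \<le> exp (A s) * (a * (a * exp a))" .
    have "exp (A s) * (a * (a * exp a)) = exp (A s + a) * a\<^sup>2" by (simp add: exp_add power2_eq_square algebra_simps)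
    also have "\<dots> \<le> exp (2 * A T) * (B * (t - s))\<^sup>2"
      using a Amono[OF _ order_trans[OF st(2,3)]] st Amono[of 0 s] A0 Amono[of s T]
      by (intro mult_mono power_mono) auto
    also have "\<dots> = C * (t - s)\<^sup>2" by (simp add: C_def power_mult_distrib)
    finally show ?thesis using 1 2 by linarith
  qed
  have "\<bar>D T\<bar> \<le> C * T\<^sup>2 / real (Suc n)" for n
  proof -
    define N where "N = Suc n"
    define t where "t k = real k * (T / real N)" for k
    have tk: "0 \<le> t k" "t k \<le> t (Suc k)" "t (Suc k) - t k = T / real N" for k
      using T by (auto simp: t_def algebra_simps add_divide_distrib)
    have tT: "t k \<le> T" if "k \<le> N" for k
      using that T mult_right_mono[of "real k" "real N" "T / real N"] by (simp add: t_def N_def)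
    have D0: "D 0 = 0" by (simp add: D_def A0 set_lebesgue_integral_def)
    have "\<bar>D (t k)\<bar> \<le> real k * (C * (T / real N)\<^sup>2)" if "k \<le> N" for k
      using that
    proof (induction k)
      case (Suc k)
      have "\<bar>D (t (Suc k)) - D (t k)\<bar> \<le> C * (T / real N)\<^sup>2"
        using Dstep[OF tk(1,2) tT[OF Suc.prems]] unfolding tk(3) .
      then show ?case using Suc by (simp add: algebra_simps)
    qed (simp add: t_def D0)
    from this[of N] have "\<bar>D T\<bar> \<le> real N * (C * (T / real N)\<^sup>2)" by (simp add: t_def N_def)
    also have "\<dots> = C * T\<^sup>2 / real N" by (simp add: power2_eq_square N_def)
    finally show ?thesis by (simp add: N_def)
  qed
  moreover have "(\<lambda>n. C * T\<^sup>2 / real (Suc n)) \<longlonglongrightarrow> 0"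
    using tendsto_mult[OF tendsto_const LIMSEQ_Suc[OF lim_1_over_n], of "C * T\<^sup>2"] by simp
  ultimately have "\<bar>D T\<bar> \<le> 0" by (intro LIMSEQ_le_const) auto
  then have "exp (A T) - 1 = (LBINT s:{0<..T}. b s)" by (simp add: D_def)
  then have "1 - exp (- A T) = exp (- A T) * (LBINT s:{0<..T}. b s)"
    by (metis exp_minus_inverse mult.commute mult.right_neutral right_diff_distrib)
  also have "\<dots> = (LBINT s:{0<..T}. exp (- A T) * b s)" by simp
  also have "\<dots> = (LBINT s:{0<..T}. r s * exp (- (A T - A s)))"
    by (intro set_lebesgue_integral_cong) (auto simp: b_def exp_diff exp_minus field_simps)
  finally show "1 - exp (- A T) = (LBINT s:{0<..T}. r s * exp (- (A T - A s)))" .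
qed

section \<open>The Markov property of additive functionals\<close>

context regular_levy
begin

text \<open>What accumulates between times \<open>s\<close> and \<open>s + T\<close> along the one
  path \<open>x + Y\<close>: the parameter \<open>s\<close> shifts the clock, the path is not
  restarted.\<close>

definition additive :: "(real \<Rightarrow> real) \<Rightarrow> real \<Rightarrow> real \<Rightarrow> real \<Rightarrow> 'a \<Rightarrow> real" where
  "additive r T s x \<omega> = (LBINT u:{0<..T}. r (x + Y (s + u) \<omega>))"

definition survival :: "(real \<Rightarrow> real) \<Rightarrow> real \<Rightarrow> real \<Rightarrow> ennreal" where
  "survival r T x = (\<integral>\<^sup>+\<omega>. exp (- additive r T 0 x \<omega>) \<partial>M)"

definition rate :: "real \<Rightarrow> (real \<Rightarrow> real) \<Rightarrow> bool" where
  "rate B r \<longleftrightarrow> r \<in> borel_measurable borel \<and> (\<forall>y. 0 \<le> r y \<and> r y \<le> B)"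

lemma rate_measurable: "rate B r \<Longrightarrow> r \<in> borel_measurable borel"
  by (simp add: rate_def)

lemma additive_measurable:
  assumes r: "rate B r" and [measurable]: "f \<in> borel_measurable N" "t \<in> borel_measurable N" "w \<in> measurable N M"
  shows "(\<lambda>p. additive r T (t p) (f p) (w p)) \<in> borel_measurable N"
proof -
  note [measurable] = rate_measurable[OF r]
  have "(\<lambda>p. LBINT u. indicator {0<..T} u *\<^sub>R r (f p + Y (t p + u) (w p))) \<in> borel_measurable N"
    by (rule lborel.borel_measurable_lebesgue_integral) measurable
  then show ?thesis by (simp add: additive_def set_lebesgue_integral_def)
qed

lemma additive_nonneg: "rate B r \<Longrightarrow> 0 \<le> additive r T s x \<omega>"
  unfolding additive_def set_lebesgue_integral_def rate_def
  by (intro Bochner_Integration.integral_nonneg) (auto simp: indicator_def)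

lemma survival_measurable: assumes r: "rate B r" shows "survival r T \<in> borel_measurable borel"
proof -
  note [measurable] = additive_measurable[OF r]
  have "(\<lambda>x. \<integral>\<^sup>+\<omega>. exp (- additive r T 0 x \<omega>) \<partial>M) \<in> borel_measurable borel"
    by (rule borel_measurable_nn_integral) measurable
  then show ?thesis by (simp add: survival_def[abs_def])
qed

lemma survival_le_1: assumes r: "rate B r" shows "survival r T x \<le> 1"
proof -
  have "survival r T x \<le> (\<integral>\<^sup>+\<omega>. 1 \<partial>M)" unfolding survival_def
    using additive_nonneg[OF r] by (intro nn_integral_mono) (simp add: ennreal_le_1)
  then show ?thesis by (simp add: emeasure_space_1)
qed

text \<open>A property of the rate \<open>r\<close>, so that it can be carried from continuous rates
  to indicators by limits. The bound \<open>c\<close> on the test function \<open>G\<close> supplies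
  domination there.\<close>

definition markov :: "(real \<Rightarrow> real) \<Rightarrow> bool" where
  "markov r \<longleftrightarrow> (\<forall>T s x. \<forall>G\<in>borel_measurable borel. \<forall>c. 0 \<le> T \<longrightarrow> 0 \<le> s \<longrightarrow> c < \<infinity> \<longrightarrow> (\<forall>y. G y \<le> c) \<longrightarrow>
     (\<integral>\<^sup>+\<omega>. G (Y s \<omega>) * ennreal (exp (- additive r T s x \<omega>)) \<partial>M) = (\<integral>\<^sup>+\<omega>. G (Y s \<omega>) * survival r T (x + Y s \<omega>) \<partial>M))"

text \<open>The passage to the limit shared by two approximations: Riemann sums to the integral over
  time, and continuous rates to an indicator.\<close>

lemma markov_limit_step:
  assumes G [measurable]: "G \<in> borel_measurable borel" and c: "c < \<infinity>" "\<And>y. G y \<le> c"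
    and [measurable]: "\<And>n. (\<lambda>(x, \<omega>). D n x \<omega>) \<in> borel_measurable (borel \<Otimes>\<^sub>M M)" "(\<lambda>(x, \<omega>). L x \<omega>) \<in> borel_measurable (borel \<Otimes>\<^sub>M M)"
      "\<And>n. D' n \<in> borel_measurable M" "L' \<in> borel_measurable M"
    and D0: "\<And>n x \<omega>. 0 \<le> D n x \<omega>" "\<And>n \<omega>. 0 \<le> D' n \<omega>"
    and lim: "\<And>x \<omega>. (\<lambda>n. D n x \<omega>) \<longlonglongrightarrow> L x \<omega>" "\<And>\<omega>. (\<lambda>n. D' n \<omega>) \<longlonglongrightarrow> L' \<omega>"
    and eq: "\<And>n. (\<integral>\<^sup>+\<omega>. G (Y s \<omega>) * ennreal (exp (- D' n \<omega>)) \<partial>M) =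
      (\<integral>\<^sup>+\<omega>. G (Y s \<omega>) * (\<integral>\<^sup>+\<omega>'. exp (- D n (x + Y s \<omega>) \<omega>') \<partial>M) \<partial>M)"
  shows "(\<integral>\<^sup>+\<omega>. G (Y s \<omega>) * ennreal (exp (- L' \<omega>)) \<partial>M) =
      (\<integral>\<^sup>+\<omega>. G (Y s \<omega>) * (\<integral>\<^sup>+\<omega>'. exp (- L (x + Y s \<omega>) \<omega>') \<partial>M) \<partial>M)"
proof (rule LIMSEQ_unique)
  have cf: "(\<integral>\<^sup>+\<omega>. c \<partial>M) < \<infinity>" using c(1) by (simp add: emeasure_space_1)
  have Gf: "G y \<noteq> \<infinity>" for y using c order.strict_trans1 by (metis less_irrefl)
  have [measurable]: "(\<lambda>x. \<integral>\<^sup>+\<omega>'. exp (- D n x \<omega>') \<partial>M) \<in> borel_measurable borel" for n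
    by (rule borel_measurable_nn_integral) measurable
  have [measurable]: "(\<lambda>x. \<integral>\<^sup>+\<omega>'. exp (- L x \<omega>') \<partial>M) \<in> borel_measurable borel"
    by (rule borel_measurable_nn_integral) measurable
  have le1: "(\<integral>\<^sup>+\<omega>'. exp (- D n y \<omega>') \<partial>M) \<le> 1" for n y
  proof -
    have "(\<integral>\<^sup>+\<omega>'. exp (- D n y \<omega>') \<partial>M) \<le> (\<integral>\<^sup>+\<omega>'. 1 \<partial>M)"
      using D0(1) by (intro nn_integral_mono) (simp add: ennreal_le_1)
    then show ?thesis by (simp add: emeasure_space_1)
  qed
  show "(\<lambda>n. \<integral>\<^sup>+\<omega>. G (Y s \<omega>) * ennreal (exp (- D' n \<omega>)) \<partial>M) \<longlonglongrightarrow> (\<integral>\<^sup>+\<omega>. G (Y s \<omega>) * ennreal (exp (- L' \<omega>)) \<partial>M)"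
  proof (rule nn_integral_dominated_convergence[where w="\<lambda>_. c"])
    show "AE \<omega> in M. G (Y s \<omega>) * ennreal (exp (- D' n \<omega>)) \<le> c" for n
    proof (rule AE_I2)
      fix \<omega>
      have "G (Y s \<omega>) * ennreal (exp (- D' n \<omega>)) \<le> c * 1" by (intro mult_mono c(2)) (auto simp: D0 ennreal_le_1)
      then show "G (Y s \<omega>) * ennreal (exp (- D' n \<omega>)) \<le> c" by simp
    qed
    show "AE \<omega> in M. (\<lambda>n. G (Y s \<omega>) * ennreal (exp (- D' n \<omega>))) \<longlonglongrightarrow> G (Y s \<omega>) * ennreal (exp (- L' \<omega>))"
      using Gf by (intro AE_I2 ennreal_tendsto_cmult tendsto_ennrealI tendsto_intros lim) (auto simp: less_top)
  qed (use cf in auto)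
  have inner: "(\<lambda>n. \<integral>\<^sup>+\<omega>'. exp (- D n y \<omega>') \<partial>M) \<longlonglongrightarrow> (\<integral>\<^sup>+\<omega>'. exp (- L y \<omega>') \<partial>M)" for y
  proof (rule nn_integral_dominated_convergence[where w="\<lambda>_. 1"])
    show "AE \<omega>' in M. (\<lambda>n. ennreal (exp (- D n y \<omega>'))) \<longlonglongrightarrow> ennreal (exp (- L y \<omega>'))"
      by (intro AE_I2 tendsto_ennrealI tendsto_intros lim)
  qed (auto simp: emeasure_space_1 D0 ennreal_le_1)
  show "(\<lambda>n. \<integral>\<^sup>+\<omega>. G (Y s \<omega>) * ennreal (exp (- D' n \<omega>)) \<partial>M) \<longlonglongrightarrow>
      (\<integral>\<^sup>+\<omega>. G (Y s \<omega>) * (\<integral>\<^sup>+\<omega>'. exp (- L (x + Y s \<omega>) \<omega>') \<partial>M) \<partial>M)"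
    unfolding eq
  proof (rule nn_integral_dominated_convergence[where w="\<lambda>_. c"])
    show "AE \<omega> in M. G (Y s \<omega>) * (\<integral>\<^sup>+\<omega>'. exp (- D n (x + Y s \<omega>) \<omega>') \<partial>M) \<le> c" for n
    proof (rule AE_I2)
      fix \<omega>
      have "G (Y s \<omega>) * (\<integral>\<^sup>+\<omega>'. exp (- D n (x + Y s \<omega>) \<omega>') \<partial>M) \<le> c * 1" by (intro mult_mono c(2) le1) auto
      then show "G (Y s \<omega>) * (\<integral>\<^sup>+\<omega>'. exp (- D n (x + Y s \<omega>) \<omega>') \<partial>M) \<le> c" by simp
    qed
    show "AE \<omega> in M. (\<lambda>n. G (Y s \<omega>) * (\<integral>\<^sup>+\<omega>'. exp (- D n (x + Y s \<omega>) \<omega>') \<partial>M)) \<longlonglongrightarrow> G (Y s \<omega>) * (\<integral>\<^sup>+\<omega>'. exp (- L (x + Y s \<omega>) \<omega>') \<partial>M)"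
      using Gf by (intro AE_I2 ennreal_tendsto_cmult inner) (auto simp: less_top)
  qed (use cf in auto)
qed

lemma markov_limit:
  assumes r: "\<And>n. rate B (r n)" "rate B r'" and lim: "\<And>y. (\<lambda>n. r n y) \<longlonglongrightarrow> r' y" and mk: "\<And>n. markov (r n)"
  shows "markov r'"
  unfolding markov_def survival_def
proof (intro allI ballI impI)
  fix T s x :: real and G :: "real \<Rightarrow> ennreal" and c :: ennreal
  assume G: "G \<in> borel_measurable borel" and T: "0 \<le> T" and s: "0 \<le> s" and c: "c < \<infinity>" "\<forall>y. G y \<le> c"
  note [measurable] = rate_measurable[OF r(1)] rate_measurable[OF r(2)] additive_measurable[OF r(1)] additive_measurable[OF r(2)]
  have B: "0 \<le> B" using r(2) by (auto simp: rate_def intro: order_trans)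
  have lim': "(\<lambda>n. additive (r n) T s x \<omega>) \<longlonglongrightarrow> additive r' T s x \<omega>" for s x \<omega>
    unfolding additive_def set_lebesgue_integral_def
  proof (rule integral_dominated_convergence[where w="\<lambda>u. indicator {0<..T} u * B"])
    show "integrable lborel (\<lambda>u. indicator {0<..T} u * B :: real)"
      by (rule integrable_indicator_Ioc)
    show "AE u in lborel. (\<lambda>n. indicator {0<..T} u *\<^sub>R r n (x + Y (s + u) \<omega>)) \<longlonglongrightarrow> indicator {0<..T} u *\<^sub>R r' (x + Y (s + u) \<omega>)"
      by (intro AE_I2 tendsto_intros lim)
  qed (use r(1) B in \<open>auto simp: rate_def indicator_def\<close>)
  show "(\<integral>\<^sup>+\<omega>. G (Y s \<omega>) * ennreal (exp (- additive r' T s x \<omega>)) \<partial>M) =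
      (\<integral>\<^sup>+\<omega>. G (Y s \<omega>) * (\<integral>\<^sup>+\<omega>'. exp (- additive r' T 0 (x + Y s \<omega>) \<omega>') \<partial>M) \<partial>M)"
  proof (rule markov_limit_step[where D="\<lambda>n x \<omega>. additive (r n) T 0 x \<omega>" and D'="\<lambda>n \<omega>. additive (r n) T s x \<omega>" and c=c])
    show "(\<integral>\<^sup>+\<omega>. G (Y s \<omega>) * ennreal (exp (- additive (r n) T s x \<omega>)) \<partial>M) =
      (\<integral>\<^sup>+\<omega>. G (Y s \<omega>) * (\<integral>\<^sup>+\<omega>'. exp (- additive (r n) T 0 (x + Y s \<omega>) \<omega>') \<partial>M) \<partial>M)" for n
      using mk[of n] G T s c unfolding markov_def survival_def by blast
  qed (use G c lim' additive_nonneg[OF r(1)] in auto)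
qed

text \<open>Dyadic Riemann sums depend on \<open>Y s\<close> and finitely many increments after
  \<open>s\<close>, where \<open>markov_grid\<close> applies; they converge because \<open>r\<close>
  is continuous and the paths are right-continuous.\<close>

lemma markov_continuous:
  assumes r: "rate B r" and cont: "continuous_on UNIV r"
  shows "markov r"
  unfolding markov_def
proof (intro allI ballI impI)
  fix T s x :: real and G :: "real \<Rightarrow> ennreal" and c :: ennreal
  assume G [measurable]: "G \<in> borel_measurable borel" and T: "0 \<le> T" and s: "0 \<le> s" and c: "c < \<infinity>" "\<forall>y. G y \<le> c"
  note [measurable] = rate_measurable[OF r] additive_measurable[OF r]
  have B: "0 \<le> B" using r by (auto simp: rate_def intro: order_trans)
  show "(\<integral>\<^sup>+\<omega>. G (Y s \<omega>) * ennreal (exp (- additive r T s x \<omega>)) \<partial>M) = (\<integral>\<^sup>+\<omega>. G (Y s \<omega>) * survival r T (x + Y s \<omega>) \<partial>M)"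
  proof (cases "T = 0")
    case True
    then show ?thesis by (simp add: survival_def additive_def set_lebesgue_integral_def emeasure_space_1)
  next
    case False
    then have T0: "0 < T" using T by simp
    define \<delta> where "\<delta> n = T / 2 ^ n" for n :: nat
    have \<delta>: "0 < \<delta> n" "real (2 ^ n) * \<delta> n = T" for n using T0 by (auto simp: \<delta>_def)
    define D where "D n s x \<omega> = \<delta> n * (\<Sum>k\<in>{1..2 ^ n}. r (x + Y (s + real k * \<delta> n) \<omega>))" for n s x \<omega>
    have lim: "(\<lambda>n. D n s x \<omega>) \<longlonglongrightarrow> additive r T s x \<omega>" for s x \<omega>
    proof -
      have D: "D n s x \<omega> = (LBINT u:{0<..T}. r (x + Y (s + \<delta> n * \<lceil>u / \<delta> n\<rceil>) \<omega>))" for n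
        using integral_step_function(2)[OF \<delta>(1)[of n], where N="2 ^ n" and g="\<lambda>u. r (x + Y (s + u) \<omega>)"]
        unfolding \<delta>(2) by (simp add: D_def)
      show ?thesis unfolding D additive_def set_lebesgue_integral_def
      proof (rule integral_dominated_convergence[where w="\<lambda>u. indicator {0<..T} u * B"])
        show "integrable lborel (\<lambda>u. indicator {0<..T} u * B :: real)"
          by (rule integrable_indicator_Ioc)
        show "AE u in lborel. (\<lambda>n. indicator {0<..T} u *\<^sub>R r (x + Y (s + \<delta> n * \<lceil>u / \<delta> n\<rceil>) \<omega>)) \<longlonglongrightarrow> indicator {0<..T} u *\<^sub>R r (x + Y (s + u) \<omega>)"
        proof (rule AE_I2)
          fix u
          have "(\<lambda>n. s + \<delta> n * \<lceil>u / \<delta> n\<rceil>) \<longlonglongrightarrow> s + u"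
            unfolding \<delta>_def by (intro tendsto_intros ceiling_grid_tendsto T0)
          then have "(\<lambda>n. Y (s + \<delta> n * \<lceil>u / \<delta> n\<rceil>) \<omega>) \<longlonglongrightarrow> Y (s + u) \<omega>"
            using ceiling_grid_tendsto(2)[OF T0] by (intro Y_sequentially) (auto simp: \<delta>_def)
          then have "(\<lambda>n. r (x + Y (s + \<delta> n * \<lceil>u / \<delta> n\<rceil>) \<omega>)) \<longlonglongrightarrow> r (x + Y (s + u) \<omega>)"
            using cont by (intro continuous_on_tendsto_compose[OF cont] tendsto_intros) auto
          then show "(\<lambda>n. indicator {0<..T} u *\<^sub>R r (x + Y (s + \<delta> n * \<lceil>u / \<delta> n\<rceil>) \<omega>)) \<longlonglongrightarrow> indicator {0<..T} u *\<^sub>R r (x + Y (s + u) \<omega>)"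
            by (intro tendsto_intros)
        qed
      qed (use r B in \<open>auto simp: rate_def indicator_def\<close>)
    qed
    have D0: "0 \<le> D n s x \<omega>" for n s x \<omega>
      using r \<delta>(1)[of n] by (auto simp: D_def rate_def intro!: mult_nonneg_nonneg sum_nonneg)
    have mD: "(\<lambda>(x, \<omega>). D n s x \<omega>) \<in> borel_measurable (borel \<Otimes>\<^sub>M M)" for n s
      unfolding D_def by measurable
    have mD': "D n s x \<in> borel_measurable M" for n s x unfolding D_def[abs_def] by measurable
    show ?thesis unfolding survival_def
    proof (rule markov_limit_step[where D="\<lambda>n x \<omega>. D n 0 x \<omega>" and D'="\<lambda>n \<omega>. D n s x \<omega>" and c=c])
      fix n
      define F where "F = (\<lambda>(y, v :: nat \<Rightarrow> real). G y * ennreal (exp (- (\<delta> n * (\<Sum>k\<in>{1..2 ^ n}. r (x + y + (\<Sum>i<k. v i)))))))"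
      have comp: "(\<lambda>p. \<Sum>i<k. snd p i) \<in> borel_measurable (borel \<Otimes>\<^sub>M PiM {..<2 ^ n} (\<lambda>_. borel :: real measure))" if "k \<in> {1..2 ^ n}" for k :: nat
        using that by (intro borel_measurable_sum measurable_compose[OF measurable_snd measurable_component_singleton]) auto
      have "(\<lambda>p. \<Sum>k\<in>{1..(2::nat) ^ n}. r (x + fst p + (\<Sum>i<k. snd p i))) \<in> borel_measurable (borel \<Otimes>\<^sub>M PiM {..<2 ^ n} (\<lambda>_. borel :: real measure))"
        by (intro borel_measurable_sum measurable_compose[OF _ rate_measurable[OF r]] borel_measurable_add comp) auto
      then have F: "F \<in> borel_measurable (borel \<Otimes>\<^sub>M PiM {..<2 ^ n} (\<lambda>_. borel))"
        unfolding F_def case_prod_beta by measurable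
      have Fe: "F (y, restrict (\<lambda>i. incr s' (\<delta> n) i \<omega>') {..<2 ^ n}) = G y * ennreal (exp (- (\<delta> n * (\<Sum>k\<in>{1..2 ^ n}. r (x + y + (Y (s' + real k * \<delta> n) \<omega>' - Y s' \<omega>'))))))" for s' y \<omega>'
      proof -
        have "(\<Sum>i<k. restrict (\<lambda>i. incr s' (\<delta> n) i \<omega>') {..<2 ^ n} i) = Y (s' + real k * \<delta> n) \<omega>' - Y s' \<omega>'" if "k \<in> {1..2 ^ n}" for k
        proof -
          have "(\<Sum>i<k. restrict (\<lambda>i. incr s' (\<delta> n) i \<omega>') {..<2 ^ n} i) = (\<Sum>i<k. incr s' (\<delta> n) i \<omega>')"
            using that by (intro sum.cong) auto
          then show ?thesis by (simp add: sum_incr)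
        qed
        then show ?thesis unfolding F_def by (auto intro!: sum.cong arg_cong[of _ _ "\<lambda>z. G y * ennreal (exp (- (\<delta> n * z)))"])
      qed
      have "(\<integral>\<^sup>+\<omega>. G (Y s \<omega>) * ennreal (exp (- D n s x \<omega>)) \<partial>M) = (\<integral>\<^sup>+\<omega>. F (Y s \<omega>, restrict (\<lambda>i. incr s (\<delta> n) i \<omega>) {..<2 ^ n}) \<partial>M)"
        unfolding Fe D_def by simp
      also have "\<dots> = (\<integral>\<^sup>+\<omega>. \<integral>\<^sup>+\<omega>'. F (Y s \<omega>, restrict (\<lambda>i. incr 0 (\<delta> n) i \<omega>') {..<2 ^ n}) \<partial>M \<partial>M)"
        by (rule markov_grid[OF s less_imp_le[OF \<delta>(1)] _ F]) simp
      also have "\<dots> = (\<integral>\<^sup>+\<omega>. \<integral>\<^sup>+\<omega>'. G (Y s \<omega>) * ennreal (exp (- D n 0 (x + Y s \<omega>) \<omega>')) \<partial>M \<partial>M)"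
        unfolding Fe D_def by (simp add: Y_neg)
      also have "\<dots> = (\<integral>\<^sup>+\<omega>. G (Y s \<omega>) * (\<integral>\<^sup>+\<omega>'. exp (- D n 0 (x + Y s \<omega>) \<omega>') \<partial>M) \<partial>M)"
        using mD' by (intro nn_integral_cong nn_integral_cmult) measurable
      finally show "(\<integral>\<^sup>+\<omega>. G (Y s \<omega>) * ennreal (exp (- D n s x \<omega>)) \<partial>M) =
        (\<integral>\<^sup>+\<omega>. G (Y s \<omega>) * (\<integral>\<^sup>+\<omega>'. exp (- D n 0 (x + Y s \<omega>) \<omega>') \<partial>M) \<partial>M)" .
    qed (use c lim D0 mD mD' in auto)
  qed
qed

text \<open>The continuous rates \<open>q * min 1 (n * infdist y (- A))\<close> converge to
  \<open>q\<close> times the indicator of the open set. The complement must be nonempty because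
  \<open>infdist\<close> to the empty set is 0 by convention.\<close>

lemma markov_open:
  assumes A: "open A" "A \<noteq> UNIV" and q: "0 \<le> q"
  shows "markov (\<lambda>y. q * indicator A y)"
proof (rule markov_limit)
  define r where "r n y = q * min 1 (real n * infdist y (- A))" for n y
  have cont: "continuous_on UNIV (r n)" for n
    unfolding r_def by (intro continuous_intros)
  show rn: "rate q (r n)" for n
    using borel_measurable_continuous_onI[OF cont[of n]] q infdist_nonneg
    by (auto simp: rate_def r_def[abs_def] mult_left_le intro!: mult_nonneg_nonneg)
  show "markov (r n)" for n by (rule markov_continuous[OF rn cont])
  have [measurable]: "A \<in> sets borel" using A(1) by simp
  have "(\<lambda>y. q * indicator A y) \<in> borel_measurable borel" by measurable
  then show "rate q (\<lambda>y. q * indicator A y)" using q by (simp add: rate_def indicator_def)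
  show "(\<lambda>n. r n y) \<longlonglongrightarrow> q * indicator A y" for y
  proof (cases "y \<in> A")
    case True
    have "0 < infdist y (- A)"
      using in_closed_iff_infdist_zero[of "- A" y] A True infdist_nonneg[of y "- A"] by (auto simp: less_le)
    then obtain n0 :: nat where n0: "1 / infdist y (- A) \<le> real n0" using real_arch_simple by blast
    have "\<forall>\<^sub>F n in sequentially. r n y = q"
      using eventually_ge_at_top[of n0]
    proof eventually_elim
      case (elim n)
      have "1 / infdist y (- A) \<le> real n" using n0 elim by linarith
      then have "1 \<le> real n * infdist y (- A)" using \<open>0 < infdist y (- A)\<close> by (simp add: pos_divide_le_eq)
      then show ?case by (simp add: r_def)
    qed
    then show ?thesis using True by (simp add: tendsto_eventually)
  next
    case False
    then have "infdist y (- A) = 0" by simp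
    then show ?thesis using False by (simp add: r_def)
  qed
qed

end

text \<open>\<open>f\<close> need not be measurable for \<open>M\<close>: a function almost
  everywhere equal to a measurable one is measurable for the completion. It transfers the
  expectation from the paths of \<open>X\<close> to the regular version.\<close>

lemma integral_completion_cong_AE:
  fixes f g :: "'a \<Rightarrow> real"
  assumes g [measurable]: "g \<in> borel_measurable M" and eq: "AE x in M. f x = g x"
  shows "integral\<^sup>L (completion M) f = integral\<^sup>L M g"
proof -
  have gc [measurable]: "g \<in> borel_measurable (completion M)" by (rule measurable_completion[OF g])
  have "f \<in> borel_measurable (completion M)"
  proof (rule measurableI)
    fix B :: "real set" assume B [measurable]: "B \<in> sets borel"
    have ex: "Measurable.pred (completion M) (\<lambda>x. f x \<noteq> g x \<and> f x \<in> B)"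
      "Measurable.pred (completion M) (\<lambda>x. f x \<noteq> g x)"
      by (rule sets_completion_AE, use eq in \<open>eventually_elim, simp\<close>)+
    have "f -` B \<inter> space (completion M) =
      {x\<in>space (completion M). (f x \<noteq> g x \<and> f x \<in> B) \<or> (\<not> f x \<noteq> g x \<and> g x \<in> B)}" by auto
    also have "\<dots> \<in> sets (completion M)" using ex by measurable
    finally show "f -` B \<inter> space (completion M) \<in> sets (completion M)" .
  qed simp
  then have "integral\<^sup>L (completion M) f = integral\<^sup>L (completion M) g"
    using gc by (intro integral_cong_AE) (auto simp: AE_completion_iff eq)
  then show ?thesis by (simp add: integral_completion)
qed

lemma exp_neg_tendsto:
  assumes a: "\<And>n. 0 \<le> a n" and lim: "(\<lambda>n. ennreal (a n)) \<longlonglongrightarrow> N"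
  shows "(\<lambda>n. exp (- a n)) \<longlonglongrightarrow> exp_neg N"
proof (cases "N = \<infinity>")
  case True
  have "filterlim a at_top sequentially"
    unfolding filterlim_at_top_gt[where c=0]
  proof (intro allI impI)
    fix Z :: real assume "0 < Z"
    have "\<forall>\<^sub>F n in sequentially. ennreal Z < ennreal (a n)"
      by (rule order_tendstoD(1)[OF lim]) (simp add: True)
    then show "\<forall>\<^sub>F n in sequentially. Z \<le> a n"
      by eventually_elim (use \<open>0 < Z\<close> in \<open>simp add: ennreal_less_iff\<close>)
  qed
  then have "(\<lambda>n. exp (- a n)) \<longlonglongrightarrow> 0"
    by (intro filterlim_compose[OF exp_at_bot] filterlim_compose[OF filterlim_uminus_at_bot_at_top])
  then show ?thesis by (simp add: exp_neg_def True)
next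
  case False
  then obtain b where b: "N = ennreal b" "0 \<le> b" by (cases N) auto
  have "a \<longlonglongrightarrow> b" using lim a b by (simp add: tendsto_ennreal_iff)
  then have "(\<lambda>n. exp (- a n)) \<longlonglongrightarrow> exp (- b)" by (intro tendsto_intros)
  then show ?thesis using b by (simp add: exp_neg_def)
qed

lemma exp_neg_measurable: "exp_neg \<in> borel_measurable borel"
proof -
  have "(\<lambda>t. if t = \<infinity> then 0 else exp (- enn2real t)) \<in> borel_measurable (borel :: ennreal measure)" by measurable
  then show ?thesis by (simp add: exp_neg_def[abs_def])
qed

lemma exp_neg_bounds: "0 \<le> exp_neg t" "exp_neg t \<le> 1"
  by (auto simp: exp_neg_def)

lemma exp_neg_SUP:
  assumes inc: "incseq t" and lim: "(SUP n. t n) = N"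
  shows "(\<lambda>n. exp_neg (t n)) \<longlonglongrightarrow> exp_neg N"
proof (cases "\<exists>m. t m = \<infinity>")
  case True
  then obtain m where m: "t m = \<infinity>" by blast
  have inf: "t n = \<infinity>" if "m \<le> n" for n using incseqD[OF inc that] m by (simp add: top_unique)
  then have "N = \<infinity>" using lim m by (metis SUP_upper UNIV_I infinity_ennreal_def top_unique)
  have "\<forall>\<^sub>F n in sequentially. exp_neg (t n) = exp_neg N"
    using eventually_ge_at_top[of m] by eventually_elim (simp add: inf \<open>N = \<infinity>\<close>)
  then show ?thesis by (rule tendsto_eventually)
next
  case False
  then have fin: "t n = ennreal (enn2real (t n))" for n by (metis ennreal_enn2real infinity_ennreal_def less_top)
  have "t \<longlonglongrightarrow> N" using LIMSEQ_SUP[OF inc] lim by simp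
  then have "(\<lambda>n. exp (- enn2real (t n))) \<longlonglongrightarrow> exp_neg N"
    using fin by (intro exp_neg_tendsto) (auto simp del: ennreal_enn2real)
  then show ?thesis using False by (simp add: exp_neg_def)
qed

section \<open>Feynman-Kac equations for finite and infinite horizon\<close>

context regular_levy
begin

lemma additive_measurable_horizon:
  assumes r: "rate B r"
    and [measurable]: "T \<in> borel_measurable N" "f \<in> borel_measurable N" "t \<in> borel_measurable N" "w \<in> measurable N M"
  shows "(\<lambda>p. additive r (T p) (t p) (f p) (w p)) \<in> borel_measurable N"
proof -
  note [measurable] = rate_measurable[OF r]
  have "(\<lambda>p. LBINT u. (if 0 < u \<and> u \<le> T p then r (f p + Y (t p + u) (w p)) else 0)) \<in> borel_measurable N"
    by (rule lborel.borel_measurable_lebesgue_integral) measurable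
  also have "(\<lambda>p. LBINT u. (if 0 < u \<and> u \<le> T p then r (f p + Y (t p + u) (w p)) else 0)) = (\<lambda>p. additive r (T p) (t p) (f p) (w p))"
    by (auto simp: additive_def set_lebesgue_integral_def indicator_def fun_eq_iff intro!: Bochner_Integration.integral_cong)
  finally show ?thesis .
qed

text \<open>Expectation of the pathwise identity \<open>one_minus_exp_integral\<close>. Its
  integrand at \<open>s\<close> is the rate at \<open>s\<close> times a functional of the path after
  \<open>s\<close> only, so the Markov property at the fixed time \<open>s\<close> applies under the
  time integral.\<close>

lemma survival_equation:
  assumes r: "rate B r" and mk: "markov r" and T: "0 \<le> T"
  shows "survival r T x + (\<integral>\<^sup>+s. indicator {0<..T} s * (\<integral>\<^sup>+\<omega>. ennreal (r (x + Y s \<omega>)) * survival r (T - s) (x + Y s \<omega>) \<partial>M) \<partial>lborel) = 1"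
proof -
  interpret P: pair_sigma_finite lborel M ..
  note [measurable] = rate_measurable[OF r] additive_measurable[OF r] additive_measurable_horizon[OF r]
  have B: "0 \<le> B" using r by (auto simp: rate_def intro: order_trans)
  have path: "ennreal (exp (- additive r T 0 x \<omega>)) + (\<integral>\<^sup>+s. indicator {0<..T} s * (ennreal (r (x + Y s \<omega>)) * ennreal (exp (- additive r (T - s) s x \<omega>))) \<partial>lborel) = 1"
    if "\<omega> \<in> space M" for \<omega>
  proof -
    define g where "g u = r (x + Y u \<omega>)" for u
    have [measurable]: "g \<in> borel_measurable borel" unfolding g_def[abs_def] by measurable
    have g: "0 \<le> g u" "g u \<le> B" for u using r by (auto simp: g_def rate_def)
    define A where "A t = (LBINT u:{0<..t}. g u)" for t
    note O = one_minus_exp_integral[OF \<open>g \<in> borel_measurable borel\<close> g, folded A_def]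
    have mA [measurable]: "A \<in> borel_measurable borel" using O(3)[OF T] by (simp add: A_def[abs_def])
    have AT: "A T = additive r T 0 x \<omega>" by (simp add: A_def additive_def g_def)
    have As: "A T - A s = additive r (T - s) s x \<omega>" if "0 \<le> s" "s \<le> T" for s
    proof -
      have "A T - A s = (LBINT u:{s<..T}. g u)" using O(2)[OF T that] .
      also have "\<dots> = (\<integral>u. indicator {s<..T} (s + 1 * u) *\<^sub>R g (s + 1 * u) \<partial>lborel)"
        unfolding set_lebesgue_integral_def by (subst lborel_integral_real_affine[where c=1 and t=s]) auto
      also have "\<dots> = additive r (T - s) s x \<omega>"
        unfolding additive_def set_lebesgue_integral_def
        by (intro Bochner_Integration.integral_cong) (auto simp: g_def indicator_def)
      finally show ?thesis .
    qed
    have i: "integrable lborel (\<lambda>s. indicator {0<..T} s *\<^sub>R (g s * exp (- (A T - A s))))"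
    proof (rule Bochner_Integration.integrable_bound[OF integrable_indicator_Ioc[of 0 T B]])
      show "AE s in lborel. norm (indicator {0<..T} s *\<^sub>R (g s * exp (- (A T - A s)))) \<le> norm (indicator {0<..T} s * B)"
      proof (rule AE_I2)
        fix s
        have "g s * exp (- (A T - A s)) \<le> B * 1" if "0 < s" "s \<le> T"
          using g[of s] O(4)[OF T, of s T] that B by (intro mult_mono) auto
        then show "norm (indicator {0<..T} s *\<^sub>R (g s * exp (- (A T - A s)))) \<le> norm (indicator {0<..T} s * B)"
          using g(1)[of s] B by (auto simp: indicator_def)
      qed
    qed measurable
    have "(\<integral>\<^sup>+s. indicator {0<..T} s * (ennreal (r (x + Y s \<omega>)) * ennreal (exp (- additive r (T - s) s x \<omega>))) \<partial>lborel) =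
      (\<integral>\<^sup>+s. ennreal (indicator {0<..T} s *\<^sub>R (g s * exp (- (A T - A s)))) \<partial>lborel)"
    proof (rule nn_integral_cong)
      fix s
      show "indicator {0<..T} s * (ennreal (r (x + Y s \<omega>)) * ennreal (exp (- additive r (T - s) s x \<omega>))) =
        ennreal (indicator {0<..T} s *\<^sub>R (g s * exp (- (A T - A s))))"
      proof (cases "s \<in> {0<..T}")
        case True
        then show ?thesis using g(1)[of s] As[of s] by (simp add: g_def ennreal_mult')
      qed simp
    qed
    also have "\<dots> = ennreal (1 - exp (- A T))"
      unfolding O(1)[OF T] set_lebesgue_integral_def
      by (rule nn_integral_eq_integral[OF i]) (use g(1) in \<open>auto simp: indicator_def\<close>)
    finally show ?thesis
      using additive_nonneg[OF r, of T 0 x \<omega>] by (simp add: AT ennreal_plus[symmetric] del: ennreal_plus)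
  qed
  have "1 = (\<integral>\<^sup>+\<omega>. 1 \<partial>M)" by (simp add: emeasure_space_1)
  also have "\<dots> = (\<integral>\<^sup>+\<omega>. ennreal (exp (- additive r T 0 x \<omega>)) + (\<integral>\<^sup>+s. indicator {0<..T} s * (ennreal (r (x + Y s \<omega>)) * ennreal (exp (- additive r (T - s) s x \<omega>))) \<partial>lborel) \<partial>M)"
    by (intro nn_integral_cong path[symmetric])
  also have "\<dots> = survival r T x + (\<integral>\<^sup>+\<omega>. \<integral>\<^sup>+s. indicator {0<..T} s * (ennreal (r (x + Y s \<omega>)) * ennreal (exp (- additive r (T - s) s x \<omega>))) \<partial>lborel \<partial>M)"
    unfolding survival_def by (rule nn_integral_add) measurable
  also have "(\<integral>\<^sup>+\<omega>. \<integral>\<^sup>+s. indicator {0<..T} s * (ennreal (r (x + Y s \<omega>)) * ennreal (exp (- additive r (T - s) s x \<omega>))) \<partial>lborel \<partial>M) =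
      (\<integral>\<^sup>+s. \<integral>\<^sup>+\<omega>. indicator {0<..T} s * (ennreal (r (x + Y s \<omega>)) * ennreal (exp (- additive r (T - s) s x \<omega>))) \<partial>M \<partial>lborel)"
    by (rule P.Fubini') measurable
  also have "\<dots> = (\<integral>\<^sup>+s. indicator {0<..T} s * (\<integral>\<^sup>+\<omega>. ennreal (r (x + Y s \<omega>)) * survival r (T - s) (x + Y s \<omega>) \<partial>M) \<partial>lborel)"
  proof (rule nn_integral_cong)
    fix s
    show "(\<integral>\<^sup>+\<omega>. indicator {0<..T} s * (ennreal (r (x + Y s \<omega>)) * ennreal (exp (- additive r (T - s) s x \<omega>))) \<partial>M) =
      indicator {0<..T} s * (\<integral>\<^sup>+\<omega>. ennreal (r (x + Y s \<omega>)) * survival r (T - s) (x + Y s \<omega>) \<partial>M)"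
    proof (cases "s \<in> {0<..T}")
      case True
      have "(\<lambda>y. ennreal (r (x + y))) \<in> borel_measurable borel" by measurable
      moreover have "\<forall>y. ennreal (r (x + y)) \<le> ennreal B" using r by (auto simp: rate_def intro: ennreal_leI)
      ultimately have "(\<integral>\<^sup>+\<omega>. ennreal (r (x + Y s \<omega>)) * ennreal (exp (- additive r (T - s) s x \<omega>)) \<partial>M) = (\<integral>\<^sup>+\<omega>. ennreal (r (x + Y s \<omega>)) * survival r (T - s) (x + Y s \<omega>) \<partial>M)"
        using mk[unfolded markov_def, rule_format, of "\<lambda>y. ennreal (r (x + y))" "T - s" s "ennreal B" x] True by simp
      then show ?thesis using True by simp
    qed simp
  qed
  finally show ?thesis ..
qed

definition total :: "(real \<Rightarrow> real) \<Rightarrow> real \<Rightarrow> 'a \<Rightarrow> ennreal" where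
  "total r x \<omega> = (\<integral>\<^sup>+u. indicator {0<..} u * ennreal (r (x + Y u \<omega>)) \<partial>lborel)"

definition ultimate :: "(real \<Rightarrow> real) \<Rightarrow> real \<Rightarrow> ennreal" where
  "ultimate r x = (\<integral>\<^sup>+\<omega>. exp_neg (total r x \<omega>) \<partial>M)"

lemma total_measurable:
  assumes r: "rate B r" and [measurable]: "f \<in> borel_measurable N" "w \<in> measurable N M"
  shows "(\<lambda>p. total r (f p) (w p)) \<in> borel_measurable N"
proof -
  note [measurable] = rate_measurable[OF r]
  show ?thesis unfolding total_def by (rule lborel.borel_measurable_nn_integral) measurable
qed

lemma ultimate_measurable: assumes r: "rate B r" shows "ultimate r \<in> borel_measurable borel"
proof -
  note [measurable] = total_measurable[OF r] exp_neg_measurable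
  have "(\<lambda>x. \<integral>\<^sup>+\<omega>. exp_neg (total r x \<omega>) \<partial>M) \<in> borel_measurable borel"
    by (rule borel_measurable_nn_integral) measurable
  then show ?thesis by (simp add: ultimate_def[abs_def])
qed

lemma ultimate_le_1: "ultimate r x \<le> 1"
proof -
  have "ultimate r x \<le> (\<integral>\<^sup>+\<omega>. 1 \<partial>M)" unfolding ultimate_def
    by (intro nn_integral_mono) (simp add: exp_neg_bounds ennreal_le_1)
  then show ?thesis by (simp add: emeasure_space_1)
qed

text \<open>The shift by \<open>s\<close> is the form in which the remaining horizon appears in
  \<open>survival_equation\<close>; it does not affect the limit.\<close>

lemma survival_tendsto:
  assumes r: "rate B r"
  shows "(\<lambda>n. survival r (real n - s) x) \<longlonglongrightarrow> ultimate r x"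
  unfolding survival_def ultimate_def
proof (rule nn_integral_dominated_convergence[where w="\<lambda>_. 1"])
  note [measurable] = rate_measurable[OF r] additive_measurable[OF r] total_measurable[OF r] exp_neg_measurable
  have B: "0 \<le> B" using r by (auto simp: rate_def intro: order_trans)
  show "(\<lambda>\<omega>. ennreal (exp (- additive r (real n - s) 0 x \<omega>))) \<in> borel_measurable M" for n by measurable
  show "(\<lambda>\<omega>. ennreal (exp_neg (total r x \<omega>))) \<in> borel_measurable M" by measurable
  show "AE \<omega> in M. (\<lambda>n. ennreal (exp (- additive r (real n - s) 0 x \<omega>))) \<longlonglongrightarrow> ennreal (exp_neg (total r x \<omega>))"
  proof (intro AE_I2 tendsto_ennrealI exp_neg_tendsto additive_nonneg[OF r])
    fix \<omega> assume \<omega>: "\<omega> \<in> space M"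
    have e: "ennreal (additive r (real n - s) 0 x \<omega>) = (\<integral>\<^sup>+u. indicator {0<..real n - s} u * ennreal (r (x + Y u \<omega>)) \<partial>lborel)" for n
    proof -
      have "ennreal (additive r (real n - s) 0 x \<omega>) = (\<integral>\<^sup>+u. ennreal (indicator {0<..real n - s} u *\<^sub>R r (x + Y (0 + u) \<omega>)) \<partial>lborel)"
        unfolding additive_def set_lebesgue_integral_def
      proof (rule nn_integral_eq_integral[symmetric])
        show "integrable lborel (\<lambda>u. indicator {0<..real n - s} u *\<^sub>R r (x + Y (0 + u) \<omega>))"
          by (rule Bochner_Integration.integrable_bound[OF integrable_indicator_Ioc[of 0 "real n - s" B]])
            (use r B in \<open>auto simp: rate_def indicator_def intro!: AE_I2\<close>)
      qed (use r in \<open>auto simp: rate_def\<close>)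
      also have "\<dots> = (\<integral>\<^sup>+u. indicator {0<..real n - s} u * ennreal (r (x + Y u \<omega>)) \<partial>lborel)"
        by (intro nn_integral_cong) (auto simp: indicator_def)
      finally show ?thesis .
    qed
    have inc: "incseq (\<lambda>n u. indicator {0<..real n - s} u * ennreal (r (x + Y u \<omega>)))"
      by (auto simp: incseq_def le_fun_def indicator_def)
    have "total r x \<omega> = (\<integral>\<^sup>+u. (SUP n. indicator {0<..real n - s} u * ennreal (r (x + Y u \<omega>))) \<partial>lborel)"
      unfolding total_def
    proof (rule nn_integral_cong, rule antisym)
      fix u
      obtain n :: nat where "u + s \<le> real n" using real_arch_simple by blast
      then have "indicator {0<..} u * ennreal (r (x + Y u \<omega>)) \<le> indicator {0<..real n - s} u * ennreal (r (x + Y u \<omega>))"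
        by (auto simp: indicator_def)
      then show "indicator {0<..} u * ennreal (r (x + Y u \<omega>)) \<le> (SUP n. indicator {0<..real n - s} u * ennreal (r (x + Y u \<omega>)))"
        by (rule order_trans) (rule SUP_upper, simp)
      show "(SUP n. indicator {0<..real n - s} u * ennreal (r (x + Y u \<omega>))) \<le> indicator {0<..} u * ennreal (r (x + Y u \<omega>))"
        by (rule SUP_least) (auto simp: indicator_def)
    qed
    also have "\<dots> = (SUP n. \<integral>\<^sup>+u. indicator {0<..real n - s} u * ennreal (r (x + Y u \<omega>)) \<partial>lborel)"
      by (rule nn_integral_monotone_convergence_SUP[OF inc]) measurable
    finally have "total r x \<omega> = (SUP n. ennreal (additive r (real n - s) 0 x \<omega>))" unfolding e .
    moreover have "incseq (\<lambda>n. ennreal (additive r (real n - s) 0 x \<omega>))"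
      unfolding e incseq_def by (intro allI impI nn_integral_mono) (use inc in \<open>auto simp: incseq_def le_fun_def\<close>)
    ultimately show "(\<lambda>n. ennreal (additive r (real n - s) 0 x \<omega>)) \<longlonglongrightarrow> total r x \<omega>"
      using LIMSEQ_SUP by metis
  qed
qed (auto simp: emeasure_space_1 ennreal_le_1 additive_nonneg[OF r])

text \<open>Horizon to infinity in \<open>survival_equation\<close>. The finite potential of the
  rate gives the integrable majorant; this is the point at which transience enters.\<close>

lemma ultimate_equation:
  assumes r: "rate B r" and mk: "markov r"
    and fin: "(\<integral>\<^sup>+s. indicator {0<..} s * (\<integral>\<^sup>+\<omega>. ennreal (r (x + Y s \<omega>)) \<partial>M) \<partial>lborel) < \<infinity>"
  shows "ultimate r x + (\<integral>\<^sup>+s. indicator {0<..} s * (\<integral>\<^sup>+\<omega>. ennreal (r (x + Y s \<omega>)) * ultimate r (x + Y s \<omega>) \<partial>M) \<partial>lborel) = 1"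
proof (rule LIMSEQ_unique)
  note [measurable] = rate_measurable[OF r] survival_measurable[OF r] ultimate_measurable[OF r] additive_measurable_horizon[OF r]
  have B: "0 \<le> B" using r by (auto simp: rate_def intro: order_trans)
  have rB: "ennreal (r y) \<le> ennreal B" for y using r by (auto simp: rate_def intro: ennreal_leI)
  show "(\<lambda>n. survival r (real n) x + (\<integral>\<^sup>+s. indicator {0<..real n} s * (\<integral>\<^sup>+\<omega>. ennreal (r (x + Y s \<omega>)) * survival r (real n - s) (x + Y s \<omega>) \<partial>M) \<partial>lborel)) \<longlonglongrightarrow> 1"
    using survival_equation[OF r mk] by simp
  have ms: "(\<lambda>(s, y). survival r (real n - s) y) \<in> borel_measurable (borel \<Otimes>\<^sub>M borel)" for n
  proof -
    have "(\<lambda>p. \<integral>\<^sup>+\<omega>. exp (- additive r (real n - fst p) 0 (snd p) \<omega>) \<partial>M) \<in> borel_measurable (borel \<Otimes>\<^sub>M borel)"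
      by (rule borel_measurable_nn_integral) measurable
    then show ?thesis by (simp add: survival_def case_prod_beta)
  qed
  have ms': "(\<lambda>p. survival r (real n - f p) (g p)) \<in> borel_measurable N"
    if "f \<in> borel_measurable N" "g \<in> borel_measurable N" for f g N n
    using measurable_compose[OF measurable_Pair[OF that] ms[of n]] by simp
  have inner: "(\<lambda>n. \<integral>\<^sup>+\<omega>. ennreal (r (x + Y s \<omega>)) * survival r (real n - s) (x + Y s \<omega>) \<partial>M) \<longlonglongrightarrow>
      (\<integral>\<^sup>+\<omega>. ennreal (r (x + Y s \<omega>)) * ultimate r (x + Y s \<omega>) \<partial>M)" for s
  proof (rule nn_integral_dominated_convergence[where w="\<lambda>_. ennreal B"])
    show "AE \<omega> in M. ennreal (r (x + Y s \<omega>)) * survival r (real n - s) (x + Y s \<omega>) \<le> ennreal B" for n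
    proof (rule AE_I2)
      fix \<omega>
      have "ennreal (r (x + Y s \<omega>)) * survival r (real n - s) (x + Y s \<omega>) \<le> ennreal B * 1"
        by (intro mult_mono rB survival_le_1[OF r]) auto
      then show "ennreal (r (x + Y s \<omega>)) * survival r (real n - s) (x + Y s \<omega>) \<le> ennreal B" by simp
    qed
    show "AE \<omega> in M. (\<lambda>n. ennreal (r (x + Y s \<omega>)) * survival r (real n - s) (x + Y s \<omega>)) \<longlonglongrightarrow> ennreal (r (x + Y s \<omega>)) * ultimate r (x + Y s \<omega>)"
      by (intro AE_I2 ennreal_tendsto_cmult survival_tendsto[OF r]) simp
  qed (auto simp: emeasure_space_1)
  have "(\<lambda>n. \<integral>\<^sup>+s. indicator {0<..real n} s * (\<integral>\<^sup>+\<omega>. ennreal (r (x + Y s \<omega>)) * survival r (real n - s) (x + Y s \<omega>) \<partial>M) \<partial>lborel) \<longlonglongrightarrow>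
      (\<integral>\<^sup>+s. indicator {0<..} s * (\<integral>\<^sup>+\<omega>. ennreal (r (x + Y s \<omega>)) * ultimate r (x + Y s \<omega>) \<partial>M) \<partial>lborel)"
  proof (rule nn_integral_dominated_convergence[where w="\<lambda>s. indicator {0<..} s * (\<integral>\<^sup>+\<omega>. ennreal (r (x + Y s \<omega>)) \<partial>M)"])
    show "AE s in lborel. indicator {0<..real n} s * (\<integral>\<^sup>+\<omega>. ennreal (r (x + Y s \<omega>)) * survival r (real n - s) (x + Y s \<omega>) \<partial>M) \<le> indicator {0<..} s * (\<integral>\<^sup>+\<omega>. ennreal (r (x + Y s \<omega>)) \<partial>M)" for n
    proof (intro AE_I2 mult_mono nn_integral_mono)
      fix s \<omega>
      have "ennreal (r (x + Y s \<omega>)) * survival r (real n - s) (x + Y s \<omega>) \<le> ennreal (r (x + Y s \<omega>)) * 1"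
        by (intro mult_left_mono survival_le_1[OF r]) auto
      then show "ennreal (r (x + Y s \<omega>)) * survival r (real n - s) (x + Y s \<omega>) \<le> ennreal (r (x + Y s \<omega>))" by simp
    qed (auto simp: indicator_def)
    show "AE s in lborel. (\<lambda>n. indicator {0<..real n} s * (\<integral>\<^sup>+\<omega>. ennreal (r (x + Y s \<omega>)) * survival r (real n - s) (x + Y s \<omega>) \<partial>M)) \<longlonglongrightarrow>
      indicator {0<..} s * (\<integral>\<^sup>+\<omega>. ennreal (r (x + Y s \<omega>)) * ultimate r (x + Y s \<omega>) \<partial>M)"
    proof (rule AE_I2)
      fix s :: real
      obtain n0 :: nat where n0: "s \<le> real n0" using real_arch_simple by blast
      have "\<forall>\<^sub>F n in sequentially. indicator {0<..} s * (\<integral>\<^sup>+\<omega>. ennreal (r (x + Y s \<omega>)) * survival r (real n - s) (x + Y s \<omega>) \<partial>M) =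
        indicator {0<..real n} s * (\<integral>\<^sup>+\<omega>. ennreal (r (x + Y s \<omega>)) * survival r (real n - s) (x + Y s \<omega>) \<partial>M)"
        using eventually_ge_at_top[of n0] by eventually_elim (use n0 in \<open>auto simp: indicator_def\<close>)
      moreover have "(\<lambda>n. indicator {0<..} s * (\<integral>\<^sup>+\<omega>. ennreal (r (x + Y s \<omega>)) * survival r (real n - s) (x + Y s \<omega>) \<partial>M)) \<longlonglongrightarrow>
        indicator {0<..} s * (\<integral>\<^sup>+\<omega>. ennreal (r (x + Y s \<omega>)) * ultimate r (x + Y s \<omega>) \<partial>M)"
        by (intro ennreal_tendsto_cmult inner) (auto simp: indicator_def)
      ultimately show "(\<lambda>n. indicator {0<..real n} s * (\<integral>\<^sup>+\<omega>. ennreal (r (x + Y s \<omega>)) * survival r (real n - s) (x + Y s \<omega>) \<partial>M)) \<longlonglongrightarrow>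
        indicator {0<..} s * (\<integral>\<^sup>+\<omega>. ennreal (r (x + Y s \<omega>)) * ultimate r (x + Y s \<omega>) \<partial>M)"
        by (rule Lim_transform_eventually[rotated])
    qed
    show "(\<lambda>s. indicator {0<..real n} s * (\<integral>\<^sup>+\<omega>. ennreal (r (x + Y s \<omega>)) * survival r (real n - s) (x + Y s \<omega>) \<partial>M)) \<in> borel_measurable lborel" for n
    proof (rule borel_measurable_times_ennreal)
      have s1: "(\<lambda>p. survival r (real n - fst p) (x + Y (fst p) (snd p))) \<in> borel_measurable (lborel \<Otimes>\<^sub>M M)"
        by (rule ms') measurable
      have "(\<lambda>(s, \<omega>). ennreal (r (x + Y s \<omega>)) * survival r (real n - s) (x + Y s \<omega>)) \<in> borel_measurable (lborel \<Otimes>\<^sub>M M)"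
        unfolding case_prod_beta by (rule borel_measurable_times_ennreal[OF _ s1]) measurable
      then show "(\<lambda>s. \<integral>\<^sup>+\<omega>. ennreal (r (x + Y s \<omega>)) * survival r (real n - s) (x + Y s \<omega>) \<partial>M) \<in> borel_measurable lborel"
        by (rule borel_measurable_nn_integral)
    qed measurable
    show "(\<lambda>s. indicator {0<..} s * (\<integral>\<^sup>+\<omega>. ennreal (r (x + Y s \<omega>)) * ultimate r (x + Y s \<omega>) \<partial>M)) \<in> borel_measurable lborel"
      by measurable
    show "(\<lambda>s. indicator {0<..} s * (\<integral>\<^sup>+\<omega>. ennreal (r (x + Y s \<omega>)) \<partial>M)) \<in> borel_measurable lborel"
      by measurable
  qed (fact fin)
  then show "(\<lambda>n. survival r (real n) x + (\<integral>\<^sup>+s. indicator {0<..real n} s * (\<integral>\<^sup>+\<omega>. ennreal (r (x + Y s \<omega>)) * survival r (real n - s) (x + Y s \<omega>) \<partial>M) \<partial>lborel)) \<longlonglongrightarrow>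
    ultimate r x + (\<integral>\<^sup>+s. indicator {0<..} s * (\<integral>\<^sup>+\<omega>. ennreal (r (x + Y s \<omega>)) * ultimate r (x + Y s \<omega>) \<partial>M) \<partial>lborel)"
    using survival_tendsto[OF r, of 0 x] by (intro tendsto_add) auto
qed

end

section \<open>The integral equation for a bounded interval\<close>

context transient_levy
begin

lemma potential_started:
  assumes [measurable]: "F \<in> borel_measurable borel"
  shows "(\<integral>\<^sup>+s. indicator {0<..} s * (\<integral>\<^sup>+\<omega>. F (x + Y s \<omega>) \<partial>M) \<partial>lborel) = (\<integral>\<^sup>+y. F y * ennreal (exp (\<phi> * (x - y)) / \<kappa> - W (x - y)) \<partial>lborel)"
proof -
  interpret P: pair_sigma_finite lborel M ..
  have "(\<integral>\<^sup>+s. indicator {0<..} s * (\<integral>\<^sup>+\<omega>. F (x + Y s \<omega>) \<partial>M) \<partial>lborel) = (\<integral>\<^sup>+s. \<integral>\<^sup>+\<omega>. indicator {0<..} s * F (x - - Y s \<omega>) \<partial>M \<partial>lborel)"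
    by (simp add: nn_integral_cmult)
  also have "\<dots> = (\<integral>\<^sup>+\<omega>. \<integral>\<^sup>+s. indicator {0<..} s * F (x - - Y s \<omega>) \<partial>lborel \<partial>M)"
    by (rule P.Fubini'[symmetric]) measurable
  also have "\<dots> = (\<integral>\<^sup>+y. F (x - y) * ennreal (exp (\<phi> * y) / \<kappa> - W y) \<partial>lborel)"
    by (rule potential_density[of "\<lambda>y. F (x - y)"]) measurable
  also have "\<dots> = (\<integral>\<^sup>+y. F y * ennreal (exp (\<phi> * (x - y)) / \<kappa> - W (x - y)) \<partial>lborel)"
    by (subst nn_integral_real_affine[where c="-1" and t=x]) auto
  finally show ?thesis .
qed

text \<open>The time integral in \<open>ultimate_equation\<close> is rewritten with the potential
  density; since the kernel is bounded on a bounded interval, the potential of the rate is finite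
  and all terms are real.\<close>

lemma interval_equation:
  fixes a b q x :: real
  assumes q: "0 \<le> q"
  defines "f \<equiv> \<lambda>x. enn2real (ultimate (\<lambda>y. q * indicator {a<..<b} y) x)"
  shows "f x = 1 - q * (LBINT y:{a<..<b}. f y * (exp (\<phi> * (x - y)) / \<kappa> - W (x - y)))"
proof -
  define r where "r = (\<lambda>y. q * indicator {a<..<b::real} y)"
  have r: "rate q r" using q by (auto simp: rate_def r_def indicator_def)
  have mk: "markov r" unfolding r_def by (rule markov_open) (use q in \<open>auto intro: exI[of _ a]\<close>)
  note [measurable] = rate_measurable[OF r] ultimate_measurable[OF r]
  define u where "u y = exp (\<phi> * (x - y)) / \<kappa> - W (x - y)" for y
  have [measurable]: "u \<in> borel_measurable borel" unfolding u_def[abs_def] by measurable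
  have u0: "0 \<le> u y" for y using W_le by (simp add: u_def)
  have f: "ultimate r y = ennreal (f y)" "0 \<le> f y" "f y \<le> 1" for y
  proof -
    have "ultimate r y < \<infinity>" using ultimate_le_1[of r y] by (rule order.strict_trans1) simp
    then show "ultimate r y = ennreal (f y)" by (simp add: f_def r_def[symmetric])
    show "0 \<le> f y" by (simp add: f_def)
    show "f y \<le> 1" using ultimate_le_1[of r y] \<open>ultimate r y = ennreal (f y)\<close> by simp
  qed
  have [measurable]: "f \<in> borel_measurable borel"
  proof -
    have "f = (\<lambda>y. enn2real (ultimate r y))" by (simp add: f_def r_def)
    then show ?thesis by simp
  qed
  define C where "C = exp (\<phi> * (\<bar>x\<bar> + \<bar>a\<bar> + \<bar>b\<bar>)) / \<kappa>"
  have uC: "u y \<le> C" if "y \<in> {a<..<b}" for y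
  proof -
    have "exp (\<phi> * (x - y)) \<le> exp (\<phi> * (\<bar>x\<bar> + \<bar>a\<bar> + \<bar>b\<bar>))"
      using that \<phi>_nonneg by (auto intro!: mult_left_mono)
    then have "exp (\<phi> * (x - y)) / \<kappa> \<le> C" using \<kappa>_pos by (simp add: C_def divide_right_mono)
    then show ?thesis using W_nonneg[of "x - y"] by (simp add: u_def)
  qed
  have ii: "integrable lborel (\<lambda>y. indicator {a<..<b} y *\<^sub>R (v y * u y))" if [measurable]: "v \<in> borel_measurable borel" and v: "\<And>y. 0 \<le> v y" "\<And>y. v y \<le> 1" for v
  proof (rule Bochner_Integration.integrable_bound[OF integrable_indicator_Ioc[of a b C]])
    show "AE y in lborel. norm (indicator {a<..<b} y *\<^sub>R (v y * u y)) \<le> norm (indicator {a<..b} y * C)"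
    proof (rule AE_I2)
      fix y
      show "norm (indicator {a<..<b} y *\<^sub>R (v y * u y)) \<le> norm (indicator {a<..b} y * C)"
      proof (cases "y \<in> {a<..<b}")
        case True
        have "v y * u y \<le> 1 * C" using v u0[of y] uC[OF True] by (intro mult_mono) auto
        then show ?thesis using True v(1)[of y] u0[of y] by (auto simp: abs_mult)
      qed simp
    qed
  qed measurable
  have nn: "(\<integral>\<^sup>+y. ennreal (r y) * ennreal (v y) * ennreal (u y) \<partial>lborel) = ennreal (q * (LBINT y:{a<..<b}. v y * u y))"
    if mv [measurable]: "v \<in> borel_measurable borel" and v: "\<And>y. 0 \<le> v y" "\<And>y. v y \<le> 1" for v
  proof -
    have "(\<integral>\<^sup>+y. ennreal (r y) * ennreal (v y) * ennreal (u y) \<partial>lborel) = (\<integral>\<^sup>+y. ennreal q * ennreal (indicator {a<..<b} y *\<^sub>R (v y * u y)) \<partial>lborel)"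
      using q v u0 by (intro nn_integral_cong) (auto simp: r_def indicator_def ennreal_mult'[symmetric] mult.assoc)
    also have "\<dots> = ennreal q * (\<integral>\<^sup>+y. ennreal (indicator {a<..<b} y *\<^sub>R (v y * u y)) \<partial>lborel)"
      by (rule nn_integral_cmult) measurable
    also have "(\<integral>\<^sup>+y. ennreal (indicator {a<..<b} y *\<^sub>R (v y * u y)) \<partial>lborel) = ennreal (LBINT y:{a<..<b}. v y * u y)"
      unfolding set_lebesgue_integral_def
      by (rule nn_integral_eq_integral[OF ii[OF mv v]]) (use v u0 in auto)
    finally show ?thesis using q by (simp add: ennreal_mult')
  qed
  have fin: "(\<integral>\<^sup>+s. indicator {0<..} s * (\<integral>\<^sup>+\<omega>. ennreal (r (x + Y s \<omega>)) \<partial>M) \<partial>lborel) < \<infinity>"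
    using nn[of "\<lambda>_. 1"] by (subst potential_started[of "\<lambda>y. ennreal (r y)"]) (auto simp: u_def)
  have "1 = ultimate r x + (\<integral>\<^sup>+s. indicator {0<..} s * (\<integral>\<^sup>+\<omega>. ennreal (r (x + Y s \<omega>)) * ultimate r (x + Y s \<omega>) \<partial>M) \<partial>lborel)"
    by (rule ultimate_equation[OF r mk fin, symmetric])
  also have "(\<integral>\<^sup>+s. indicator {0<..} s * (\<integral>\<^sup>+\<omega>. ennreal (r (x + Y s \<omega>)) * ultimate r (x + Y s \<omega>) \<partial>M) \<partial>lborel) =
      (\<integral>\<^sup>+y. ennreal (r y) * ultimate r y * ennreal (u y) \<partial>lborel)"
    unfolding u_def by (rule potential_started[of "\<lambda>y. ennreal (r y) * ultimate r y"]) measurable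
  also have "\<dots> = ennreal (q * (LBINT y:{a<..<b}. f y * u y))" unfolding f(1) by (rule nn) (use f in auto)
  also have "ultimate r x + ennreal (q * (LBINT y:{a<..<b}. f y * u y)) = ennreal (f x + q * (LBINT y:{a<..<b}. f y * u y))"
    unfolding f(1) using q f u0
    by (intro ennreal_plus[symmetric] mult_nonneg_nonneg) (auto simp: set_lebesgue_integral_def intro!: Bochner_Integration.integral_nonneg)
  finally have "ennreal (f x + q * (LBINT y:{a<..<b}. f y * u y)) = 1" ..
  then have "f x + q * (LBINT y:{a<..<b}. f y * u y) = 1" by (metis ennreal_eq_1)
  then show ?thesis by (simp add: u_def)
qed

end

section \<open>Occupation functionals and their monotone limits\<close>

context regular_levy
begin

text \<open>The occupation time of \<open>X\<close> equals that of \<open>Y\<close> on almost every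
  path, and counting time in \<open>{0<..}\<close> instead of \<open>{0..}\<close> drops a null
  set.\<close>

lemma occupation_laplace_eq:
  assumes X: "AE \<omega> in M. \<forall>t\<ge>0. Y t \<omega> = X t \<omega>" and A: "A \<in> sets borel" and q: "0 \<le> q"
  shows "occupation_laplace M X x q A = enn2real (ultimate (\<lambda>y. q * indicator A y) x)"
proof -
  define r where "r = (\<lambda>y. q * indicator A (y::real) :: real)"
  have [measurable]: "A \<in> sets borel" by fact
  have "r \<in> borel_measurable borel" unfolding r_def by measurable
  then have r: "rate q r" using q by (auto simp: rate_def r_def indicator_def)
  note [measurable] = total_measurable[OF r] exp_neg_measurable
  have tot: "ennreal q * occupation_time (\<lambda>s. x + Y s \<omega>) A = total r x \<omega>" for \<omega>
  proof -
    have "{s. 0 \<le> s \<and> x + Y s \<omega> \<in> A} \<in> sets lborel" by measurable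
    then have "occupation_time (\<lambda>s. x + Y s \<omega>) A = (\<integral>\<^sup>+s. indicator {s. 0 \<le> s \<and> x + Y s \<omega> \<in> A} s \<partial>lborel)"
      by (simp add: occupation_time_def)
    also have "\<dots> = (\<integral>\<^sup>+s. indicator {0<..} s * indicator A (x + Y s \<omega>) \<partial>lborel)"
    proof (rule nn_integral_cong_AE)
      show "AE s in lborel. (indicator {s. 0 \<le> s \<and> x + Y s \<omega> \<in> A} s :: ennreal) = indicator {0<..} s * indicator A (x + Y s \<omega>)"
        using AE_lborel_singleton[of 0] by eventually_elim (auto simp: indicator_def)
    qed
    also have "ennreal q * \<dots> = (\<integral>\<^sup>+s. ennreal q * (indicator {0<..} s * indicator A (x + Y s \<omega>)) \<partial>lborel)"
      by (rule nn_integral_cmult[symmetric]) measurable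
    also have "\<dots> = total r x \<omega>"
      unfolding total_def by (intro nn_integral_cong) (auto simp: r_def indicator_def)
    finally show ?thesis .
  qed
  have m: "(\<lambda>\<omega>. exp_neg (total r x \<omega>)) \<in> borel_measurable M" by measurable
  have "occupation_laplace M X x q A = (\<integral>\<omega>. exp_neg (total r x \<omega>) \<partial>M)"
    unfolding occupation_laplace_def
  proof (rule integral_completion_cong_AE[OF m])
    show "AE \<omega> in M. exp_neg (ennreal q * occupation_time (\<lambda>s. x + X s \<omega>) A) = exp_neg (total r x \<omega>)"
      using X
    proof eventually_elim
      case (elim \<omega>)
      have "occupation_time (\<lambda>s. x + X s \<omega>) A = occupation_time (\<lambda>s. x + Y s \<omega>) A"
        unfolding occupation_time_def by (rule arg_cong[where f="emeasure lborel"]) (use elim in auto)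
      then show ?case by (simp add: tot)
    qed
  qed
  also have "\<dots> = enn2real (ultimate r x)"
    unfolding ultimate_def by (rule integral_eq_nn_integral) (use m exp_neg_bounds in auto)
  finally show ?thesis by (simp add: r_def)
qed

text \<open>The accumulated total increases with the set, possibly to infinity;
  \<open>exp_neg\<close> is continuous along such sequences and bounded by 1.\<close>

lemma ultimate_tendsto:
  assumes A [measurable]: "\<And>n. A n \<in> sets borel" and inc: "incseq A" and q: "0 \<le> q"
  shows "(\<lambda>n. enn2real (ultimate (\<lambda>y. q * indicator (A n) y) x)) \<longlonglongrightarrow> enn2real (ultimate (\<lambda>y. q * indicator (\<Union>n. A n) y) x)"
proof -
  have rate: "rate q (\<lambda>y. q * indicator S y)" if [measurable]: "S \<in> sets borel" for S
  proof -
    have "(\<lambda>y. q * indicator S y) \<in> borel_measurable borel" by measurable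
    then show ?thesis using q by (simp add: rate_def indicator_def)
  qed
  have U: "(\<Union>n. A n) \<in> sets borel" by measurable
  note [measurable] = total_measurable[OF rate[OF A]] total_measurable[OF rate[OF U]] exp_neg_measurable
  have "(\<lambda>n. ultimate (\<lambda>y. q * indicator (A n) y) x) \<longlonglongrightarrow> ultimate (\<lambda>y. q * indicator (\<Union>n. A n) y) x"
    unfolding ultimate_def
  proof (rule nn_integral_dominated_convergence[where w="\<lambda>_. 1"])
    show "AE \<omega> in M. (\<lambda>n. ennreal (exp_neg (total (\<lambda>y. q * indicator (A n) y) x \<omega>))) \<longlonglongrightarrow> ennreal (exp_neg (total (\<lambda>y. q * indicator (\<Union>n. A n) y) x \<omega>))"
    proof (intro AE_I2 tendsto_ennrealI exp_neg_SUP)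
      fix \<omega>
      have mono: "indicator {0<..} u * ennreal (q * indicator (A m) (x + Y u \<omega>)) \<le> indicator {0<..} u * ennreal (q * indicator (A n) (x + Y u \<omega>))"
        if "m \<le> n" for m n u
        using incseqD[OF inc that] q by (auto simp: indicator_def)
      show "incseq (\<lambda>n. total (\<lambda>y. q * indicator (A n) y) x \<omega>)"
        unfolding incseq_def total_def by (intro allI impI nn_integral_mono mono)
      have "(SUP n. total (\<lambda>y. q * indicator (A n) y) x \<omega>) = (\<integral>\<^sup>+u. (SUP n. indicator {0<..} u * ennreal (q * indicator (A n) (x + Y u \<omega>))) \<partial>lborel)"
        unfolding total_def
        by (rule nn_integral_monotone_convergence_SUP[symmetric]) (auto simp: incseq_def le_fun_def intro: mono)
      also have "\<dots> = total (\<lambda>y. q * indicator (\<Union>n. A n) y) x \<omega>"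
        unfolding total_def
      proof (rule nn_integral_cong, rule antisym)
        fix u
        show "(SUP n. indicator {0<..} u * ennreal (q * indicator (A n) (x + Y u \<omega>))) \<le> indicator {0<..} u * ennreal (q * indicator (\<Union>n. A n) (x + Y u \<omega>))"
          using q by (intro SUP_least) (auto simp: indicator_def)
        show "indicator {0<..} u * ennreal (q * indicator (\<Union>n. A n) (x + Y u \<omega>)) \<le> (SUP n. indicator {0<..} u * ennreal (q * indicator (A n) (x + Y u \<omega>)))"
        proof (cases "\<exists>n. x + Y u \<omega> \<in> A n")
          case True
          then obtain n where n: "x + Y u \<omega> \<in> A n" by blast
          then have "indicator {0<..} u * ennreal (q * indicator (\<Union>n. A n) (x + Y u \<omega>)) = indicator {0<..} u * ennreal (q * indicator (A n) (x + Y u \<omega>))"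
            by (auto simp: indicator_def)
          also have "\<dots> \<le> (SUP n. indicator {0<..} u * ennreal (q * indicator (A n) (x + Y u \<omega>)))" by (rule SUP_upper) simp
          finally show ?thesis .
        qed (simp add: indicator_def)
      qed
      finally show "(SUP n. total (\<lambda>y. q * indicator (A n) y) x \<omega>) = total (\<lambda>y. q * indicator (\<Union>n. A n) y) x \<omega>" .
    qed
  qed (auto simp: emeasure_space_1 exp_neg_bounds ennreal_le_1)
  moreover have "ultimate (\<lambda>y. q * indicator (\<Union>n. A n) y) x = ennreal (enn2real (ultimate (\<lambda>y. q * indicator (\<Union>n. A n) y) x))"
    using order.strict_trans1[OF ultimate_le_1 ennreal_one_less_top] by simp
  ultimately show ?thesis by (intro tendsto_enn2real) auto
qed

end

section \<open>Exponential growth rates\<close>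

lemma indefinite_set_integral:
  fixes g :: "real \<Rightarrow> real"
  assumes g: "continuous_on {0..} g"
  shows "continuous_on {0..} (\<lambda>z. LBINT y:{0..z}. g y)"
    and "\<And>z. 0 < z \<Longrightarrow> ((\<lambda>z. LBINT y:{0..z}. g y) has_real_derivative g z) (at z)"
proof -
  have eq: "(LBINT y:{0..z}. g y) = integral {0..z} g" for z
    by (rule set_borel_integral_eq_integral(2)) (auto intro!: borel_integrable_atLeastAtMost' continuous_on_subset[OF g])
  have ci: "continuous_on {0..L} (\<lambda>z. LBINT y:{0..z}. g y)" for L
    unfolding eq by (intro indefinite_integral_continuous_1 integrable_continuous_real continuous_on_subset[OF g]) auto
  have der: "((\<lambda>z. LBINT y:{0..z}. g y) has_real_derivative g z) (at z)" if "0 < z" for z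
  proof -
    have "((\<lambda>z. integral {0..z} g) has_real_derivative g z) (at z within {0..z + 1})"
      by (rule integral_has_real_derivative) (use that in \<open>auto intro!: continuous_on_subset[OF g]\<close>)
    moreover have "at z within {0..z + 1} = at z" using that by (intro at_within_interior) auto
    ultimately show ?thesis unfolding eq by simp
  qed
  then show "\<And>z. 0 < z \<Longrightarrow> ((\<lambda>z. LBINT y:{0..z}. g y) has_real_derivative g z) (at z)" .
  show "continuous_on {0..} (\<lambda>z. LBINT y:{0..z}. g y)"
    unfolding continuous_on_eq_continuous_within
  proof
    fix z :: real assume z: "z \<in> {0..}"
    have "continuous (at z within {0..z + 1}) (\<lambda>z. LBINT y:{0..z}. g y)"
      using ci[of "z + 1"] z by (simp add: continuous_on_eq_continuous_within)
    moreover have "at z within {0..} = at z within {0..z + 1}"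
      by (rule at_within_nhd[of z "{..<z + 1}"]) auto
    ultimately show "continuous (at z within {0..}) (\<lambda>z. LBINT y:{0..z}. g y)" by simp
  qed
qed

lemma laplace_exp:
  fixes l c :: real
  assumes "c < l"
  shows "set_integrable lborel {0..} (\<lambda>y. exp (- l * y) * exp (c * y))"
    and "(LBINT y:{0..}. exp (- l * y) * exp (c * y)) = 1 / (l - c)"
proof -
  have e: "exp (- l * y) * exp (c * y) = exp (- (l - c) * y)" for y
    by (simp add: exp_add[symmetric] algebra_simps)
  have der: "((\<lambda>x. - exp (- d * x) / d) has_real_derivative exp (- d * x)) (at x)" if "d \<noteq> 0" for d x :: real
    using that by (auto intro!: derivative_eq_intros)
  have "(\<integral>\<^sup>+x. ennreal (exp (- (l - c) * x)) * indicator {0..} x \<partial>lborel) = ennreal (0 - (- exp (- (l - c) * 0) / (l - c)))"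
  proof (rule nn_integral_FTC_atLeast)
    show "((\<lambda>x. - exp (- (l - c) * x) / (l - c)) has_real_derivative exp (- (l - c) * x)) (at x)" for x
      using der[of "l - c" x] assms by simp
    have "((\<lambda>x. exp (- (l - c) * x)) \<longlongrightarrow> 0) at_top"
      using assms by (intro filterlim_compose[OF exp_at_bot] filterlim_tendsto_neg_mult_at_bot[OF tendsto_const _ filterlim_ident]) auto
    then show "((\<lambda>x. - exp (- (l - c) * x) / (l - c)) \<longlongrightarrow> 0) at_top"
      using tendsto_divide[OF tendsto_minus tendsto_const, of "\<lambda>x. exp (- (l - c) * x)" 0 at_top "l - c"] assms by simp
  qed auto
  then have nn: "(\<integral>\<^sup>+x. ennreal (indicator {0..} x *\<^sub>R (exp (- l * x) * exp (c * x))) \<partial>lborel) = ennreal (1 / (l - c))"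
    unfolding e by (simp add: ennreal_mult' ennreal_indicator mult.commute)
  show i: "set_integrable lborel {0..} (\<lambda>y. exp (- l * y) * exp (c * y))"
    unfolding set_integrable_def by (rule integrableI_nonneg) (use nn in auto)
  have "ennreal (LBINT y:{0..}. exp (- l * y) * exp (c * y)) = ennreal (1 / (l - c))"
    using nn_integral_eq_integral[OF i[unfolded set_integrable_def]] nn by (simp add: set_lebesgue_integral_def)
  then show "(LBINT y:{0..}. exp (- l * y) * exp (c * y)) = 1 / (l - c)"
    using assms by (subst (asm) ennreal_inj) (auto simp: set_lebesgue_integral_def intro!: Bochner_Integration.integral_nonneg)
qed

text \<open>\<open>ln G\<close> has derivative \<open>c * k\<close>, so it grows at the rate \<open>c * \<kappa>\<close>.\<close>

locale log_growth =
  fixes Z :: "real \<Rightarrow> real" and c :: real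
  assumes Z_cont: "continuous_on {0..} Z" and Z_nonneg: "\<And>z. 0 \<le> z \<Longrightarrow> 0 \<le> Z z" and c: "0 < c"
begin

definition G :: "real \<Rightarrow> real" where "G z = 1 + c * (LBINT y:{0..z}. Z y)"

lemma G_ge_1: "1 \<le> G z"
proof -
  have "0 \<le> (LBINT y:{0..z}. Z y)" unfolding set_lebesgue_integral_def
    using Z_nonneg by (intro Bochner_Integration.integral_nonneg) (auto simp: indicator_def)
  then show ?thesis using c by (simp add: G_def)
qed

definition k :: "real \<Rightarrow> real" where "k z = Z z / G z"

lemma Z_eq: "Z z = k z * G z"
  using G_ge_1[of z] by (simp add: k_def)

lemma G_growth_eq:
  assumes "0 < z" "0 < t" shows "\<exists>\<xi>. z < \<xi> \<and> \<xi> < z + t \<and> G (z + t) = G z * exp (c * k \<xi> * t)"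
proof -
  have "((\<lambda>z. ln (G z)) has_real_derivative c * k x) (at x)" if "0 < x" for x
  proof -
    have "(G has_real_derivative c * Z x) (at x)"
      unfolding G_def using indefinite_set_integral(2)[OF Z_cont that] by (auto intro!: derivative_eq_intros)
    then have "((\<lambda>z. ln (G z)) has_real_derivative inverse (G x) * (c * Z x)) (at x)"
      using G_ge_1[of x] by (intro DERIV_chain2[OF DERIV_ln]) auto
    then show ?thesis by (simp add: k_def divide_inverse mult_ac)
  qed
  then obtain \<xi> where \<xi>: "z < \<xi>" "\<xi> < z + t" "ln (G (z + t)) - ln (G z) = (z + t - z) * (c * k \<xi>)"
    using MVT2[of z "z + t" "\<lambda>z. ln (G z)" "\<lambda>x. c * k x"] assms by auto
  then have "ln (G (z + t)) = ln (G z) + c * k \<xi> * t" by (simp add: algebra_simps)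
  then have "exp (ln (G (z + t))) = exp (ln (G z)) * exp (c * k \<xi> * t)" by (simp only: exp_add)
  then have "G (z + t) = G z * exp (c * k \<xi> * t)" using G_ge_1[of z] G_ge_1[of "z + t"] by simp
  then show ?thesis using \<xi> by blast
qed

end

locale log_growth_limit = log_growth +
  fixes \<kappa> :: real
  assumes k_antimono: "\<And>x y. 0 < x \<Longrightarrow> x \<le> y \<Longrightarrow> k y \<le> k x" and k_lim: "(k \<longlongrightarrow> \<kappa>) at_top"
begin

lemma k_ge: "0 < z \<Longrightarrow> \<kappa> \<le> k z"
  by (rule tendsto_upperbound[OF k_lim]) (auto simp: eventually_at_top_linorder intro!: exI[of _ z] k_antimono)

lemma \<kappa>_nonneg: "0 \<le> \<kappa>"
proof (rule tendsto_lowerbound[OF k_lim])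
  have "0 \<le> k z" if "0 \<le> z" for z using Z_nonneg[OF that] G_ge_1[of z] by (simp add: k_def)
  then show "\<forall>\<^sub>F z in at_top. 0 \<le> k z" by (auto simp: eventually_at_top_linorder)
qed simp

lemma G_growth:
  assumes "0 < z" "0 \<le> t"
  shows "G z * exp (c * \<kappa> * t) \<le> G (z + t)" "G (z + t) \<le> G z * exp (c * k z * t)"
proof -
  have "G z * exp (c * \<kappa> * t) \<le> G (z + t) \<and> G (z + t) \<le> G z * exp (c * k z * t)"
  proof (cases "t = 0")
    case False
    then have t: "0 < t" using assms by simp
    obtain \<xi> where \<xi>: "z < \<xi>" "G (z + t) = G z * exp (c * k \<xi> * t)" using G_growth_eq[OF assms(1) t] by blast
    have "c * \<kappa> * t \<le> c * k \<xi> * t" "c * k \<xi> * t \<le> c * k z * t"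
      using k_ge[of \<xi>] k_antimono[of z \<xi>] \<xi>(1) assms(1) c t by (auto intro!: mult_right_mono mult_left_mono)
    then show ?thesis unfolding \<xi>(2) using G_ge_1[of z] by (auto intro!: mult_left_mono)
  qed simp
  then show "G z * exp (c * \<kappa> * t) \<le> G (z + t)" "G (z + t) \<le> G z * exp (c * k z * t)" by auto
qed

text \<open>For \<open>t \<ge> 0\<close> monotonicity squeezes the exponent between
  \<open>c * \<kappa> * t\<close> and \<open>c * k z * t\<close>; negative \<open>t\<close> is the
  reciprocal of this with a shifted argument.\<close>

lemma G_ratio_tendsto: "((\<lambda>z. G (z + t) / G z) \<longlongrightarrow> exp (c * \<kappa> * t)) at_top"
proof -
  have pos: "((\<lambda>z. G (z + t) / G z) \<longlongrightarrow> exp (c * \<kappa> * t)) at_top" if t: "0 \<le> t" for t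
  proof (rule real_tendsto_sandwich)
    show "\<forall>\<^sub>F z in at_top. exp (c * \<kappa> * t) \<le> G (z + t) / G z"
      using eventually_gt_at_top[of 0]
    proof eventually_elim
      case (elim z)
      show ?case using G_growth(1)[OF elim t] G_ge_1[of z] by (simp add: pos_le_divide_eq mult.commute)
    qed
    show "\<forall>\<^sub>F z in at_top. G (z + t) / G z \<le> exp (c * k z * t)"
      using eventually_gt_at_top[of 0]
    proof eventually_elim
      case (elim z)
      show ?case using G_growth(2)[OF elim t] G_ge_1[of z] by (simp add: pos_divide_le_eq mult.commute)
    qed
    show "((\<lambda>z. exp (c * k z * t)) \<longlongrightarrow> exp (c * \<kappa> * t)) at_top" by (intro tendsto_intros k_lim)
  qed (rule tendsto_const)
  show ?thesis
  proof (cases "0 \<le> t")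
    case False
    have "filterlim (\<lambda>z. z + t) at_top at_top"
      using filterlim_tendsto_add_at_top[OF tendsto_const[of t] filterlim_ident[of at_top]] by (simp add: add.commute)
    from filterlim_compose[OF pos[of "- t"] this] False
    have "((\<lambda>z. G z / G (z + t)) \<longlongrightarrow> exp (- (c * \<kappa> * t))) at_top" by simp
    then have "((\<lambda>z. inverse (G z / G (z + t))) \<longlongrightarrow> inverse (exp (- (c * \<kappa> * t)))) at_top" by (intro tendsto_inverse) auto
    then show ?thesis by (simp add: exp_minus)
  qed (rule pos)
qed

lemma Z_ratio_tendsto: "((\<lambda>z. Z (z + t) / G z) \<longlongrightarrow> \<kappa> * exp (c * \<kappa> * t)) at_top"
proof -
  have "filterlim (\<lambda>z. z + t) at_top at_top"
    using filterlim_tendsto_add_at_top[OF tendsto_const[of t] filterlim_ident[of at_top]] by (simp add: add.commute)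
  from tendsto_mult[OF filterlim_compose[OF k_lim this] G_ratio_tendsto[of t]]
  show ?thesis by (simp add: Z_eq[of "_ + t"])
qed

text \<open>Both sides are the abscissa of convergence of the transform of \<open>Z\<close>. A rate
  above \<open>r\<close> would make the transform diverge at \<open>l = c * \<kappa> > r\<close>; a
  rate below \<open>r\<close> would keep it bounded as \<open>l\<close> decreases to
  \<open>r\<close>, whereas \<open>v\<close> makes it blow up there, since
  \<open>\<psi> l - p\<close> tends to 0 and \<open>\<psi> l\<close> to
  \<open>p > 0\<close>.\<close>

lemma growth_rate:
  assumes r: "0 \<le> r" and p: "0 < p" and \<psi>: "(\<psi> \<longlongrightarrow> p) (at_right r)"
    and i: "\<And>l. r < l \<Longrightarrow> set_integrable lborel {0..} (\<lambda>y. exp (- l * y) * Z y)"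
    and v: "\<And>l. r < l \<Longrightarrow> (LBINT y:{0..}. exp (- l * y) * Z y) * (l * (\<psi> l - p)) = \<psi> l"
    and gt: "\<And>l. r < l \<Longrightarrow> p < \<psi> l"
  shows "c * \<kappa> = r"
proof (rule antisym)
  show "c * \<kappa> \<le> r"
  proof (rule ccontr)
    assume "\<not> c * \<kappa> \<le> r"
    then have g: "r < c * \<kappa>" by simp
    then have \<kappa>: "0 < \<kappa>" using r c zero_less_mult_pos[of c \<kappa>] by linarith
    define C where "C = \<kappa> * exp (- (c * \<kappa>))"
    define l where "l = c * \<kappa>"
    have C: "0 < C" using \<kappa> by (simp add: C_def)
    have bnd: "C \<le> exp (- l * z) * Z z" if z: "1 \<le> z" for z
    proof -
      have "exp (c * \<kappa> * (z - 1)) \<le> G 1 * exp (c * \<kappa> * (z - 1))" using G_ge_1[of 1] by simp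
      also have "\<dots> \<le> G z" using G_growth(1)[of 1 "z - 1"] z by simp
      finally have "\<kappa> * exp (c * \<kappa> * (z - 1)) \<le> k z * G z"
        using k_ge[of z] \<kappa> z by (intro mult_mono) auto
      then have "exp (- l * z) * (\<kappa> * exp (c * \<kappa> * (z - 1))) \<le> exp (- l * z) * Z z" by (simp add: Z_eq)
      also have "exp (- l * z) * (\<kappa> * exp (c * \<kappa> * (z - 1))) = \<kappa> * (exp (- l * z) * exp (c * \<kappa> * (z - 1)))" by simp
      also have "exp (- l * z) * exp (c * \<kappa> * (z - 1)) = exp (- (c * \<kappa>))"
        unfolding exp_add[symmetric] by (simp add: l_def algebra_simps)
      finally show ?thesis by (simp add: C_def)
    qed
    define V where "V = (LBINT y:{0..}. exp (- l * y) * Z y)"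
    have "C * real n \<le> V" for n
    proof -
      have "(\<integral>y. indicator {1<..1 + real n} y * C \<partial>lborel) \<le> V"
        unfolding V_def set_lebesgue_integral_def
      proof (rule integral_mono)
        show "integrable lborel (\<lambda>y. indicator {0..} y *\<^sub>R (exp (- l * y) * Z y))"
          using i[of l] g by (simp add: set_integrable_def l_def)
        show "integrable lborel (\<lambda>y. indicator {1<..1 + real n} y * C)"
          by (rule integrable_indicator_Ioc)
      qed (use bnd Z_nonneg in \<open>auto simp: indicator_def\<close>)
      then show ?thesis by (simp add: mult.commute)
    qed
    moreover obtain n :: nat where "V / C < real n" using reals_Archimedean2 by blast
    ultimately show False using C by (simp add: pos_divide_less_eq mult.commute not_less[symmetric])
  qed
  show "r \<le> c * \<kappa>"
  proof (rule ccontr)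
    assume "\<not> r \<le> c * \<kappa>"
    then have g: "c * \<kappa> < r" by simp
    have "((\<lambda>z. c * k z) \<longlongrightarrow> c * \<kappa>) at_top" by (intro tendsto_intros k_lim)
    then have "\<forall>\<^sub>F z in at_top. c * k z < r" using g by (rule order_tendstoD(2))
    \<comment> \<open>Beyond \<open>z0\<close> the rate is already below \<open>r\<close>, so
      \<open>\<beta>\<close> bounds it from there on.\<close>
    then obtain z0 where z0: "0 < z0" "c * k z0 < r"
      using eventually_conj[OF _ eventually_gt_at_top[of 0]] eventually_happens'[OF trivial_limit_at_top_linorder]
      by (metis (mono_tags, lifting) eventually_conj_iff eventually_gt_at_top)
    define \<beta> where "\<beta> = c * k z0"
    have \<beta>: "0 \<le> \<beta>" "\<beta> < r" using z0 k_ge[of z0] \<kappa>_nonneg c by (auto simp: \<beta>_def)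
    obtain B where B': "\<forall>z\<in>{0..z0}. \<bar>Z z\<bar> \<le> B"
      using compact_imp_bounded[OF compact_continuous_image[OF continuous_on_subset[OF Z_cont, of "{0..z0}"] compact_Icc]]
      by (auto simp: bounded_iff)
    have B: "\<bar>Z z\<bar> \<le> B" if "0 \<le> z" "z \<le> z0" for z using B' that by simp
    have B0: "0 \<le> B" using B[of 0] z0 by auto
    \<comment> \<open>\<open>B\<close> covers \<open>{0..z0}\<close>, and \<open>k z0 * G z0\<close>
      is the prefactor of the growth bound beyond \<open>z0\<close>.\<close>
    define C where "C = B + k z0 * G z0"
    have C: "0 \<le> C" using B0 k_ge[OF z0(1)] \<kappa>_nonneg G_ge_1[of z0] by (auto simp: C_def)
    have up: "Z z \<le> C * exp (\<beta> * z)" if z: "0 \<le> z" for z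
    proof (cases "z \<le> z0")
      case True
      have "Z z \<le> C" using B[OF z True] k_ge[OF z0(1)] \<kappa>_nonneg G_ge_1[of z0] by (auto simp: C_def intro!: add_increasing2)
      also have "\<dots> \<le> C * exp (\<beta> * z)" using C \<beta> z by (intro mult_le_cancel_left1[THEN iffD2]) auto
      finally show ?thesis .
    next
      case False
      have "Z z = k z * G z" by (rule Z_eq)
      also have "\<dots> \<le> k z0 * (G z0 * exp (\<beta> * (z - z0)))"
        using G_growth(2)[OF z0(1), of "z - z0"] k_antimono[OF z0(1), of z] False G_ge_1[of z] k_ge[OF z0(1)] \<kappa>_nonneg
        by (intro mult_mono) (auto simp: \<beta>_def)
      also have "\<dots> \<le> k z0 * (G z0 * exp (\<beta> * z))"
        using k_ge[OF z0(1)] \<kappa>_nonneg G_ge_1[of z0] \<beta> z0 by (intro mult_left_mono) (auto intro!: mult_left_mono)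
      also have "\<dots> \<le> C * exp (\<beta> * z)" using B0 by (simp add: C_def distrib_right mult.assoc)
      finally show ?thesis .
    qed
    have le: "\<psi> l \<le> C / (r - \<beta>) * (l * (\<psi> l - p))" if l: "r < l" for l
    proof -
      have "(LBINT y:{0..}. exp (- l * y) * Z y) \<le> (LBINT y:{0..}. C * (exp (- l * y) * exp (\<beta> * y)))"
        using up l \<beta> by (intro set_integral_mono i set_integrable_mult_right laplace_exp) (auto simp: mult.left_commute)
      also have "\<dots> = C / (l - \<beta>)" using laplace_exp(2)[of \<beta> l] \<beta> l by simp
      also have "\<dots> \<le> C / (r - \<beta>)" using C \<beta> l by (intro divide_left_mono mult_pos_pos) auto
      finally have "(LBINT y:{0..}. exp (- l * y) * Z y) * (l * (\<psi> l - p)) \<le> C / (r - \<beta>) * (l * (\<psi> l - p))"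
        using gt[OF l] l r by (intro mult_right_mono) auto
      then show ?thesis by (simp only: v[OF l])
    qed
    have "p \<le> C / (r - \<beta>) * (r * (p - p))"
    proof (rule tendsto_le[OF _ _ \<psi>])
      show "((\<lambda>l. C / (r - \<beta>) * (l * (\<psi> l - p))) \<longlongrightarrow> C / (r - \<beta>) * (r * (p - p))) (at_right r)"
        by (intro tendsto_intros \<psi>)
      show "\<forall>\<^sub>F l in at_right r. \<psi> l \<le> C / (r - \<beta>) * (l * (\<psi> l - p))"
        using le by (auto simp: eventually_at_filter)
    qed simp
    then show False using p by simp
  qed
qed

end

section \<open>Intervals and half-lines\<close>

context regular_levy
begin

definition occ :: "real \<Rightarrow> real set \<Rightarrow> real \<Rightarrow> real" where
  "occ q A x = enn2real (ultimate (\<lambda>y. q * indicator A y) x)"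

lemma occ_rate: "A \<in> sets borel \<Longrightarrow> 0 \<le> q \<Longrightarrow> rate q (\<lambda>y. q * indicator A y)"
  by (auto simp: rate_def indicator_def)

lemma occ_nonneg: "0 \<le> occ q A x"
  by (simp add: occ_def)

lemma occ_le_1: "occ q A x \<le> 1"
  using enn2real_mono[OF ultimate_le_1] by (simp add: occ_def)

lemma occ_measurable: "A \<in> sets borel \<Longrightarrow> 0 \<le> q \<Longrightarrow> occ q A \<in> borel_measurable borel"
  using ultimate_measurable[OF occ_rate] by (simp add: occ_def[abs_def])

lemma occ_antimono:
  assumes "A \<subseteq> B" "0 \<le> q" shows "occ q B x \<le> occ q A x"
  unfolding occ_def
proof (rule enn2real_mono)
  have le: "exp_neg t \<le> exp_neg s" if "s \<le> t" for s t
  proof (cases "t = \<infinity>")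
    case False
    then have "s \<noteq> \<infinity>" "enn2real s \<le> enn2real t" using that by (auto intro!: enn2real_mono simp: less_top)
    then show ?thesis using False by (simp add: exp_neg_def)
  qed (simp add: exp_neg_def)
  have "total (\<lambda>y. q * indicator A y) x \<omega> \<le> total (\<lambda>y. q * indicator B y) x \<omega>" for \<omega>
    unfolding total_def using assms by (intro nn_integral_mono mult_left_mono ennreal_leI) (auto simp: indicator_def)
  then show "ultimate (\<lambda>y. q * indicator B y) x \<le> ultimate (\<lambda>y. q * indicator A y) x"
    unfolding ultimate_def by (intro nn_integral_mono ennreal_leI le)
  show "ultimate (\<lambda>y. q * indicator A y) x < top"
    using ultimate_le_1[of "\<lambda>y. q * indicator A y" x] by (rule order_le_less_trans) simp
qed

lemma occ_null: assumes "q = 0 \<or> A = {}" shows "occ q A x = 1"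
proof -
  have "total (\<lambda>y. q * indicator A y) x \<omega> = 0" for \<omega>
    using assms by (auto simp: total_def)
  then show ?thesis by (simp add: occ_def ultimate_def exp_neg_def emeasure_space_1)
qed

end

locale scaled_levy = transient_levy M Y "\<Phi> 0" \<kappa> "W 0"
  for M :: "'a measure" and Y and \<Phi> :: "real \<Rightarrow> real" and \<kappa> :: real and W :: "real \<Rightarrow> real \<Rightarrow> real" +
  assumes scale: "\<And>r. 0 \<le> r \<Longrightarrow> is_scale_function (laplace_exponent M Y) r (W r)"
    and \<Phi>_eq: "\<Phi> = right_inverse (laplace_exponent M Y)"
    and \<psi>_\<Phi>: "\<And>r. 0 \<le> r \<Longrightarrow> laplace_exponent M Y (\<Phi> r) = r"
    and \<Phi>_less: "\<And>r l. 0 \<le> r \<Longrightarrow> \<Phi> r < l \<Longrightarrow> r < laplace_exponent M Y l"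
begin

lemma \<Phi>_pos: assumes "0 < q" shows "\<Phi> 0 < \<Phi> q"
proof (rule ccontr)
  assume n: "\<not> \<Phi> 0 < \<Phi> q"
  show False
  proof (cases "\<Phi> q = \<Phi> 0")
    case True
    then show False using \<psi>_\<Phi>[of q] \<psi>_\<Phi>[of 0] assms by simp
  next
    case False
    then show False using \<Phi>_less[of q "\<Phi> 0"] \<psi>_\<Phi>[of 0] n assms by simp
  qed
qed

lemma \<Phi>_mono: "0 \<le> q \<Longrightarrow> \<Phi> 0 \<le> \<Phi> q"
  using \<Phi>_pos[of q] by (cases "q = 0") auto

lemma scale_laplace:
  assumes "0 \<le> q" "\<Phi> q < l"
  shows "set_integrable lborel {0..} (\<lambda>y. exp (- l * y) * W q y)"
    "(LBINT y:{0..}. exp (- l * y) * W q y) = 1 / (\<psi> l - q)"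
  using scale[OF assms(1)] assms(2) by (auto simp: is_scale_function_def \<Phi>_eq)

lemma volterra: assumes q: "0 \<le> q" shows "volterra_resolvent (W 0) (W q) q"
proof
  show "locbd (W 0)" "locbd (W q)" using scale_function_locbd[OF scale] q by auto
  show "AE y in lborel. 0 \<le> y \<longrightarrow> W q y = W 0 y + q * conv (W 0) (W q) y"
    using \<Phi>_less \<Phi>_mono[OF q] q by (intro scale_function_resolvent[OF scale scale]) (force simp: \<Phi>_eq)+
  \<comment> \<open>Any \<open>l > \<Phi> q\<close> has \<open>\<psi> l > q\<close>, which makes the
    contraction factor \<open>q / \<psi> l\<close> less than 1.\<close>
  define l where "l = \<Phi> q + 1"
  have l: "\<Phi> q < l" "\<Phi> 0 < l" "0 \<le> l" using \<Phi>_mono[OF q] \<phi>_nonneg by (auto simp: l_def)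
  have "q / \<psi> l < 1" using \<Phi>_less[OF q l(1)] q by simp
  then show "\<exists>l\<ge>0. set_integrable lborel {0..} (\<lambda>y. exp (- l * y) * W 0 y) \<and> q * (LBINT y:{0..}. exp (- l * y) * W 0 y) < 1"
    using l W_laplace[OF l(2)] by (intro exI[of _ l]) simp
qed (use q W_nonneg W_neg in auto)

lemma scale_Z_eq: "0 \<le> q \<Longrightarrow> scale_Z W q = volterra_resolvent.R (W q) q (\<lambda>_. 1)"
  by (auto simp: volterra_resolvent.R_def[OF volterra] scale_Z_def conv_def)

lemma scale_H_eq: "0 \<le> q \<Longrightarrow> scale_H \<Phi> W 0 q = volterra_resolvent.R (W q) q (\<lambda>x. exp (\<Phi> 0 * x))"
proof
  fix x assume q: "0 \<le> q"
  have e: "exp (\<Phi> 0 * (x - y)) * W q y = exp (\<Phi> 0 * x) * (exp (- \<Phi> 0 * y) * W q y)" for y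
    by (simp add: mult.assoc[symmetric] exp_add[symmetric] right_diff_distrib)
  show "scale_H \<Phi> W 0 q x = volterra_resolvent.R (W q) q (\<lambda>x. exp (\<Phi> 0 * x)) x"
    unfolding scale_H_def volterra_resolvent.R_def[OF volterra[OF q]] conv_def e by (simp add: distrib_left mult.left_commute)
qed

lemma interval_formula:
  assumes ab: "a \<le> b" and q: "0 \<le> q"
  shows "occ q {a<..<b} x = scale_Z W q (x - a) - q * (LBINT y:{b..x}. W 0 (x - y) * scale_Z W q (y - a))
      - q * (LBINT y:{0..b - a}. exp (- \<Phi> 0 * y) * scale_Z W q y)
          / (\<kappa> + q * (LBINT y:{0..b - a}. exp (- \<Phi> 0 * y) * scale_H \<Phi> W 0 q y))
        * (scale_H \<Phi> W 0 q (x - a) - q * (LBINT y:{b..x}. W 0 (x - y) * scale_H \<Phi> W 0 q (y - a)))"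
proof -
  interpret V: volterra_resolvent "W 0" "W q" q by (rule volterra[OF q])
  show ?thesis unfolding scale_Z_eq[OF q] scale_H_eq[OF q]
  proof (rule V.integral_equation_solution[OF _ _ ab \<kappa>_pos])
    show "occ q {a<..<b} \<in> borel_measurable borel" by (rule occ_measurable[OF _ q]) simp
    show "\<bar>occ q {a<..<b} x\<bar> \<le> 1" for x using occ_nonneg occ_le_1 by simp
    show "occ q {a<..<b} x = 1 - q * (LBINT y:{a<..<b}. occ q {a<..<b} y * (exp (\<Phi> 0 * (x - y)) / \<kappa> - W 0 (x - y)))" for x
      unfolding occ_def by (rule interval_equation[OF q])
  qed
qed

lemma scale_Z_ge_1: assumes "0 \<le> q" shows "1 \<le> scale_Z W q x"
proof -
  interpret V: volterra_resolvent "W 0" "W q" q by (rule volterra[OF assms])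
  show ?thesis unfolding scale_Z_eq[OF assms] by (rule V.R_ge) (simp_all add: locbd_const)
qed

lemma scale_Z_measurable: assumes "0 \<le> q" shows "scale_Z W q \<in> borel_measurable borel"
proof -
  interpret V: volterra_resolvent "W 0" "W q" q by (rule volterra[OF assms])
  show ?thesis unfolding scale_Z_eq[OF assms] by (intro locbd_measurable V.locbd_R locbd_const)
qed

lemma scale_Z_0: "scale_Z W q 0 = 1"
  by (simp add: scale_Z_def set_integral_Icc_null del: atLeastAtMost_singleton)

lemma scale_H_0: "scale_H \<Phi> W 0 q 0 = 1"
  by (simp add: scale_H_def set_integral_Icc_null del: atLeastAtMost_singleton)

lemma scale_Z_continuous: "0 \<le> q \<Longrightarrow> continuous_on {0..} (scale_Z W q)"
  unfolding scale_Z_def[abs_def] using scale[of q]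
  by (intro continuous_intros indefinite_set_integral(1)) (simp add: is_scale_function_def)

text \<open>In transforms \<open>R\<close> multiplies by
  \<open>1 + q / (\<psi> l - q) = \<psi> l / (\<psi> l - q)\<close>.\<close>

lemma laplace_resolvent:
  assumes q: "0 \<le> q" and h: "locbd h" and l: "\<Phi> q < l"
    and hi: "set_integrable lborel {0..} (\<lambda>y. exp (- l * y) * h y)"
  shows "set_integrable lborel {0..} (\<lambda>y. exp (- l * y) * volterra_resolvent.R (W q) q h y)"
    "(LBINT y:{0..}. exp (- l * y) * volterra_resolvent.R (W q) q h y)
      = (LBINT y:{0..}. exp (- l * y) * h y) * \<psi> l / (\<psi> l - q)"
proof -
  interpret V: volterra_resolvent "W 0" "W q" q by (rule volterra[OF q])
  note c = laplace_conv[OF h V.lWq hi scale_laplace(1)[OF q l]]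
  have e: "exp (- l * y) * V.R h y = exp (- l * y) * h y + q * (exp (- l * y) * conv h (W q) y)" for y
    by (simp add: V.R_def distrib_left mult.left_commute)
  show "set_integrable lborel {0..} (\<lambda>y. exp (- l * y) * V.R h y)"
    unfolding e by (intro set_integral_add hi set_integrable_mult_right c)
  have "(LBINT y:{0..}. exp (- l * y) * V.R h y)
      = (LBINT y:{0..}. exp (- l * y) * h y) + q * (LBINT y:{0..}. exp (- l * y) * conv h (W q) y)"
    unfolding e using set_integral_add(2)[OF hi set_integrable_mult_right[OF c(1), of q]] by simp
  then show "(LBINT y:{0..}. exp (- l * y) * V.R h y) = (LBINT y:{0..}. exp (- l * y) * h y) * \<psi> l / (\<psi> l - q)"
    using \<Phi>_less[OF q l] unfolding c(2) scale_laplace(2)[OF q l] by (simp add: field_simps)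
qed

lemma scale_Z_laplace:
  assumes q: "0 \<le> q" and l: "\<Phi> q < l"
  shows "set_integrable lborel {0..} (\<lambda>y. exp (- l * y) * scale_Z W q y)"
    "(LBINT y:{0..}. exp (- l * y) * scale_Z W q y) = 1 / l * \<psi> l / (\<psi> l - q)"
proof -
  have "0 < l" using l \<Phi>_mono[OF q] \<phi>_nonneg by linarith
  then have e: "set_integrable lborel {0..} (\<lambda>y. exp (- l * y) * 1)" "(LBINT y:{0..}. exp (- l * y) * 1) = 1 / l"
    using laplace_exp[of 0 l] by auto
  show "set_integrable lborel {0..} (\<lambda>y. exp (- l * y) * scale_Z W q y)"
    "(LBINT y:{0..}. exp (- l * y) * scale_Z W q y) = 1 / l * \<psi> l / (\<psi> l - q)"
    unfolding scale_Z_eq[OF q] using laplace_resolvent[OF q locbd_const l e(1)] unfolding e(2) by auto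
qed

lemma scale_H_laplace:
  assumes q: "0 \<le> q" and l: "\<Phi> q < l"
  shows "set_integrable lborel {0..} (\<lambda>y. exp (- l * y) * scale_H \<Phi> W 0 q y)"
    "(LBINT y:{0..}. exp (- l * y) * scale_H \<Phi> W 0 q y) = 1 / (l - \<Phi> 0) * \<psi> l / (\<psi> l - q)"
proof -
  have e: "\<Phi> 0 < l" using l \<Phi>_mono[OF q] by simp
  show "set_integrable lborel {0..} (\<lambda>y. exp (- l * y) * scale_H \<Phi> W 0 q y)"
    "(LBINT y:{0..}. exp (- l * y) * scale_H \<Phi> W 0 q y) = 1 / (l - \<Phi> 0) * \<psi> l / (\<psi> l - q)"
    unfolding scale_H_eq[OF q] using laplace_resolvent[OF q locbd_exp l laplace_exp(1)[OF e]] unfolding laplace_exp(2)[OF e] by auto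
qed

lemma \<psi>_at_right: assumes "0 < q" shows "(\<psi> \<longlongrightarrow> q) (at_right (\<Phi> q))"
proof -
  have "0 < \<Phi> q" using \<Phi>_pos[OF assms] \<phi>_nonneg by simp
  then have "isCont \<psi> (\<Phi> q)" using \<psi>_differentiable DERIV_isCont by blast
  then have "(\<psi> \<longlongrightarrow> \<psi> (\<Phi> q)) (at (\<Phi> q))" by (simp add: isCont_def)
  then have "(\<psi> \<longlongrightarrow> \<psi> (\<Phi> q)) (at_right (\<Phi> q))" by (rule tendsto_mono[OF at_le, rotated]) simp
  then show ?thesis using \<psi>_\<Phi> assms by simp
qed

text \<open>Letting the right end point tend to infinity in the interval formula leaves an unknown
  factor \<open>\<rho>\<close>. Since the left-hand side is bounded, its Laplace transform has no pole
  at \<open>\<Phi> q\<close>, which determines \<open>\<rho>\<close>.\<close>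

lemma upper_half_line:
  assumes q: "0 \<le> q"
  shows "occ q {a<..} x = scale_Z W q (x - a) - (\<Phi> q - \<Phi> 0) / \<Phi> q * scale_H \<Phi> W 0 q (x - a)"
proof (cases "q = 0")
  case True
  then show ?thesis by (simp add: occ_null scale_Z_def)
next
  case False
  then have q0: "0 < q" using q by simp
  define \<rho> where "\<rho> = 1 - occ q {a<..} a"
  have lim: "(\<lambda>n. occ q {a<..<a + real n} x) \<longlonglongrightarrow> occ q {a<..} x" for x
  proof -
    have U: "(\<Union>n. {a<..<a + real n}) = {a<..}"
    proof safe
      fix y assume "a < y"
      moreover obtain n :: nat where "y - a < real n" using reals_Archimedean2 by blast
      ultimately show "y \<in> (\<Union>n. {a<..<a + real n})" by (auto intro!: exI[of _ n])
    qed auto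
    have "incseq (\<lambda>n. {a<..<a + real n})" by (auto simp: incseq_def)
    from ultimate_tendsto[OF _ this q, of x] show ?thesis unfolding U occ_def by simp
  qed
  define r where "r n = q * (LBINT y:{0..real n}. exp (- \<Phi> 0 * y) * scale_Z W q y)
          / (\<kappa> + q * (LBINT y:{0..real n}. exp (- \<Phi> 0 * y) * scale_H \<Phi> W 0 q y))" for n
  \<comment> \<open>For \<open>x\<close> up to the right end point both integrals over
    \<open>{b..x}\<close> are null, leaving a combination of \<open>scale_Z\<close> and
    \<open>scale_H\<close> in which only the factor \<open>r n\<close> depends on
    \<open>n\<close>.\<close>
  have fn: "occ q {a<..<a + real n} x = scale_Z W q (x - a) - r n * scale_H \<Phi> W 0 q (x - a)" if "x \<le> a + real n" for n x
    using interval_formula[OF _ q, of a "a + real n" x] that by (simp add: r_def set_integral_Icc_null)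
  \<comment> \<open>At \<open>x = a\<close> both \<open>scale_Z\<close> and \<open>scale_H\<close>
    are 1, which expresses \<open>r n\<close> by \<open>occ\<close>; hence \<open>r\<close>
    converges because \<open>occ\<close> does.\<close>
  have "r n = 1 - occ q {a<..<a + real n} a" for n
    using fn[of a n] by (simp add: scale_Z_0 scale_H_0)
  then have "r = (\<lambda>n. 1 - occ q {a<..<a + real n} a)" by auto
  then have r: "r \<longlonglongrightarrow> \<rho>" unfolding \<rho>_def using tendsto_diff[OF tendsto_const lim[of a], of 1] by simp
  have eq: "occ q {a<..} x = scale_Z W q (x - a) - \<rho> * scale_H \<Phi> W 0 q (x - a)" for x
  proof (rule LIMSEQ_unique[OF lim])
    have "(\<lambda>n. scale_Z W q (x - a) - r n * scale_H \<Phi> W 0 q (x - a)) \<longlonglongrightarrow> scale_Z W q (x - a) - \<rho> * scale_H \<Phi> W 0 q (x - a)"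
      by (intro tendsto_intros r)
    moreover obtain N :: nat where "x - a < real N" using reals_Archimedean2 by blast
    then have "\<forall>\<^sub>F n in sequentially. scale_Z W q (x - a) - r n * scale_H \<Phi> W 0 q (x - a) = occ q {a<..<a + real n} x"
      by (intro eventually_sequentiallyI[of N]) (subst fn, auto)
    ultimately show "(\<lambda>n. occ q {a<..<a + real n} x) \<longlonglongrightarrow> scale_Z W q (x - a) - \<rho> * scale_H \<Phi> W 0 q (x - a)"
      by (rule Lim_transform_eventually)
  qed
  \<comment> \<open>The transform \<open>V\<close> of the half-line functional lies between 0 and
    \<open>1 / l\<close>. Multiplied by \<open>\<psi> l - q\<close>, it is squeezed to 0 as
    \<open>l\<close> decreases to \<open>\<Phi> q\<close>, so the numerator vanishes there.\<close>
  have bounds: "0 \<le> \<psi> l * (1 / l - \<rho> / (l - \<Phi> 0)) \<and> \<psi> l * (1 / l - \<rho> / (l - \<Phi> 0)) \<le> (\<psi> l - q) / l" if l: "\<Phi> q < l" for l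
  proof -
    have l0: "0 < l" "\<Phi> 0 < l" using l \<Phi>_mono[OF q] \<phi>_nonneg by linarith+
    have pl: "0 < \<psi> l - q" using \<Phi>_less[OF q l] by simp
    define V where "V = (LBINT y:{0..}. exp (- l * y) * occ q {a<..} (a + y))"
    have e: "exp (- l * y) * occ q {a<..} (a + y) = exp (- l * y) * scale_Z W q y - \<rho> * (exp (- l * y) * scale_H \<Phi> W 0 q y)" for y
      unfolding eq by (simp add: right_diff_distrib mult.left_commute)
    have Vi: "set_integrable lborel {0..} (\<lambda>y. exp (- l * y) * occ q {a<..} (a + y))"
      unfolding e by (intro set_integral_diff set_integrable_mult_right scale_Z_laplace[OF q l] scale_H_laplace[OF q l])
    have "V = 1 / l * \<psi> l / (\<psi> l - q) - \<rho> * (1 / (l - \<Phi> 0) * \<psi> l / (\<psi> l - q))"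
      unfolding V_def e using scale_Z_laplace[OF q l] scale_H_laplace[OF q l] by (subst set_integral_diff(2)) auto
    also have "\<dots> = \<psi> l * (1 / l - \<rho> / (l - \<Phi> 0)) / (\<psi> l - q)" by (simp add: right_diff_distrib diff_divide_distrib)
    finally have V: "V * (\<psi> l - q) = \<psi> l * (1 / l - \<rho> / (l - \<Phi> 0))" using pl by simp
    have V0: "0 \<le> V" unfolding V_def set_lebesgue_integral_def
      using occ_nonneg by (intro Bochner_Integration.integral_nonneg) (auto simp: indicator_def)
    have "V \<le> (LBINT y:{0..}. exp (- l * y) * exp (0 * y))"
      unfolding V_def using occ_le_1 l0 by (intro set_integral_mono Vi laplace_exp) auto
    also have "\<dots> = 1 / l" using laplace_exp(2)[of 0 l] l0 by simp
    finally have "V * (\<psi> l - q) \<le> 1 / l * (\<psi> l - q)" using pl by (intro mult_right_mono) auto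
    moreover have "0 \<le> V * (\<psi> l - q)" using V0 pl by (intro mult_nonneg_nonneg) auto
    ultimately show ?thesis unfolding V by simp
  qed
  have \<Phi>q: "0 < \<Phi> q" "\<Phi> 0 < \<Phi> q" using \<Phi>_pos[OF q0] \<phi>_nonneg by auto
  note \<psi> = \<psi>_at_right[OF q0]
  have "((\<lambda>l. \<psi> l * (1 / l - \<rho> / (l - \<Phi> 0))) \<longlongrightarrow> q * (1 / \<Phi> q - \<rho> / (\<Phi> q - \<Phi> 0))) (at_right (\<Phi> q))"
    using \<Phi>q by (intro tendsto_intros \<psi>) auto
  moreover have "((\<lambda>l. \<psi> l * (1 / l - \<rho> / (l - \<Phi> 0))) \<longlongrightarrow> 0) (at_right (\<Phi> q))"
  proof (rule real_tendsto_sandwich[of "\<lambda>_. 0"])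
    have "((\<lambda>l. (\<psi> l - q) / l) \<longlongrightarrow> (q - q) / \<Phi> q) (at_right (\<Phi> q))" using \<Phi>q by (intro tendsto_intros \<psi>) auto
    then show "((\<lambda>l. (\<psi> l - q) / l) \<longlongrightarrow> 0) (at_right (\<Phi> q))" by simp
    show "\<forall>\<^sub>F l in at_right (\<Phi> q). 0 \<le> \<psi> l * (1 / l - \<rho> / (l - \<Phi> 0))"
      "\<forall>\<^sub>F l in at_right (\<Phi> q). \<psi> l * (1 / l - \<rho> / (l - \<Phi> 0)) \<le> (\<psi> l - q) / l"
      using bounds unfolding eventually_at_filter by (auto intro!: always_eventually)
  qed simp
  ultimately have "q * (1 / \<Phi> q - \<rho> / (\<Phi> q - \<Phi> 0)) = 0"
    by (rule tendsto_unique[rotated]) simp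
  then have "\<rho> / (\<Phi> q - \<Phi> 0) = 1 / \<Phi> q" using q0 by simp
  then have "\<rho> = (\<Phi> q - \<Phi> 0) / \<Phi> q" using \<Phi>q by (simp add: nonzero_divide_eq_eq)
  then show ?thesis using eq by simp
qed

text \<open>For \<open>\<Phi> 0 = 0\<close> the functions \<open>scale_H \<Phi> W 0 q\<close> and
  \<open>scale_Z W q\<close> coincide, so the general formula reads
  \<open>A - q * I / (\<kappa> + q * I) * A\<close>.\<close>

lemma interval_formula_drift:
  assumes \<Phi>0: "\<Phi> 0 = 0" and ab: "a \<le> b" and q: "0 \<le> q"
  shows "occ q {a<..<b} x = (scale_Z W q (x - a) - q * (LBINT y:{b..x}. W 0 (x - y) * scale_Z W q (y - a)))
    / (1 + q / \<kappa> * (LBINT y:{0..b - a}. scale_Z W q y))"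
proof -
  have H: "scale_H \<Phi> W 0 q = scale_Z W q" by (simp add: fun_eq_iff scale_H_def scale_Z_def \<Phi>0)
  define I where "I = (LBINT y:{0..b - a}. scale_Z W q y)"
  define A where "A = scale_Z W q (x - a) - q * (LBINT y:{b..x}. W 0 (x - y) * scale_Z W q (y - a))"
  have "0 \<le> scale_Z W q y" for y using scale_Z_ge_1[OF q, of y] by simp
  then have I: "0 \<le> I" unfolding I_def set_lebesgue_integral_def
    by (intro Bochner_Integration.integral_nonneg) (auto simp: indicator_def)
  have "0 < \<kappa> + q * I" using \<kappa>_pos I q by (intro add_pos_nonneg mult_nonneg_nonneg)
  moreover have "occ q {a<..<b} x = A - q * I / (\<kappa> + q * I) * A"
    using interval_formula[OF ab q, of x] by (simp add: H \<Phi>0 I_def A_def)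
  ultimately have "occ q {a<..<b} x = A / (1 + q / \<kappa> * I)"
    using \<kappa>_pos by (simp add: field_simps)
  then show ?thesis by (simp add: A_def I_def)
qed

text \<open>At \<open>x = b\<close> the interval formula is \<open>Z / G\<close> with \<open>G\<close> its denominator, and \<open>Z / G\<close> is, up to a
  factor, the logarithmic derivative of \<open>G\<close>. Being monotone in \<open>a\<close>, it converges, and its limit is the
  exponential growth rate of \<open>Z\<close>, which is \<open>\<Phi> q\<close> by the Laplace transform of \<open>Z\<close>.\<close>

lemma lower_half_line:
  assumes \<Phi>0: "\<Phi> 0 = 0" and q: "0 < q"
  shows "occ q {..<b} x = \<kappa> * (\<Phi> q / q) * scale_H \<Phi> W q (- q) (x - b)"
proof -
  define c where "c = q / \<kappa>"
  define Z where "Z = scale_Z W q"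
  define p where "p = occ q {..<b} b"
  have q0: "0 \<le> q" and c: "0 < c" using q \<kappa>_pos by (auto simp: c_def)
  have Z1: "1 \<le> Z z" for z unfolding Z_def by (rule scale_Z_ge_1[OF q0])
  interpret L: log_growth Z c
  proof
    show "continuous_on {0..} Z" unfolding Z_def by (rule scale_Z_continuous[OF q0])
    show "0 \<le> Z z" for z by (rule order_trans[OF zero_le_one Z1])
  qed (rule c)
  have lim: "(\<lambda>n. occ q {b - real n<..<b} x) \<longlonglongrightarrow> occ q {..<b} x" for x
  proof -
    have U: "(\<Union>n. {b - real n<..<b}) = {..<b}"
    proof safe
      fix y assume "y < b"
      moreover obtain n :: nat where "b - y < real n" using reals_Archimedean2 by blast
      ultimately show "y \<in> (\<Union>n. {b - real n<..<b})" by (auto intro!: exI[of _ n])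
    qed auto
    have "incseq (\<lambda>n. {b - real n<..<b})" by (auto simp: incseq_def)
    from ultimate_tendsto[OF _ this q0, of x] show ?thesis unfolding U occ_def by simp
  qed
  have fz: "occ q {b - z<..<b} x = (Z (x - b + z) - q * (LBINT y:{b..x}. W 0 (x - y) * Z (y - b + z))) / L.G z"
    if "0 \<le> z" for z x
  proof -
    have e: "y - (b - z) = y - b + z" for y by simp
    have "b - b + z = z" by simp
    then show ?thesis
      using interval_formula_drift[OF \<Phi>0 _ q0, of "b - z" b x] that
      unfolding e L.G_def unfolding Z_def c_def by simp
  qed
  have kz: "L.k z = occ q {b - z<..<b} b" if "0 \<le> z" for z
    using fz[OF that, of b] by (simp add: L.k_def set_integral_Icc_null del: atLeastAtMost_singleton)
  have k1: "L.k z \<le> 1" if "0 \<le> z" for z using kz[OF that] occ_le_1 by simp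
  interpret L: log_growth_limit Z c p
  proof
    show "L.k y \<le> L.k x" if "0 < x" "x \<le> y" for x y
    proof -
      have "{b - x<..<b} \<subseteq> {b - y<..<b}" using that by auto
      from occ_antimono[OF this q0, of b] show ?thesis using that by (simp add: kz)
    qed
    \<comment> \<open>The limit along integers extends to real \<open>z\<close> by monotonicity; the
      sign is reversed to obtain a nondecreasing function.\<close>
    have "((\<lambda>z. - occ q {b - z<..<b} b) \<longlongrightarrow> - p) at_top"
    proof (rule tendsto_at_topI_sequentially_real)
      show "mono (\<lambda>z. - occ q {b - z<..<b} b)" using q0 by (auto simp: mono_def intro!: occ_antimono)
      show "(\<lambda>n. - occ q {b - real n<..<b} b) \<longlonglongrightarrow> - p" unfolding p_def by (intro tendsto_intros lim)
    qed
    then have "((\<lambda>z. occ q {b - z<..<b} b) \<longlongrightarrow> p) at_top" by (rule tendsto_minus_cancel)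
    moreover have "\<forall>\<^sub>F z in at_top. occ q {b - z<..<b} b = L.k z"
      using eventually_ge_at_top[of "0::real"] by eventually_elim (simp add: kz)
    ultimately show "(L.k \<longlongrightarrow> p) at_top" by (rule Lim_transform_eventually)
  qed
  have \<Phi>q: "0 < \<Phi> q" using \<Phi>_pos[OF q] \<Phi>0 by simp
  have cp: "c * p = \<Phi> q"
  proof (rule L.growth_rate[OF _ q \<psi>_at_right[OF q]])
    fix l assume l: "\<Phi> q < l"
    show "set_integrable lborel {0..} (\<lambda>y. exp (- l * y) * Z y)" unfolding Z_def by (rule scale_Z_laplace[OF q0 l])
    show "q < \<psi> l" by (rule \<Phi>_less[OF q0 l])
    then show "(LBINT y:{0..}. exp (- l * y) * Z y) * (l * (\<psi> l - q)) = \<psi> l"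
      unfolding Z_def scale_Z_laplace(2)[OF q0 l] using l \<Phi>q by simp
  qed (use \<Phi>q in simp)
  have p: "p = \<kappa> * (\<Phi> q / q)" using cp q \<kappa>_pos by (simp add: c_def field_simps)
  have seq: "filterlim (\<lambda>n. real (Suc n)) at_top sequentially"
    by (rule filterlim_compose[OF filterlim_real_sequentially filterlim_Suc])
  \<comment> \<open>The \<open>Z\<close> terms of the interval formula, normalised by its
    denominator. Levels \<open>Suc n\<close> keep the argument of \<open>G\<close> positive, as the
    growth bounds require.\<close>
  define F where "F n t = Z (t + real (Suc n)) / L.G (real (Suc n))" for n t
  have F_lim: "(\<lambda>n. F n t) \<longlonglongrightarrow> p * exp (\<Phi> q * t)" for t
  proof -
    have e: "t + real (Suc n) = real (Suc n) + t" for n by (rule add.commute)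
    show ?thesis unfolding F_def e cp[symmetric] by (rule filterlim_compose[OF L.Z_ratio_tendsto seq])
  qed
  have F_nonneg: "0 \<le> F n t" for n t
    using Z1[of "t + real (Suc n)"] L.G_ge_1[of "real (Suc n)"] by (simp add: F_def)
  \<comment> \<open>\<open>k \<le> 1\<close> bounds \<open>Z\<close> by \<open>G\<close> and the
    growth exponent of \<open>G\<close> by \<open>c\<close>, which gives a majorant independent of
    \<open>n\<close>.\<close>
  have F_le: "F n t \<le> exp (c * t)" if t: "0 \<le> t" for n t
  proof -
    obtain z where z: "real (Suc n) = z" "0 < z" by simp
    have "Z (t + z) \<le> L.G (z + t)"
      using k1[of "z + t"] L.G_ge_1[of "z + t"] t z(2) L.Z_eq[of "z + t"] by (simp add: add.commute)
    also have "\<dots> \<le> L.G z * exp (c * L.k z * t)" by (rule L.G_growth(2)[OF z(2) t])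
    also have "\<dots> \<le> L.G z * exp (c * t)"
      using k1[of z] L.G_ge_1[of z] t z(2) c mult_right_mono[of "c * L.k z" c t] by (intro mult_left_mono) auto
    finally show ?thesis unfolding F_def z(1) using L.G_ge_1[of z] by (simp add: pos_divide_le_eq mult.commute)
  qed
  have lW: "locbd (W 0)" by (rule scale_function_locbd[OF scale]) simp
  note [measurable] = locbd_measurable[OF lW]
  have [measurable]: "Z \<in> borel_measurable borel" unfolding Z_def by (rule scale_Z_measurable[OF q0])
  have [measurable]: "F n \<in> borel_measurable borel" for n unfolding F_def[abs_def] by measurable
  have intlim: "(\<lambda>n. LBINT y:{b..x}. W 0 (x - y) * F n (y - b)) \<longlonglongrightarrow> (LBINT y:{b..x}. W 0 (x - y) * (p * exp (\<Phi> q * (y - b))))"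
  proof -
    obtain C where C: "0 \<le> C" "\<And>y. 0 \<le> y \<Longrightarrow> y \<le> x - b \<Longrightarrow> \<bar>W 0 y\<bar> \<le> C" using locbdE[OF lW] by blast
    show ?thesis unfolding set_lebesgue_integral_def
    proof (rule integral_dominated_convergence)
      show "integrable lborel (\<lambda>y. indicator {b..x} y * (C * exp (c * (x - b))) :: real)" by (rule integrable_indicator_Icc)
      show "AE y in lborel. (\<lambda>n. indicator {b..x} y *\<^sub>R (W 0 (x - y) * F n (y - b)))
          \<longlonglongrightarrow> indicator {b..x} y *\<^sub>R (W 0 (x - y) * (p * exp (\<Phi> q * (y - b))))"
        by (intro AE_I2 tendsto_scaleR tendsto_mult tendsto_const F_lim)
      fix n
      have "\<bar>W 0 (x - y) * F n (y - b)\<bar> \<le> C * exp (c * (x - b))" if y: "b \<le> y" "y \<le> x" for y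
      proof -
        have "F n (y - b) \<le> exp (c * (y - b))" using y by (intro F_le) simp
        also have "\<dots> \<le> exp (c * (x - b))" using y c by simp
        finally show ?thesis unfolding abs_mult using y C F_nonneg by (intro mult_mono) auto
      qed
      then show "AE y in lborel. norm (indicator {b..x} y *\<^sub>R (W 0 (x - y) * F n (y - b))) \<le> indicator {b..x} y * (C * exp (c * (x - b)))"
        by (intro AE_I2) (simp add: indicator_def)
      show "(\<lambda>y. indicator {b..x} y *\<^sub>R (W 0 (x - y) * (p * exp (\<Phi> q * (y - b))))) \<in> borel_measurable lborel"
        by measurable
      show "(\<lambda>y. indicator {b..x} y *\<^sub>R (W 0 (x - y) * F n (y - b))) \<in> borel_measurable lborel"
        by measurable
    qed
  qed
  have "occ q {..<b} x = p * exp (\<Phi> q * (x - b)) - q * (LBINT y:{b..x}. W 0 (x - y) * (p * exp (\<Phi> q * (y - b))))"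
  proof (rule LIMSEQ_unique[OF LIMSEQ_Suc[OF lim]])
    have "occ q {b - real (Suc n)<..<b} x = F n (x - b) - q * (LBINT y:{b..x}. W 0 (x - y) * F n (y - b))" for n
      unfolding F_def by (subst fz) (simp_all add: diff_divide_distrib del: of_nat_Suc)
    then have e: "(\<lambda>n. occ q {b - real (Suc n)<..<b} x) = (\<lambda>n. F n (x - b) - q * (LBINT y:{b..x}. W 0 (x - y) * F n (y - b)))" by blast
    show "(\<lambda>n. occ q {b - real (Suc n)<..<b} x) \<longlonglongrightarrow> p * exp (\<Phi> q * (x - b)) - q * (LBINT y:{b..x}. W 0 (x - y) * (p * exp (\<Phi> q * (y - b))))"
      unfolding e by (intro tendsto_diff tendsto_mult tendsto_const F_lim intlim)
  qed
  \<comment> \<open>Reflecting \<open>y\<close> to \<open>x - y\<close> moves a decaying exponential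
    onto \<open>W 0\<close>. This is the integral inside \<open>scale_H \<Phi> W q (- q)\<close>,
    where the index \<open>q + - q\<close> of the scale function is 0.\<close>
  also have "(LBINT y:{b..x}. W 0 (x - y) * (p * exp (\<Phi> q * (y - b))))
      = p * exp (\<Phi> q * (x - b)) * (LBINT y:{0..x - b}. exp (- \<Phi> q * y) * W 0 y)"
  proof -
    have "(LBINT y:{b..x}. W 0 (x - y) * (p * exp (\<Phi> q * (y - b))))
        = (\<integral>y. indicator {b..x} (x + (-1) * y) * (W 0 (x - (x + (-1) * y)) * (p * exp (\<Phi> q * (x + (-1) * y - b)))) \<partial>lborel)"
      unfolding set_lebesgue_integral_def by (subst lborel_integral_real_affine[where c="-1" and t=x]) auto
    also have "\<dots> = (\<integral>y. p * exp (\<Phi> q * (x - b)) * (indicator {0..x - b} y *\<^sub>R (exp (- \<Phi> q * y) * W 0 y)) \<partial>lborel)"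
    proof (intro Bochner_Integration.integral_cong refl)
      fix y
      have "exp (\<Phi> q * (x + (-1) * y - b)) = exp (\<Phi> q * (x - b)) * exp (- \<Phi> q * y)"
        unfolding exp_add[symmetric] by (simp add: algebra_simps)
      then show "indicator {b..x} (x + (-1) * y) * (W 0 (x - (x + (-1) * y)) * (p * exp (\<Phi> q * (x + (-1) * y - b))))
         = p * exp (\<Phi> q * (x - b)) * (indicator {0..x - b} y *\<^sub>R (exp (- \<Phi> q * y) * W 0 y))"
        by (auto simp: indicator_def)
    qed
    finally show ?thesis by (simp add: set_lebesgue_integral_def)
  qed
  finally show ?thesis unfolding p[symmetric] scale_H_def right_minus by (simp add: right_diff_distrib)
qed

end

theorem corollary3:
  fixes M :: "'a measure" and X :: "real \<Rightarrow> 'a \<Rightarrow> real"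
    and \<psi> \<Phi> :: "real \<Rightarrow> real" and W Z :: "real \<Rightarrow> real \<Rightarrow> real"
    and H :: "real \<Rightarrow> real \<Rightarrow> real \<Rightarrow> real" and m :: real
  assumes "spectrally_negative_levy M X"
    and "\<psi> = laplace_exponent M X"
    and "\<Phi> = right_inverse \<psi>"
    and "m = real_of_ereal (right_deriv_0 \<psi>)"
    and "\<And>r. 0 \<le> r \<Longrightarrow> is_scale_function \<psi> r (W r)"
    and "Z = scale_Z W"
    and "H = scale_H \<Phi> W"
  shows
    "(right_deriv_0 \<psi> > 0 \<longrightarrow>
       (\<forall>a b q x. a \<le> b \<longrightarrow> 0 \<le> q \<longrightarrow>
          occupation_laplace M X x q {a<..<b} =
            (Z q (x - a) - q * (LBINT y:{b..x}. W 0 (x - y) * Z q (y - a)))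
              / (1 + q / m * (LBINT y:{0..b - a}. Z q y))))
     \<and>
     (right_deriv_0 \<psi> > 0 \<longrightarrow>
       ((\<lambda>q. \<Phi> q / q) \<longlongrightarrow> 1 / m) (at_right 0) \<and>
       (\<forall>b q x. 0 \<le> q \<longrightarrow>
          occupation_laplace M X x q {..<b} =
            m * (if q = 0 then 1 / m else \<Phi> q / q) * H q (- q) (x - b)))
     \<and>
     (right_deriv_0 \<psi> < 0 \<longrightarrow>
       (\<forall>a b q x. a \<le> b \<longrightarrow> 0 \<le> q \<longrightarrow>
          occupation_laplace M X x q {a<..<b} =
            Z q (x - a) - q * (LBINT y:{b..x}. W 0 (x - y) * Z q (y - a))
            - q * (LBINT y:{0..b - a}. exp (- \<Phi> 0 * y) * Z q y)
                / (deriv \<psi> (\<Phi> 0) + q * (LBINT y:{0..b - a}. exp (- \<Phi> 0 * y) * H 0 q y))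
              * (H 0 q (x - a) - q * (LBINT y:{b..x}. W 0 (x - y) * H 0 q (y - a)))))
     \<and>
     (right_deriv_0 \<psi> < 0 \<longrightarrow>
       (\<forall>a q x. 0 \<le> q \<longrightarrow>
          occupation_laplace M X x q {a<..} =
            Z q (x - a) - (\<Phi> q - \<Phi> 0) / \<Phi> q * H 0 q (x - a)))"
proof -
  interpret X: spectrally_negative_levy M X by (rule assms(1))
  obtain Y where "regular_levy M Y" and XY: "AE \<omega> in M. \<forall>t\<ge>0. Y t \<omega> = X t \<omega>"
    using X.regular_version by blast
  interpret Y: regular_levy M Y by fact
  have \<psi>: "\<psi> = laplace_exponent M Y"
  proof
    fix l
    have [measurable]: "X 1 \<in> borel_measurable M" by (rule X.measurable_X) simp
    have "(LINT \<omega>|M. exp (l * X 1 \<omega>)) = (LINT \<omega>|M. exp (l * Y 1 \<omega>))"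
    proof (rule integral_cong_AE)
      show "AE \<omega> in M. exp (l * X 1 \<omega>) = exp (l * Y 1 \<omega>)" using XY by eventually_elim simp
    qed measurable
    then show "\<psi> l = laplace_exponent M Y l" by (simp add: assms(2) laplace_exponent_def)
  qed
  note scale = assms(5)[unfolded \<psi>] and \<Phi> = assms(3)[unfolded \<psi>] and Z = assms(6) and H = assms(7)
  have "\<not> (AE \<omega> in M. \<forall>s t. 0 \<le> s \<longrightarrow> s \<le> t \<longrightarrow> Y t \<omega> \<le> Y s \<omega>)"
  proof
    assume "AE \<omega> in M. \<forall>s t. 0 \<le> s \<longrightarrow> s \<le> t \<longrightarrow> Y t \<omega> \<le> Y s \<omega>"
    with XY have "AE \<omega> in M. \<forall>s t. 0 \<le> s \<longrightarrow> s \<le> t \<longrightarrow> X t \<omega> \<le> X s \<omega>"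
      by eventually_elim (metis order_trans)
    then show False using X.not_neg_subordinator by simp
  qed
  note unbdd = Y.\<psi>_unbounded[OF Y.prob_pos[OF this]]
  note \<Phi>p = right_inverse_properties[OF Y.\<psi>_continuous Y.\<psi>_convex Y.\<psi>_0 unbdd, folded \<Phi>]
  \<comment> \<open>Both signs of the drift enter through this one instantiation; what each case
    must supply is a positive slope \<open>\<kappa>\<close> of the exponent at
    \<open>\<Phi> 0\<close>.\<close>
  have scaled: "scaled_levy M Y \<Phi> \<kappa> W"
    if "0 < \<kappa>" "((\<lambda>h. laplace_exponent M Y (\<Phi> 0 + h) / h) \<longlongrightarrow> \<kappa>) (at_right 0)" for \<kappa>
  proof
    show "0 < \<kappa>" "((\<lambda>h. laplace_exponent M Y (\<Phi> 0 + h) / h) \<longlongrightarrow> \<kappa>) (at_right 0)" by fact+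
    show "0 \<le> \<Phi> 0" "laplace_exponent M Y (\<Phi> 0) = 0" by (rule \<Phi>p; simp)+
    show "0 < laplace_exponent M Y l" if "\<Phi> 0 < l" for l using \<Phi>p(3)[OF _ that] by simp
    show "W 0 \<in> borel_measurable borel" by (rule scale_function_measurable[OF scale]) simp
    show "continuous_on {0..} (W 0)" using scale[of 0] by (simp add: is_scale_function_def)
    show "W 0 x = 0" if "x < 0" for x using scale[of 0] that by (simp add: is_scale_function_def)
    show "set_integrable lborel {0..} (\<lambda>y. exp (- l * y) * W 0 y)"
      "(LBINT y:{0..}. exp (- l * y) * W 0 y) = 1 / laplace_exponent M Y l" if "\<Phi> 0 < l" for l
      using scale[of 0] that by (auto simp: is_scale_function_def \<Phi>)
    show "is_scale_function (laplace_exponent M Y) r (W r)" if "0 \<le> r" for r by (rule scale[OF that])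
    show "\<Phi> = right_inverse (laplace_exponent M Y)" by (rule \<Phi>)
    show "laplace_exponent M Y (\<Phi> r) = r" if "0 \<le> r" for r by (rule \<Phi>p(2)[OF that])
    show "r < laplace_exponent M Y l" if "0 \<le> r" "\<Phi> r < l" for r l by (rule \<Phi>p(3)[OF that])
  qed
  have occ: "occupation_laplace M X x q A = Y.occ q A x" if "A \<in> sets borel" "0 \<le> q" for x q A
    unfolding Y.occ_def by (rule Y.occupation_laplace_eq[OF XY that])
  note d = Y.\<psi>_convex Y.\<psi>_0
  have pos: "(\<forall>a b q x. a \<le> b \<longrightarrow> 0 \<le> q \<longrightarrow>
      occupation_laplace M X x q {a<..<b} =
        (Z q (x - a) - q * (LBINT y:{b..x}. W 0 (x - y) * Z q (y - a))) / (1 + q / m * (LBINT y:{0..b - a}. Z q y))) \<and>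
      ((\<lambda>q. \<Phi> q / q) \<longlongrightarrow> 1 / m) (at_right 0) \<and>
      (\<forall>b q x. 0 \<le> q \<longrightarrow>
        occupation_laplace M X x q {..<b} = m * (if q = 0 then 1 / m else \<Phi> q / q) * H q (- q) (x - b))"
    if "right_deriv_0 \<psi> > 0"
  proof -
    note p = right_deriv_0_pos[OF d that[unfolded \<psi>], folded assms(4)[unfolded \<psi>]]
    \<comment> \<open>The bound \<open>m * h \<le> \<psi> h\<close> with \<open>m > 0\<close> leaves
      no positive root.\<close>
    have \<Phi>0: "\<Phi> 0 = 0"
      using p(1) p(3)[of "\<Phi> 0"] \<Phi>p(1,2)[of 0] by (cases "\<Phi> 0 = 0") (auto simp: mult_le_0_iff)
    interpret S: scaled_levy M Y \<Phi> m W
      by (rule scaled) (use p \<Phi>0 in auto)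
    have "((\<lambda>q. \<Phi> q / q) \<longlongrightarrow> 1 / m) (at_right 0)"
      by (rule right_inverse_ratio_tendsto[OF p]) (use S.\<Phi>_pos \<Phi>0 \<Phi>p(2) in auto)
    moreover have "occupation_laplace M X x q {..<b} = m * (if q = 0 then 1 / m else \<Phi> q / q) * H q (- q) (x - b)"
      if "0 \<le> q" for b q x
    proof (cases "q = 0")
      case True
      then show ?thesis using p(1) by (simp add: occ Y.occ_null H scale_H_def \<Phi>0)
    next
      case False
      then show ?thesis using that S.lower_half_line[OF \<Phi>0, of q b x] by (simp add: occ H)
    qed
    ultimately show ?thesis using S.interval_formula_drift[OF \<Phi>0] by (simp add: occ Z)
  qed
  have neg: "(\<forall>a b q x. a \<le> b \<longrightarrow> 0 \<le> q \<longrightarrow>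
      occupation_laplace M X x q {a<..<b} =
        Z q (x - a) - q * (LBINT y:{b..x}. W 0 (x - y) * Z q (y - a))
        - q * (LBINT y:{0..b - a}. exp (- \<Phi> 0 * y) * Z q y)
            / (deriv \<psi> (\<Phi> 0) + q * (LBINT y:{0..b - a}. exp (- \<Phi> 0 * y) * H 0 q y))
          * (H 0 q (x - a) - q * (LBINT y:{b..x}. W 0 (x - y) * H 0 q (y - a)))) \<and>
      (\<forall>a q x. 0 \<le> q \<longrightarrow>
        occupation_laplace M X x q {a<..} = Z q (x - a) - (\<Phi> q - \<Phi> 0) / \<Phi> q * H 0 q (x - a))"
    if R: "right_deriv_0 \<psi> < 0"
  proof -
    obtain h where h: "0 < h" "laplace_exponent M Y h < 0" using right_deriv_0_neg[OF d R[unfolded \<psi>]] by blast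
    \<comment> \<open>Beyond \<open>\<Phi> 0\<close> the exponent is positive, so the point
      \<open>h\<close> with negative value lies to its left; the root is then crossed with positive
      slope.\<close>
    have "h < \<Phi> 0"
    proof (rule ccontr)
      assume "\<not> h < \<Phi> 0"
      then have "h = \<Phi> 0 \<or> \<Phi> 0 < h" by auto
      then show False using \<Phi>p(2)[of 0] \<Phi>p(3)[of 0 h] h by auto
    qed
    then have "0 < \<Phi> 0" using h by simp
    note D = convex_deriv_at_root_pos[OF Y.\<psi>_convex less_imp_le[OF h(1)] h(2) \<open>h < \<Phi> 0\<close> \<Phi>p(2)[OF order_refl] Y.\<psi>_differentiable[OF this]]
    interpret S: scaled_levy M Y \<Phi> "deriv \<psi> (\<Phi> 0)" W
      unfolding \<psi> by (rule scaled[OF D])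
    show ?thesis using S.interval_formula S.upper_half_line by (simp add: occ Z H)
  qed
  show ?thesis using pos neg by blast
qed

end
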